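(* For every $\beta\in[\gamma_0,\infty)$, the set $F_\beta$ has Hausdorff dimension $\tilde t(\beta)$. Furthermore, the function $\tilde t$ has the following properties: 1) $\tilde t(\lambda_0)=1$ and $\tilde t(+\infty):=\lim_{\beta\to+\infty}\tilde t(\beta)=1/2$; 2) $\tilde t'(\beta)<0$ for all $\beta>\lambda_0$, $\tilde t'(\lambda_0)=0$, and $\tilde t'(\beta)>0$ for all $\gamma_0<\beta<\lambda_0$; 3) $\tilde t'(\gamma_0+):=\lim_{\beta\to\gamma_0+}\tilde t'(\beta)=+\infty$ and $\tilde t'(+\infty):=\lim_{\beta\to+\infty}\tilde t'(\beta)=0$; 4) $\tilde t''(\lambda_0)<0$, but $\tilde t''(\beta_1)>0$ for some $\beta_1>\lambda_0$; i.e. $\tilde t$ is neither convex nor concave.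
   Context: $T:[0,1)\to[0,1)$ is the Gauss map, $T(0)=0$, $T(x)=\frac1x\pmod1$ for $x\in(0,1)$. For irrational $x\in[0,1)$ the Lyapunov exponent is $\lambda(x)=\lim_{n\to\infty}\frac1n\log|(T^n)'(x)|$ when the limit exists, and $F_\beta=\{x\in[0,1):\lambda(x)=\beta\}$ (rational $x$, a countable set, are ignored). $\mu_G$ is the Gauss measure $d\mu_G=\frac{dx}{(1+x)\log2}$; $\lambda_0=\int\log|T'(x)|\,d\mu_G(x)$; $\gamma_0=2\log\frac{1+\sqrt5}2$. Write $[\omega_1,\dots,\omega_n+x]=\cfrac{1}{\omega_1+\cfrac{1}{\ddots+\cfrac{1}{\omega_n+x}}}$. Let $\tilde D=\{(\tilde t,q)\in\mathbb{R}^2:\tilde t-q>1/2\}$ and $\tilde D_0=\{(\tilde t,q)\in\mathbb{R}^2:\tilde t-q>1/2,\ 0\le\tilde t\le1\}$. For $(\tilde t,q)\in\tilde D$ let $$P_1(\tilde t,q)=\lim_{n\to\infty}\frac1n\log\sum_{\omega_1=1}^\infty\cdots\sum_{\omega_n=1}^\infty\exp\Big(\sup_{x\in[0,1]}\log\prod_{j=1}^n([\omega_j,\dots,\omega_n+x])^{2(\tilde t-q)}\Big),$$ which is real-analytic on $\tilde D$. For $\beta\in(\gamma_0,\infty)$, $(\tilde t(\beta),q(\beta))\in\tilde D_0$ denotes the unique solution in $\tilde D_0$ of the system $P_1(\tilde t,q)=q\beta$, $\frac{\partial P_1}{\partial q}(\tilde t,q)=\beta$; and $\tilde t(\gamma_0):=0$.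 *)

theory Defs
  imports "HOL-Analysis.Analysis"
begin

section \<open>Hausdorff dimension\<close>

text \<open>
  The usual convention \<open>diam(U)\<^sup>0 = 1\<close> for nonempty \<open>U\<close> (also if \<open>diam(U) = 0\<close>) has to be made
  explicit, since \<open>0 powr 0 = 0\<close>; the empty set never contributes.
\<close>
definition hausdorff_gauge :: "real \<Rightarrow> 'a::metric_space set \<Rightarrow> real" where
  "hausdorff_gauge s U = (if U = {} then 0 else if s = 0 then 1 else diameter U powr s)"

text \<open>
  Boundedness is required because \<^const>\<open>diameter\<close> has no meaning on unbounded sets.
\<close>
definition hausdorff_pre_measure :: "real \<Rightarrow> real \<Rightarrow> 'a::metric_space set \<Rightarrow> ennreal" where
  "hausdorff_pre_measure s \<delta> A =
     (INF U \<in> {U :: nat \<Rightarrow> 'a set. A \<subseteq> (\<Union>i. U i) \<and> (\<forall>i. bounded (U i) \<and> diameter (U i) \<le> \<delta>)}.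
        \<Sum>i. ennreal (hausdorff_gauge s (U i)))"

definition hausdorff_measure :: "real \<Rightarrow> 'a::metric_space set \<Rightarrow> ennreal" where
  "hausdorff_measure s A = (SUP \<delta> \<in> {0<..}. hausdorff_pre_measure s \<delta> A)"

definition hausdorff_dim :: "'a::metric_space set \<Rightarrow> ereal" where
  "hausdorff_dim A = Inf {ereal s | s. 0 \<le> s \<and> hausdorff_measure s A = 0}"


section \<open>The Gauss map and Lyapunov exponents\<close>

definition gauss_map :: "real \<Rightarrow> real" where
  "gauss_map x = (if x = 0 then 0 else frac (1 / x))"

text \<open>
  Every iterate of the Gauss map is differentiable at every irrational point of \<open>[0,1)\<close>, so
  \<^const>\<open>deriv\<close> is the true derivative below.
\<close>
definition lyapunov_level_set :: "real \<Rightarrow> real set" where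
  "lyapunov_level_set \<beta> =
     {x \<in> {0..<1}. x \<notin> \<rat> \<and>
        (\<lambda>n. 1 / real n * ln \<bar>deriv (gauss_map ^^ n) x\<bar>) \<longlonglongrightarrow> \<beta>}"

definition gauss_measure :: "real measure" where
  "gauss_measure = density (restrict_space lborel {0..<1}) (\<lambda>x. ennreal (1 / ((1 + x) * ln 2)))"

definition lambda0 :: real where
  "lambda0 = (LINT x|gauss_measure. ln \<bar>deriv gauss_map x\<bar>)"

definition gamma0 :: real where
  "gamma0 = 2 * ln ((1 + sqrt 5) / 2)"


section \<open>The pressure function\<close>

text \<open>
  \<open>cfrac_tail [\<omega>\<^sub>1, \<dots>, \<omega>\<^sub>n] x\<close> is the finite continued fraction \<open>[\<omega>\<^sub>1, \<dots>, \<omega>\<^sub>n + x]\<close> for \<open>n \<ge> 1\<close>.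
\<close>
fun cfrac_tail :: "nat list \<Rightarrow> real \<Rightarrow> real" where
  "cfrac_tail [] x = x"
| "cfrac_tail (w # ws) x = 1 / (real w + cfrac_tail ws x)"

text \<open>
  The \<open>n\<close>-fold sum over \<open>\<omega>\<^sub>1, \<dots>, \<omega>\<^sub>n \<ge> 1\<close> has positive terms and is written as one unordered sum
  over the words of length \<open>n\<close>. With 0-based \<open>j\<close>, \<open>drop j \<omega>\<close> is \<open>[\<omega>\<^bsub>j+1\<^esub>, \<dots>, \<omega>\<^sub>n]\<close>.
\<close>
definition pressure_sum :: "nat \<Rightarrow> real \<Rightarrow> real \<Rightarrow> real" where
  "pressure_sum n t q =
     (\<Sum>\<^sub>\<infinity>\<omega> \<in> {\<omega> :: nat list. length \<omega> = n \<and> (\<forall>w \<in> set \<omega>. 1 \<le> w)}.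
        exp (SUP x \<in> {0..1}. ln (\<Prod>j<n. cfrac_tail (drop j \<omega>) x powr (2 * (t - q)))))"

text \<open>Only meaningful for \<open>t - q > 1/2\<close>, where all the sums and the limit exist.\<close>
definition P1 :: "real \<Rightarrow> real \<Rightarrow> real" where
  "P1 t q = lim (\<lambda>n. 1 / real n * ln (pressure_sum n t q))"

definition D0 :: "(real \<times> real) set" where
  "D0 = {(t, q). t - q > 1 / 2 \<and> 0 \<le> t \<and> t \<le> 1}"

definition spectrum_point :: "real \<Rightarrow> real \<times> real" where
  "spectrum_point \<beta> =
     (THE (t, q). (t, q) \<in> D0 \<and> P1 t q = q * \<beta> \<and>
        ((\<lambda>q'. P1 t q') has_real_derivative \<beta>) (at q))"

text \<open>Only meaningful for \<open>\<beta> \<ge> gamma0\<close>.\<close>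
definition t_tilde :: "real \<Rightarrow> real" where
  "t_tilde \<beta> = (if \<beta> = gamma0 then 0 else fst (spectrum_point \<beta>))"

end

theory Submission
  imports Defs "HOL-Complex_Analysis.Complex_Analysis" "HOL-Probability.Probability"
begin

text \<open>
  The pressure depends only on \<open>s = t - q\<close>: it is the logarithm of the leading eigenvalue of the
  transfer operator \<open>L\<^sub>s f x = (\<Sum>k. (1 / (k + x)) powr (2 * s) * f (1 / (k + x)))\<close>, whose iterates
  at the constant function \<open>1\<close> are the sums over words, up to bounded factors. These iterates
  stay in a cone of functions with bounded logarithmic oscillation. For complex \<open>s\<close> near the real
  axis they stay in a complex cone, hence do not vanish, and their normalised logarithms converge
  to a holomorphic extension of the pressure \<open>P\<close>. A Cauchy--Schwarz inequality with a definite
  gain at each step makes \<open>P\<close> strictly convex.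

  If \<open>P' s = - \<beta>\<close>, the system solves to \<open>t = s + P s / \<beta>\<close> and \<open>q = P s / \<beta>\<close>, so that
  \<open>t' = - P s / \<beta>\<^sup>2\<close>. The Gauss density is the eigenfunction at \<open>s = 1\<close>, which gives \<open>P 1 = 0\<close> and
  \<open>P' 1 = - \<lambda>\<^sub>0\<close>; the limits come from the divergence of \<open>P\<close> at \<open>1/2\<close> and from
  \<open>P s + \<gamma>\<^sub>0 * s \<longlonglongrightarrow> 0\<close> at infinity.

  The dimension is bounded above by covering with the cylinders on which the derivative has the
  right size. It is bounded below by the mass distribution principle for a Gibbs measure on digit
  sequences: a Markov chain whose kernel is \<open>L\<^sub>s\<close> normalised by a function \<open>h\<close> with
  \<open>exp (P s) * h \<le> L\<^sub>s h\<close>, run over the reversed words.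
\<close>

section \<open>The transfer operator of the Gauss map\<close>

text \<open>What takes the place of a spectral gap is one metric, \<open>ldist\<close>, in which
  every branch contracts by 1/2, although branch 0 has Euclidean slope -1 at 0. A bound
  \<open>a\<close> on the logarithmic oscillation becomes \<open>2 * s + a / 2\<close>, so
  \<open>4 * s\<close> is invariant and every larger value is strictly improved. The strict
  improvement is what survives a complex perturbation of \<open>s\<close>, uniformly in the number
  of iterations. It makes the normalised logarithmic derivatives a normal family, and a
  subsequential limit is enough because the pressure is already a limit along all \<open>n\<close>.

  For the lower bound on the dimension, cylinder masses are wanted only from above, and a one-sided
  inequality for \<open>h\<close> yields that. Typical sequences come from exponential tail bounds,
  paid for by the derivative of the pressure at the chosen \<open>s\<close>, not from an ergodic
  theorem. The neighbours of a cylinder may be far shorter than the cylinder itself; the mass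
  estimate therefore rests on the fact that at most two typical words of a suitable length can meet
  a small set.\<close>

text \<open>\<open>branch k\<close> belongs to the continued fraction digit \<open>k + 1\<close>.\<close>

definition branch :: "nat \<Rightarrow> real \<Rightarrow> real" where
  "branch k x = 1 / (real k + 1 + x)"

text \<open>Length measured by \<open>1 / (1 + x)\<close>, the Gauss density up to a factor. It
  controls both the weights (\<open>ln_branch_diff\<close>) and the branches
  (\<open>ldist_branch\<close>) with constants that do not depend on the branch.\<close>

definition ldist :: "real \<Rightarrow> real \<Rightarrow> real" where
  "ldist x y = \<bar>ln (1 + x) - ln (1 + y)\<bar>"

definition transfer :: "real \<Rightarrow> (real \<Rightarrow> real) \<Rightarrow> real \<Rightarrow> real" where
  "transfer s f x = (\<Sum>k. branch k x powr (2 * s) * f (branch k x))"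

text \<open>The partition function: by \<open>has_sum_words\<close> the sum of
  \<open>wprod \<omega> x powr (2 * s)\<close> over the words of length \<open>n\<close>.\<close>

definition zpart :: "nat \<Rightarrow> real \<Rightarrow> real \<Rightarrow> real" where
  "zpart n s = (transfer s ^^ n) (\<lambda>_. 1)"

text \<open>Written without logarithms, so that all conditions are linear in \<open>f\<close>; this
  is what the complexification builds on.\<close>

definition lcone :: "real \<Rightarrow> (real \<Rightarrow> real) set" where
  "lcone a = {f. (\<forall>x\<in>{0..1}. 0 \<le> f x) \<and> (\<forall>x\<in>{0..1}. \<forall>y\<in>{0..1}. f y \<le> exp (a * ldist x y) * f x)}"

lemma branch_pos: "0 \<le> x \<Longrightarrow> 0 < branch k x"
  by (simp add: branch_def add_pos_nonneg)

lemma branch_le: "0 \<le> x \<Longrightarrow> branch k x \<le> 1 / (real k + 1)"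
  by (simp add: branch_def frac_le)

lemma branch_le_1: "0 \<le> x \<Longrightarrow> branch k x \<le> 1"
  by (simp add: branch_def)

lemma branch_simps [simp]:
  assumes "0 \<le> x"
  shows "0 < branch k x" "0 \<le> branch k x" "branch k x \<le> 1" "branch k x \<noteq> 0"
  using branch_pos[OF assms, of k] branch_le_1[OF assms, of k] by auto

lemma branch_in: "x \<in> {0..1} \<Longrightarrow> branch k x \<in> {0..1}"
  using branch_pos[of x k] branch_le_1[of x k] by auto

lemma branch_powr_le:
  assumes "0 \<le> x" "0 \<le> s"
  shows "branch k x powr (2 * s) \<le> (real k + 1) powr (- 2 * s)"
proof -
  have "branch k x powr (2 * s) \<le> (1 / (real k + 1)) powr (2 * s)"
    using branch_le[of x k] branch_pos[of x k] assms by (intro powr_mono2) auto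
  also have "\<dots> = (real k + 1) powr (- 2 * s)"
    by (simp add: powr_divide powr_minus divide_simps)
  finally show ?thesis .
qed

lemma summable_shift_powr:
  fixes s :: real
  assumes "s > 1/2"
  shows "summable (\<lambda>k. (real k + 1) powr (- 2 * s))"
proof -
  have "summable (\<lambda>k. real k powr (- 2 * s))"
    using assms by (subst summable_real_powr_iff) auto
  hence "summable (\<lambda>k. real (Suc k) powr (- 2 * s))"
    by (subst summable_Suc_iff)
  thus ?thesis by (simp add: add.commute)
qed

lemma summable_branch_powr:
  assumes "s > 1/2" "0 \<le> x"
  shows "summable (\<lambda>k. branch k x powr (2 * s))"
  using branch_powr_le[OF assms(2), of s] assms
  by (intro summable_comparison_test'[OF summable_shift_powr[OF assms(1)], of 0]) auto

lemma summable_transfer: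
  fixes f :: "real \<Rightarrow> real"
  assumes "s > 1/2" "x \<in> {0..1}" "\<And>y. y \<in> {0..1} \<Longrightarrow> \<bar>f y\<bar> \<le> B"
  shows "summable (\<lambda>k. branch k x powr (2 * s) * f (branch k x))"
proof (rule summable_comparison_test'[of "\<lambda>k. branch k x powr (2 * s) * B" 0])
  show "summable (\<lambda>k. branch k x powr (2 * s) * B)"
    using assms by (intro summable_mult2 summable_branch_powr) auto
  show "norm (branch k x powr (2 * s) * f (branch k x)) \<le> branch k x powr (2 * s) * B" for k
    using assms(2) assms(3)[of "branch k x"] by (auto simp: abs_mult intro!: mult_left_mono)
qed

lemma ldist_nonneg [simp]: "0 \<le> ldist x y"
  by (simp add: ldist_def)

lemma ldist_sym: "ldist x y = ldist y x"
  by (simp add: ldist_def abs_minus_commute)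

lemma ldist_self [simp]: "ldist x x = 0"
  by (simp add: ldist_def)

lemma ldist_le_ln2:
  assumes "x \<in> {0..1}" "y \<in> {0..1}"
  shows "ldist x y \<le> ln 2"
proof -
  have "0 \<le> ln (1 + x)" "0 \<le> ln (1 + y)" "ln (1 + x) \<le> ln 2" "ln (1 + y) \<le> ln 2"
    using assms by auto
  thus ?thesis by (simp add: ldist_def)
qed

text \<open>For \<open>x \<le> y\<close> the ratio \<open>(k + 1 + y) / (k + 1 + x)\<close> is
  largest at \<open>k = 0\<close>, where the bound is an equality.\<close>

lemma ln_branch_diff:
  assumes "x \<in> {0..1}" "y \<in> {0..1}"
  shows "\<bar>ln (branch k x) - ln (branch k y)\<bar> \<le> ldist x y"
proof -
  have *: "\<bar>ln (branch k x) - ln (branch k y)\<bar> \<le> ldist x y"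
    if "x \<le> y" "x \<in> {0..1}" "y \<in> {0..1}" for x y :: real
  proof -
    have "(real k + 1 + y) / (real k + 1 + x) \<le> (1 + y) / (1 + x)"
      using that by (simp add: divide_simps) (simp add: algebra_simps mult_right_mono)
    hence "ln ((real k + 1 + y) / (real k + 1 + x)) \<le> ln ((1 + y) / (1 + x))"
      using that by (subst ln_le_cancel_iff) (auto intro!: divide_pos_pos)
    hence "ln (real k + 1 + y) - ln (real k + 1 + x) \<le> ln (1 + y) - ln (1 + x)"
      using that by (subst (asm) (1 2) ln_div) auto
    moreover have "ln (real k + 1 + x) \<le> ln (real k + 1 + y)"
      using that by auto
    ultimately show ?thesis
      using that by (simp add: branch_def ldist_def ln_div)
  qed
  show ?thesis
    using *[of x y] *[of y x] assms by (cases "x \<le> y") (auto simp: ldist_sym abs_minus_commute)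
qed

text \<open>As \<open>1 + branch k z = (k + 2 + z) / (k + 1 + z)\<close>, the claim integrates the
  inequality \<open>2 * (1 + z) \<le> (k + 1 + z) * (k + 2 + z)\<close>. Equality at
  \<open>k = z = 0\<close> makes 1/2 the best factor.\<close>

lemma ldist_branch:
  assumes "x \<in> {0..1}" "y \<in> {0..1}"
  shows "ldist (branch k x) (branch k y) \<le> ldist x y / 2"
proof -
  define G where "G = (\<lambda>x::real. ln (1 + x) / 2 - ln (real k + 1 + x) + ln (real k + 2 + x))"
  have *: "ldist (branch k x) (branch k y) \<le> ldist x y / 2"
    if "x \<le> y" "x \<in> {0..1}" "y \<in> {0..1}" for x y :: real
  proof -
    have e: "ln (1 + branch k z) = ln (real k + 2 + z) - ln (real k + 1 + z)" if "z \<ge> 0" for z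
    proof -
      have "1 + branch k z = (real k + 2 + z) / (real k + 1 + z)"
        using that by (simp add: branch_def field_simps)
      thus ?thesis using that by (simp add: ln_div)
    qed
    have "G x \<le> G y"
    proof (rule DERIV_nonneg_imp_nondecreasing[OF \<open>x \<le> y\<close>])
      fix z assume z: "x \<le> z" "z \<le> y"
      hence z0: "z \<ge> 0" using that by auto
      have "(G has_real_derivative (1 / (1 + z) / 2 - 1 / (real k + 1 + z) + 1 / (real k + 2 + z))) (at z)"
        unfolding G_def using z0
        by (intro DERIV_add DERIV_diff DERIV_cdivide) (auto intro!: derivative_eq_intros)
      hence "(G has_real_derivative (1 / (2 * (1 + z)) - 1 / (real k + 1 + z) + 1 / (real k + 2 + z))) (at z)"
        by (simp only: divide_divide_eq_left mult.commute)
      moreover have "1 / (2 * (1 + z)) - 1 / (real k + 1 + z) + 1 / (real k + 2 + z) \<ge> 0"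
      proof -
        have "2 * (1 + z) \<le> (real k + 1 + z) * (real k + 2 + z)"
        proof -
          have "2 * (1 + z) \<le> (2 + z) * (1 + z)"
            using z0 by (intro mult_right_mono) auto
          also have "\<dots> \<le> (real k + 2 + z) * (real k + 1 + z)"
            using z0 by (intro mult_mono) auto
          finally show ?thesis by (simp add: mult.commute)
        qed
        hence "1 / ((real k + 1 + z) * (real k + 2 + z)) \<le> 1 / (2 * (1 + z))"
          using z0 by (intro divide_left_mono mult_pos_pos) auto
        moreover have "1 / (real k + 1 + z) - 1 / (real k + 2 + z) = 1 / ((real k + 1 + z) * (real k + 2 + z))"
          using z0 by (simp add: divide_simps)
        ultimately show ?thesis by linarith
      qed
      ultimately show "\<exists>y. (G has_real_derivative y) (at z) \<and> 0 \<le> y" by blast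
    qed
    moreover have "ln (1 + branch k y) \<le> ln (1 + branch k x)"
      using that branch_pos[of x k] branch_pos[of y k] frac_le[of 1 1 "real k + 1 + x" "real k + 1 + y"]
      by (subst ln_le_cancel_iff) (auto simp: branch_def add_pos_nonneg)
    moreover have "ln (1 + x) \<le> ln (1 + y)" using that by auto
    ultimately show ?thesis
      unfolding ldist_def using that by (simp add: G_def e)
  qed
  show ?thesis
    using *[of x y] *[of y x] assms by (cases "x \<le> y") (auto simp: ldist_sym)
qed

lemma branch_powr_ratio:
  assumes "x \<in> {0..1}" "y \<in> {0..1}" "0 \<le> s"
  shows "branch k y powr (2 * s) \<le> exp (2 * s * ldist x y) * branch k x powr (2 * s)"
proof -
  have "ln (branch k y) \<le> ldist x y + ln (branch k x)"
    using ln_branch_diff[OF assms(1,2), of k] by linarith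
  hence "2 * s * ln (branch k y) \<le> 2 * s * (ldist x y + ln (branch k x))"
    using assms by (intro mult_left_mono) auto
  hence "exp (2 * s * ln (branch k y)) \<le> exp (2 * s * ldist x y + 2 * s * ln (branch k x))"
    by (simp add: algebra_simps)
  thus ?thesis
    using branch_pos[of x k] branch_pos[of y k] assms by (simp add: powr_def exp_add)
qed

section \<open>Cones of functions of bounded logarithmic oscillation\<close>

lemma coneD_nonneg: "f \<in> lcone a \<Longrightarrow> x \<in> {0..1} \<Longrightarrow> 0 \<le> f x"
  by (auto simp: lcone_def)

lemma coneD: "f \<in> lcone a \<Longrightarrow> x \<in> {0..1} \<Longrightarrow> y \<in> {0..1} \<Longrightarrow> f y \<le> exp (a * ldist x y) * f x"
  by (auto simp: lcone_def)

lemma cone_le: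
  assumes "f \<in> lcone a" "0 \<le> a" "x \<in> {0..1}" "y \<in> {0..1}"
  shows "f y \<le> 2 powr a * f x"
proof -
  have "f y \<le> exp (a * ldist x y) * f x" using assms coneD by blast
  also have "\<dots> \<le> 2 powr a * f x"
    using ldist_le_ln2[OF assms(3,4)] assms coneD_nonneg[OF assms(1,3)]
    by (intro mult_right_mono) (auto simp: powr_def mult_left_mono)
  finally show ?thesis .
qed

lemma cone_bound:
  assumes "f \<in> lcone a" "0 \<le> a" "y \<in> {0..1}"
  shows "\<bar>f y\<bar> \<le> 2 powr a * f 0"
  using cone_le[OF assms(1,2), of 0 y] assms coneD_nonneg[OF assms(1,3)] by auto

lemma cone_const:
  assumes "0 \<le> c" "0 \<le> a"
  shows "(\<lambda>_. c) \<in> lcone a"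
  unfolding lcone_def
proof (intro CollectI conjI ballI)
  fix x y :: real
  have "1 * c \<le> exp (a * ldist x y) * c"
    using assms by (intro mult_right_mono) auto
  thus "c \<le> exp (a * ldist x y) * c" by simp
qed (use assms in auto)

text \<open>The weights contribute \<open>2 * s\<close> to the oscillation, and the contraction of
  the branches halves the old value. The fixed point of this recursion is \<open>4 * s\<close>, the
  constant of \<open>part_cone\<close>.\<close>

lemma transfer_cone:
  assumes "f \<in> lcone a" "0 \<le> a" "s > 1/2"
  shows "transfer s f \<in> lcone (2 * s + a / 2)"
  unfolding lcone_def
proof (intro CollectI conjI ballI)
  have summ: "summable (\<lambda>k. branch k x powr (2 * s) * f (branch k x))" if "x \<in> {0..1}" for x
    using that assms by (intro summable_transfer[OF _ _ cone_bound]) auto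
  have nn: "0 \<le> f y" if "y \<in> {0..1}" for y using assms that coneD_nonneg by blast
  fix x :: real assume x: "x \<in> {0..1}"
  show "0 \<le> transfer s f x"
    unfolding transfer_def using x summ nn by (intro suminf_nonneg) auto
  fix y :: real assume y: "y \<in> {0..1}"
  have "transfer s f y \<le> (\<Sum>k. exp ((2 * s + a / 2) * ldist x y) * (branch k x powr (2 * s) * f (branch k x)))"
    unfolding transfer_def
  proof (rule suminf_le)
    show "summable (\<lambda>k. exp ((2 * s + a / 2) * ldist x y) * (branch k x powr (2 * s) * f (branch k x)))"
      using summ x by (intro summable_mult)
    show "branch k y powr (2 * s) * f (branch k y) \<le>
         exp ((2 * s + a / 2) * ldist x y) * (branch k x powr (2 * s) * f (branch k x))" for k
    proof -
      have "f (branch k y) \<le> exp (a * ldist (branch k x) (branch k y)) * f (branch k x)"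
        using assms x y by (intro coneD) auto
      also have "\<dots> \<le> exp (a / 2 * ldist x y) * f (branch k x)"
        using ldist_branch[OF x y, of k] nn[of "branch k x"] x \<open>0 \<le> a\<close> mult_left_mono[OF ldist_branch[OF x y, of k] \<open>0 \<le> a\<close>]
        by (intro mult_right_mono) (auto simp: field_simps)
      finally have "branch k y powr (2 * s) * f (branch k y)
          \<le> (exp (2 * s * ldist x y) * branch k x powr (2 * s)) * (exp (a / 2 * ldist x y) * f (branch k x))"
        using branch_powr_ratio[OF x y, of s k] nn[of "branch k y"] y assms by (intro mult_mono) auto
      thus ?thesis by (simp add: exp_add algebra_simps)
    qed
  qed (use summ y in auto)
  also have "\<dots> = exp ((2 * s + a / 2) * ldist x y) * transfer s f x"
    unfolding transfer_def using summ x by (intro suminf_mult)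
  finally show "transfer s f y \<le> exp ((2 * s + a / 2) * ldist x y) * transfer s f x" .
qed

lemma transfer_mono:
  assumes "s > 1/2" "x \<in> {0..1}" "\<And>y. y \<in> {0..1} \<Longrightarrow> f y \<le> g y"
    "\<And>y. y \<in> {0..1} \<Longrightarrow> \<bar>f y\<bar> \<le> B" "\<And>y. y \<in> {0..1} \<Longrightarrow> \<bar>g y\<bar> \<le> C"
  shows "transfer s f x \<le> transfer s g x"
  unfolding transfer_def
proof (rule suminf_le)
  show "summable (\<lambda>k. branch k x powr (2 * s) * f (branch k x))"
    using assms by (intro summable_transfer[where B=B]) auto
  show "summable (\<lambda>k. branch k x powr (2 * s) * g (branch k x))"
    using assms by (intro summable_transfer[where B=C]) auto
qed (use assms in \<open>auto intro!: mult_left_mono\<close>)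

lemma transfer_cmult:
  assumes "s > 1/2" "x \<in> {0..1}" "\<And>y. y \<in> {0..1} \<Longrightarrow> \<bar>f y\<bar> \<le> B"
  shows "transfer s (\<lambda>y. c * f y) x = c * transfer s f x"
  using suminf_mult[OF summable_transfer[OF assms], where c=c]
  unfolding transfer_def by (simp add: algebra_simps)

lemma part_0 [simp]: "zpart 0 s x = 1"
  by (simp add: zpart_def)

lemma part_Suc: "zpart (Suc n) s = transfer s (zpart n s)"
  by (simp add: zpart_def)

lemma part_cone:
  assumes "s > 1/2"
  shows "zpart n s \<in> lcone (4 * s)"
proof (induction n)
  case 0
  then show ?case unfolding zpart_def using assms by (auto intro!: cone_const)
next
  case (Suc n)
  show ?case using transfer_cone[OF Suc _ assms] assms by (simp add: part_Suc)
qed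

lemma part_ratio:
  assumes "s > 1/2" "x \<in> {0..1}" "y \<in> {0..1}"
  shows "zpart n s y \<le> 2 powr (4 * s) * zpart n s x"
  using assms by (intro cone_le part_cone) auto

lemma part_bound:
  assumes "s > 1/2" "y \<in> {0..1}"
  shows "\<bar>zpart n s y\<bar> \<le> 2 powr (4 * s) * zpart n s 0"
  using assms by (intro cone_bound part_cone) auto

lemma transfer_pos:
  assumes "f \<in> lcone a" "0 \<le> a" "s > 1/2" "x \<in> {0..1}" "\<And>y. y \<in> {0..1} \<Longrightarrow> 0 < f y"
  shows "0 < transfer s f x"
  unfolding transfer_def
proof (rule suminf_pos)
  show "summable (\<lambda>k. branch k x powr (2 * s) * f (branch k x))"
    using assms cone_bound[OF assms(1,2)] by (intro summable_transfer) auto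
qed (use assms in auto)

lemma part_pos:
  assumes "s > 1/2" "x \<in> {0..1}"
  shows "0 < zpart n s x"
  using assms(2)
proof (induction n arbitrary: x)
  case (Suc n)
  thus ?case unfolding part_Suc using assms part_cone[OF assms(1)]
    by (intro transfer_pos[of _ "4 * s"]) auto
qed auto

text \<open>Positivity of the operator propagates the bounds \<open>c\<close> and \<open>C\<close>,
  so iterates of a bounded function are compared with those of the constant 1.\<close>

lemma transfer_iter_bounds:
  assumes "s > 1/2" "x \<in> {0..1}" "\<And>y. y \<in> {0..1} \<Longrightarrow> c \<le> f y" "\<And>y. y \<in> {0..1} \<Longrightarrow> f y \<le> C"
  shows "c * zpart n s x \<le> (transfer s ^^ n) f x \<and> (transfer s ^^ n) f x \<le> C * zpart n s x"
  using assms(2)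
proof (induction n arbitrary: x)
  case 0
  thus ?case using assms by auto
next
  case (Suc n)
  \<comment> \<open>A crude bound, wanted only for the convergence of the series in
    \<open>transfer_mono\<close>.\<close>
  define B where "B = (\<bar>c\<bar> + \<bar>C\<bar>) * (2 powr (4 * s) * zpart n s 0)"
  have B: "\<bar>g\<bar> \<le> B" if "y \<in> {0..1}" "c * zpart n s y \<le> g" "g \<le> C * zpart n s y" for g y
  proof -
    have "\<bar>g\<bar> \<le> (\<bar>c\<bar> + \<bar>C\<bar>) * \<bar>zpart n s y\<bar>"
    proof -
      have "\<bar>g\<bar> \<le> \<bar>c * zpart n s y\<bar> + \<bar>C * zpart n s y\<bar>" using that by linarith
      thus ?thesis by (simp add: abs_mult algebra_simps)
    qed
    also have "\<dots> \<le> B" unfolding B_def using part_bound[OF assms(1) that(1)] by (intro mult_left_mono) auto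
    finally show ?thesis .
  qed
  have cC: "c * zpart n s y \<le> C * zpart n s y" if "y \<in> {0..1}" for y
    using Suc.IH[OF that] by linarith
  have "transfer s (\<lambda>y. c * zpart n s y) x \<le> transfer s ((transfer s ^^ n) f) x"
    using Suc assms B cC by (intro transfer_mono[where B=B and C=B]) auto
  moreover have "transfer s ((transfer s ^^ n) f) x \<le> transfer s (\<lambda>y. C * zpart n s y) x"
    using Suc assms B cC by (intro transfer_mono[where B=B and C=B]) auto
  moreover have "transfer s (\<lambda>y. d * zpart n s y) x = d * transfer s (zpart n s) x" for d
    using Suc.prems assms(1) part_bound[OF assms(1)] by (intro transfer_cmult)
  ultimately show ?case by (simp add: part_Suc)
qed

lemma part_add: "zpart (n + m) s = (transfer s ^^ n) (zpart m s)"
  by (simp add: zpart_def funpow_add)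

text \<open>Bounded distortion: \<open>zpart m s\<close> varies by a factor of at most
  \<open>2 powr (4 * s)\<close>, so concatenating blocks is multiplicative up to that factor.
  Together with \<open>part_add_ge\<close> this yields the pressure with a bounded error.\<close>

lemma part_add_le:
  assumes "s > 1/2"
  shows "zpart (n + m) s 0 \<le> 2 powr (4 * s) * zpart n s 0 * zpart m s 0"
proof -
  have "(transfer s ^^ n) (zpart m s) 0 \<le> (2 powr (4 * s) * zpart m s 0) * zpart n s 0"
    using transfer_iter_bounds[of s 0 "2 powr (- (4 * s)) * zpart m s 0" "zpart m s" "2 powr (4 * s) * zpart m s 0" n]
      part_ratio[OF assms, of _ _ m] assms by (auto simp: powr_minus divide_simps mult.commute)
  thus ?thesis by (simp add: part_add mult_ac)
qed

lemma part_add_ge: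
  assumes "s > 1/2"
  shows "2 powr (- (4 * s)) * zpart n s 0 * zpart m s 0 \<le> zpart (n + m) s 0"
proof -
  have "(2 powr (- (4 * s)) * zpart m s 0) * zpart n s 0 \<le> (transfer s ^^ n) (zpart m s) 0"
    using transfer_iter_bounds[of s 0 "2 powr (- (4 * s)) * zpart m s 0" "zpart m s" "2 powr (4 * s) * zpart m s 0" n]
      part_ratio[OF assms, of _ _ m] assms by (auto simp: powr_minus divide_simps mult.commute)
  thus ?thesis by (simp add: part_add mult_ac)
qed

section \<open>Continued fraction words and the pressure\<close>

definition words :: "nat \<Rightarrow> nat list set" where
  "words n = {\<omega>. length \<omega> = n \<and> (\<forall>w\<in>set \<omega>. 1 \<le> w)}"

text \<open>Its square is the absolute derivative of \<open>cfrac_tail \<omega>\<close> at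
  \<open>x\<close>; \<open>cfrac_tail_diff\<close> is the exact version for differences.\<close>

definition wprod :: "nat list \<Rightarrow> real \<Rightarrow> real" where
  "wprod \<omega> x = (\<Prod>j<length \<omega>. cfrac_tail (drop j \<omega>) x)"

text \<open>The denominators \<open>q_n\<close> and \<open>q_(n-1)\<close> of the last two
  convergents, in this order.\<close>

fun cden :: "nat list \<Rightarrow> nat \<times> nat" where
  "cden \<omega> = foldl (\<lambda>(a, b) w. (a * w + b, a)) (1, 0) \<omega>"

declare cden.simps [simp del]

lemma cden_Nil [simp]: "cden [] = (1, 0)"
  by (simp add: cden.simps)

lemma cden_snoc: "cden (\<omega> @ [w]) = (fst (cden \<omega>) * w + snd (cden \<omega>), fst (cden \<omega>))"
  by (simp add: cden.simps split_beta)

lemma words_0 [simp]: "words 0 = {[]}"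
  by (auto simp: words_def)

text \<open>Digits are split off at the end, because there a digit acts by substituting
  \<open>branch k x\<close> for \<open>x\<close>, exactly as in \<open>transfer\<close>.\<close>

lemma words_Suc: "words (Suc n) = (\<lambda>(k, \<omega>). \<omega> @ [Suc k]) ` (UNIV \<times> words n)"
proof (intro equalityI subsetI)
  fix \<omega> assume w: "\<omega> \<in> words (Suc n)"
  then obtain \<omega>' w where e: "\<omega> = \<omega>' @ [w]"
    by (cases \<omega> rule: rev_cases) (auto simp: words_def)
  with w have "\<omega> = (\<lambda>(k, \<omega>). \<omega> @ [Suc k]) (w - 1, \<omega>')" "\<omega>' \<in> words n"
    by (auto simp: words_def)
  thus "\<omega> \<in> (\<lambda>(k, \<omega>). \<omega> @ [Suc k]) ` (UNIV \<times> words n)" by blast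
qed (auto simp: words_def)

lemma cfrac_tail_snoc: "cfrac_tail (\<omega> @ [Suc k]) x = cfrac_tail \<omega> (branch k x)"
  by (induction \<omega>) (auto simp: branch_def add.commute)

lemma wprod_Nil [simp]: "wprod [] x = 1"
  by (simp add: wprod_def)

lemma wprod_snoc: "wprod (\<omega> @ [Suc k]) x = wprod \<omega> (branch k x) * branch k x"
proof -
  have "wprod (\<omega> @ [Suc k]) x = (\<Prod>j<length \<omega>. cfrac_tail (drop j (\<omega> @ [Suc k])) x) * cfrac_tail [Suc k] x"
    unfolding wprod_def by simp
  also have "(\<Prod>j<length \<omega>. cfrac_tail (drop j (\<omega> @ [Suc k])) x) = wprod \<omega> (branch k x)"
    unfolding wprod_def by (intro prod.cong) (auto simp: cfrac_tail_snoc[symmetric])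
  finally show ?thesis by (simp add: branch_def add.commute)
qed

lemma cden_bounds: "\<omega> \<in> words n \<Longrightarrow> snd (cden \<omega>) \<le> fst (cden \<omega>) \<and> 1 \<le> fst (cden \<omega>)"
proof (induction n arbitrary: \<omega>)
  case (Suc n)
  then obtain k \<omega>' where "\<omega> = \<omega>' @ [Suc k]" "\<omega>' \<in> words n" by (auto simp: words_Suc)
  with Suc.IH[of \<omega>'] show ?case by (auto simp: cden_snoc)
qed auto

text \<open>The classical formula \<open>1 / (q_n + q_(n-1) * x)\<close>, from which all distortion
  estimates are read off.\<close>

lemma wprod_eq:
  assumes "\<omega> \<in> words n" "0 \<le> x"
  shows "wprod \<omega> x = 1 / (real (fst (cden \<omega>)) + real (snd (cden \<omega>)) * x)"
  using assms
proof (induction n arbitrary: \<omega> x)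
  case (Suc n)
  then obtain k \<omega>' where w: "\<omega> = \<omega>' @ [Suc k]" "\<omega>' \<in> words n" by (auto simp: words_Suc)
  have "real (fst (cden \<omega>')) \<ge> 1" using cden_bounds[OF w(2)] by simp
  hence "wprod \<omega> x = 1 / (real (fst (cden \<omega>')) + real (snd (cden \<omega>')) * branch k x) * branch k x"
    using Suc.IH[OF w(2), of "branch k x"] Suc.prems by (simp add: w wprod_snoc)
  also have "\<dots> = 1 / ((real (fst (cden \<omega>')) + real (snd (cden \<omega>')) * branch k x) * (real k + 1 + x))"
    using Suc.prems(2) by (simp add: branch_def)
  also have "(real (fst (cden \<omega>')) + real (snd (cden \<omega>')) * branch k x) * (real k + 1 + x)
     = real (fst (cden \<omega>)) + real (snd (cden \<omega>)) * x"
    using Suc.prems(2) by (simp add: branch_def w cden_snoc field_simps add_nonneg_eq_0_iff)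
  finally show ?case .
qed auto

lemma wprod_0: "\<omega> \<in> words n \<Longrightarrow> wprod \<omega> 0 = 1 / real (fst (cden \<omega>))"
  by (simp add: wprod_eq)

lemma wprod_0_pos: "\<omega> \<in> words n \<Longrightarrow> 0 < wprod \<omega> 0"
  using cden_bounds by (force simp: wprod_0)

text \<open>The factor 2 is the whole distortion: \<open>q_(n-1) \<le> q_n\<close> gives
  \<open>q_n + q_(n-1) * x \<le> 2 * q_n\<close>.\<close>

lemma wprod_bounds:
  assumes "\<omega> \<in> words n" "x \<in> {0..1}"
  shows "wprod \<omega> x \<le> wprod \<omega> 0" "wprod \<omega> 0 \<le> 2 * wprod \<omega> x" "0 < wprod \<omega> x"
proof -
  define A B where "A = real (fst (cden \<omega>))" "B = real (snd (cden \<omega>))"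
  have AB: "1 \<le> A" "0 \<le> B" "B \<le> A" using cden_bounds[OF assms(1)] by (auto simp: A_B_def)
  have w: "wprod \<omega> y = 1 / (A + B * y)" if "y \<in> {0..1}" for y
    using wprod_eq[OF assms(1), of y] that by (simp add: A_B_def)
  have pos: "A + B * x > 0" using AB assms by (intro add_pos_nonneg) auto
  show "wprod \<omega> x \<le> wprod \<omega> 0" "0 < wprod \<omega> x"
    using pos AB assms by (auto simp: w intro!: divide_left_mono mult_pos_pos)
  have "B * x \<le> A * 1" using AB assms by (intro mult_mono) auto
  thus "wprod \<omega> 0 \<le> 2 * wprod \<omega> x"
    using pos AB assms by (auto simp: w field_simps)
qed

lemma cfrac_tail_pos:
  assumes "\<forall>w\<in>set \<omega>. 1 \<le> w" "0 \<le> x"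
  shows "0 \<le> cfrac_tail \<omega> x" "\<omega> \<noteq> [] \<Longrightarrow> 0 < cfrac_tail \<omega> x"
  using assms by (induction \<omega>) (auto simp: add_pos_nonneg)

text \<open>Moebius maps of determinant +-1 satisfy the mean value theorem exactly, with the
  geometric mean of the derivatives at the two points.\<close>

lemma cfrac_tail_diff:
  assumes "\<forall>w\<in>set \<omega>. 1 \<le> w" "0 \<le> x" "0 \<le> y"
  shows "\<bar>cfrac_tail \<omega> x - cfrac_tail \<omega> y\<bar> = wprod \<omega> x * wprod \<omega> y * \<bar>x - y\<bar>"
  using assms
proof (induction \<omega>)
  case (Cons w ws)
  let ?c = "cfrac_tail ws x" and ?d = "cfrac_tail ws y"
  have wp: "wprod (w # ws) z = cfrac_tail (w # ws) z * wprod ws z" for z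
    unfolding wprod_def by (simp add: prod.lessThan_Suc_shift del: prod.lessThan_Suc)
  have pos: "real w + ?c > 0" "real w + ?d > 0"
    using Cons.prems cfrac_tail_pos[of ws x] cfrac_tail_pos[of ws y] by (auto intro: add_pos_nonneg)
  have "cfrac_tail (w # ws) x - cfrac_tail (w # ws) y = (?d - ?c) * (1 / (real w + ?c) * (1 / (real w + ?d)))"
    using pos by (simp add: divide_simps)
  hence "\<bar>cfrac_tail (w # ws) x - cfrac_tail (w # ws) y\<bar> = \<bar>?c - ?d\<bar> * (1 / (real w + ?c) * (1 / (real w + ?d)))"
    using pos by (simp add: abs_mult abs_minus_commute)
  also have "\<bar>?c - ?d\<bar> = wprod ws x * wprod ws y * \<bar>x - y\<bar>"
    using Cons by auto
  finally show ?case by (simp add: wp)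
qed auto

lemma has_sum_words:
  assumes "s > 1/2" "x \<in> {0..1}"
  shows "((\<lambda>\<omega>. wprod \<omega> x powr (2 * s)) has_sum zpart n s x) (words n)"
  using assms(2)
proof (induction n arbitrary: x)
  case 0
  show ?case using has_sum_finite[of "{[]}" "\<lambda>\<omega>. wprod \<omega> x powr (2 * s)"] by simp
next
  case (Suc n)
  define f where "f = (\<lambda>(k, \<omega>). wprod (\<omega> @ [Suc k]) x powr (2 * s))"
  have sm: "summable (\<lambda>k. branch k x powr (2 * s) * zpart n s (branch k x))"
    using Suc.prems assms(1) part_bound[OF assms(1)] by (intro summable_transfer) auto
  have g: "((\<lambda>k. branch k x powr (2 * s) * zpart n s (branch k x)) has_sum zpart (Suc n) s x) UNIV"
    unfolding part_Suc transfer_def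
    using Suc.prems assms(1) part_pos[OF assms(1), of "branch _ x" n] less_imp_le
    by (intro sums_nonneg_imp_has_sum summable_sums sm mult_nonneg_nonneg) (force simp: branch_in less_imp_le)+
  have f: "((\<lambda>\<omega>. f (k, \<omega>)) has_sum (branch k x powr (2 * s) * zpart n s (branch k x))) (words n)" for k
  proof -
    have "((\<lambda>\<omega>. branch k x powr (2 * s) * wprod \<omega> (branch k x) powr (2 * s)) has_sum
        (branch k x powr (2 * s) * zpart n s (branch k x))) (words n)"
      using Suc.prems by (intro has_sum_cmult_right Suc.IH) (auto simp: branch_in)
    also have "?this \<longleftrightarrow> ?thesis"
    proof (rule has_sum_cong)
      fix \<omega> assume "\<omega> \<in> words n"
      hence "0 < wprod \<omega> (branch k x)" using Suc.prems by (intro wprod_bounds(3)) (auto simp: branch_in)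
      thus "branch k x powr (2 * s) * wprod \<omega> (branch k x) powr (2 * s) = f (k, \<omega>)"
        using Suc.prems by (simp add: f_def wprod_snoc powr_mult mult.commute)
    qed
    finally show ?thesis .
  qed
  have "(f has_sum zpart (Suc n) s x) (UNIV \<times> words n)"
  proof (rule has_sum_SigmaI[OF f g])
    show "f summable_on UNIV \<times> words n"
      by (rule summable_on_SigmaI[OF f]) (use g in \<open>auto simp: f_def summable_on_def\<close>)
  qed
  also have "f = (\<lambda>\<omega>. wprod \<omega> x powr (2 * s)) \<circ> (\<lambda>(k, \<omega>). \<omega> @ [Suc k])"
    by (auto simp: f_def fun_eq_iff)
  also have "(\<dots> has_sum zpart (Suc n) s x) (UNIV \<times> words n) \<longleftrightarrow> ?case"
    unfolding words_Suc by (subst has_sum_reindex) (auto simp: inj_on_def)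
  finally show ?case .
qed

text \<open>The supremum sits at \<open>x = 0\<close>, since
  \<open>wprod \<omega> x \<le> wprod \<omega> 0\<close> and the exponent is positive.\<close>

lemma sup_wprod:
  assumes "\<omega> \<in> words n" "t - q > 0"
  shows "exp (SUP x\<in>{0..1}. ln (\<Prod>j<n. cfrac_tail (drop j \<omega>) x powr (2 * (t - q)))) = wprod \<omega> 0 powr (2 * (t - q))"
proof -
  have n: "n = length \<omega>" using assms by (auto simp: words_def)
  have *: "(\<Prod>j<n. cfrac_tail (drop j \<omega>) x powr (2 * (t - q))) = wprod \<omega> x powr (2 * (t - q))" if "x \<in> {0..1}" for x
    unfolding n wprod_def by (rule prod_powr_distrib[symmetric])
  have "(SUP x\<in>{0..1}. ln (\<Prod>j<n. cfrac_tail (drop j \<omega>) x powr (2 * (t - q)))) = (SUP x\<in>{0..1}. ln (wprod \<omega> x powr (2 * (t - q))))"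
    using * by (intro SUP_cong) auto
  also have "\<dots> = ln (wprod \<omega> 0 powr (2 * (t - q)))"
  proof (rule cSup_eq_maximum)
    fix y assume "y \<in> (\<lambda>x. ln (wprod \<omega> x powr (2 * (t - q)))) ` {0..1}"
    then obtain x where x: "x \<in> {0..1}" "y = ln (wprod \<omega> x powr (2 * (t - q)))" by blast
    thus "y \<le> ln (wprod \<omega> 0 powr (2 * (t - q)))"
      using wprod_bounds[OF assms(1) x(1)] assms(2) by (auto intro!: powr_mono2)
  qed auto
  finally show ?thesis using wprod_0_pos[OF assms(1)] by (simp add: powr_def)
qed

lemma pressure_sum_eq:
  assumes "t - q > 1/2"
  shows "pressure_sum n t q = zpart n (t - q) 0"
proof -
  have "pressure_sum n t q = (\<Sum>\<^sub>\<infinity>\<omega>\<in>words n. wprod \<omega> 0 powr (2 * (t - q)))"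
    unfolding pressure_sum_def words_def[symmetric]
    using sup_wprod assms by (intro infsum_cong) auto
  also have "\<dots> = zpart n (t - q) 0"
    using has_sum_words[OF assms, of 0 n] by (intro infsumI) auto
  finally show ?thesis .
qed

section \<open>Almost additive sequences and the pressure\<close>

text \<open>A two-sided Fekete lemma. Computing \<open>a (m * n)\<close> both from
  \<open>a n\<close> and from \<open>a m\<close> makes the quotients Cauchy. The error bound
  \<open>c\<close> does not grow with \<open>n\<close>, which later determines \<open>zpart\<close>
  up to constant factors.\<close>

lemma approx_additive:
  fixes a :: "nat \<Rightarrow> real"
  assumes add: "\<And>n m. \<bar>a (n + m) - a n - a m\<bar> \<le> c"
  obtains L where "(\<lambda>n. a n / real n) \<longlonglongrightarrow> L" "\<And>n. \<bar>a n - real n * L\<bar> \<le> c"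
proof -
  have c: "0 \<le> c" using add[of 0 0] by linarith
  have mult: "\<bar>a (Suc m * n) - real (Suc m) * a n\<bar> \<le> real m * c" for m n
  proof (induction m)
    case (Suc m)
    have "\<bar>a (Suc m * n + n) - a (Suc m * n) - a n\<bar> \<le> c" by (rule add)
    moreover have "Suc m * n + n = Suc (Suc m) * n" by simp
    moreover have "real (Suc (Suc m)) * a n = real (Suc m) * a n + a n" by (simp add: algebra_simps)
    moreover have "real (Suc m) * c = real m * c + c" by (simp add: algebra_simps)
    ultimately show ?case using Suc by (smt (verit))
  qed auto
  have mult': "\<bar>a (m * n) - real m * a n\<bar> \<le> real m * c" if "m > 0" for m n
  proof -
    have "real (m - 1) * c \<le> real m * c" using c by (intro mult_right_mono) auto
    thus ?thesis using mult[of "m - 1" n] that by simp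
  qed
  have diff: "\<bar>a n / real n - a m / real m\<bar> \<le> c / real n + c / real m" if "n > 0" "m > 0" for n m
  proof -
    have 1: "\<bar>a (m * n) - real m * a n\<bar> \<le> real m * c" and 2: "\<bar>a (m * n) - real n * a m\<bar> \<le> real n * c"
      using mult'[of m n] mult'[of n m] that by (auto simp: mult.commute)
    have "real (m * n) * \<bar>a n / real n - a m / real m\<bar> = \<bar>real m * a n - real n * a m\<bar>"
    proof -
      have "real (m * n) * (a n / real n - a m / real m) = real m * a n - real n * a m"
        using that by (simp add: field_simps)
      thus ?thesis by (metis abs_mult abs_of_nat)
    qed
    also have "\<dots> \<le> real m * c + real n * c" using 1 2 by linarith
    also have "\<dots> = real (m * n) * (c / real n + c / real m)"
      using that by (simp add: field_simps)
    finally show ?thesis using that by simp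
  qed
  have "Cauchy (\<lambda>n. a n / real n)"
  proof (rule CauchyI)
    fix e :: real assume e: "0 < e"
    obtain N :: nat where N: "2 * c / e < real N" using reals_Archimedean2 by blast
    have "norm (a n / real n - a m / real m) < e" if "n \<ge> Suc N" "m \<ge> Suc N" for n m
    proof -
      have *: "c / real k < e / 2" if "k \<ge> Suc N" for k
      proof -
        have "2 * c < e * real k"
        proof -
          have "2 * c < e * real N" using N e by (simp add: divide_less_eq mult.commute)
          also have "\<dots> \<le> e * real k" using e that by (intro mult_left_mono) auto
          finally show ?thesis .
        qed
        thus ?thesis using that by (simp add: divide_less_eq mult.commute)
      qed
      have "n > 0" "m > 0" using that by auto
      hence "\<bar>a n / real n - a m / real m\<bar> < e / 2 + e / 2"
        using diff[of n m] *[OF that(1)] *[OF that(2)] by linarith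
      thus ?thesis by simp
    qed
    thus "\<exists>M. \<forall>m\<ge>M. \<forall>n\<ge>M. norm (a m / real m - a n / real n) < e" by blast
  qed
  then obtain L where L: "(\<lambda>n. a n / real n) \<longlonglongrightarrow> L"
    using Cauchy_convergent convergent_def by blast
  moreover have "\<bar>a n - real n * L\<bar> \<le> c" for n
  proof (cases "n = 0")
    case True
    thus ?thesis using add[of 0 0] by simp
  next
    case False
    have "\<bar>a n / real n - L\<bar> \<le> c / real n + 0"
    proof (rule tendsto_le[OF trivial_limit_sequentially])
      show "(\<lambda>m. \<bar>a n / real n - a m / real m\<bar>) \<longlonglongrightarrow> \<bar>a n / real n - L\<bar>"
        by (intro tendsto_intros L)
      show "(\<lambda>m. c / real n + c / real m) \<longlonglongrightarrow> c / real n + 0"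
        by (intro tendsto_intros lim_const_over_n)
      show "eventually (\<lambda>m. \<bar>a n / real n - a m / real m\<bar> \<le> c / real n + c / real m) sequentially"
        using eventually_gt_at_top[of 0] by eventually_elim (use diff False in auto)
    qed
    hence "real n * \<bar>a n / real n - L\<bar> \<le> real n * (c / real n)" by (intro mult_left_mono) auto
    moreover have "real n * \<bar>a n / real n - L\<bar> = \<bar>a n - real n * L\<bar>"
    proof -
      have "real n * (a n / real n - L) = a n - real n * L" using False by (simp add: field_simps)
      thus ?thesis by (metis abs_mult abs_of_nat)
    qed
    ultimately show ?thesis using False by simp
  qed
  ultimately show ?thesis using that by blast
qed

definition pressure :: "real \<Rightarrow> real" where
  "pressure s = lim (\<lambda>n. ln (zpart n s 0) / real n)"

lemma
  assumes "s > 1/2"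
  shows pressure_lim: "(\<lambda>n. ln (zpart n s 0) / real n) \<longlonglongrightarrow> pressure s"
    and pressure_approx: "\<bar>ln (zpart n s 0) - real n * pressure s\<bar> \<le> 4 * s * ln 2"
proof -
  have "\<bar>ln (zpart (n + m) s 0) - ln (zpart n s 0) - ln (zpart m s 0)\<bar> \<le> 4 * s * ln 2" for n m
  proof -
    have pos: "zpart k s 0 > 0" for k using part_pos[OF assms] by simp
    have "ln (zpart (n + m) s 0) \<le> ln (2 powr (4 * s) * zpart n s 0 * zpart m s 0)"
      using part_add_le[OF assms, of n m] pos by (subst ln_le_cancel_iff) auto
    moreover have "ln (2 powr (- (4 * s)) * zpart n s 0 * zpart m s 0) \<le> ln (zpart (n + m) s 0)"
      using part_add_ge[OF assms, of n m] pos by (subst ln_le_cancel_iff) auto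
    ultimately show ?thesis using pos[of n] pos[of m]
      by (auto simp: ln_mult ln_powr abs_le_iff)
  qed
  then obtain L where L: "(\<lambda>n. ln (zpart n s 0) / real n) \<longlonglongrightarrow> L" "\<And>n. \<bar>ln (zpart n s 0) - real n * L\<bar> \<le> 4 * s * ln 2"
    using approx_additive[of "\<lambda>n. ln (zpart n s 0)"] by metis
  have "L = pressure s" unfolding pressure_def using L(1) by (simp add: limI)
  thus "(\<lambda>n. ln (zpart n s 0) / real n) \<longlonglongrightarrow> pressure s" "\<bar>ln (zpart n s 0) - real n * pressure s\<bar> \<le> 4 * s * ln 2"
    using L by auto
qed

lemma P1_eq:
  assumes "t - q > 1/2"
  shows "P1 t q = pressure (t - q)"
  unfolding P1_def pressure_def pressure_sum_eq[OF assms] by simp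

lemma part_le_exp:
  assumes "s > 1/2" "x \<in> {0..1}"
  shows "zpart n s x \<le> 2 powr (8 * s) * exp (real n * pressure s)"
proof -
  have "zpart n s 0 \<le> exp (4 * s * ln 2 + real n * pressure s)"
    using pressure_approx[OF assms(1), of n] part_pos[OF assms(1), of 0 n]
    by (subst ln_le_cancel_iff[symmetric]) auto
  also have "\<dots> = 2 powr (4 * s) * exp (real n * pressure s)"
    by (simp add: powr_def exp_add[symmetric])
  finally have *: "zpart n s 0 \<le> 2 powr (4 * s) * exp (real n * pressure s)" .
  have "zpart n s x \<le> 2 powr (4 * s) * zpart n s 0"
    using part_bound[OF assms, of n] by linarith
  also have "\<dots> \<le> 2 powr (4 * s) * (2 powr (4 * s) * exp (real n * pressure s))"
    using * by (intro mult_left_mono) auto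
  finally show ?thesis by (simp add: mult.assoc[symmetric] powr_add[symmetric])
qed

lemma part_ge_exp:
  assumes "s > 1/2" "x \<in> {0..1}"
  shows "2 powr (- (8 * s)) * exp (real n * pressure s) \<le> zpart n s x"
proof -
  have "exp (- (4 * s * ln 2) + real n * pressure s) \<le> zpart n s 0"
    using pressure_approx[OF assms(1), of n] part_pos[OF assms(1), of 0 n]
    by (subst ln_le_cancel_iff[symmetric]) auto
  also have "exp (- (4 * s * ln 2) + real n * pressure s) = 2 powr (- (4 * s)) * exp (real n * pressure s)"
    by (simp add: powr_def exp_add[symmetric])
  finally have *: "2 powr (- (4 * s)) * exp (real n * pressure s) \<le> zpart n s 0" .
  have "2 powr (- (4 * s)) * zpart n s 0 \<le> zpart n s x"
    using part_ratio[OF assms(1), of x 0 n] assms by (simp add: powr_minus divide_simps mult.commute)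
  moreover have "2 powr (- (4 * s)) * (2 powr (- (4 * s)) * exp (real n * pressure s)) \<le> 2 powr (- (4 * s)) * zpart n s 0"
    using * by (intro mult_left_mono) auto
  ultimately show ?thesis by (simp add: mult.assoc[symmetric] powr_add[symmetric])
qed

section \<open>Invariant complex cones\<close>

definition ctransfer :: "complex \<Rightarrow> (real \<Rightarrow> complex) \<Rightarrow> real \<Rightarrow> complex" where
  "ctransfer s f x = (\<Sum>k. exp (2 * s * of_real (ln (branch k x))) * f (branch k x))"

lemma norm_cweight: "0 \<le> x \<Longrightarrow> norm (exp (2 * s * of_real (ln (branch k x)))) = branch k x powr (2 * Re s)"
  by (simp add: powr_def)

lemma csummable_norm:
  assumes "Re s > 1/2" "x \<in> {0..1}" "\<And>y. y \<in> {0..1} \<Longrightarrow> norm (f y) \<le> B"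
  shows "summable (\<lambda>k. norm (exp (2 * s * of_real (ln (branch k x))) * f (branch k x)))"
proof -
  have "summable (\<lambda>k. branch k x powr (2 * Re s) * norm (f (branch k x)))"
    using summable_transfer[of "Re s" x "\<lambda>y. norm (f y)" B] assms by auto
  thus ?thesis using assms by (simp add: norm_mult norm_cweight del: norm_exp_eq_Re)
qed

lemmas csummable = csummable_norm[THEN summable_norm_cancel]

lemma ctransfer_norm_le:
  assumes "Re s > 1/2" "x \<in> {0..1}" "\<And>y. y \<in> {0..1} \<Longrightarrow> norm (f y) \<le> g y" "\<And>y. y \<in> {0..1} \<Longrightarrow> g y \<le> B"
  shows "norm (ctransfer s f x) \<le> transfer (Re s) g x"
proof -
  have fB: "norm (f y) \<le> B" and gB: "\<bar>g y\<bar> \<le> B" if "y \<in> {0..1}" for y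
    using assms(3,4)[OF that] norm_ge_zero[of "f y"] by linarith+
  have sf: "summable (\<lambda>k. norm (exp (2 * s * of_real (ln (branch k x))) * f (branch k x)))"
    using csummable_norm[OF assms(1,2) fB] .
  have "norm (ctransfer s f x) \<le> (\<Sum>k. norm (exp (2 * s * of_real (ln (branch k x))) * f (branch k x)))"
    unfolding ctransfer_def by (rule summable_norm[OF sf])
  also have "\<dots> \<le> transfer (Re s) g x"
    unfolding transfer_def
  proof (rule suminf_le)
    show "summable (\<lambda>k. branch k x powr (2 * Re s) * g (branch k x))"
      by (intro summable_transfer[OF assms(1,2) gB])
    show "norm (exp (2 * s * of_real (ln (branch k x))) * f (branch k x)) \<le> branch k x powr (2 * Re s) * g (branch k x)" for k
      using assms(2) assms(3)[of "branch k x"]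
      by (simp add: norm_mult norm_cweight mult_left_mono del: norm_exp_eq_Re)
  qed (rule sf)
  finally show ?thesis .
qed

lemma ctransfer_lin:
  assumes "Re s > 1/2" "x \<in> {0..1}" "\<And>y. y \<in> {0..1} \<Longrightarrow> norm (f y) \<le> B" "\<And>y. y \<in> {0..1} \<Longrightarrow> norm (g y) \<le> C"
  shows "ctransfer s (\<lambda>y. b * f y + c * g y) x = b * ctransfer s f x + c * ctransfer s g x"
proof -
  let ?e = "\<lambda>k. exp (2 * s * of_real (ln (branch k x)))"
  have sf: "summable (\<lambda>k. ?e k * f (branch k x))" and sg: "summable (\<lambda>k. ?e k * g (branch k x))"
    using csummable[OF assms(1,2) assms(3)] csummable[OF assms(1,2) assms(4)] by simp_all
  have "ctransfer s (\<lambda>y. b * f y + c * g y) x = (\<Sum>k. b * (?e k * f (branch k x)) + c * (?e k * g (branch k x)))"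
    unfolding ctransfer_def by (simp add: algebra_simps)
  also have "\<dots> = b * ctransfer s f x + c * ctransfer s g x"
    unfolding ctransfer_def using sf sg
    by (simp add: suminf_add[symmetric] suminf_mult summable_mult)
  finally show ?thesis .
qed

lemma ctransfer_cong: "(\<And>y. y \<in> {0..1} \<Longrightarrow> f y = g y) \<Longrightarrow> x \<in> {0..1} \<Longrightarrow> ctransfer s f x = ctransfer s g x"
  unfolding ctransfer_def by (intro suminf_cong) auto

section \<open>Sets of complex numbers at most a right angle apart\<close>

lemma midpoint_dist:
  fixes a :: real
  assumes "m \<le> a" "a \<le> M" "M \<le> m + p / 2"
  shows "\<bar>a - (M + m) / 2\<bar> \<le> p / 4"
proof -
  have "a - (M + m) / 2 = a - M / 2 - m / 2" by (simp add: add_divide_distrib)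
  thus ?thesis using assms by linarith
qed

text \<open>Turning \<open>z0\<close> to the positive axis puts all arguments into
  \<open>[-pi/2, pi/2]\<close>, away from the cut of \<open>Arg\<close>. There angles are
  differences of arguments, so the arguments lie in an interval of length at most
  \<open>pi / 2\<close>, whose midpoint is then turned to 0.\<close>

lemma sector:
  assumes "z0 \<in> Z" "z0 \<noteq> 0" "\<And>z w. z \<in> Z \<Longrightarrow> w \<in> Z \<Longrightarrow> 0 \<le> Re (z * cnj w)"
  obtains c where "norm c = 1" "\<And>z. z \<in> Z \<Longrightarrow> \<bar>Im (c * z)\<bar> \<le> Re (c * z)"
proof -
  define c0 where "c0 = cnj z0 / of_real (norm z0)"
  have c0: "norm c0 = 1" using assms by (simp add: c0_def norm_divide)
  have rot: "Re ((c0 * z) * cnj (c0 * w)) = Re (z * cnj w)" for z w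
  proof -
    have "(c0 * z) * cnj (c0 * w) = (c0 * cnj c0) * (z * cnj w)" by (simp add: mult_ac)
    also have "c0 * cnj c0 = 1" using c0 by (simp add: complex_norm_square[symmetric])
    finally show ?thesis by (simp only: mult_1)
  qed
  have c0z0: "c0 * z0 = of_real (norm z0)"
    using assms(2) complex_norm_square[of z0] by (simp add: c0_def divide_simps power2_eq_square mult.commute)
  have re: "0 \<le> Re (c0 * z)" if "z \<in> Z" for z
  proof -
    have "Re ((c0 * z) * cnj (c0 * z0)) = norm z0 * Re (c0 * z)" unfolding c0z0 by simp
    moreover have "Re ((c0 * z) * cnj (c0 * z0)) \<ge> 0" unfolding rot using assms that by blast
    ultimately show ?thesis using assms(2) by (simp add: zero_le_mult_iff)
  qed
  \<comment> \<open>At 0 the value of \<open>Arg\<close> is a mere default, so 0 is left out here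
    and treated apart at the end.\<close>
  define A where "A = (\<lambda>z. Arg (c0 * z)) ` (Z - {0})"
  have polar: "c0 * z = of_real (norm z) * cis (Arg (c0 * z))" for z
    using rcis_cmod_Arg[of "c0 * z"] c0 by (simp add: rcis_def norm_mult)
  have bd: "\<bar>Arg (c0 * z)\<bar> \<le> pi / 2" if "z \<in> Z" for z
    using re[OF that] Arg_Re_nonneg[of "c0 * z"] by blast
  have pair: "\<bar>Arg (c0 * z) - Arg (c0 * w)\<bar> \<le> pi / 2" if zw: "z \<in> Z - {0}" "w \<in> Z - {0}" for z w
  proof (rule ccontr)
    let ?t = "Arg (c0 * z) - Arg (c0 * w)"
    assume n: "\<not> \<bar>?t\<bar> \<le> pi / 2"
    have "\<bar>?t\<bar> \<le> pi" using bd[of z] bd[of w] zw by auto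
    hence "cos \<bar>?t\<bar> < cos (pi / 2)" using n by (intro cos_monotone_0_pi) auto
    hence neg: "cos ?t < 0" by (simp only: cos_abs_real cos_pi_half)
    have "(c0 * z) * cnj (c0 * w) = of_real (norm z * norm w) * (cis (Arg (c0 * z)) * cis (- Arg (c0 * w)))"
      by (subst polar[of z], subst polar[of w]) (simp add: cis_cnj mult_ac)
    hence "Re ((c0 * z) * cnj (c0 * w)) = norm z * norm w * cos ?t"
      by (simp add: cis_mult)
    hence "Re (z * cnj w) < 0" unfolding rot using neg zw by (simp add: mult_pos_neg)
    thus False using assms(3)[of z w] zw by auto
  qed
  have ne: "A \<noteq> {}" using assms by (auto simp: A_def)
  have bdA: "bdd_above A" "bdd_below A"
    using bd by (force simp: A_def intro!: bdd_aboveI[of _ "pi/2"] bdd_belowI[of _ "- pi/2"] simp: abs_le_iff)+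
  define M m where "M = Sup A" "m = Inf A"
  have spread: "M \<le> m + pi / 2"
    unfolding M_m_def
  proof (rule cSup_least[OF ne])
    fix u assume u: "u \<in> A"
    have "u - pi / 2 \<le> Inf A"
    proof (rule cInf_greatest[OF ne])
      fix v assume "v \<in> A"
      thus "u - pi / 2 \<le> v" using u pair unfolding A_def abs_le_iff by fastforce
    qed
    thus "u \<le> Inf A + pi / 2" by linarith
  qed
  define c where "c = cis (- ((M + m) / 2)) * c0"
  show ?thesis
  proof
    show "norm c = 1" using c0 by (simp add: c_def norm_mult)
    fix z assume z: "z \<in> Z"
    show "\<bar>Im (c * z)\<bar> \<le> Re (c * z)"
    proof (cases "z = 0")
      case False
      define t where "t = Arg (c0 * z) - (M + m) / 2"
      have "Arg (c0 * z) \<in> A" using z False by (auto simp: A_def)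
      hence "m \<le> Arg (c0 * z)" "Arg (c0 * z) \<le> M"
        using bdA by (auto simp: M_m_def intro: cSup_upper cInf_lower)
      hence t: "\<bar>t\<bar> \<le> pi / 4" using spread unfolding t_def by (rule midpoint_dist)
      have "- (pi / 2) \<le> t" "t \<le> pi / 2" "- (pi / 2) \<le> 2 * t" "2 * t \<le> pi / 2"
        using t pi_gt_zero by linarith+
      hence cosp: "0 \<le> cos t" and "0 \<le> cos (2 * t)" by (auto intro!: cos_ge_zero)
      hence "(sin t)\<^sup>2 \<le> (cos t)\<^sup>2" unfolding cos_double by linarith
      hence "\<bar>sin t\<bar>\<^sup>2 \<le> (cos t)\<^sup>2" by simp
      hence "\<bar>sin t\<bar> \<le> cos t"
        using cosp by (rule power2_le_imp_le)
      moreover have "c * z = of_real (norm z) * cis t"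
      proof -
        have "c * z = cis (- ((M + m) / 2)) * (of_real (norm z) * cis (Arg (c0 * z)))"
          by (simp only: c_def mult.assoc polar[of z, symmetric])
        also have "\<dots> = of_real (norm z) * (cis (- ((M + m) / 2)) * cis (Arg (c0 * z)))" by simp
        also have "cis (- ((M + m) / 2)) * cis (Arg (c0 * z)) = cis t" by (simp add: cis_mult t_def)
        finally show ?thesis .
      qed
      ultimately have "Re (c * z) = norm z * cos t" "Im (c * z) = norm z * sin t" "\<bar>sin t\<bar> \<le> cos t"
        by simp_all
      thus ?thesis by (simp only: abs_mult abs_norm_cancel) (intro mult_left_mono, auto)
    qed auto
  qed
qed

definition cfn :: "real \<Rightarrow> real \<times> real \<times> real \<Rightarrow> (real \<Rightarrow> complex) \<Rightarrow> complex" where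
  "cfn a = (\<lambda>(x, y, \<theta>) f. of_real (exp (a * ldist x y)) * f x - of_real \<theta> * f y)"

definition rfn :: "real \<Rightarrow> real \<times> real \<times> real \<Rightarrow> (real \<Rightarrow> real) \<Rightarrow> real" where
  "rfn a = (\<lambda>(x, y, \<theta>) f. exp (a * ldist x y) * f x - \<theta> * f y)"

definition fidx :: "(real \<times> real \<times> real) set" where
  "fidx = {0..1} \<times> {0..1} \<times> {0, 1}"

text \<open>The size at which a functional degenerates: for \<open>\<theta> = 1\<close> it vanishes
  as \<open>y\<close> approaches \<open>x\<close>, so the interior estimate
  \<open>fnl_bounds\<close> and the error estimate \<open>cfn_error\<close> both carry the factor
  \<open>ldist x y\<close>.\<close>

definition fwt :: "real \<times> real \<times> real \<Rightarrow> real" where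
  "fwt = (\<lambda>(x, y, \<theta>). if \<theta> = 0 then 1 else ldist x y)"

text \<open>The values of the functionals that define the real cone may not be more than a right angle apart.
  In the index \<open>(x, y, \<theta>)\<close>, \<open>\<theta> = 1\<close> is the cone inequality for \<open>x\<close> and \<open>y\<close>; \<open>\<theta> = 0\<close> is the value at \<open>x\<close> up to a factor.\<close>

definition ccone :: "real \<Rightarrow> (real \<Rightarrow> complex) set" where
  "ccone a = {f. f 0 \<noteq> 0 \<and> (\<forall>i\<in>fidx. \<forall>j\<in>fidx. 0 \<le> Re (cfn a i f * cnj (cfn a j f)))}"

lemma fwt_nonneg [simp]: "0 \<le> fwt i"
  by (auto simp: fwt_def split: prod.splits)

lemma lcone_iff: "f \<in> lcone a \<longleftrightarrow> (\<forall>i\<in>fidx. 0 \<le> rfn a i f)"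
proof
  assume r: "\<forall>i\<in>fidx. 0 \<le> rfn a i f"
  show "f \<in> lcone a"
    unfolding lcone_def
  proof (intro CollectI conjI ballI)
    fix x :: real assume x: "x \<in> {0..1}"
    have "(x, x, 0) \<in> fidx" using x by (simp add: fidx_def)
    from r[rule_format, OF this] show "0 \<le> f x" by (simp add: rfn_def)
    fix y :: real assume y: "y \<in> {0..1}"
    have "(x, y, 1) \<in> fidx" using x y by (simp add: fidx_def)
    from r[rule_format, OF this] show "f y \<le> exp (a * ldist x y) * f x" by (simp add: rfn_def)
  qed
qed (auto simp: fidx_def rfn_def lcone_def)

lemma cfn_lin: "cfn a i (\<lambda>x. b * f x + c * g x) = b * cfn a i f + c * cfn a i g"
  by (auto simp: cfn_def algebra_simps split: prod.splits)

lemma cfn_scale: "cfn a i (\<lambda>x. b * f x) = b * cfn a i f"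
  by (auto simp: cfn_def algebra_simps split: prod.splits)

lemma cfn_add: "cfn a i (\<lambda>x. f x + g x) = cfn a i f + cfn a i g"
  by (auto simp: cfn_def algebra_simps split: prod.splits)

lemma cfn_of_real: "cfn a i (\<lambda>x. of_real (f x)) = of_real (rfn a i f)"
  by (auto simp: cfn_def rfn_def split: prod.splits)

lemma cfn_cong: "i \<in> fidx \<Longrightarrow> (\<And>x. x \<in> {0..1} \<Longrightarrow> f x = g x) \<Longrightarrow> cfn a i f = cfn a i g"
  by (auto simp: cfn_def fidx_def)

lemma cfn_Re_Im: "Re (cfn a i f) + r * Im (cfn a i f) = rfn a i (\<lambda>x. Re (f x) + r * Im (f x))"
  by (auto simp: cfn_def rfn_def algebra_simps split: prod.splits)

text \<open>After a rotation all functionals take values with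
  \<open>\<bar>Im\<bar> \<le> Re\<close>, by \<open>sector\<close>. The functionals have real
  coefficients, so \<open>Re + Im\<close> and \<open>Re - Im\<close> satisfy every real cone
  condition; the rotated \<open>f\<close> is recovered from these two with the coefficients
  \<open>(1 + \<i>) / 2\<close> and \<open>(1 - \<i>) / 2\<close>.\<close>

lemma ccone_decomp:
  assumes "f \<in> ccone a"
  obtains c where "norm c = 1" "(\<lambda>x. Re (c * f x) + Im (c * f x)) \<in> lcone a"
    "(\<lambda>x. Re (c * f x) - Im (c * f x)) \<in> lcone a"
proof -
  have "f 0 \<in> (\<lambda>i. cfn a i f) ` fidx"
    by (rule image_eqI[of _ _ "(0, 0, 0)"]) (auto simp: cfn_def fidx_def)
  moreover have "f 0 \<noteq> 0" using assms by (simp add: ccone_def)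
  moreover have "0 \<le> Re (z * cnj w)" if "z \<in> (\<lambda>i. cfn a i f) ` fidx" "w \<in> (\<lambda>i. cfn a i f) ` fidx" for z w
    using assms that by (auto simp: ccone_def)
  ultimately obtain c where c: "norm c = 1"
      "\<And>z. z \<in> (\<lambda>i. cfn a i f) ` fidx \<Longrightarrow> \<bar>Im (c * z)\<bar> \<le> Re (c * z)"
    using sector[of "f 0" "(\<lambda>i. cfn a i f) ` fidx"] by blast
  have *: "\<bar>Im (cfn a i (\<lambda>x. c * f x))\<bar> \<le> Re (cfn a i (\<lambda>x. c * f x))" if "i \<in> fidx" for i
    using c(2)[of "cfn a i f"] that by (auto simp: cfn_scale)
  have "(\<lambda>x. Re (c * f x) + Im (c * f x)) \<in> lcone a"
    unfolding lcone_iff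
  proof
    fix i assume "i \<in> fidx"
    from *[OF this] show "0 \<le> rfn a i (\<lambda>x. Re (c * f x) + Im (c * f x))"
      using cfn_Re_Im[of a i "\<lambda>x. c * f x" 1] by (simp add: abs_le_iff)
  qed
  moreover have "(\<lambda>x. Re (c * f x) - Im (c * f x)) \<in> lcone a"
    unfolding lcone_iff
  proof
    fix i assume "i \<in> fidx"
    from *[OF this] show "0 \<le> rfn a i (\<lambda>x. Re (c * f x) - Im (c * f x))"
      using cfn_Re_Im[of a i "\<lambda>x. c * f x" "-1"] unfolding abs_le_iff mult_minus1 diff_conv_add_uminus by linarith
  qed
  ultimately show ?thesis using c(1) that by blast
qed

text \<open>\<open>2 * (norm (f z))\<^sup>2\<close> is the sum of the squares of the two real
  functions of \<open>ccone_decomp\<close>, and both obey \<open>cone_le\<close>.\<close>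

lemma ccone_ratio:
  assumes "f \<in> ccone a" "0 \<le> a" "x \<in> {0..1}" "y \<in> {0..1}"
  shows "norm (f x) \<le> 2 powr a * norm (f y)"
proof -
  obtain c where c: "norm c = 1" "(\<lambda>x. Re (c * f x) + Im (c * f x)) \<in> lcone a"
    "(\<lambda>x. Re (c * f x) - Im (c * f x)) \<in> lcone a" using ccone_decomp[OF assms(1)] .
  define p m where "p = (\<lambda>x. Re (c * f x) + Im (c * f x))" "m = (\<lambda>x. Re (c * f x) - Im (c * f x))"
  have n: "2 * (norm (f z))\<^sup>2 = (p z)\<^sup>2 + (m z)\<^sup>2" for z
  proof -
    have "(norm (f z))\<^sup>2 = (norm (c * f z))\<^sup>2" using c(1) by (simp add: norm_mult)
    also have "\<dots> = (Re (c * f z))\<^sup>2 + (Im (c * f z))\<^sup>2" by (rule cmod_power2)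
    finally show ?thesis unfolding p_m_def by (simp add: power2_eq_square algebra_simps)
  qed
  have "p x \<le> 2 powr a * p y" "m x \<le> 2 powr a * m y"
    unfolding p_m_def using cone_le[OF c(2) assms(2,4,3)] cone_le[OF c(3) assms(2,4,3)] by auto
  moreover have "0 \<le> p x" "0 \<le> m x"
    unfolding p_m_def using coneD_nonneg[OF c(2) assms(3)] coneD_nonneg[OF c(3) assms(3)] by auto
  ultimately have "(p x)\<^sup>2 \<le> (2 powr a * p y)\<^sup>2" "(m x)\<^sup>2 \<le> (2 powr a * m y)\<^sup>2"
    by (auto intro!: power_mono)
  hence "2 * (norm (f x))\<^sup>2 \<le> (2 powr a)\<^sup>2 * (2 * (norm (f y))\<^sup>2)"
    unfolding n by (simp add: power_mult_distrib algebra_simps)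
  hence "(norm (f x))\<^sup>2 \<le> (2 powr a * norm (f y))\<^sup>2" by (simp add: power_mult_distrib)
  thus ?thesis by (rule power2_le_imp_le) auto
qed

section \<open>Functionals on the interior of the cone and perturbed weights\<close>

lemma exp_diff_le: "exp u - 1 \<le> u * exp u" for u :: real
proof -
  have "1 - u \<le> exp (- u)" using exp_ge_add_one_self[of "- u"] by simp
  hence "exp u * (1 - u) \<le> exp u * exp (- u)" by (intro mult_left_mono) auto
  thus ?thesis by (simp add: exp_minus algebra_simps)
qed

text \<open>A function of the strictly smaller cone keeps away from every face of the larger one, at
  a rate \<open>fwt i\<close> common to all such functions. Hence the smaller cone has finite
  projective diameter in the larger: after normalisation by \<open>g 0\<close> functionals agree up
  to the factor \<open>K1 / K0\<close>.\<close>

lemma fnl_bounds: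
  assumes "0 \<le> a'" "a' < a"
  obtains K0 K1 where "0 < K0" "0 < K1"
    "\<And>g i. g \<in> lcone a' \<Longrightarrow> i \<in> fidx \<Longrightarrow> K0 * fwt i * g 0 \<le> rfn a i g \<and> rfn a i g \<le> K1 * fwt i * g 0"
proof -
  \<comment> \<open>The minimum and the maximum merge the cases \<theta> = 0 and \<theta> = 1; for
    \<theta> = 1 the margin is \<open>a - a'\<close> and the upper slope is
    \<open>a + a'\<close>.\<close>
  define K0 where "K0 = min 1 (a - a') * 2 powr (- a')"
  define K1 where "K1 = max 1 (a + a') * 2 powr a * 2 powr a'"
  have "K0 * fwt i * g 0 \<le> rfn a i g \<and> rfn a i g \<le> K1 * fwt i * g 0" if g: "g \<in> lcone a'" and i: "i \<in> fidx" for g i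
  proof -
    obtain x y \<theta> where i': "i = (x, y, \<theta>)" "x \<in> {0..1}" "y \<in> {0..1}" "\<theta> = 0 \<or> \<theta> = 1"
      using i by (auto simp: fidx_def)
    define d where "d = ldist x y"
    have d: "0 \<le> d" "d \<le> ln 2" using ldist_le_ln2[OF i'(2,3)] by (auto simp: d_def)
    have gx: "g x \<le> 2 powr a' * g 0" "2 powr (- a') * g 0 \<le> g x" "0 \<le> g x" "0 \<le> g 0"
      using cone_le[OF g assms(1), of 0 x] cone_le[OF g assms(1), of x 0] coneD_nonneg[OF g] i'
      by (auto simp: powr_minus divide_simps mult.commute)
    have ea: "1 \<le> exp (a * d)" "exp (a * d) \<le> 2 powr a"
      using d assms mult_left_mono[OF d(2), of a] by (auto simp: powr_def)
    show ?thesis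
      using i'(4)
    proof
      assume t: "\<theta> = 0"
      have "K0 * g 0 \<le> 1 * (2 powr (- a') * g 0)"
        unfolding K0_def mult.assoc using gx by (intro mult_right_mono) auto
      also have "\<dots> \<le> exp (a * d) * g x" using ea gx by (intro mult_mono) auto
      finally have 1: "K0 * g 0 \<le> exp (a * d) * g x" .
      have "exp (a * d) * g x \<le> 2 powr a * (2 powr a' * g 0)" using ea gx by (intro mult_mono) auto
      also have "\<dots> = 1 * (2 powr a * 2 powr a' * g 0)" by simp
      also have "\<dots> \<le> max 1 (a + a') * (2 powr a * 2 powr a' * g 0)" using gx by (intro mult_right_mono) auto
      finally have 2: "exp (a * d) * g x \<le> K1 * g 0" by (simp add: K1_def mult_ac)
      show ?thesis using 1 2 t by (simp add: i' rfn_def fwt_def d_def)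
    next
      assume t: "\<theta> = 1"
      have gy: "g y \<le> exp (a' * d) * g x" "exp (- (a' * d)) * g x \<le> g y"
        using coneD[OF g i'(2,3)] coneD[OF g i'(3,2)] by (auto simp: d_def ldist_sym exp_minus divide_simps mult.commute)
      have "(a - a') * d \<le> exp ((a - a') * d) - 1" using exp_ge_add_one_self[of "(a - a') * d"] by linarith
      also have "\<dots> \<le> exp (a' * d) * (exp ((a - a') * d) - 1)"
        using assms d mult_right_mono[of 1 "exp (a' * d)" "exp ((a - a') * d) - 1"] by simp
      also have "\<dots> = exp (a * d) - exp (a' * d)" by (simp add: exp_diff[symmetric] algebra_simps exp_add[symmetric])
      finally have A: "(a - a') * d \<le> exp (a * d) - exp (a' * d)" .
      have "K0 * d * g 0 = min 1 (a - a') * (d * (2 powr (- a') * g 0))" by (simp add: K0_def mult_ac)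
      also have "\<dots> \<le> (a - a') * (d * g x)"
        using gx assms d by (intro mult_mono) auto
      also have "\<dots> \<le> (exp (a * d) - exp (a' * d)) * g x"
        using mult_right_mono[OF A gx(3)] by (simp add: mult_ac)
      also have "\<dots> \<le> exp (a * d) * g x - g y" using gy by (simp add: algebra_simps)
      finally have 1: "K0 * d * g 0 \<le> exp (a * d) * g x - g y" .
      have "exp (a * d) - exp (- (a' * d)) = exp (- (a' * d)) * (exp ((a + a') * d) - 1)"
        by (simp add: algebra_simps exp_add[symmetric])
      also have "\<dots> \<le> exp (- (a' * d)) * ((a + a') * d * exp ((a + a') * d))"
        by (intro mult_left_mono exp_diff_le) auto
      also have "\<dots> = (a + a') * d * exp (a * d)"
        by (simp add: algebra_simps exp_add[symmetric])
      also have "\<dots> \<le> max 1 (a + a') * d * 2 powr a"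
        using ea assms d by (intro mult_mono) auto
      finally have B: "exp (a * d) - exp (- (a' * d)) \<le> max 1 (a + a') * d * 2 powr a" .
      have "exp (a * d) * g x - g y \<le> (exp (a * d) - exp (- (a' * d))) * g x"
        using gy by (simp add: algebra_simps)
      also have "\<dots> \<le> (max 1 (a + a') * d * 2 powr a) * (2 powr a' * g 0)"
        using B gx d assms by (intro mult_mono) auto
      finally have 2: "exp (a * d) * g x - g y \<le> K1 * d * g 0" by (simp add: K1_def mult_ac)
      show ?thesis using 1 2 t by (simp add: i' rfn_def fwt_def d_def)
    qed
  qed
  moreover have "K0 > 0" "K1 > 0" using assms by (auto simp: K0_def K1_def)
  ultimately show ?thesis using that by blast
qed

text \<open>For \<theta> = 1 a bound on the size of \<open>e\<close> alone would leave an error that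
  does not vanish as \<open>y\<close> approaches \<open>x\<close>; the Lipschitz bound supplies the
  factor \<open>ldist x y\<close>.\<close>

lemma cfn_error:
  assumes "0 \<le> a" "i \<in> fidx" "\<And>x. x \<in> {0..1} \<Longrightarrow> norm (e x) \<le> \<delta>"
    "\<And>x y. x \<in> {0..1} \<Longrightarrow> y \<in> {0..1} \<Longrightarrow> norm (e x - e y) \<le> \<delta> * ldist x y"
  shows "norm (cfn a i e) \<le> (a + 1) * 2 powr a * fwt i * \<delta>"
proof -
  obtain x y \<theta> where i': "i = (x, y, \<theta>)" "x \<in> {0..1}" "y \<in> {0..1}" "\<theta> = 0 \<or> \<theta> = 1"
    using assms(2) by (auto simp: fidx_def)
  define d where "d = ldist x y"
  have d: "0 \<le> d" "d \<le> ln 2" using ldist_le_ln2[OF i'(2,3)] by (auto simp: d_def)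
  have ea: "1 \<le> exp (a * d)" "exp (a * d) \<le> 2 powr a"
    using d assms mult_left_mono[OF d(2), of a] by (auto simp: powr_def)
  have \<delta>: "0 \<le> \<delta>" using assms(3)[OF i'(2)] norm_ge_zero order_trans by blast
  have p1: "1 \<le> 2 powr a" using assms(1) by (simp add: ge_one_powr_ge_zero)
  show ?thesis
    using i'(4)
  proof
    assume t: "\<theta> = 0"
    have "norm (cfn a i e) = exp (a * d) * norm (e x)" using t by (simp add: cfn_def i' norm_mult d_def)
    also have "\<dots> \<le> 2 powr a * \<delta>" using ea assms(3)[OF i'(2)] by (intro mult_mono) auto
    also have "\<dots> \<le> (a + 1) * (2 powr a * \<delta>)" using \<delta> assms(1) mult_right_mono[of 1 "a + 1" "2 powr a * \<delta>"] by simp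
    finally show ?thesis using t by (simp add: i' fwt_def mult_ac)
  next
    assume t: "\<theta> = 1"
    have "cfn a i e = of_real (exp (a * d) - 1) * e x + (e x - e y)"
      using t by (simp add: cfn_def i' d_def algebra_simps)
    hence "norm (cfn a i e) \<le> norm (of_real (exp (a * d) - 1) * e x) + norm (e x - e y)"
      by (simp only: norm_triangle_ineq)
    also have "\<dots> = (exp (a * d) - 1) * norm (e x) + norm (e x - e y)"
      using ea by (simp add: norm_mult del: of_real_diff of_real_1)
    also have "\<dots> \<le> (a * d * 2 powr a) * \<delta> + \<delta> * d"
    proof (intro add_mono mult_mono)
      have "exp (a * d) - 1 \<le> a * d * exp (a * d)" by (rule exp_diff_le)
      also have "\<dots> \<le> a * d * 2 powr a" using ea assms d by (intro mult_left_mono) auto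
      finally show "exp (a * d) - 1 \<le> a * d * 2 powr a" .
    qed (use assms(3,4) i' d in \<open>auto simp: d_def assms(1)\<close>)
    also have "\<delta> * d \<le> (1 * d * 2 powr a) * \<delta>"
      using p1 \<delta> d mult_right_mono[OF p1, of "d * \<delta>"] by (simp add: mult_ac)
    finally show ?thesis using t by (simp add: i' fwt_def d_def algebra_simps)
  qed
qed

lemma norm_exp_minus_one_le: "norm (exp w - 1) \<le> norm w * exp (norm w)" for w :: complex
proof -
  have "norm (exp w - exp 0) \<le> exp (norm w) * norm (w - 0)"
  proof (rule field_differentiable_bound[of "cball 0 (norm w)" exp exp])
    show "norm (exp z) \<le> exp (norm w)" if "z \<in> cball 0 (norm w)" for z :: complex
      using that abs_Re_le_cmod[of z] by (simp add: norm_exp_eq_Re)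
  qed (auto intro!: derivative_eq_intros)
  thus ?thesis by (simp add: mult.commute)
qed

lemma le_exp_div: "0 < \<eta> \<Longrightarrow> \<tau> \<le> exp (\<eta> * \<tau>) / \<eta>" for \<eta> \<tau> :: real
proof -
  assume "0 < \<eta>"
  moreover have "\<eta> * \<tau> \<le> exp (\<eta> * \<tau>)" using exp_ge_add_one_self[of "\<eta> * \<tau>"] by linarith
  ultimately show ?thesis by (simp add: pos_le_divide_eq mult.commute)
qed

text \<open>With \<open>\<tau> = - ln (branch k x)\<close> a weight is
  \<open>exp (- 2 * s * \<tau>)\<close>. The lower bound \<open>T\<close> on \<tau> will be
  \<open>ln (k + 1)\<close>, for which \<open>exp (- (1 + \<eta> / 2) * T)\<close> is still summable
  over the branches.\<close>

lemma weight_pert: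
  fixes \<eta> :: real
  assumes "\<eta> > 0"
  obtains C where "C > 0"
    "\<And>\<zeta> T \<tau>. norm \<zeta> \<le> \<eta> / 4 \<Longrightarrow> 0 \<le> T \<Longrightarrow> T \<le> \<tau> \<Longrightarrow>
      norm (exp (- 2 * (of_real (1/2 + \<eta>) + \<zeta>) * of_real \<tau>) - exp (- 2 * of_real (1/2 + \<eta>) * of_real \<tau>))
        \<le> C * norm (\<zeta>::complex) * exp (- (1 + \<eta> / 2) * T)"
    "\<And>\<zeta> T \<tau> \<tau>'. norm \<zeta> \<le> \<eta> / 4 \<Longrightarrow> 0 \<le> T \<Longrightarrow> T \<le> \<tau> \<Longrightarrow> T \<le> \<tau>' \<Longrightarrow>
      norm ((exp (- 2 * (of_real (1/2 + \<eta>) + \<zeta>) * of_real \<tau>) - exp (- 2 * of_real (1/2 + \<eta>) * of_real \<tau>))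
        - (exp (- 2 * (of_real (1/2 + \<eta>) + \<zeta>) * of_real \<tau>') - exp (- 2 * of_real (1/2 + \<eta>) * of_real \<tau>')))
        \<le> C * norm (\<zeta>::complex) * exp (- (1 + \<eta> / 2) * T) * \<bar>\<tau> - \<tau>'\<bar>"
proof -
  define s0 where "s0 = 1/2 + \<eta>"
  define G where "G = (\<lambda>\<zeta> z. exp (- 2 * (of_real s0 + \<zeta>) * z) - exp (- 2 * of_real s0 * z :: complex))"
  define C where "C = 2 / \<eta> + 2 * (s0 + \<eta> / 4) * (2 / \<eta>) + 2"
  have b1: "norm (G \<zeta> (of_real \<tau>)) \<le> 2 / \<eta> * norm \<zeta> * exp (- (1 + \<eta> / 2) * T)"
    if "norm \<zeta> \<le> \<eta> / 4" "0 \<le> T" "T \<le> \<tau>" for \<zeta> T \<tau>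
  proof -
    have \<tau>: "0 \<le> \<tau>" using that by simp
    have "G \<zeta> (of_real \<tau>) = exp (of_real (- 2 * s0 * \<tau>)) * (exp (- 2 * \<zeta> * of_real \<tau>) - 1)"
      by (simp add: G_def algebra_simps exp_add[symmetric])
    hence "norm (G \<zeta> (of_real \<tau>)) = exp (- 2 * s0 * \<tau>) * norm (exp (- 2 * \<zeta> * of_real \<tau>) - 1)"
      by (simp add: norm_mult del: of_real_mult)
    also have "\<dots> \<le> exp (- 2 * s0 * \<tau>) * (norm (- 2 * \<zeta> * of_real \<tau>) * exp (norm (- 2 * \<zeta> * of_real \<tau>)))"
      by (intro mult_left_mono norm_exp_minus_one_le) auto
    also have "\<dots> = exp (- 2 * s0 * \<tau>) * (2 * norm \<zeta> * \<tau> * exp (2 * norm \<zeta> * \<tau>))"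
      using \<tau> by (simp add: norm_mult)
    \<comment> \<open>The exponent \<open>2 * s0 = 1 + 2 * \<eta>\<close> has
      \<open>2 * \<eta>\<close> to spare: \<eta> absorbs the factor \<tau>,
      \<open>\<eta> / 2\<close> absorbs the growth due to \<zeta>, and \<open>\<eta> / 2\<close>
      remains.\<close>
    also have "\<dots> \<le> exp (- 2 * s0 * \<tau>) * (2 * norm \<zeta> * (exp (\<eta> * \<tau>) / \<eta>) * exp (\<eta> / 2 * \<tau>))"
      using that \<tau> assms le_exp_div[OF assms, of \<tau>] mult_right_mono[of "4 * norm \<zeta>" \<eta> \<tau>] by (intro mult_left_mono mult_mono) (auto intro!: mult_right_mono)
    also have "\<dots> = 2 / \<eta> * norm \<zeta> * (exp (- 2 * s0 * \<tau>) * exp (\<eta> * \<tau>) * exp (\<eta> / 2 * \<tau>))"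
      by (simp add: field_simps)
    also have "exp (- 2 * s0 * \<tau>) * exp (\<eta> * \<tau>) * exp (\<eta> / 2 * \<tau>) = exp (- (1 + \<eta> / 2) * \<tau>)"
      by (simp add: exp_add[symmetric] s0_def algebra_simps)
    also have "2 / \<eta> * norm \<zeta> * exp (- (1 + \<eta> / 2) * \<tau>) \<le> 2 / \<eta> * norm \<zeta> * exp (- (1 + \<eta> / 2) * T)"
      using that assms by (intro mult_left_mono) auto
    finally show ?thesis .
  qed
  have b2: "norm (G \<zeta> (of_real \<tau>) - G \<zeta> (of_real \<tau>')) \<le> C * norm \<zeta> * exp (- (1 + \<eta> / 2) * T) * \<bar>\<tau> - \<tau>'\<bar>"
    if z: "norm \<zeta> \<le> \<eta> / 4" and T: "0 \<le> T" "T \<le> \<tau>" "T \<le> \<tau>'" for \<zeta> T \<tau> \<tau>'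
  proof -
    \<comment> \<open>The real ray from \<open>T\<close> on, as a convex set for the mean value
      estimate. On it the derivative of \<open>G \<zeta>\<close> is a combination of
      \<open>G \<zeta>\<close> and \<zeta> times the unperturbed weight.\<close>
    define S where "S = {z. Im z = 0 \<and> T \<le> Re z}"
    have cvx: "convex S"
    proof (rule convexI)
      fix x y u v assume "x \<in> S" "y \<in> S" "0 \<le> u" "0 \<le> v" "u + v = (1::real)"
      moreover from this have "u * T + v * T \<le> u * Re x + v * Re y"
        by (intro add_mono mult_left_mono) (auto simp: S_def)
      moreover have "u * T + v * T = T" using \<open>u + v = 1\<close> by (simp add: distrib_right[symmetric])
      ultimately show "u *\<^sub>R x + v *\<^sub>R y \<in> S" by (simp add: S_def)
    qed
    have "norm (G \<zeta> (of_real \<tau>) - G \<zeta> (of_real \<tau>')) \<le> (C * norm \<zeta> * exp (- (1 + \<eta> / 2) * T)) * norm (of_real \<tau> - of_real \<tau>' :: complex)"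
    proof (rule field_differentiable_bound[OF cvx])
      show "(G \<zeta> has_field_derivative - (2 * (of_real s0 + \<zeta>) * G \<zeta> z) - 2 * \<zeta> * exp (- 2 * of_real s0 * z)) (at z within S)" for z
        unfolding G_def by (auto intro!: derivative_eq_intros simp: algebra_simps)
      fix z assume "z \<in> S"
      then obtain \<sigma> where \<sigma>: "z = of_real \<sigma>" "T \<le> \<sigma>"
        by (intro that[of "Re z"]) (auto simp: S_def complex_eq_iff)
      have "norm (- (2 * (of_real s0 + \<zeta>) * G \<zeta> z) - 2 * \<zeta> * exp (- 2 * of_real s0 * z))
          \<le> norm (- (2 * (of_real s0 + \<zeta>) * G \<zeta> z)) + norm (2 * \<zeta> * exp (- 2 * of_real s0 * z))"
        by (rule norm_triangle_ineq4)
      also have "\<dots> = 2 * norm (of_real s0 + \<zeta>) * norm (G \<zeta> z) + 2 * norm \<zeta> * exp (- 2 * s0 * \<sigma>)"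
        by (simp add: norm_mult \<sigma> del: distrib_left_numeral)
      also have "\<dots> \<le> 2 * (s0 + \<eta> / 4) * (2 / \<eta> * norm \<zeta> * exp (- (1 + \<eta> / 2) * T)) + 2 * norm \<zeta> * exp (- (1 + \<eta> / 2) * T)"
      proof (intro add_mono mult_mono mult_left_mono)
        have "norm (of_real s0 + \<zeta>) \<le> norm (of_real s0 :: complex) + norm \<zeta>" by (rule norm_triangle_ineq)
        moreover have "norm (of_real s0 :: complex) = s0" using assms by (subst norm_of_real) (simp add: s0_def)
        ultimately show "norm (of_real s0 + \<zeta>) \<le> s0 + \<eta> / 4" using z by linarith
        show "norm (G \<zeta> z) \<le> 2 / \<eta> * norm \<zeta> * exp (- (1 + \<eta> / 2) * T)" unfolding \<sigma>(1) using b1 z T \<sigma> by blast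
        have "(1 + \<eta> / 2) * T \<le> 2 * s0 * \<sigma>" using \<sigma> T assms by (intro mult_mono) (auto simp: s0_def)
        thus "exp (- 2 * s0 * \<sigma>) \<le> exp (- (1 + \<eta> / 2) * T)" by (simp add: algebra_simps)
      qed (use assms in \<open>auto simp: s0_def\<close>)
      also have "\<dots> = (2 * (s0 + \<eta> / 4) * (2 / \<eta>) + 2) * (norm \<zeta> * exp (- (1 + \<eta> / 2) * T))"
        by (simp only: distrib_right mult.assoc)
      also have "\<dots> \<le> C * (norm \<zeta> * exp (- (1 + \<eta> / 2) * T))"
        using assms by (intro mult_right_mono) (auto simp: C_def)
      finally show "norm (- (2 * (of_real s0 + \<zeta>) * G \<zeta> z) - 2 * \<zeta> * exp (- 2 * of_real s0 * z)) \<le> C * norm \<zeta> * exp (- (1 + \<eta> / 2) * T)"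
        by (simp add: mult.assoc)
    qed (use T in \<open>auto simp: S_def\<close>)
    also have "norm (of_real \<tau> - of_real \<tau>' :: complex) = \<bar>\<tau> - \<tau>'\<bar>"
      by (metis norm_of_real of_real_diff)
    finally show ?thesis .
  qed
  have Cp: "C > 0" using assms by (auto simp: C_def s0_def intro!: add_nonneg_pos)
  have b1': "norm (G \<zeta> (of_real \<tau>)) \<le> C * norm \<zeta> * exp (- (1 + \<eta> / 2) * T)"
    if "norm \<zeta> \<le> \<eta> / 4" "0 \<le> T" "T \<le> \<tau>" for \<zeta> T \<tau>
  proof -
    have "2 / \<eta> * (norm \<zeta> * exp (- (1 + \<eta> / 2) * T)) \<le> C * (norm \<zeta> * exp (- (1 + \<eta> / 2) * T))"
      using assms by (intro mult_right_mono) (auto simp: C_def s0_def intro!: add_nonneg_nonneg)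
    thus ?thesis using b1[OF that] by (simp only: mult.assoc)
  qed
  show ?thesis
    by (rule that[OF Cp]) (use b1' b2 in \<open>auto simp: G_def s0_def\<close>)
qed

lemma cone_lip:
  assumes "p \<in> lcone a" "0 \<le> a" "u \<in> {0..1}" "v \<in> {0..1}"
  shows "\<bar>p u - p v\<bar> \<le> a * 2 powr a * 2 powr a * p 0 * ldist u v"
proof -
  have *: "p u - p v \<le> a * 2 powr a * 2 powr a * p 0 * ldist u v" if "u \<in> {0..1}" "v \<in> {0..1}" for u v
  proof -
    have "p u - p v \<le> (exp (a * ldist u v) - 1) * p v"
      using coneD[OF assms(1) that(2,1)] by (simp add: algebra_simps ldist_sym)
    also have "\<dots> \<le> (a * ldist u v * exp (a * ldist u v)) * p v"
      using coneD_nonneg[OF assms(1) that(2)] by (intro mult_right_mono exp_diff_le) auto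
    also have "\<dots> \<le> (a * ldist u v * 2 powr a) * (2 powr a * p 0)"
      using cone_le[OF assms(1,2), of 0 v] that assms(2) mult_left_mono[OF ldist_le_ln2[OF that] assms(2)]
        coneD_nonneg[OF assms(1)]
      by (intro mult_mono) (auto simp: powr_def)
    finally show ?thesis by (simp add: mult_ac)
  qed
  show ?thesis using *[OF assms(3,4)] *[OF assms(4,3)] by (simp add: abs_le_iff ldist_sym)
qed

text \<open>Relative to \<open>p 0\<close>, the passage from \<open>s0\<close> to
  \<open>s0 + \<zeta>\<close> costs order \<open>norm \<zeta>\<close> in size and in Lipschitz
  constant, the form of error that \<open>cfn_error\<close> accepts.\<close>

lemma ctransfer_pert:
  assumes "s0 > 1/2" "0 \<le> a"
  obtains C where "C > 0"
    "\<And>\<zeta> p x. norm \<zeta> \<le> (s0 - 1/2) / 4 \<Longrightarrow> p \<in> lcone a \<Longrightarrow> x \<in> {0..1} \<Longrightarrow>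
      norm (ctransfer (of_real s0 + \<zeta>) (\<lambda>x. of_real (p x)) x - of_real (transfer s0 p x)) \<le> C * norm \<zeta> * p 0"
    "\<And>\<zeta> p x y. norm \<zeta> \<le> (s0 - 1/2) / 4 \<Longrightarrow> p \<in> lcone a \<Longrightarrow> x \<in> {0..1} \<Longrightarrow> y \<in> {0..1} \<Longrightarrow>
      norm ((ctransfer (of_real s0 + \<zeta>) (\<lambda>x. of_real (p x)) x - of_real (transfer s0 p x)) -
        (ctransfer (of_real s0 + \<zeta>) (\<lambda>x. of_real (p x)) y - of_real (transfer s0 p y))) \<le> C * norm \<zeta> * p 0 * ldist x y"
proof -
  define \<eta> where "\<eta> = s0 - 1/2"
  have \<eta>: "\<eta> > 0" and s0: "1/2 + \<eta> = s0" using assms by (auto simp: \<eta>_def)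
  define G where "G = (\<lambda>\<zeta> \<tau>. exp (- 2 * (of_real s0 + \<zeta>) * of_real \<tau>) - exp (- 2 * of_real s0 * of_real \<tau> :: complex))"
  obtain C1 where C1: "C1 > 0"
    "\<And>\<zeta> T \<tau>. norm \<zeta> \<le> \<eta> / 4 \<Longrightarrow> 0 \<le> T \<Longrightarrow> T \<le> \<tau> \<Longrightarrow> norm (G \<zeta> \<tau>) \<le> C1 * norm \<zeta> * exp (- (1 + \<eta> / 2) * T)"
    "\<And>\<zeta> T \<tau> \<tau>'. norm \<zeta> \<le> \<eta> / 4 \<Longrightarrow> 0 \<le> T \<Longrightarrow> T \<le> \<tau> \<Longrightarrow> T \<le> \<tau>' \<Longrightarrow>
      norm (G \<zeta> \<tau> - G \<zeta> \<tau>') \<le> C1 * norm \<zeta> * exp (- (1 + \<eta> / 2) * T) * \<bar>\<tau> - \<tau>'\<bar>"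
    using weight_pert[OF \<eta>] unfolding s0 G_def by metis
  define \<tau> where "\<tau> = (\<lambda>k x. - ln (branch k x))"
  define b where "b = (\<lambda>k. (real k + 1) powr (- 2 * (1/2 + \<eta> / 4)))"
  have b_exp: "exp (- (1 + \<eta> / 2) * ln (real k + 1)) = b k" for k
    by (simp add: b_def powr_def algebra_simps)
  have bs: "summable b" unfolding b_def using \<eta> by (intro summable_shift_powr) auto
  have b0: "0 \<le> b k" for k by (simp add: b_def)
  have \<tau>T: "0 \<le> ln (real k + 1)" "ln (real k + 1) \<le> \<tau> k x" if "x \<in> {0..1}" for k x
    using that by (auto simp: \<tau>_def branch_def ln_div)
  define E where "E = (\<lambda>\<zeta> p x. ctransfer (of_real s0 + \<zeta>) (\<lambda>x. of_real (p x)) x - of_real (transfer s0 p x))"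
  define C2 where "C2 = C1 * 2 powr a * (1 + a * 2 powr a) * suminf b"
  have Eq: "(\<lambda>k. G \<zeta> (\<tau> k x) * of_real (p (branch k x))) sums E \<zeta> p x"
    if "norm \<zeta> \<le> \<eta> / 4" "p \<in> lcone a" "x \<in> {0..1}" for \<zeta> p x
  proof -
    have re: "Re (of_real s0 + \<zeta>) > 1/2"
      using that(1) abs_Re_le_cmod[of \<zeta>] \<eta> by (simp add: s0[symmetric] abs_le_iff)
    have "(\<lambda>k. exp (2 * (of_real s0 + \<zeta>) * of_real (ln (branch k x))) * of_real (p (branch k x))) sums
        ctransfer (of_real s0 + \<zeta>) (\<lambda>x. of_real (p x)) x"
      unfolding ctransfer_def
      using cone_bound[OF that(2) assms(2)]
      by (intro summable_sums csummable[OF re that(3), of _ "2 powr a * p 0"]) simp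
    moreover have "(\<lambda>k. of_real (branch k x powr (2 * s0) * p (branch k x)) :: complex) sums of_real (transfer s0 p x)"
      unfolding transfer_def sums_of_real_iff using that assms cone_bound[OF that(2) assms(2)]
      by (intro summable_sums summable_transfer) auto
    ultimately have "(\<lambda>k. exp (2 * (of_real s0 + \<zeta>) * of_real (ln (branch k x))) * of_real (p (branch k x)) -
        of_real (branch k x powr (2 * s0) * p (branch k x))) sums E \<zeta> p x"
      unfolding E_def by (rule sums_diff)
    moreover have "of_real (branch k x powr (2 * s0)) = exp (2 * of_real s0 * of_real (ln (branch k x)) :: complex)" for k
      using that(3) by (simp add: powr_def exp_of_real[symmetric])
    ultimately show ?thesis
      by (simp add: G_def \<tau>_def algebra_simps)
  qed
  have g1: "norm (G \<zeta> (\<tau> k x) * of_real (p (branch k x))) \<le> C1 * norm \<zeta> * (2 powr a * p 0) * b k"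
    if "norm \<zeta> \<le> \<eta> / 4" "p \<in> lcone a" "x \<in> {0..1}" for \<zeta> p x k
  proof -
    have "norm (G \<zeta> (\<tau> k x)) \<le> C1 * norm \<zeta> * b k"
      using C1(2)[OF that(1) \<tau>T[OF that(3)], of k] by (simp only: b_exp)
    moreover have "norm (of_real (p (branch k x)) :: complex) \<le> 2 powr a * p 0"
      using cone_bound[OF that(2) assms(2)] that(3) by simp
    ultimately have "norm (G \<zeta> (\<tau> k x)) * norm (of_real (p (branch k x)) :: complex) \<le> (C1 * norm \<zeta> * b k) * (2 powr a * p 0)"
      using C1(1) b0 by (intro mult_mono) auto
    thus ?thesis by (simp add: norm_mult mult_ac)
  qed
  have g2: "norm (G \<zeta> (\<tau> k x) * of_real (p (branch k x)) - G \<zeta> (\<tau> k y) * of_real (p (branch k y)))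
      \<le> (C1 * 2 powr a * (1 + a * 2 powr a) * norm \<zeta> * p 0 * ldist x y) * b k"
    if "norm \<zeta> \<le> \<eta> / 4" "p \<in> lcone a" "x \<in> {0..1}" "y \<in> {0..1}" for \<zeta> p x y k
  proof -
    have p0: "0 \<le> p 0" using coneD_nonneg[OF that(2)] by simp
    have "norm (G \<zeta> (\<tau> k x) - G \<zeta> (\<tau> k y)) \<le> C1 * norm \<zeta> * b k * \<bar>\<tau> k x - \<tau> k y\<bar>"
      using C1(3)[OF that(1) \<tau>T(1)[OF that(3)] \<tau>T(2)[OF that(3)] \<tau>T(2)[OF that(4)]] by (simp only: b_exp)
    also have "\<dots> \<le> C1 * norm \<zeta> * b k * ldist x y"
      using ln_branch_diff[OF that(3,4), of k] C1(1) b0 by (intro mult_left_mono) (auto simp: \<tau>_def)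
    finally have 1: "norm (G \<zeta> (\<tau> k x) - G \<zeta> (\<tau> k y)) \<le> C1 * norm \<zeta> * b k * ldist x y" .
    have 2: "norm (of_real (p (branch k x)) :: complex) \<le> 2 powr a * p 0"
      using cone_bound[OF that(2) assms(2)] that(3) by simp
    have 3: "norm (G \<zeta> (\<tau> k y)) \<le> C1 * norm \<zeta> * b k"
      using C1(2)[OF that(1) \<tau>T[OF that(4)], of k] by (simp only: b_exp)
    have "\<bar>p (branch k x) - p (branch k y)\<bar> \<le> a * 2 powr a * 2 powr a * p 0 * ldist (branch k x) (branch k y)"
      using that by (intro cone_lip assms) auto
    also have "\<dots> \<le> a * 2 powr a * 2 powr a * p 0 * ldist x y"
    proof (rule mult_left_mono)
      show "ldist (branch k x) (branch k y) \<le> ldist x y"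
        using ldist_branch[OF that(3,4), of k] ldist_nonneg[of x y] by linarith
    qed (use p0 assms(2) in auto)
    finally have "\<bar>p (branch k x) - p (branch k y)\<bar> \<le> a * 2 powr a * 2 powr a * p 0 * ldist x y" .
    hence 4: "norm (of_real (p (branch k x)) - of_real (p (branch k y)) :: complex) \<le> a * 2 powr a * 2 powr a * p 0 * ldist x y"
      by (metis norm_of_real of_real_diff)
    have "norm (G \<zeta> (\<tau> k x) * of_real (p (branch k x)) - G \<zeta> (\<tau> k y) * of_real (p (branch k y)))
      = norm ((G \<zeta> (\<tau> k x) - G \<zeta> (\<tau> k y)) * of_real (p (branch k x)) + G \<zeta> (\<tau> k y) * (of_real (p (branch k x)) - of_real (p (branch k y))))"
      by (simp add: algebra_simps)
    also have "\<dots> \<le> norm (G \<zeta> (\<tau> k x) - G \<zeta> (\<tau> k y)) * norm (of_real (p (branch k x)) :: complex) +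
       norm (G \<zeta> (\<tau> k y)) * norm (of_real (p (branch k x)) - of_real (p (branch k y)) :: complex)"
      by (metis norm_triangle_ineq norm_mult)
    also have "\<dots> \<le> (C1 * norm \<zeta> * b k * ldist x y) * (2 powr a * p 0) + (C1 * norm \<zeta> * b k) * (a * 2 powr a * 2 powr a * p 0 * ldist x y)"
      using 1 2 3 4 C1(1) b0 p0 by (intro add_mono mult_mono) auto
    finally show ?thesis by (simp add: algebra_simps)
  qed
  have e2: "norm (E \<zeta> p x - E \<zeta> p y) \<le> C2 * norm \<zeta> * p 0 * ldist x y"
    if "norm \<zeta> \<le> \<eta> / 4" "p \<in> lcone a" "x \<in> {0..1}" "y \<in> {0..1}" for \<zeta> p x y
  proof -
    have "E \<zeta> p x - E \<zeta> p y = (\<Sum>k. G \<zeta> (\<tau> k x) * of_real (p (branch k x)) - G \<zeta> (\<tau> k y) * of_real (p (branch k y)))"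
      using sums_diff[OF Eq[OF that(1-3)] Eq[OF that(1,2,4)]] by (simp add: sums_iff)
    also have "norm \<dots> \<le> (\<Sum>k. (C1 * 2 powr a * (1 + a * 2 powr a) * norm \<zeta> * p 0 * ldist x y) * b k)"
      by (intro norm_suminf_le g2 that summable_mult bs)
    also have "\<dots> = (C1 * 2 powr a * (1 + a * 2 powr a) * norm \<zeta> * p 0 * ldist x y) * suminf b"
      by (intro suminf_mult bs)
    finally show ?thesis by (simp add: C2_def mult_ac)
  qed
  have e1: "norm (E \<zeta> p x) \<le> C2 * norm \<zeta> * p 0" if "norm \<zeta> \<le> \<eta> / 4" "p \<in> lcone a" "x \<in> {0..1}" for \<zeta> p x
  proof -
    have p0: "0 \<le> p 0" using coneD_nonneg[OF that(2)] by simp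
    have "E \<zeta> p x = (\<Sum>k. G \<zeta> (\<tau> k x) * of_real (p (branch k x)))"
      using Eq[OF that] by (simp add: sums_iff)
    also have "norm \<dots> \<le> (\<Sum>k. C1 * norm \<zeta> * (2 powr a * p 0) * b k)"
      by (intro norm_suminf_le g1 that summable_mult bs)
    also have "\<dots> = C1 * norm \<zeta> * (2 powr a * p 0) * suminf b"
      by (intro suminf_mult bs)
    also have "\<dots> = 1 * (C1 * 2 powr a * suminf b * norm \<zeta> * p 0)" by simp
    also have "\<dots> \<le> (1 + a * 2 powr a) * (C1 * 2 powr a * suminf b * norm \<zeta> * p 0)"
      using C1(1) p0 assms(2) suminf_nonneg[OF bs b0] by (intro mult_right_mono) auto
    finally show ?thesis by (simp add: C2_def mult_ac)
  qed
  have "0 < suminf b" by (intro suminf_pos bs) (auto simp: b_def)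
  hence "C2 > 0" using C1(1) assms(2) by (auto simp: C2_def intro!: mult_pos_pos add_pos_nonneg)
  thus ?thesis using that[of C2] e1 e2 by (auto simp: E_def \<eta>_def)
qed

section \<open>Contraction of the complex cone\<close>

text \<open>The square of the mixed product is at most \<open>k\<^sup>2\<close> times the product of
  the two aligned ones, and a geometric mean is at most the sum.\<close>

lemma cross_bound:
  fixes \<alpha> \<beta> \<alpha>' \<beta>' k :: real
  assumes "0 \<le> \<alpha>" "0 \<le> \<beta>" "0 \<le> \<alpha>'" "0 \<le> \<beta>'" "0 \<le> k" "\<alpha> * \<beta>' \<le> k\<^sup>2 * (\<alpha>' * \<beta>)"
  shows "\<alpha> * \<beta>' \<le> k * (\<alpha> * \<alpha>' + \<beta> * \<beta>')"
proof (rule power2_le_imp_le)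
  have "(\<alpha> * \<beta>')\<^sup>2 \<le> k\<^sup>2 * (\<alpha>' * \<beta>) * (\<alpha> * \<beta>')"
    unfolding power2_eq_square[of "\<alpha> * \<beta>'"] using assms by (intro mult_right_mono) auto
  also have "\<dots> = k\<^sup>2 * ((\<alpha> * \<alpha>') * (\<beta> * \<beta>'))" by (simp add: mult_ac)
  also have "\<dots> \<le> k\<^sup>2 * ((\<alpha> * \<alpha>' + \<beta> * \<beta>') * (\<alpha> * \<alpha>' + \<beta> * \<beta>'))"
    using assms by (intro mult_left_mono mult_mono) auto
  finally show "(\<alpha> * \<beta>')\<^sup>2 \<le> (k * (\<alpha> * \<alpha>' + \<beta> * \<beta>'))\<^sup>2"
    by (simp add: power2_eq_square mult_ac)
qed (use assms in auto)

text \<open>Without errors \<open>Re (w * cnj w')\<close> is half of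
  \<open>\<alpha> * \<alpha>' + \<beta> * \<beta>'\<close>. The errors cost a multiple of \<epsilon>
  times \<open>(\<alpha> + \<beta>) * (\<alpha>' + \<beta>')\<close>; the cross ratio bounds reduce
  the mixed terms in it to the aligned ones, and the constant 12 ensures that at most half of the
  main term is lost.\<close>

lemma quad_bound:
  fixes \<alpha> \<beta> \<alpha>' \<beta>' k \<epsilon> :: real and e1 e2 e1' e2' :: complex
  assumes nn: "0 \<le> \<alpha>" "0 \<le> \<beta>" "0 \<le> \<alpha>'" "0 \<le> \<beta>'" "0 \<le> k" "0 \<le> \<epsilon>" "12 * \<epsilon> * (1 + 2 * k) \<le> 1"
    and cr: "\<alpha> * \<beta>' \<le> k\<^sup>2 * (\<alpha>' * \<beta>)" "\<alpha>' * \<beta> \<le> k\<^sup>2 * (\<alpha> * \<beta>')"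
    and e: "norm e1 \<le> \<epsilon> * \<alpha>" "norm e2 \<le> \<epsilon> * \<beta>" "norm e1' \<le> \<epsilon> * \<alpha>'" "norm e2' \<le> \<epsilon> * \<beta>'"
    and w: "w = (1 + \<i>) / 2 * (of_real \<alpha> + e1) + (1 - \<i>) / 2 * (of_real \<beta> + e2)"
       "w' = (1 + \<i>) / 2 * (of_real \<alpha>' + e1') + (1 - \<i>) / 2 * (of_real \<beta>' + e2')"
  shows "(\<alpha> * \<alpha>' + \<beta> * \<beta>') / 4 \<le> Re (w * cnj w')"
proof -
  define z z' where "z = (1 + \<i>) / 2 * of_real \<alpha> + (1 - \<i>) / 2 * of_real \<beta>"
    "z' = (1 + \<i>) / 2 * of_real \<alpha>' + (1 - \<i>) / 2 * of_real \<beta>'"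
  define d d' where "d = (1 + \<i>) / 2 * e1 + (1 - \<i>) / 2 * e2" "d' = (1 + \<i>) / 2 * e1' + (1 - \<i>) / 2 * e2'"
  have wz: "w = z + d" "w' = z' + d'" unfolding w z_z'_def d_d'_def by (simp_all only: distrib_left add_ac)
  have n1: "norm ((1 + \<i>) / 2) \<le> 1" "norm ((1 - \<i>) / 2) \<le> 1"
    using norm_triangle_ineq[of 1 \<i>] norm_triangle_ineq4[of 1 \<i>] by (auto simp: norm_divide)
  have comb: "norm ((1 + \<i>) / 2 * a + (1 - \<i>) / 2 * b) \<le> A + B" if "norm a \<le> A" "norm b \<le> B" for a b :: complex and A B
  proof -
    have "norm ((1 + \<i>) / 2 * a + (1 - \<i>) / 2 * b) \<le> norm ((1 + \<i>) / 2 * a) + norm ((1 - \<i>) / 2 * b)"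
      by (rule norm_triangle_ineq)
    also have "\<dots> \<le> 1 * A + 1 * B" unfolding norm_mult using n1 that by (intro add_mono mult_mono) auto
    finally show ?thesis by simp
  qed
  have nz: "norm z \<le> \<alpha> + \<beta>" "norm z' \<le> \<alpha>' + \<beta>'"
    unfolding z_z'_def using nn comb[of "of_real \<alpha>" \<alpha> "of_real \<beta>" \<beta>] comb[of "of_real \<alpha>'" \<alpha>' "of_real \<beta>'" \<beta>'] by simp_all
  have nd: "norm d \<le> \<epsilon> * (\<alpha> + \<beta>)" "norm d' \<le> \<epsilon> * (\<alpha>' + \<beta>')"
    unfolding d_d'_def distrib_left[of \<epsilon>] by (rule comb[OF e(1,2)], rule comb[OF e(3,4)])
  have rz: "Re (z * cnj z') = (\<alpha> * \<alpha>' + \<beta> * \<beta>') / 2"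
    unfolding z_z'_def by (simp add: field_simps)
  have "12 * \<epsilon> * 1 \<le> 12 * \<epsilon> * (1 + 2 * k)" using nn by (intro mult_left_mono) auto
  hence \<epsilon>1: "\<epsilon> \<le> 1" using nn by linarith
  have "Re (w * cnj w') = Re (z * cnj z') + Re (d * cnj z' + z * cnj d' + d * cnj d')"
    by (simp add: wz algebra_simps)
  moreover have "\<bar>Re (d * cnj z' + z * cnj d' + d * cnj d')\<bar> \<le> 3 * \<epsilon> * ((\<alpha> + \<beta>) * (\<alpha>' + \<beta>'))"
  proof -
    have "\<bar>Re (d * cnj z' + z * cnj d' + d * cnj d')\<bar> \<le> norm (d * cnj z' + z * cnj d' + d * cnj d')"
      by (rule abs_Re_le_cmod)
    also have "\<dots> \<le> norm (d * cnj z') + norm (z * cnj d') + norm (d * cnj d')"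
      by (intro order_trans[OF norm_triangle_ineq] add_mono order_refl norm_triangle_ineq)
    also have "\<dots> = norm d * norm z' + norm z * norm d' + norm d * norm d'" by (simp add: norm_mult)
    also have "\<dots> \<le> (\<epsilon> * (\<alpha> + \<beta>)) * (\<alpha>' + \<beta>') + (\<alpha> + \<beta>) * (\<epsilon> * (\<alpha>' + \<beta>')) + (\<epsilon> * (\<alpha> + \<beta>)) * (1 * (\<alpha>' + \<beta>'))"
    proof (intro add_mono mult_mono)
      show "norm d' \<le> 1 * (\<alpha>' + \<beta>')"
        using nd(2) mult_right_mono[OF \<epsilon>1, of "\<alpha>' + \<beta>'"] nn by linarith
    qed (use nz nd nn in auto)
    finally show ?thesis by (simp add: algebra_simps)
  qed
  moreover have "3 * \<epsilon> * ((\<alpha> + \<beta>) * (\<alpha>' + \<beta>')) \<le> (\<alpha> * \<alpha>' + \<beta> * \<beta>') / 4"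
  proof -
    have "(\<alpha> + \<beta>) * (\<alpha>' + \<beta>') = (\<alpha> * \<alpha>' + \<beta> * \<beta>') + \<alpha> * \<beta>' + \<alpha>' * \<beta>" by (simp add: algebra_simps)
    also have "\<dots> \<le> (1 + 2 * k) * (\<alpha> * \<alpha>' + \<beta> * \<beta>')"
      using cross_bound[OF nn(1-5) cr(1)] cross_bound[OF nn(3,4,1,2,5) cr(2)] by (simp add: algebra_simps)
    finally have "3 * \<epsilon> * ((\<alpha> + \<beta>) * (\<alpha>' + \<beta>')) \<le> 3 * \<epsilon> * ((1 + 2 * k) * (\<alpha> * \<alpha>' + \<beta> * \<beta>'))"
      using nn by (intro mult_left_mono) auto
    also have "\<dots> = (12 * \<epsilon> * (1 + 2 * k)) * ((\<alpha> * \<alpha>' + \<beta> * \<beta>') / 4)" by (simp add: field_simps)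
    also have "\<dots> \<le> 1 * ((\<alpha> * \<alpha>' + \<beta> * \<beta>') / 4)" using nn by (intro mult_right_mono) auto
    finally show ?thesis by simp
  qed
  ultimately show ?thesis unfolding rz by linarith
qed

lemma transfer_ge_0:
  assumes "p \<in> lcone a" "0 \<le> a" "s > 1/2"
  shows "2 powr (- a) * p 0 \<le> transfer s p 0"
proof -
  have sm: "summable (\<lambda>k. branch k 0 powr (2 * s) * p (branch k 0))"
    using assms cone_bound[OF assms(1,2)] by (intro summable_transfer) auto
  have "2 powr (- a) * p 0 \<le> p 1"
    using cone_le[OF assms(1,2), of 1 0] by (simp add: powr_minus divide_simps mult.commute)
  \<comment> \<open>\<open>branch 0 0 = 1\<close>, so the term of the first branch has weight
    1.\<close>
  also have "\<dots> = (\<Sum>k\<in>{0}. branch k 0 powr (2 * s) * p (branch k 0))" by (simp add: branch_def)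
  also have "\<dots> \<le> transfer s p 0"
    unfolding transfer_def using coneD_nonneg[OF assms(1)] by (intro sum_le_suminf sm) auto
  finally show ?thesis .
qed

text \<open>At the real point \<open>s0\<close> the operator maps the cone of \<open>8 * s0\<close>
  strictly inside itself, into that of \<open>6 * s0\<close>. Applied to the two real parts of a
  complex function, this leaves a margin in all products of functionals, which a perturbation of
  radius \<open>r\<close> does not use up.\<close>

lemma ccone_step:
  assumes "s0 > 1/2"
  obtains r c where "r > 0" "c > 0" "r < s0 - 1/2"
    "\<And>s f. dist s (of_real s0) \<le> r \<Longrightarrow> f \<in> ccone (8 * s0) \<Longrightarrow>
       ctransfer s f \<in> ccone (8 * s0) \<and> c * norm (f 0) \<le> norm (ctransfer s f 0)"
proof -
  \<comment> \<open>Any \<open>a > 4 * s0\<close> would do, since then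
    \<open>a' = 2 * s0 + a / 2\<close> is smaller than \<open>a\<close>.\<close>
  define a a' where "a = 8 * s0" "a' = 6 * s0"
  have a: "0 \<le> a" "0 \<le> a'" "a' < a" "2 * s0 + a / 2 = a'" using assms by (auto simp: a_a'_def)
  obtain K0 K1 where K: "0 < K0" "0 < K1"
    "\<And>g i. g \<in> lcone a' \<Longrightarrow> i \<in> fidx \<Longrightarrow> K0 * fwt i * g 0 \<le> rfn a i g \<and> rfn a i g \<le> K1 * fwt i * g 0"
    using fnl_bounds[OF a(2,3)] by blast
  obtain C where C: "C > 0"
    "\<And>\<zeta> p x. norm \<zeta> \<le> (s0 - 1/2) / 4 \<Longrightarrow> p \<in> lcone a \<Longrightarrow> x \<in> {0..1} \<Longrightarrow>
      norm (ctransfer (of_real s0 + \<zeta>) (\<lambda>x. of_real (p x)) x - of_real (transfer s0 p x)) \<le> C * norm \<zeta> * p 0"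
    "\<And>\<zeta> p x y. norm \<zeta> \<le> (s0 - 1/2) / 4 \<Longrightarrow> p \<in> lcone a \<Longrightarrow> x \<in> {0..1} \<Longrightarrow> y \<in> {0..1} \<Longrightarrow>
      norm ((ctransfer (of_real s0 + \<zeta>) (\<lambda>x. of_real (p x)) x - of_real (transfer s0 p x)) -
        (ctransfer (of_real s0 + \<zeta>) (\<lambda>x. of_real (p x)) y - of_real (transfer s0 p y))) \<le> C * norm \<zeta> * p 0 * ldist x y"
    using ctransfer_pert[OF assms a(1)] by metis
  define k where "k = K1 / K0"
  have k: "0 \<le> k" using K by (simp add: k_def)
  define \<epsilon> where "\<epsilon> = 1 / (12 * (1 + 2 * k))"
  have \<epsilon>: "0 < \<epsilon>" "12 * \<epsilon> * (1 + 2 * k) \<le> 1"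
    using k mult_pos_pos[of 12 "1 + 2 * k"] unfolding \<epsilon>_def by (auto simp del: distrib_left_numeral)
  define D where "D = (a + 1) * 2 powr a * C * 2 powr a / K0"
  have D: "D > 0" using a K C by (simp add: D_def)
  define r where "r = min ((s0 - 1/2) / 4) (\<epsilon> / D)"
  have r3: "r \<le> (s0 - 1/2) / 4" by (simp only: r_def min.cobounded1)
  have "0 < r" using assms D \<epsilon> by (auto simp: r_def)
  moreover have "r < s0 - 1/2" using r3 assms by (auto simp: field_simps)
  ultimately have r: "0 < r" "r < s0 - 1/2" "r \<le> (s0 - 1/2) / 4" using r3 by auto
  have "r \<le> \<epsilon> / D" by (simp add: r_def)
  hence rD: "D * r \<le> \<epsilon>" using D by (simp add: pos_le_divide_eq mult.commute)
  have rnn: "0 \<le> rfn a i (transfer s0 p)"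
    and low2: "K0 * fwt i * (2 powr (- a) * p 0) \<le> rfn a i (transfer s0 p)"
    if p: "p \<in> lcone a" and i: "i \<in> fidx" for p i
  proof -
    have p0: "0 \<le> p 0" using coneD_nonneg[OF p] by simp
    have tc: "transfer s0 p \<in> lcone a'" using transfer_cone[OF p a(1) assms] by (simp only: a(4))
    have low: "K0 * fwt i * transfer s0 p 0 \<le> rfn a i (transfer s0 p)" using K(3)[OF tc i] by simp
    have tp: "2 powr (- a) * p 0 \<le> transfer s0 p 0" using transfer_ge_0[OF p a(1) assms] .
    have "K0 * fwt i * (2 powr (- a) * p 0) \<le> K0 * fwt i * transfer s0 p 0"
      using tp K by (intro mult_left_mono) auto
    thus *: "K0 * fwt i * (2 powr (- a) * p 0) \<le> rfn a i (transfer s0 p)" using low by linarith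
    have "0 \<le> K0 * fwt i * (2 powr (- a) * p 0)" using K p0 by simp
    thus "0 \<le> rfn a i (transfer s0 p)" using * by linarith
  qed
  have err: "norm (cfn a i (\<lambda>x. ctransfer s (\<lambda>x. of_real (p x)) x - of_real (transfer s0 p x))) \<le> \<epsilon> * rfn a i (transfer s0 p)"
    if s: "dist s (of_real s0) \<le> r" and p: "p \<in> lcone a" and i: "i \<in> fidx" for s p i
  proof -
    define \<zeta> where "\<zeta> = s - of_real s0"
    have \<zeta>: "norm \<zeta> \<le> r" "norm \<zeta> \<le> (s0 - 1/2) / 4" "s = of_real s0 + \<zeta>"
      using s r by (auto simp: \<zeta>_def dist_norm)
    have p0: "0 \<le> p 0" using coneD_nonneg[OF p] by simp
    have "norm (cfn a i (\<lambda>x. ctransfer s (\<lambda>x. of_real (p x)) x - of_real (transfer s0 p x))) \<le> (a + 1) * 2 powr a * fwt i * (C * norm \<zeta> * p 0)"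
      unfolding \<zeta>(3) using C(2,3)[OF \<zeta>(2) p] by (intro cfn_error a i) auto
    also have "\<dots> = (D * norm \<zeta>) * (K0 * fwt i * (2 powr (- a) * p 0))"
      using K by (simp add: D_def powr_minus field_simps)
    also have "\<dots> \<le> \<epsilon> * rfn a i (transfer s0 p)"
    proof (intro mult_mono low2 p i)
      have "D * norm \<zeta> \<le> D * r" using \<zeta>(1) D by (intro mult_left_mono) auto
      thus "D * norm \<zeta> \<le> \<epsilon>" using rD by linarith
    qed (use \<epsilon> K p0 in auto)
    finally show "norm (cfn a i (\<lambda>x. ctransfer s (\<lambda>x. of_real (p x)) x - of_real (transfer s0 p x))) \<le> \<epsilon> * rfn a i (transfer s0 p)" .
  qed
  \<comment> \<open>Cross ratios are bounded because of the finite projective diameter; each of the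
    two functions contributes one factor \<open>K1 / K0\<close>.\<close>
  have cross: "rfn a i (transfer s0 p) * rfn a j (transfer s0 q) \<le> k\<^sup>2 * (rfn a j (transfer s0 p) * rfn a i (transfer s0 q))"
    if p: "p \<in> lcone a" and q: "q \<in> lcone a" and ij: "i \<in> fidx" "j \<in> fidx" for p q i j
  proof -
    have tc: "transfer s0 p \<in> lcone a'" "transfer s0 q \<in> lcone a'"
      using transfer_cone[OF p a(1) assms] transfer_cone[OF q a(1) assms] by (simp_all only: a(4))
    have nn: "0 \<le> transfer s0 p 0" "0 \<le> transfer s0 q 0" using coneD_nonneg tc by auto
    have rn: "0 \<le> rfn a i (transfer s0 p)" "0 \<le> rfn a j (transfer s0 q)" "0 \<le> rfn a j (transfer s0 p)"
      using rnn p q ij by auto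
    have "rfn a i (transfer s0 p) * rfn a j (transfer s0 q) \<le> (K1 * fwt i * transfer s0 p 0) * (K1 * fwt j * transfer s0 q 0)"
      using K(3)[OF tc(1) ij(1)] K(3)[OF tc(2) ij(2)] rn K nn by (intro mult_mono) auto
    also have "\<dots> = k\<^sup>2 * ((K0 * fwt j * transfer s0 p 0) * (K0 * fwt i * transfer s0 q 0))"
      using K by (simp add: k_def power2_eq_square field_simps)
    also have "\<dots> \<le> k\<^sup>2 * (rfn a j (transfer s0 p) * rfn a i (transfer s0 q))"
      using K(3)[OF tc(1) ij(2)] K(3)[OF tc(2) ij(1)] rn K nn by (intro mult_left_mono mult_mono) auto
    finally show ?thesis .
  qed
  \<comment> \<open>The estimates would allow \<open>2 powr (- a) / sqrt 2\<close>; halving avoids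
    the root.\<close>
  define c where "c = 2 powr (- a) / 2"
  have step: "ctransfer s f \<in> ccone a \<and> c * norm (f 0) \<le> norm (ctransfer s f 0)"
    if s: "dist s (of_real s0) \<le> r" and f: "f \<in> ccone a" for s f
  proof -
    obtain u where u: "norm u = 1" "(\<lambda>x. Re (u * f x) + Im (u * f x)) \<in> lcone a"
      "(\<lambda>x. Re (u * f x) - Im (u * f x)) \<in> lcone a" using ccone_decomp[OF f] .
    define p m where "p = (\<lambda>x. Re (u * f x) + Im (u * f x))" "m = (\<lambda>x. Re (u * f x) - Im (u * f x))"
    have pm: "p \<in> lcone a" "m \<in> lcone a" using u by (auto simp: p_m_def)
    have Res: "Re s > 1/2"
      using abs_Re_le_cmod[of "s - of_real s0"] s r(2) by (simp add: dist_norm abs_le_iff)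
    have uf: "u * f x = (1 + \<i>) / 2 * of_real (p x) + (1 - \<i>) / 2 * of_real (m x)" for x
      by (rule complex_eqI) (simp_all add: p_m_def field_simps)
    have fb: "norm (f y) \<le> 2 powr a * norm (f 0)" if "y \<in> {0..1}" for y
      using ccone_ratio[OF f a(1) that] by simp
    have pb1: "norm (of_real (p y) :: complex) \<le> 2 powr a * p 0" and pb2: "norm (of_real (m y) :: complex) \<le> 2 powr a * m 0"
      if "y \<in> {0..1}" for y using cone_bound[OF pm(1) a(1) that] cone_bound[OF pm(2) a(1) that] by auto
    have uMf: "u * ctransfer s f x = (1 + \<i>) / 2 * ctransfer s (\<lambda>x. of_real (p x)) x + (1 - \<i>) / 2 * ctransfer s (\<lambda>x. of_real (m x)) x"
      if x: "x \<in> {0..1}" for x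
    proof -
      have "u * ctransfer s f x = ctransfer s (\<lambda>y. u * f y + 0 * f y) x"
        using ctransfer_lin[OF Res x fb fb, where b=u and c=0] by simp
      also have "\<dots> = ctransfer s (\<lambda>x. (1 + \<i>) / 2 * of_real (p x) + (1 - \<i>) / 2 * of_real (m x)) x"
        by (simp only: uf mult_zero_left add_0_right)
      also have "\<dots> = (1 + \<i>) / 2 * ctransfer s (\<lambda>x. of_real (p x)) x + (1 - \<i>) / 2 * ctransfer s (\<lambda>x. of_real (m x)) x"
        by (rule ctransfer_lin[OF Res x pb1 pb2])
      finally show ?thesis .
    qed
    define ep where "ep = (\<lambda>p i. cfn a i (\<lambda>x. ctransfer s (\<lambda>x. of_real (p x)) x - of_real (transfer s0 p x)))"
    have split: "cfn a i (ctransfer s (\<lambda>x. of_real (p x))) = of_real (rfn a i (transfer s0 p)) + ep p i" for p i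
      unfolding ep_def cfn_of_real[symmetric] cfn_add[symmetric] by simp
    have w: "u * cfn a i (ctransfer s f) = (1 + \<i>) / 2 * (of_real (rfn a i (transfer s0 p)) + ep p i)
        + (1 - \<i>) / 2 * (of_real (rfn a i (transfer s0 m)) + ep m i)" if "i \<in> fidx" for i
    proof -
      have "u * cfn a i (ctransfer s f) = cfn a i (\<lambda>x. u * ctransfer s f x)" by (simp add: cfn_scale)
      also have "\<dots> = cfn a i (\<lambda>x. (1 + \<i>) / 2 * ctransfer s (\<lambda>x. of_real (p x)) x + (1 - \<i>) / 2 * ctransfer s (\<lambda>x. of_real (m x)) x)"
        using that uMf by (intro cfn_cong) auto
      finally show ?thesis by (simp only: cfn_lin split)
    qed
    have key: "(rfn a i (transfer s0 p) * rfn a j (transfer s0 p) + rfn a i (transfer s0 m) * rfn a j (transfer s0 m)) / 4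
        \<le> Re ((u * cfn a i (ctransfer s f)) * cnj (u * cfn a j (ctransfer s f)))"
      if ij: "i \<in> fidx" "j \<in> fidx" for i j
    proof (rule quad_bound[OF _ _ _ _ k less_imp_le[OF \<epsilon>(1)] \<epsilon>(2) _ _ _ _ _ _ w[OF ij(1)] w[OF ij(2)]])
      show "rfn a i (transfer s0 p) * rfn a j (transfer s0 m) \<le> k\<^sup>2 * (rfn a j (transfer s0 p) * rfn a i (transfer s0 m))"
        "rfn a j (transfer s0 p) * rfn a i (transfer s0 m) \<le> k\<^sup>2 * (rfn a i (transfer s0 p) * rfn a j (transfer s0 m))"
        using cross pm ij by blast+
    qed (use rnn err[OF s] pm ij in \<open>auto simp: ep_def\<close>)
    have rot: "Re ((u * z) * cnj (u * z')) = Re (z * cnj z')" for z z'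
    proof -
      have "(u * z) * cnj (u * z') = (u * cnj u) * (z * cnj z')" by (simp add: mult_ac)
      also have "u * cnj u = 1" using u(1) by (simp add: complex_norm_square[symmetric])
      finally show ?thesis by (simp only: mult_1)
    qed
    have o: "(0, 0, 0) \<in> fidx" by (simp add: fidx_def)
    have ev: "cfn a (0, 0, 0) g = g 0" "rfn a (0, 0, 0) h = h 0" for g h by (auto simp: cfn_def rfn_def)
    have lower: "c * norm (f 0) \<le> norm (ctransfer s f 0)"
    proof (rule power2_le_imp_le)
      have "(2 powr (- a) * p 0)\<^sup>2 \<le> (transfer s0 p 0)\<^sup>2" "(2 powr (- a) * m 0)\<^sup>2 \<le> (transfer s0 m 0)\<^sup>2"
        using transfer_ge_0[OF pm(1) a(1) assms] transfer_ge_0[OF pm(2) a(1) assms] coneD_nonneg[OF pm(1)] coneD_nonneg[OF pm(2)]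
        by (auto intro!: power_mono)
      hence "((2 powr (- a) * p 0)\<^sup>2 + (2 powr (- a) * m 0)\<^sup>2) / 4 \<le> ((transfer s0 p 0)\<^sup>2 + (transfer s0 m 0)\<^sup>2) / 4"
        by (intro divide_right_mono add_mono) auto
      also have "\<dots> \<le> Re ((u * ctransfer s f 0) * cnj (u * ctransfer s f 0))"
        using key[OF o o] unfolding ev power2_eq_square .
      also have "\<dots> = (norm (ctransfer s f 0))\<^sup>2"
        unfolding rot cmod_power2 by (simp add: power2_eq_square)
      also have "((2 powr (- a) * p 0)\<^sup>2 + (2 powr (- a) * m 0)\<^sup>2) / 4 = (2 powr (- a))\<^sup>2 * (((p 0)\<^sup>2 + (m 0)\<^sup>2) / 4)"
        by (simp add: power_mult_distrib field_simps)
      also have "(p 0)\<^sup>2 + (m 0)\<^sup>2 = 2 * (norm (f 0))\<^sup>2"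
      proof -
        have "(norm (f 0))\<^sup>2 = (norm (u * f 0))\<^sup>2" using u(1) by (simp add: norm_mult)
        also have "\<dots> = (Re (u * f 0))\<^sup>2 + (Im (u * f 0))\<^sup>2" by (rule cmod_power2)
        finally show ?thesis unfolding p_m_def by (simp add: power2_eq_square algebra_simps)
      qed
      finally have "(2 powr (- a))\<^sup>2 * (2 * (norm (f 0))\<^sup>2 / 4) \<le> (norm (ctransfer s f 0))\<^sup>2" .
      moreover have "(c * norm (f 0))\<^sup>2 = (2 powr (- a))\<^sup>2 * ((norm (f 0))\<^sup>2 / 4)"
        unfolding c_def power_mult_distrib power_divide by simp
      moreover have "(2 powr (- a))\<^sup>2 * ((norm (f 0))\<^sup>2 / 4) \<le> (2 powr (- a))\<^sup>2 * (2 * (norm (f 0))\<^sup>2 / 4)"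
        by (intro mult_left_mono) auto
      ultimately show "(c * norm (f 0))\<^sup>2 \<le> (norm (ctransfer s f 0))\<^sup>2" by linarith
    qed auto
    moreover have "ctransfer s f 0 \<noteq> 0"
    proof -
      have "f 0 \<noteq> 0" using f by (simp add: ccone_def)
      hence "0 < c * norm (f 0)" by (simp add: c_def)
      thus ?thesis using lower by auto
    qed
    moreover have "0 \<le> Re (cfn a i (ctransfer s f) * cnj (cfn a j (ctransfer s f)))" if ij: "i \<in> fidx" "j \<in> fidx" for i j
    proof -
      have "0 \<le> (rfn a i (transfer s0 p) * rfn a j (transfer s0 p) + rfn a i (transfer s0 m) * rfn a j (transfer s0 m)) / 4"
        using rnn pm ij by simp
      thus ?thesis using key[OF ij] unfolding rot by linarith
    qed
    ultimately show ?thesis unfolding ccone_def by blast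
  qed
  show ?thesis
    by (rule that[of r c]) (use r step in \<open>auto simp: c_def a_a'_def\<close>)
qed

section \<open>Smoothness of the pressure\<close>

definition cpart :: "nat \<Rightarrow> complex \<Rightarrow> real \<Rightarrow> complex" where
  "cpart n s = (ctransfer s ^^ n) (\<lambda>_. 1)"

lemma cpart_0 [simp]: "cpart 0 s x = 1"
  by (simp add: cpart_def)

lemma cpart_Suc: "cpart (Suc n) s = ctransfer s (cpart n s)"
  by (simp add: cpart_def)

lemma norm_cpart_le:
  assumes "Re s > 1/2" "x \<in> {0..1}"
  shows "norm (cpart n s x) \<le> zpart n (Re s) x"
  using assms(2)
proof (induction n arbitrary: x)
  case (Suc n)
  have "zpart n (Re s) y \<le> 2 powr (4 * Re s) * zpart n (Re s) 0" if "y \<in> {0..1}" for y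
    using part_bound[OF assms(1) that, of n] by linarith
  thus ?case unfolding cpart_Suc part_Suc using Suc assms(1) by (intro ctransfer_norm_le) auto
qed auto

lemma ctransfer_of_real:
  assumes "s > 1/2" "x \<in> {0..1}" "\<And>y. y \<in> {0..1} \<Longrightarrow> \<bar>f y\<bar> \<le> B"
  shows "ctransfer (of_real s) (\<lambda>y. of_real (f y)) x = of_real (transfer s f x)"
proof -
  have "(\<lambda>k. of_real (branch k x powr (2 * s) * f (branch k x)) :: complex) sums of_real (transfer s f x)"
    unfolding transfer_def sums_of_real_iff using summable_transfer[OF assms] by (rule summable_sums)
  moreover have "of_real (branch k x powr (2 * s)) = exp (2 * of_real s * of_real (ln (branch k x)) :: complex)" for k
    using assms(2) by (simp add: powr_def exp_of_real[symmetric])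
  ultimately show ?thesis unfolding ctransfer_def by (simp add: sums_iff)
qed

lemma cpart_of_real:
  assumes "s > 1/2" "x \<in> {0..1}"
  shows "cpart n (of_real s) x = of_real (zpart n s x)"
  using assms(2)
proof (induction n arbitrary: x)
  case (Suc n)
  have "cpart (Suc n) (of_real s) x = ctransfer (of_real s) (\<lambda>y. of_real (zpart n s y)) x"
    unfolding cpart_Suc using Suc by (intro ctransfer_cong) auto
  also have "\<dots> = of_real (zpart (Suc n) s x)"
    unfolding part_Suc by (rule ctransfer_of_real[OF assms(1) Suc.prems part_bound[OF assms(1)]])
  finally show ?case .
qed auto

lemma branch_powr_antimono:
  assumes "0 \<le> x" "\<sigma> \<le> s"
  shows "branch k x powr (2 * s) \<le> branch k x powr (2 * \<sigma>)"
  using assms by (intro powr_mono') auto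

lemma part_antimono:
  assumes "\<sigma> > 1/2" "\<sigma> \<le> s" "x \<in> {0..1}"
  shows "zpart n s x \<le> zpart n \<sigma> x"
  using assms(3)
proof (induction n arbitrary: x)
  case (Suc n)
  have s: "s > 1/2" using assms by simp
  have pp: "0 \<le> zpart n s y" "0 \<le> zpart n \<sigma> y" if "y \<in> {0..1}" for y
    using part_pos[OF s that, of n] part_pos[OF assms(1) that, of n] by auto
  show ?case
    unfolding part_Suc transfer_def
  proof (rule suminf_le)
    show "branch k x powr (2 * s) * zpart n s (branch k x) \<le> branch k x powr (2 * \<sigma>) * zpart n \<sigma> (branch k x)" for k
      using Suc assms(2) pp by (intro mult_mono branch_powr_antimono) auto
    show "summable (\<lambda>k. branch k x powr (2 * s) * zpart n s (branch k x))"
      by (rule summable_transfer[OF s Suc.prems part_bound[OF s]])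
    show "summable (\<lambda>k. branch k x powr (2 * \<sigma>) * zpart n \<sigma> (branch k x))"
      by (rule summable_transfer[OF assms(1) Suc.prems part_bound[OF assms(1)]])
  qed
qed auto

text \<open>On a closed disc the series is dominated by the real series at the leftmost abscissa
  \<open>\<sigma> > 1/2\<close>, so convergence is locally uniform.\<close>

lemma cpart_holomorphic:
  assumes "x \<in> {0..1}"
  shows "(\<lambda>s. cpart n s x) holomorphic_on {s. Re s > 1/2}"
  using assms
proof (induction n arbitrary: x)
  case (Suc n)
  show ?case
    unfolding cpart_Suc ctransfer_def
  proof (rule holomorphic_uniform_sequence)
    show "open {s. Re s > 1/2}" by (rule open_halfspace_Re_gt)
    show "(\<lambda>s. \<Sum>k<N. exp (2 * s * of_real (ln (branch k x))) * cpart n s (branch k x)) holomorphic_on {s. Re s > 1/2}" for N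
      using Suc by (intro holomorphic_intros) auto
    fix s assume s: "s \<in> {s. Re s > 1/2}"
    define d where "d = (Re s - 1/2) / 2"
    define \<sigma> where "\<sigma> = Re s - d"
    have d: "d > 0" and \<sigma>: "\<sigma> > 1/2" using s by (auto simp: d_def \<sigma>_def field_simps)
    have sub: "\<sigma> \<le> Re z" if "z \<in> cball s d" for z
      using that abs_Re_le_cmod[of "s - z"] by (simp add: \<sigma>_def dist_norm abs_le_iff)
    have "uniform_limit (cball s d) (\<lambda>N s. \<Sum>k<N. exp (2 * s * of_real (ln (branch k x))) * cpart n s (branch k x))
        (\<lambda>s. \<Sum>k. exp (2 * s * of_real (ln (branch k x))) * cpart n s (branch k x)) sequentially"
    proof (rule Weierstrass_m_test)
      show "summable (\<lambda>k. branch k x powr (2 * \<sigma>) * zpart n \<sigma> (branch k x))"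
        by (rule summable_transfer[OF \<sigma> Suc.prems part_bound[OF \<sigma>]])
      fix k z assume z: "z \<in> cball s d"
      have "norm (cpart n z (branch k x)) \<le> zpart n (Re z) (branch k x)"
        using sub[OF z] \<sigma> Suc.prems by (intro norm_cpart_le) auto
      also have "\<dots> \<le> zpart n \<sigma> (branch k x)" using sub[OF z] \<sigma> Suc.prems by (intro part_antimono) auto
      finally have 1: "norm (cpart n z (branch k x)) \<le> zpart n \<sigma> (branch k x)" .
      have 2: "branch k x powr (2 * Re z) \<le> branch k x powr (2 * \<sigma>)"
        using Suc.prems sub[OF z] by (intro branch_powr_antimono) auto
      have "norm (exp (2 * z * of_real (ln (branch k x))) * cpart n z (branch k x)) = branch k x powr (2 * Re z) * norm (cpart n z (branch k x))"
        unfolding norm_mult using Suc.prems by (subst norm_cweight) auto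
      also have "\<dots> \<le> branch k x powr (2 * \<sigma>) * zpart n \<sigma> (branch k x)"
        using 1 2 by (intro mult_mono) auto
      finally show "norm (exp (2 * z * of_real (ln (branch k x))) * cpart n z (branch k x)) \<le> branch k x powr (2 * \<sigma>) * zpart n \<sigma> (branch k x)" .
    qed
    moreover have "cball s d \<subseteq> {s. Re s > 1/2}" using sub \<sigma> by fastforce
    ultimately show "\<exists>d>0. cball s d \<subseteq> {s. Re s > 1/2} \<and>
       uniform_limit (cball s d) (\<lambda>N s. \<Sum>k<N. exp (2 * s * of_real (ln (branch k x))) * cpart n s (branch k x))
        (\<lambda>s. \<Sum>k. exp (2 * s * of_real (ln (branch k x))) * cpart n s (branch k x)) sequentially"
      using d by blast
  qed
qed auto

lemma one_in_ccone:
  assumes "0 \<le> a"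
  shows "(\<lambda>_. 1) \<in> ccone a"
proof -
  have "(\<lambda>_. 1) \<in> lcone a" using assms by (intro cone_const) auto
  hence "0 \<le> rfn a i (\<lambda>_. 1)" if "i \<in> fidx" for i using that by (simp add: lcone_iff)
  moreover have "cfn a i (\<lambda>_. 1) = of_real (rfn a i (\<lambda>_. 1))" for i using cfn_of_real[of a i "\<lambda>_. 1"] by simp
  ultimately show ?thesis by (simp add: ccone_def)
qed

text \<open>Invariance of the complex cone makes all constants independent of \<open>n\<close>. A
  zero anywhere would, by the ratio bound, force a zero at 0, which the cone excludes.\<close>

lemma cpart_uniform:
  assumes "s0 > 1/2"
  obtains r C where "0 < r" "0 < C" "r < s0 - 1/2"
    "\<And>s n x. dist s (of_real s0) \<le> r \<Longrightarrow> x \<in> {0..1} \<Longrightarrow> cpart n s x \<noteq> 0"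
    "\<And>s n x y. dist s (of_real s0) \<le> r \<Longrightarrow> x \<in> {0..1} \<Longrightarrow> y \<in> {0..1} \<Longrightarrow> norm (cpart n s x) \<le> C * norm (cpart n s y)"
    "\<And>s n. dist s (of_real s0) \<le> r \<Longrightarrow> norm (cpart n s 0) \<le> C * norm (cpart (Suc n) s 0)"
proof -
  obtain r c where r: "r > 0" "c > 0" "r < s0 - 1/2"
    and st: "\<And>s f. dist s (of_real s0) \<le> r \<Longrightarrow> f \<in> ccone (8 * s0) \<Longrightarrow>
       ctransfer s f \<in> ccone (8 * s0) \<and> c * norm (f 0) \<le> norm (ctransfer s f 0)"
    using ccone_step[OF assms] by blast
  define C where "C = max (2 powr (8 * s0)) (1 / c)"
  have C: "C > 0" "2 powr (8 * s0) \<le> C" "1 / c \<le> C" by (auto simp: C_def less_max_iff_disj)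
  have inv: "cpart n s \<in> ccone (8 * s0)" if "dist s (of_real s0) \<le> r" for n s
    by (induction n) (use st that assms one_in_ccone[of "8 * s0"] in \<open>auto simp: cpart_Suc cpart_def\<close>)
  have rat: "norm (cpart n s x) \<le> C * norm (cpart n s y)"
    if "dist s (of_real s0) \<le> r" "x \<in> {0..1}" "y \<in> {0..1}" for s n x y
  proof -
    have "norm (cpart n s x) \<le> 2 powr (8 * s0) * norm (cpart n s y)"
      using ccone_ratio[OF inv[OF that(1)]] that assms by auto
    also have "\<dots> \<le> C * norm (cpart n s y)" using C by (intro mult_right_mono) auto
    finally show ?thesis .
  qed
  have nz: "cpart n s x \<noteq> 0" if "dist s (of_real s0) \<le> r" "x \<in> {0..1}" for s n x
  proof
    assume "cpart n s x = 0"
    hence "cpart n s 0 = 0" using rat[OF that(1), of 0 x n] that by auto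
    thus False using inv[OF that(1), of n] by (simp add: ccone_def)
  qed
  have low: "norm (cpart n s 0) \<le> C * norm (cpart (Suc n) s 0)" if "dist s (of_real s0) \<le> r" for s n
  proof -
    have "norm (cpart n s 0) \<le> 1 / c * norm (cpart (Suc n) s 0)"
      using st[OF that inv[OF that, of n]] r(2) by (simp add: cpart_Suc field_simps)
    also have "\<dots> \<le> C * norm (cpart (Suc n) s 0)" using C by (intro mult_right_mono) auto
    finally show ?thesis .
  qed
  show ?thesis using that[OF r(1) C(1) r(3)] nz rat low by blast
qed

lemma ball_Re_gt:
  assumes "dist s (of_real s0) \<le> r" "r < s0 - 1/2"
  shows "Re s > 1/2"
  using abs_Re_le_cmod[of "s - of_real s0"] assms by (simp add: dist_norm abs_le_iff)

lemma zpart_deriv: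
  assumes "t > 1/2" "x \<in> {0..1}"
  shows "((\<lambda>t. zpart n t x) has_real_derivative Re (deriv (\<lambda>s. cpart n s x) (of_real t))) (at t)"
proof -
  have "((\<lambda>s. cpart n s x) has_field_derivative deriv (\<lambda>s. cpart n s x) (of_real t)) (at (of_real t))"
    using assms by (intro holomorphic_derivI[OF cpart_holomorphic[OF assms(2)] open_halfspace_Re_gt]) auto
  hence "((\<lambda>t. cpart n (of_real t) x) has_vector_derivative deriv (\<lambda>s. cpart n s x) (of_real t)) (at t)"
    by (rule has_vector_derivative_real_field)
  hence "((\<lambda>t. Re (cpart n (of_real t) x)) has_real_derivative Re (deriv (\<lambda>s. cpart n s x) (of_real t))) (at t)"
    by (rule has_field_derivative_Re)
  moreover have "Re (cpart n (of_real u) x) = zpart n u x" if "u \<in> {1/2<..}" for u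
    using that assms by (simp add: cpart_of_real)
  ultimately show ?thesis
    using assms by (elim has_field_derivative_transform_within_open[where S="{1/2<..}"]) auto
qed

lemma deriv_bound_cball:
  assumes "f holomorphic_on cball z0 r" "\<And>z. z \<in> cball z0 r \<Longrightarrow> norm (f z) \<le> B" "0 < r" "dist z z0 \<le> r / 2"
  shows "norm (deriv f z) \<le> 2 * B / r"
proof -
  have sub: "cball z (r / 2) \<subseteq> cball z0 r"
  proof
    fix w assume "w \<in> cball z (r / 2)"
    hence "dist z0 w \<le> r / 2 + r / 2"
      using assms(4) dist_triangle[of z0 w z] by (simp add: dist_commute)
    thus "w \<in> cball z0 r" by simp
  qed
  have "norm ((deriv ^^ 1) f z) \<le> fact 1 * B / (r / 2) ^ 1"
  proof (rule Cauchy_inequality)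
    have h: "f holomorphic_on cball z (r / 2)" using assms(1) sub by (rule holomorphic_on_subset)
    show "f holomorphic_on ball z (r / 2)" using h ball_subset_cball by (rule holomorphic_on_subset)
    show "continuous_on (cball z (r / 2)) f" using h by (rule holomorphic_on_imp_continuous_on)
    fix w assume "norm (z - w) = r / 2"
    hence "w \<in> cball z (r / 2)" by (simp add: dist_norm)
    thus "norm (f w) \<le> B" using sub assms(2) by blast
  qed (use assms in auto)
  thus ?thesis by (simp add: field_simps)
qed

text \<open>The quotient of \<open>cpart n\<close> at two points is holomorphic on a fixed disc and
  bounded there from both sides, so Cauchy's estimate bounds its logarithmic derivative uniformly in
  \<open>n\<close>. In the convexity argument this keeps \<open>zpart n\<close> from undoing the
  difference between the weights of two branches.\<close>

lemma part_ratio_lip: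
  assumes "s0 > 1/2"
  obtains \<rho> L where "0 < \<rho>" "0 \<le> L" "\<rho> < s0 - 1/2"
    "\<And>n x y s s'. x \<in> {0..1} \<Longrightarrow> y \<in> {0..1} \<Longrightarrow> \<bar>s - s0\<bar> \<le> \<rho> \<Longrightarrow> \<bar>s' - s0\<bar> \<le> \<rho> \<Longrightarrow>
       \<bar>(ln (zpart n s x) - ln (zpart n s y)) - (ln (zpart n s' x) - ln (zpart n s' y))\<bar> \<le> L * \<bar>s - s'\<bar>"
proof -
  obtain r C where rC: "0 < r" "0 < C" "r < s0 - 1/2"
    "\<And>s n x. dist s (of_real s0) \<le> r \<Longrightarrow> x \<in> {0..1} \<Longrightarrow> cpart n s x \<noteq> 0"
    "\<And>s n x y. dist s (of_real s0) \<le> r \<Longrightarrow> x \<in> {0..1} \<Longrightarrow> y \<in> {0..1} \<Longrightarrow> norm (cpart n s x) \<le> C * norm (cpart n s y)"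
    using cpart_uniform[OF assms] by metis
  have re: "Re s > 1/2" if "dist s (of_real s0) \<le> r" for s using ball_Re_gt[OF that rC(3)] .
  have hol: "(\<lambda>s. cpart n s x) holomorphic_on cball (of_real s0) r" if "x \<in> {0..1}" for n x
    using re by (intro holomorphic_on_subset[OF cpart_holomorphic[OF that]]) (auto simp: dist_commute)
  have nz: "cpart n s x \<noteq> 0" if "s \<in> cball (of_real s0) r" "x \<in> {0..1}" for n s x
    using rC(4) that by (auto simp: dist_commute)
  show ?thesis
  proof (rule that[of "r / 2" "2 * C / r * C"])
    fix n x y s s'
    assume x: "x \<in> {0..1::real}" and y: "y \<in> {0..1::real}" and s: "\<bar>s - s0\<bar> \<le> r / 2" "\<bar>s' - s0\<bar> \<le> r / 2"
    define G where "G = (\<lambda>s. cpart n s x / cpart n s y)"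
    have G: "G holomorphic_on cball (of_real s0) r"
      unfolding G_def using hol x y nz by (intro holomorphic_intros) auto
    have Gb: "norm (G z) \<le> C" "1 \<le> C * norm (G z)" if "z \<in> cball (of_real s0) r" for z
    proof -
      have d: "dist z (of_real s0) \<le> r" using that by (simp add: dist_commute)
      show "norm (G z) \<le> C" "1 \<le> C * norm (G z)"
        using rC(5)[OF d x y, of n] rC(5)[OF d y x, of n] nz[OF that y, of n]
        by (auto simp: G_def norm_divide divide_simps)
    qed
    have der: "((\<lambda>t. ln (zpart n t x) - ln (zpart n t y)) has_real_derivative Re (deriv G (of_real t)) / (zpart n t x / zpart n t y)) (at t)"
      if "\<bar>t - s0\<bar> \<le> r / 2" for t
    proof -
      have t: "t > 1/2" "of_real t \<in> ball (of_real s0 :: complex) r"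
      proof -
        have "dist (of_real t :: complex) (of_real s0) = \<bar>t - s0\<bar>" by (simp add: dist_norm flip: of_real_diff)
        thus "of_real t \<in> ball (of_real s0 :: complex) r" using that rC(1) by (simp add: dist_commute)
        show "t > 1/2" using that rC(1,3) unfolding abs_le_iff by linarith
      qed
      let ?X = "\<lambda>s. cpart n s x" and ?Y = "\<lambda>s. cpart n s y"
      have tc: "of_real t \<in> cball (of_real s0 :: complex) r" using t(2) ball_subset_cball by blast
      have "deriv G (of_real t) = (deriv ?X (of_real t) * ?Y (of_real t) - ?X (of_real t) * deriv ?Y (of_real t)) / (?Y (of_real t))\<^sup>2"
        unfolding G_def using t nz[OF tc y] x y
        by (intro deriv_divide holomorphic_on_imp_differentiable_at[OF holomorphic_on_subset[OF hol ball_subset_cball], of _ "of_real t"]) auto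
      hence R: "Re (deriv G (of_real t)) = (Re (deriv ?X (of_real t)) * zpart n t y - zpart n t x * Re (deriv ?Y (of_real t))) / (zpart n t y)\<^sup>2"
        using t(1) x y by (simp add: cpart_of_real flip: of_real_power)
      have p: "zpart n t x > 0" "zpart n t y > 0" using part_pos t x y by auto
      have "((\<lambda>t. ln (zpart n t x) - ln (zpart n t y)) has_real_derivative
          Re (deriv ?X (of_real t)) / zpart n t x - Re (deriv ?Y (of_real t)) / zpart n t y) (at t)"
        using p by (auto intro!: derivative_eq_intros zpart_deriv t x y)
      also have "Re (deriv ?X (of_real t)) / zpart n t x - Re (deriv ?Y (of_real t)) / zpart n t y = Re (deriv G (of_real t)) / (zpart n t x / zpart n t y)"
        unfolding R using p by (simp add: field_simps power2_eq_square)
      finally show ?thesis .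
    qed
    have "norm ((ln (zpart n s x) - ln (zpart n s y)) - (ln (zpart n s' x) - ln (zpart n s' y))) \<le> (2 * C / r * C) * norm (s - s')"
    proof (rule field_differentiable_bound[of "{s0 - r/2..s0 + r/2}"])
      fix t assume "t \<in> {s0 - r/2..s0 + r/2}"
      hence t: "\<bar>t - s0\<bar> \<le> r / 2" unfolding atLeastAtMost_iff abs_le_iff by linarith
      show "((\<lambda>t. ln (zpart n t x) - ln (zpart n t y)) has_real_derivative Re (deriv G (of_real t)) / (zpart n t x / zpart n t y)) (at t within {s0 - r/2..s0 + r/2})"
        using der[OF t] by (rule has_field_derivative_at_within)
      have t2: "t > 1/2" using t rC(1,3) unfolding abs_le_iff by linarith
      have dt: "dist (of_real t :: complex) (of_real s0) = \<bar>t - s0\<bar>" by (simp add: dist_norm flip: of_real_diff)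
      have tc: "of_real t \<in> cball (of_real s0 :: complex) r" using t rC(1) dt by (simp add: dist_commute)
      have p: "zpart n t x > 0" "zpart n t y > 0" using part_pos t2 x y by auto
      have gq: "zpart n t x / zpart n t y = norm (G (of_real t))"
        unfolding G_def using t2 x y p by (simp add: cpart_of_real norm_divide)
      have gp: "0 < zpart n t x / zpart n t y" using p by simp
      have "\<bar>Re (deriv G (of_real t))\<bar> \<le> norm (deriv G (of_real t))" by (rule abs_Re_le_cmod)
      also have "\<dots> \<le> 2 * C / r"
        using Gb rC(1) t dt by (intro deriv_bound_cball[OF G]) auto
      also have "\<dots> = 2 * C / r * 1" by simp
      also have "\<dots> \<le> 2 * C / r * (C * (zpart n t x / zpart n t y))"
        unfolding gq using Gb(2)[OF tc] rC by (intro mult_left_mono) auto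
      finally have "\<bar>Re (deriv G (of_real t))\<bar> \<le> (2 * C / r * C) * (zpart n t x / zpart n t y)" by (simp only: mult.assoc)
      thus "norm (Re (deriv G (of_real t)) / (zpart n t x / zpart n t y)) \<le> 2 * C / r * C"
        using gp by (simp only: real_norm_def abs_divide[of "Re (deriv G (of_real t))"] abs_of_pos[OF gp] pos_divide_le_eq)
    next
      show "s \<in> {s0 - r/2..s0 + r/2}" "s' \<in> {s0 - r/2..s0 + r/2}"
        using s unfolding atLeastAtMost_iff abs_le_iff by linarith+
    qed simp
    thus "\<bar>(ln (zpart n s x) - ln (zpart n s y)) - (ln (zpart n s' x) - ln (zpart n s' y))\<bar> \<le> 2 * C / r * C * \<bar>s - s'\<bar>"
      by simp
  qed (use rC in auto)
qed

text \<open>Logarithmic derivatives serve instead of logarithms, which would call for a choice of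
  branch. They telescope over the quotients \<open>R n\<close>, which are holomorphic with uniform
  bounds from both sides; hence \<open>ll n / n\<close> is uniformly bounded and Montel's theorem
  applies. A subsequence suffices, as \<open>pressure\<close> is the limit along all
  \<open>n\<close>.\<close>

lemma pressure_smooth:
  assumes "s0 > 1/2"
  obtains g r where "0 < r" "r < s0 - 1/2" "g holomorphic_on ball (of_real s0) r"
    "\<And>t. \<bar>t - s0\<bar> < r \<Longrightarrow> (pressure has_real_derivative Re (g (of_real t))) (at t)"
proof -
  obtain r C where rC: "0 < r" "0 < C" "r < s0 - 1/2"
    "\<And>s n x. dist s (of_real s0) \<le> r \<Longrightarrow> x \<in> {0..1} \<Longrightarrow> cpart n s x \<noteq> 0"
    "\<And>s n x y. dist s (of_real s0) \<le> r \<Longrightarrow> x \<in> {0..1} \<Longrightarrow> y \<in> {0..1} \<Longrightarrow> norm (cpart n s x) \<le> C * norm (cpart n s y)"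
    "\<And>s n. dist s (of_real s0) \<le> r \<Longrightarrow> norm (cpart n s 0) \<le> C * norm (cpart (Suc n) s 0)"
    using cpart_uniform[OF assms] by blast
  let ?B = "cball (of_real s0 :: complex) r"
  have re: "Re s > 1/2" if "s \<in> ?B" for s using ball_Re_gt[OF _ rC(3), of s] that by (simp add: dist_commute)
  have hol: "(\<lambda>s. cpart n s 0) holomorphic_on ?B" for n
    using re by (intro holomorphic_on_subset[OF cpart_holomorphic]) auto
  have nz: "cpart n s 0 \<noteq> 0" if "s \<in> ?B" for n s
    using rC(4)[of s 0 n] that by (auto simp: dist_commute)
  define \<sigma> where "\<sigma> = s0 - r"
  have \<sigma>: "\<sigma> > 1/2" using rC by (simp add: \<sigma>_def)
  define K where "K = C * zpart 1 \<sigma> 0"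
  have Kp: "K > 0" using rC(2) part_pos[OF \<sigma>, of 0 1] by (simp add: K_def)
  define R where "R = (\<lambda>n s. cpart (Suc n) s 0 / cpart n s 0)"
  have Rhol: "R n holomorphic_on ?B" for n unfolding R_def using hol nz by (intro holomorphic_intros) auto
  have Rup: "norm (R n s) \<le> K" and Rlow: "1 \<le> C * norm (R n s)" if s: "s \<in> ?B" for n s
  proof -
    have d: "dist s (of_real s0) \<le> r" using s by (simp add: dist_commute)
    have "\<sigma> \<le> Re s" using abs_Re_le_cmod[of "s - of_real s0"] d by (simp add: \<sigma>_def dist_norm abs_le_iff)
    have "norm (cpart (Suc n) s 0) \<le> transfer (Re s) (\<lambda>_. C * norm (cpart n s 0)) 0"
      unfolding cpart_Suc using rC(5)[OF d] re[OF s] by (intro ctransfer_norm_le[where B="C * norm (cpart n s 0)"]) auto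
    also have "\<dots> = C * norm (cpart n s 0) * transfer (Re s) (\<lambda>_. 1) 0"
      using transfer_cmult[OF re[OF s], of 0 "\<lambda>_. 1" 1 "C * norm (cpart n s 0)"] by simp
    also have "transfer (Re s) (\<lambda>_. 1) 0 = zpart 1 (Re s) 0" by (simp add: zpart_def)
    also have "C * norm (cpart n s 0) * zpart 1 (Re s) 0 \<le> C * norm (cpart n s 0) * zpart 1 \<sigma> 0"
      using rC(2) \<open>\<sigma> \<le> Re s\<close> \<sigma> by (intro mult_left_mono part_antimono) auto
    finally show "norm (R n s) \<le> K" using nz[OF s, of n] by (simp add: R_def K_def norm_divide divide_simps mult_ac)
    show "1 \<le> C * norm (R n s)" using rC(6)[OF d, of n] nz[OF s, of n] by (simp add: R_def norm_divide divide_simps)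
  qed
  define ll where "ll = (\<lambda>n s. deriv (\<lambda>s. cpart n s 0) s / cpart n s 0)"
  define M where "M = 2 * K / r * C"
  let ?S = "ball (of_real s0 :: complex) (r / 2)"
  have SB: "?S \<subseteq> ?B" using rC(1) by auto
  have inB: "s \<in> ball (of_real s0) r" if "s \<in> ?S" for s using that rC(1) by auto
  have llb: "norm (ll n s) \<le> real n * M" if s: "s \<in> ?S" for n s
  proof (induction n)
    case 0
    show ?case by (simp add: ll_def)
  next
    case (Suc n)
    have sB: "s \<in> ?B" using s SB by blast
    have diff: "(\<lambda>s. cpart n s 0) field_differentiable at s" for n
      using inB[OF s] by (intro holomorphic_on_imp_differentiable_at[OF holomorphic_on_subset[OF hol ball_subset_cball]]) auto
    have "deriv (R n) s = (deriv (\<lambda>s. cpart (Suc n) s 0) s * cpart n s 0 - cpart (Suc n) s 0 * deriv (\<lambda>s. cpart n s 0) s) / (cpart n s 0)\<^sup>2"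
      unfolding R_def using nz[OF sB] by (intro deriv_divide diff) auto
    hence "ll (Suc n) s = ll n s + deriv (R n) s / R n s"
      using nz[OF sB, of n] nz[OF sB, of "Suc n"] by (simp add: ll_def R_def field_simps power2_eq_square)
    hence "norm (ll (Suc n) s) \<le> norm (ll n s) + norm (deriv (R n) s) / norm (R n s)"
      by (metis norm_triangle_ineq norm_divide)
    also have "norm (deriv (R n) s) / norm (R n s) \<le> M"
    proof -
      have Rp: "0 < norm (R n s)" using Rlow[OF sB, of n] rC(2) by (auto simp: zero_less_mult_iff)
      have "norm (deriv (R n) s) \<le> 2 * K / r"
        using s rC(1) Rup by (intro deriv_bound_cball[OF Rhol]) (auto simp: dist_commute)
      also have "\<dots> = 2 * K / r * 1" by simp
      also have "\<dots> \<le> 2 * K / r * (C * norm (R n s))" using Rlow[OF sB] Kp rC by (intro mult_left_mono) auto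
      finally show ?thesis using Rp by (simp add: M_def pos_divide_le_eq mult_ac)
    qed
    finally show ?case using Suc by (simp add: algebra_simps)
  qed
  have Mp: "0 \<le> M" using Kp rC by (simp add: M_def)
  define FF where "FF = (\<lambda>n s. ll n s / of_nat n)"
  have FFhol: "FF n holomorphic_on ?S" for n
  proof (cases "n = 0")
    case False
    show ?thesis
      unfolding FF_def ll_def using False nz SB
      by (intro holomorphic_intros holomorphic_deriv[OF holomorphic_on_subset[OF hol]] holomorphic_on_subset[OF hol]) auto
  qed (simp add: FF_def)
  have FFb: "norm (FF n s) \<le> M" if "s \<in> ?S" for n s
    using llb[OF that, of n] Mp by (cases "n = 0") (auto simp: FF_def norm_divide divide_simps mult.commute)
  define H where "H = {h. h holomorphic_on ?S \<and> (\<forall>s\<in>?S. norm (h s) \<le> M)}"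
  obtain g sub where g: "g holomorphic_on ?S" and sub: "strict_mono (sub :: nat \<Rightarrow> nat)"
    and ul: "\<And>K. \<lbrakk>compact K; K \<subseteq> ?S\<rbrakk> \<Longrightarrow> uniform_limit K (FF \<circ> sub) g sequentially"
  proof (rule Montel[of ?S H FF])
    show "\<And>h. h \<in> H \<Longrightarrow> h holomorphic_on ?S" by (simp add: H_def)
    show "\<And>K. compact K \<Longrightarrow> K \<subseteq> ?S \<Longrightarrow> \<exists>B. \<forall>h\<in>H. \<forall>z\<in>K. norm (h z) \<le> B"
      by (rule exI[of _ M]) (auto simp: H_def)
    show "range FF \<subseteq> H" using FFhol FFb by (auto simp: H_def)
  qed (use that in auto)
  \<comment> \<open>Convergence is uniform only on compact subsets of the disc of radius
    \<open>r / 2\<close>.\<close>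
  define \<rho> where "\<rho> = r / 4"
  have \<rho>: "0 < \<rho>" "\<rho> < r / 2" "\<rho> < s0 - 1/2" using rC by (auto simp: \<rho>_def)
  let ?I = "{s0 - \<rho>..s0 + \<rho>}"
  have I: "t > 1/2" "of_real t \<in> ?S" if "t \<in> ?I" for t
  proof -
    have "dist (of_real t :: complex) (of_real s0) = \<bar>t - s0\<bar>" by (simp add: dist_norm flip: of_real_diff)
    moreover have "\<bar>t - s0\<bar> \<le> \<rho>" using that unfolding atLeastAtMost_iff abs_le_iff by linarith
    ultimately show "of_real t \<in> ?S" using \<rho> by (simp add: dist_commute)
    show "t > 1/2" using that \<rho> by simp
  qed
  have comp: "compact (of_real ` ?I :: complex set)" "of_real ` ?I \<subseteq> ?S"
    using I by (auto intro!: compact_continuous_image continuous_intros)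
  have "\<exists>G. \<forall>x\<in>?I. (\<lambda>n. ln (zpart (sub n) x 0) / real (sub n)) \<longlonglongrightarrow> G x \<and> (G has_derivative (\<lambda>h. Re (g (of_real x)) * h)) (at x within ?I)"
  proof (rule has_derivative_sequence)
    fix n t assume t: "t \<in> ?I"
    have p: "zpart (sub n) t 0 > 0" using I[OF t] part_pos by auto
    have "((\<lambda>t. ln (zpart (sub n) t 0) / real (sub n)) has_real_derivative
        (Re (deriv (\<lambda>s. cpart (sub n) s 0) (of_real t)) / zpart (sub n) t 0) / real (sub n)) (at t)"
      using p by (cases "sub n = 0") (auto intro!: derivative_eq_intros zpart_deriv I[OF t])
    also have "(Re (deriv (\<lambda>s. cpart (sub n) s 0) (of_real t)) / zpart (sub n) t 0) / real (sub n) = Re (FF (sub n) (of_real t))"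
      using I[OF t] by (simp add: FF_def ll_def cpart_of_real Re_divide_of_nat)
    finally show "((\<lambda>t. ln (zpart (sub n) t 0) / real (sub n)) has_derivative (\<lambda>h. Re (FF (sub n) (of_real t)) * h)) (at t within ?I)"
      unfolding has_field_derivative_def by (rule has_derivative_at_withinI)
  next
    fix e :: real assume "e > 0"
    hence "\<forall>\<^sub>F n in sequentially. \<forall>z\<in>of_real ` ?I. dist ((FF \<circ> sub) n z) (g z) < e"
      using ul[OF comp] by (auto simp: uniform_limit_iff)
    thus "\<forall>\<^sub>F n in sequentially. \<forall>x\<in>?I. \<forall>h. norm (Re (FF (sub n) (of_real x)) * h - Re (g (of_real x)) * h) \<le> e * norm h"
    proof eventually_elim
      case (elim n)
      show ?case
      proof (intro ballI allI)
        fix x h assume "x \<in> ?I"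
        hence "norm (FF (sub n) (of_real x) - g (of_real x)) \<le> e" using elim by (auto simp: dist_norm intro: less_imp_le)
        hence "\<bar>Re (FF (sub n) (of_real x)) - Re (g (of_real x))\<bar> \<le> e"
          using abs_Re_le_cmod[of "FF (sub n) (of_real x) - g (of_real x)"] by simp
        hence "\<bar>Re (FF (sub n) (of_real x)) - Re (g (of_real x))\<bar> * \<bar>h\<bar> \<le> e * \<bar>h\<bar>" by (intro mult_right_mono) auto
        thus "norm (Re (FF (sub n) (of_real x)) * h - Re (g (of_real x)) * h) \<le> e * norm h"
          by (simp only: real_norm_def abs_mult left_diff_distrib[symmetric])
      qed
    qed
  next
    show "(\<lambda>n. ln (zpart (sub n) s0 0) / real (sub n)) \<longlonglongrightarrow> pressure s0"
      using LIMSEQ_subseq_LIMSEQ[OF pressure_lim[OF assms] sub] by (simp add: o_def)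
  qed (use \<rho> in auto)
  then obtain G where G: "\<And>x. x \<in> ?I \<Longrightarrow> (\<lambda>n. ln (zpart (sub n) x 0) / real (sub n)) \<longlonglongrightarrow> G x"
    "\<And>x. x \<in> ?I \<Longrightarrow> (G has_derivative (\<lambda>h. Re (g (of_real x)) * h)) (at x within ?I)" by blast
  have GP: "G x = pressure x" if "x \<in> ?I" for x
    using LIMSEQ_unique[OF G(1)[OF that]] LIMSEQ_subseq_LIMSEQ[OF pressure_lim[OF I(1)[OF that]] sub] by (simp add: o_def)
  have der: "(pressure has_real_derivative Re (g (of_real t))) (at t)" if "\<bar>t - s0\<bar> < \<rho>" for t
  proof -
    have t: "t \<in> {s0 - \<rho><..<s0 + \<rho>}" using that unfolding abs_less_iff greaterThanLessThan_iff by linarith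
    hence "(G has_derivative (\<lambda>h. Re (g (of_real t)) * h)) (at t within ?I)" by (intro G(2)) auto
    hence "(G has_real_derivative Re (g (of_real t))) (at t within {s0 - \<rho><..<s0 + \<rho>})"
      unfolding has_field_derivative_def by (rule has_derivative_subset) auto
    hence "(G has_real_derivative Re (g (of_real t))) (at t)"
      by (simp only: at_within_open[OF t open_greaterThanLessThan])
    thus ?thesis
      by (rule has_field_derivative_transform_within_open[where S="{s0 - \<rho><..<s0 + \<rho>}"]) (use t GP in auto)
  qed
  show ?thesis
  proof (rule that[OF \<rho>(1,3) _ der])
    show "g holomorphic_on ball (of_real s0) \<rho>" using \<rho> by (intro holomorphic_on_subset[OF g]) auto
  qed
qed

section \<open>Strict convexity of the pressure\<close>

lemma one_minus_exp_ge: "0 \<le> h \<Longrightarrow> h \<le> 1 \<Longrightarrow> h / 4 \<le> 1 - exp (- h / 2)" for h :: real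
proof -
  assume h: "0 \<le> h" "h \<le> 1"
  have "1 + h / 2 \<le> exp (h / 2)" by (rule exp_ge_add_one_self)
  hence "exp (- h / 2) \<le> 1 / (1 + h / 2)"
    using h by (simp add: exp_minus divide_simps)
  also have "1 / (1 + h / 2) \<le> 1 - h / 4"
  proof -
    have "1 \<le> (1 - h / 4) * (1 + h / 2)"
      using mult_left_mono[OF h(2,1)] h by (simp add: algebra_simps)
    thus ?thesis using h by (simp add: pos_divide_le_eq)
  qed
  finally show ?thesis by simp
qed

text \<open>A quantitative Cauchy--Schwarz inequality: the two indices \<open>i\<close> and \<open>j\<close> carry a fixed
  proportion of the mass and have visibly different ratios, which yields a definite gain.\<close>

lemma cauchy_schwarz_gain:
  fixes A B :: "nat \<Rightarrow> real"
  assumes A: "\<And>k. 0 < A k" "summable A" and B: "\<And>k. 0 < B k" "summable B"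
    and h: "0 \<le> h" "h \<le> 1" and \<eta>: "0 < \<eta>" "\<eta> \<le> 1" "\<eta> * suminf A \<le> A i" "\<eta> * suminf B \<le> B j"
    and ratio: "exp (2 * h) * (A j * B i) \<le> A i * B j"
    and G: "\<And>k. 0 \<le> G k" "\<And>k. G k \<le> sqrt (A k * B k)"
  shows "summable G" "exp (\<eta> * h\<^sup>2 / 32) * suminf G \<le> sqrt (suminf A * suminf B)"
proof -
  define Sa Sb where "Sa = suminf A" "Sb = suminf B"
  have S: "0 < Sa" "0 < Sb" using A B by (auto simp: Sa_Sb_def intro: suminf_pos)
  \<comment> \<open>Scaling by \<theta> gives both sequences the same sum \<open>T\<close>, the
    geometric mean of the two sums. The defect in Cauchy-Schwarz is then at least the sum of the
    squares \<open>(sqrt (a k) - sqrt (b k))\<^sup>2\<close>, of which a single term is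
    kept.\<close>
  define \<theta> where "\<theta> = sqrt (Sb / Sa)"
  have \<theta>: "0 < \<theta>" using S by (simp add: \<theta>_def)
  define T where "T = sqrt (Sa * Sb)"
  have T0: "0 < T" using S by (simp add: T_def)
  have T: "\<theta> * Sa = T" "Sb / \<theta> = T"
    using S real_sqrt_mult_self[of Sa] real_sqrt_mult_self[of Sb] unfolding \<theta>_def T_def real_sqrt_divide real_sqrt_mult
    by (auto simp: field_simps)
  define a b where "a = (\<lambda>k. \<theta> * A k)" "b = (\<lambda>k. B k / \<theta>)"
  have ab: "0 < a k" "0 < b k" for k using \<theta> A B by (auto simp: a_b_def)
  have ab_prod: "sqrt (a k) * sqrt (b k) = sqrt (A k * B k)" for k
    using \<theta> by (simp add: a_b_def real_sqrt_mult[symmetric])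
  have sa: "summable a" "suminf a = T" and sb: "summable b" "suminf b = T"
    using A B T by (auto simp: a_b_def Sa_Sb_def suminf_mult suminf_divide summable_mult summable_divide)
  have Gab: "2 * G k \<le> a k + b k" for k
  proof -
    have "0 \<le> (sqrt (a k) - sqrt (b k))\<^sup>2" by simp
    also have "\<dots> = a k + b k - 2 * sqrt (A k * B k)"
      using ab[of k] by (simp add: power2_diff flip: ab_prod)
    finally show ?thesis using G(2)[of k] by linarith
  qed
  show sG: "summable G"
  proof (rule summable_comparison_test'[of "\<lambda>k. a k + b k" 0])
    show "norm (G k) \<le> a k + b k" for k using Gab[of k] G(1)[of k] by simp
  qed (intro summable_add sa sb)
  define c where "c = (\<lambda>k. a k + b k - 2 * G k)"
  have c: "0 \<le> c k" "summable c" for k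
    using Gab[of k] by (auto simp: c_def intro!: summable_diff summable_add sa sb summable_mult sG)
  have cs: "suminf c = 2 * T - 2 * suminf G"
  proof -
    have "suminf c = suminf (\<lambda>k. a k + b k) - suminf (\<lambda>k. 2 * G k)"
      unfolding c_def by (intro suminf_diff[symmetric] summable_add sa sb summable_mult sG)
    thus ?thesis using sa sb sG by (simp add: suminf_add[symmetric] suminf_mult)
  qed
  have cterm: "(sqrt (a k) - sqrt (b k))\<^sup>2 \<le> 2 * T - 2 * suminf G" for k
  proof -
    have "(sqrt (a k) - sqrt (b k))\<^sup>2 = a k + b k - 2 * sqrt (A k * B k)"
      using ab[of k] by (simp add: power2_diff flip: ab_prod)
    also have "\<dots> \<le> c k" using G(2)[of k] by (simp add: c_def)
    also have "\<dots> \<le> suminf c" using sum_le_suminf[of c "{k}"] c by simp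
    finally show ?thesis unfolding cs .
  qed
  have ai: "\<eta> * T \<le> a i"
    using mult_left_mono[OF \<eta>(3), of \<theta>] \<theta> unfolding T(1)[symmetric] a_b_def Sa_Sb_def by (simp add: mult_ac)
  have bj: "\<eta> * T \<le> b j"
    using divide_right_mono[OF \<eta>(4), of \<theta>] \<theta> unfolding T(2)[symmetric] a_b_def Sa_Sb_def by simp
  have gain: "\<eta> * T * (h\<^sup>2 / 16) \<le> (u - v)\<^sup>2"
    if "exp (h / 2) * v \<le> u" "0 < v" "0 < u" "\<eta> * T \<le> u\<^sup>2" for u v
  proof -
    have "v \<le> exp (- h / 2) * u"
    proof -
      have "exp (- h / 2) * (exp (h / 2) * v) \<le> exp (- h / 2) * u" using that(1) by (intro mult_left_mono) auto
      thus ?thesis by (simp add: mult.assoc[symmetric] exp_add[symmetric])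
    qed
    hence "(1 - exp (- h / 2)) * u \<le> u - v" by (simp add: algebra_simps)
    moreover have "h / 4 * u \<le> (1 - exp (- h / 2)) * u"
      using one_minus_exp_ge[OF h] that by (intro mult_right_mono) auto
    ultimately have "h / 4 * u \<le> u - v" by linarith
    hence "(h / 4 * u)\<^sup>2 \<le> (u - v)\<^sup>2" using h that by (intro power_mono) auto
    moreover have "\<eta> * T * (h\<^sup>2 / 16) \<le> u\<^sup>2 * (h\<^sup>2 / 16)" using that(4) by (intro mult_right_mono) auto
    moreover have "(h / 4 * u)\<^sup>2 = u\<^sup>2 * (h\<^sup>2 / 16)" by (simp add: power_mult_distrib power_divide)
    ultimately show ?thesis by linarith
  qed
  \<comment> \<open>By \<open>ratio\<close> the quotients \<open>a i / b i\<close> and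
    \<open>a j / b j\<close> are a factor \<open>exp (2 * h)\<close> apart, so either
    \<open>a i\<close> exceeds \<open>b i\<close> or \<open>b j\<close> exceeds \<open>a j\<close>
    by the factor \<open>exp h\<close>.\<close>
  have gp: "\<eta> * T * (h\<^sup>2 / 16) \<le> 2 * T - 2 * suminf G"
  proof (cases "exp (h / 2) * sqrt (b i) \<le> sqrt (a i)")
    case True
    thus ?thesis using gain[OF True] ab[of i] ai bj cterm[of i] by (intro order_trans[OF _ cterm[of i]]) auto
  next
    case False
    have "exp (h / 2) * sqrt (a j) \<le> sqrt (b j)"
    proof (rule ccontr)
      assume "\<not> exp (h / 2) * sqrt (a j) \<le> sqrt (b j)"
      hence "sqrt (a i) * sqrt (b j) < (exp (h / 2) * sqrt (b i)) * (exp (h / 2) * sqrt (a j))"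
        using False ab by (intro mult_strict_mono) (auto intro: less_imp_le)
      moreover have "exp (h / 2) * exp (h / 2) = exp h" by (simp add: exp_add[symmetric])
      ultimately have "sqrt (a i * b j) < exp h * sqrt (a j * b i)"
        by (metis mult.assoc mult.commute mult.left_commute real_sqrt_mult)
      also have "\<dots> = sqrt (exp (2 * h) * (a j * b i))"
        by (simp add: real_sqrt_mult exp_double)
      finally have "a i * b j < exp (2 * h) * (a j * b i)" by simp
      moreover have "a i * b j = A i * B j" "a j * b i = A j * B i" using \<theta> by (auto simp: a_b_def)
      ultimately show False using ratio by simp
    qed
    hence "\<eta> * T * (h\<^sup>2 / 16) \<le> (sqrt (b j) - sqrt (a j))\<^sup>2"
      using ab[of j] ai bj by (intro gain) auto
    also have "\<dots> = (sqrt (a j) - sqrt (b j))\<^sup>2" by (rule power2_commute)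
    finally show ?thesis using cterm[of j] by linarith
  qed
  have *: "suminf G \<le> (1 - \<eta> * h\<^sup>2 / 32) * T" using gp by (simp add: algebra_simps)
  have "1 - \<eta> * h\<^sup>2 / 32 \<le> exp (- (\<eta> * h\<^sup>2 / 32))" using exp_ge_add_one_self[of "- (\<eta> * h\<^sup>2 / 32)"] by simp
  hence "(1 - \<eta> * h\<^sup>2 / 32) * T \<le> exp (- (\<eta> * h\<^sup>2 / 32)) * T" using T0 by (intro mult_right_mono) auto
  with * have "suminf G \<le> exp (- (\<eta> * h\<^sup>2 / 32)) * T" by linarith
  hence "exp (\<eta> * h\<^sup>2 / 32) * suminf G \<le> exp (\<eta> * h\<^sup>2 / 32) * (exp (- (\<eta> * h\<^sup>2 / 32)) * T)" by (intro mult_left_mono) auto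
  thus "exp (\<eta> * h\<^sup>2 / 32) * suminf G \<le> sqrt (suminf A * suminf B)"
    by (simp add: mult.assoc[symmetric] exp_add[symmetric] T_def Sa_Sb_def)
qed

text \<open>Induction on \<open>n\<close>, where each level gains from the branches 0 and
  \<open>K\<close>. Their weights respond so differently to a change of \<open>s\<close> that the
  response of \<open>zpart n\<close>, bounded by \<open>part_ratio_lip\<close>, cannot
  compensate.\<close>

lemma part_strict_convex:
  assumes "s0 > 1/2"
  obtains c h0 where "0 < c" "0 < h0" "h0 < s0 - 1/2"
    "\<And>n h x. 0 \<le> h \<Longrightarrow> h \<le> h0 \<Longrightarrow> x \<in> {0..1} \<Longrightarrow>
       exp (c * real n * h\<^sup>2) * zpart n s0 x \<le> sqrt (zpart n (s0 + h) x * zpart n (s0 - h) x)"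
proof -
  obtain \<rho> L where \<rho>: "0 < \<rho>" "0 \<le> L" "\<rho> < s0 - 1/2"
    "\<And>n x y s s'. x \<in> {0..1} \<Longrightarrow> y \<in> {0..1} \<Longrightarrow> \<bar>s - s0\<bar> \<le> \<rho> \<Longrightarrow> \<bar>s' - s0\<bar> \<le> \<rho> \<Longrightarrow>
       \<bar>(ln (zpart n s x) - ln (zpart n s y)) - (ln (zpart n s' x) - ln (zpart n s' y))\<bar> \<le> L * \<bar>s - s'\<bar>"
    using part_ratio_lip[OF assms] by blast
  \<comment> \<open>With this \<open>K\<close> the logarithms of the branches 0 and \<open>K\<close>
    differ by at least \<open>(L + 1) / 2\<close>. This contributes \<open>2 * h * (L + 1)\<close>
    to the exponent in the ratio condition, of which the Lipschitz bound can destroy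
    \<open>2 * h * L\<close>.\<close>
  obtain K :: nat where K: "2 * exp ((L + 1) / 2) \<le> real K" using real_arch_simple by blast
  define h0 where "h0 = min \<rho> 1"
  have h0: "0 < h0" "h0 \<le> \<rho>" "h0 \<le> 1" using \<rho> by (auto simp: h0_def)
  define S where "S = s0 + \<rho>"
  define \<sigma> where "\<sigma> = s0 - \<rho>"
  have \<sigma>: "\<sigma> > 1/2" using \<rho> by (simp add: \<sigma>_def)
  define Z where "Z = 2 powr (8 * S) * zpart 1 \<sigma> 0"
  \<comment> \<open>A lower bound, common to all exponents in \<open>{\<sigma>..S}\<close> and all
    \<open>n\<close>, for the share of a branch \<open>k \<le> K\<close> in the whole sum.\<close>
  define \<eta> where "\<eta> = (real K + 2) powr (- 2 * S) * 2 powr (- (4 * S)) / Z"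
  have S0: "S > 0" using assms \<rho> by (simp add: S_def)
  have z1: "1 \<le> zpart 1 \<sigma> 0"
  proof -
    have "1 = (\<Sum>k\<in>{0}. branch k 0 powr (2 * \<sigma>) * 1)" by (simp add: branch_def)
    also have "\<dots> \<le> transfer \<sigma> (\<lambda>_. 1) 0"
      unfolding transfer_def by (intro sum_le_suminf summable_transfer[where B=1] \<sigma>) auto
    finally show ?thesis by (simp add: zpart_def)
  qed
  have Z1: "1 \<le> Z" unfolding Z_def using z1 S0 mult_mono[of 1 "2 powr (8 * S)" 1 "zpart 1 \<sigma> 0"]
    by (simp add: ge_one_powr_ge_zero)
  have \<eta>: "0 < \<eta>" "\<eta> \<le> 1"
  proof -
    show "0 < \<eta>" using Z1 by (auto simp: \<eta>_def)
    have "(real K + 2) powr (- 2 * S) \<le> (real K + 2) powr 0" "2 powr (- (4 * S)) \<le> (2::real) powr 0"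
      using S0 by (intro powr_mono; simp)+
    hence "(real K + 2) powr (- 2 * S) * 2 powr (- (4 * S)) \<le> 1 * 1" by (intro mult_mono) auto
    also have "\<dots> \<le> Z" using Z1 by simp
    finally show "\<eta> \<le> 1" using Z1 by (simp add: \<eta>_def)
  qed
  have mass: "\<eta> * zpart (Suc n) s x \<le> branch k x powr (2 * s) * zpart n s (branch k x)"
    if s: "\<sigma> \<le> s" "s \<le> S" and x: "x \<in> {0..1}" and k: "k \<le> K" for s x k n
  proof -
    have s': "s > 1/2" using s \<sigma> by simp
    define F where "F = zpart n s 0"
    have F: "0 < F" using part_pos[OF s'] by (simp add: F_def)
    have p4: "2 powr (4 * s) \<le> 2 powr (4 * S)" using s by simp
    have up: "zpart n s y \<le> 2 powr (4 * S) * F" if "y \<in> {0..1}" for y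
    proof -
      have "zpart n s y \<le> 2 powr (4 * s) * F" using part_ratio[OF s', of 0 y n] that by (simp add: F_def)
      also have "\<dots> \<le> 2 powr (4 * S) * F" using p4 F by (intro mult_right_mono) auto
      finally show ?thesis .
    qed
    have lo: "2 powr (- (4 * S)) * F \<le> zpart n s y" if "y \<in> {0..1}" for y
    proof -
      have "2 powr (- (4 * S)) * F \<le> 2 powr (- (4 * s)) * F" using s F by (intro mult_right_mono) auto
      also have "\<dots> \<le> zpart n s y"
        using part_ratio[OF s', of y 0 n] that by (simp add: F_def powr_minus divide_simps mult.commute)
      finally show ?thesis .
    qed
    have "zpart (Suc n) s x \<le> transfer s (\<lambda>_. 2 powr (4 * S) * F * 1) x"
      unfolding part_Suc using up part_bound[OF s'] F x
      by (intro transfer_mono[OF s' x, where B="2 powr (4 * s) * zpart n s 0" and C="2 powr (4 * S) * F"]) auto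
    also have "\<dots> = 2 powr (4 * S) * F * zpart 1 s x"
      using transfer_cmult[OF s' x, of "\<lambda>_. 1" 1 "2 powr (4 * S) * F"] by (simp add: zpart_def)
    also have "\<dots> \<le> 2 powr (4 * S) * F * (2 powr (4 * S) * zpart 1 \<sigma> 0)"
    proof (rule mult_left_mono)
      have "zpart 1 s x \<le> zpart 1 \<sigma> x" by (rule part_antimono[OF \<sigma> s(1) x])
      also have "\<dots> \<le> 2 powr (4 * \<sigma>) * zpart 1 \<sigma> 0" using part_ratio[OF \<sigma>, of 0 x 1] x by simp
      also have "\<dots> \<le> 2 powr (4 * S) * zpart 1 \<sigma> 0" using s z1 by (intro mult_right_mono) auto
      finally show "zpart 1 s x \<le> 2 powr (4 * S) * zpart 1 \<sigma> 0" .
    qed (use F in auto)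
    also have "\<dots> = F * Z" by (simp add: Z_def powr_add[symmetric] mult_ac)
    finally have "\<eta> * zpart (Suc n) s x \<le> \<eta> * (F * Z)" using \<eta> by (intro mult_left_mono) auto
    also have "\<dots> = (real K + 2) powr (- 2 * S) * (2 powr (- (4 * S)) * F)" using Z1 by (simp add: \<eta>_def)
    also have "\<dots> \<le> branch k x powr (2 * s) * zpart n s (branch k x)"
    proof (intro mult_mono lo)
      have "(real K + 2) powr (- 2 * S) = (1 / (real K + 2)) powr (2 * S)" by (simp add: powr_divide powr_minus divide_simps)
      also have "\<dots> \<le> branch k x powr (2 * S)"
        using x k S0 by (intro powr_mono2) (auto simp: branch_def intro!: divide_left_mono)
      also have "\<dots> \<le> branch k x powr (2 * s)" using x s by (intro branch_powr_antimono) auto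
      finally show "(real K + 2) powr (- 2 * S) \<le> branch k x powr (2 * s)" .
    qed (use x F in auto)
    finally show ?thesis .
  qed
  define c where "c = \<eta> / 32"
  have main: "exp (c * real n * h\<^sup>2) * zpart n s0 x \<le> sqrt (zpart n (s0 + h) x * zpart n (s0 - h) x)"
    if h: "0 \<le> h" "h \<le> h0" and x: "x \<in> {0..1}" for n h x
    using x
  proof (induction n arbitrary: x)
    case (Suc n)
    let ?b = "\<lambda>k. branch k x"
    have sp: "s0 + h > 1/2" "s0 - h > 1/2" "\<sigma> \<le> s0 + h" "s0 + h \<le> S" "\<sigma> \<le> s0 - h" "s0 - h \<le> S"
      using h h0 \<sigma> assms by (auto simp: \<sigma>_def S_def)
    define A where "A = (\<lambda>k. ?b k powr (2 * (s0 + h)) * zpart n (s0 + h) (?b k))"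
    define B where "B = (\<lambda>k. ?b k powr (2 * (s0 - h)) * zpart n (s0 - h) (?b k))"
    define G where "G = (\<lambda>k. exp (c * real n * h\<^sup>2) * (?b k powr (2 * s0) * zpart n s0 (?b k)))"
    have bin: "?b k \<in> {0..1}" "0 < ?b k" for k using Suc.prems by auto
    have fp: "0 < zpart n (s0 + h) (?b k)" "0 < zpart n (s0 - h) (?b k)" "0 < zpart n s0 (?b k)" for k
      using part_pos bin sp assms by auto
    have A: "0 < A k" "summable A" "suminf A = zpart (Suc n) (s0 + h) x" for k
    proof -
      have "?b k powr (2 * (s0 + h)) > 0" using bin(2)[of k] by (simp only: powr_gt_zero)
      thus "0 < A k" unfolding A_def using fp(1) by (intro mult_pos_pos)
      show "summable A" unfolding A_def by (rule summable_transfer[OF sp(1) Suc.prems part_bound[OF sp(1)]])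
      show "suminf A = zpart (Suc n) (s0 + h) x" unfolding A_def part_Suc transfer_def ..
    qed
    have B: "0 < B k" "summable B" "suminf B = zpart (Suc n) (s0 - h) x" for k
    proof -
      have "?b k powr (2 * (s0 - h)) > 0" using bin(2)[of k] by (simp only: powr_gt_zero)
      thus "0 < B k" unfolding B_def using fp(2) by (intro mult_pos_pos)
      show "summable B" unfolding B_def by (rule summable_transfer[OF sp(2) Suc.prems part_bound[OF sp(2)]])
      show "suminf B = zpart (Suc n) (s0 - h) x" unfolding B_def part_Suc transfer_def ..
    qed
    have sG: "suminf G = exp (c * real n * h\<^sup>2) * zpart (Suc n) s0 x"
      unfolding G_def part_Suc transfer_def
      by (intro suminf_mult summable_transfer[OF assms Suc.prems part_bound[OF assms]])
    have "exp (\<eta> * h\<^sup>2 / 32) * suminf G \<le> sqrt (suminf A * suminf B)"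
    proof (rule cauchy_schwarz_gain(2)[where i=0 and j=K])
      show "0 < A k" "summable A" "0 < B k" "summable B" for k using A B by auto
      show "0 \<le> h" "h \<le> 1" using h h0 by auto
      show "\<eta> * suminf A \<le> A 0"
        unfolding A(3) unfolding A_def by (rule mass) (use sp Suc.prems in simp_all)
      show "\<eta> * suminf B \<le> B K"
        unfolding B(3) unfolding B_def by (rule mass) (use sp Suc.prems in simp_all)
      show "0 \<le> G k" for k unfolding G_def using less_imp_le[OF fp(3)] by (intro mult_nonneg_nonneg) simp_all
      show "G k \<le> sqrt (A k * B k)" for k
      proof -
        have "A k * B k = (?b k powr (2 * s0))\<^sup>2 * (zpart n (s0 + h) (?b k) * zpart n (s0 - h) (?b k))"
        proof -
          have "?b k powr (2 * (s0 + h)) * ?b k powr (2 * (s0 - h)) = ?b k powr (2 * s0) * ?b k powr (2 * s0)"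
            by (simp add: powr_add[symmetric] algebra_simps)
          thus ?thesis by (simp add: A_def B_def power2_eq_square mult_ac)
        qed
        hence "sqrt (A k * B k) = ?b k powr (2 * s0) * sqrt (zpart n (s0 + h) (?b k) * zpart n (s0 - h) (?b k))"
          by (simp add: real_sqrt_mult)
        moreover have "?b k powr (2 * s0) * (exp (c * real n * h\<^sup>2) * zpart n s0 (?b k)) \<le> \<dots>"
          using Suc.IH[OF bin(1)[of k]] by (intro mult_left_mono) auto
        ultimately show ?thesis by (simp add: G_def mult_ac)
      qed
      show "exp (2 * h) * (A K * B 0) \<le> A 0 * B K"
      proof -
        have x0: "0 \<le> x" "x \<le> 1" using Suc.prems by auto
        have lb: "ln (?b 0) - ln (?b K) \<ge> (L + 1) / 2"
        proof -
          have Kp: "0 < real K" by (rule less_le_trans[OF _ K]) simp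
          have "exp ((L + 1) / 2) \<le> real K / 2" using K by linarith
          hence "ln (exp ((L + 1) / 2)) \<le> ln (real K / 2)" by (intro ln_mono exp_gt_zero)
          hence "(L + 1) / 2 \<le> ln (real K / 2)" by (simp only: ln_exp)
          also have "\<dots> \<le> ln ((real K + 1 + x) / (1 + x))"
          proof (rule ln_mono)
            show "0 < real K / 2" using Kp by simp
            have "real K / 2 * (1 + x) \<le> real K / 2 * 2" using x0 by (intro mult_left_mono) auto
            also have "\<dots> \<le> real K + 1 + x" using x0 by simp
            finally show "real K / 2 \<le> (real K + 1 + x) / (1 + x)" using x0 by (simp only: pos_le_divide_eq)
          qed
          also have "\<dots> = ln (?b 0) - ln (?b K)" using x0 by (simp add: branch_def ln_div)
          finally show ?thesis .
        qed
        have lip: "\<bar>(ln (zpart n (s0 + h) (?b 0)) - ln (zpart n (s0 + h) (?b K))) - (ln (zpart n (s0 - h) (?b 0)) - ln (zpart n (s0 - h) (?b K)))\<bar>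
            \<le> L * \<bar>(s0 + h) - (s0 - h)\<bar>"
          using h h0 by (intro \<rho>(4) bin(1)) simp_all
        have l1: "4 * h * (ln (?b 0) - ln (?b K)) \<ge> 4 * h * ((L + 1) / 2)"
          using lb h(1) by (intro mult_left_mono) simp_all
        have lA: "ln (A k) = 2 * (s0 + h) * ln (?b k) + ln (zpart n (s0 + h) (?b k))"
          and lB: "ln (B k) = 2 * (s0 - h) * ln (?b k) + ln (zpart n (s0 - h) (?b k))" for k
          using fp[of k] bin(2)[of k] unfolding A_def B_def by (simp_all only: ln_mult_pos ln_powr powr_gt_zero)
        have "2 * h + ln (A K) + ln (B 0) \<le> ln (A 0) + ln (B K)"
        proof -
          have e1: "ln (A 0) + ln (B K) - ln (A K) - ln (B 0) = 4 * h * (ln (?b 0) - ln (?b K)) +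
             ((ln (zpart n (s0 + h) (?b 0)) - ln (zpart n (s0 + h) (?b K))) - (ln (zpart n (s0 - h) (?b 0)) - ln (zpart n (s0 - h) (?b K))))"
          proof -
            have alg: "(2 * (s0 + h) * a + u) + (2 * (s0 - h) * b + z) - (2 * (s0 + h) * b + v) - (2 * (s0 - h) * a + w)
                = 4 * h * (a - b) + ((u - v) - (w - z))" for a b u v w z :: real
              by (simp add: algebra_simps)
            show ?thesis unfolding lA lB by (rule alg)
          qed
          have e2: "L * \<bar>(s0 + h) - (s0 - h)\<bar> = 2 * h * L" using h by simp
          have e3: "4 * h * ((L + 1) / 2) = 2 * h * L + 2 * h" by (simp add: algebra_simps)
          show ?thesis using e1 lip l1 unfolding e2 e3 by linarith
        qed
        hence "exp (2 * h + ln (A K) + ln (B 0)) \<le> exp (ln (A 0) + ln (B K))" by (simp only: exp_le_cancel_iff)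
        thus ?thesis using A(1) B(1) by (simp only: exp_add exp_ln mult.assoc)
      qed
    qed (rule \<eta>(1), rule \<eta>(2))
    also have "exp (\<eta> * h\<^sup>2 / 32) * suminf G = exp (c * real (Suc n) * h\<^sup>2) * zpart (Suc n) s0 x"
    proof -
      have "c * real (Suc n) * h\<^sup>2 = \<eta> * h\<^sup>2 / 32 + c * real n * h\<^sup>2" by (simp add: c_def algebra_simps)
      thus ?thesis unfolding sG by (simp only: exp_add mult.assoc)
    qed
    finally show ?case unfolding A(3) B(3) .
  qed auto
  show ?thesis
    by (rule that[of c h0]) (use main \<eta> h0 \<rho> in \<open>auto simp: c_def\<close>)
qed

text \<open>The gain in the exponent is linear in \<open>n\<close>, so it survives the division by
  \<open>n\<close>.\<close>

lemma pressure_second_difference: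
  assumes "s0 > 1/2"
  obtains c h0 where "0 < c" "0 < h0" "h0 < s0 - 1/2"
    "\<And>h. 0 \<le> h \<Longrightarrow> h \<le> h0 \<Longrightarrow> c * h\<^sup>2 \<le> pressure (s0 + h) + pressure (s0 - h) - 2 * pressure s0"
proof -
  obtain c h0 where c: "0 < c" "0 < h0" "h0 < s0 - 1/2"
    "\<And>n h x. 0 \<le> h \<Longrightarrow> h \<le> h0 \<Longrightarrow> x \<in> {0..1} \<Longrightarrow>
       exp (c * real n * h\<^sup>2) * zpart n s0 x \<le> sqrt (zpart n (s0 + h) x * zpart n (s0 - h) x)"
    using part_strict_convex[OF assms] by blast
  have "2 * c * h\<^sup>2 \<le> pressure (s0 + h) + pressure (s0 - h) - 2 * pressure s0" if h: "0 \<le> h" "h \<le> h0" for h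
  proof (rule tendsto_le[OF trivial_limit_sequentially])
    have sp: "s0 + h > 1/2" "s0 - h > 1/2" using h c assms by auto
    show "(\<lambda>n. ln (zpart n (s0 + h) 0) / real n + ln (zpart n (s0 - h) 0) / real n - 2 * (ln (zpart n s0 0) / real n))
        \<longlonglongrightarrow> pressure (s0 + h) + pressure (s0 - h) - 2 * pressure s0"
      by (intro tendsto_intros pressure_lim sp assms)
    show "(\<lambda>n. 2 * c * h\<^sup>2) \<longlonglongrightarrow> 2 * c * h\<^sup>2" by simp
    show "\<forall>\<^sub>F n in sequentially. 2 * c * h\<^sup>2 \<le> ln (zpart n (s0 + h) 0) / real n + ln (zpart n (s0 - h) 0) / real n - 2 * (ln (zpart n s0 0) / real n)"
      using eventually_gt_at_top[of 0]
    proof eventually_elim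
      case (elim n)
      have p: "0 < zpart n (s0 + h) 0" "0 < zpart n (s0 - h) 0" "0 < zpart n s0 0" using part_pos sp assms by auto
      have "ln (exp (c * real n * h\<^sup>2) * zpart n s0 0) \<le> ln (sqrt (zpart n (s0 + h) 0 * zpart n (s0 - h) 0))"
        using c(4)[OF h, of 0 n] p by (intro ln_mono) auto
      hence "2 * (c * real n * h\<^sup>2) + 2 * ln (zpart n s0 0) \<le> ln (zpart n (s0 + h) 0) + ln (zpart n (s0 - h) 0)"
        using p by (simp add: ln_mult ln_sqrt)
      hence "(2 * (c * real n * h\<^sup>2) + 2 * ln (zpart n s0 0)) / real n \<le> (ln (zpart n (s0 + h) 0) + ln (zpart n (s0 - h) 0)) / real n"
        by (intro divide_right_mono) auto
      thus ?case using elim by (simp add: add_divide_distrib)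
    qed
  qed
  thus ?thesis using that[of "2 * c" h0] c by auto
qed

section \<open>Asymptotics of the pressure\<close>

lemma pressure_deriv2_aux:
  assumes "s > 1/2"
  obtains r D where "0 < r" "r < s - 1/2" "(deriv pressure has_real_derivative D) (at s)"
    "\<And>t. \<bar>t - s\<bar> < r \<Longrightarrow> (pressure has_real_derivative deriv pressure t) (at t)"
proof -
  obtain g r where g: "0 < r" "r < s - 1/2" "g holomorphic_on ball (of_real s) r"
    "\<And>t. \<bar>t - s\<bar> < r \<Longrightarrow> (pressure has_real_derivative Re (g (of_real t))) (at t)"
    using pressure_smooth[OF assms] by blast
  have eq: "deriv pressure t = Re (g (of_real t))" if "\<bar>t - s\<bar> < r" for t
    using g(4)[OF that] by (rule DERIV_imp_deriv)
  have "(g has_field_derivative deriv g (of_real s)) (at (of_real s))"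
    using g(1) by (intro holomorphic_derivI[OF g(3)]) auto
  hence "((\<lambda>t. g (of_real t)) has_vector_derivative deriv g (of_real s)) (at s)"
    by (rule has_vector_derivative_real_field)
  hence "((\<lambda>t. Re (g (of_real t))) has_real_derivative Re (deriv g (of_real s))) (at s)"
    by (rule has_field_derivative_Re)
  hence "(deriv pressure has_real_derivative Re (deriv g (of_real s))) (at s)"
    by (rule has_field_derivative_transform_within_open[where S="ball s r"])
       (use g(1) in \<open>auto simp: eq dist_real_def abs_minus_commute\<close>)
  moreover have "(pressure has_real_derivative deriv pressure t) (at t)" if "\<bar>t - s\<bar> < r" for t
    using g(4)[OF that] unfolding eq[OF that] .
  ultimately show ?thesis using that g(1,2) by blast
qed

lemma pressure_deriv:
  assumes "s > 1/2"
  shows "(pressure has_real_derivative deriv pressure s) (at s)"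
proof -
  obtain r where "0 < r" "\<And>t. \<bar>t - s\<bar> < r \<Longrightarrow> (pressure has_real_derivative deriv pressure t) (at t)"
    using pressure_deriv2_aux[OF assms] by metis
  thus ?thesis by simp
qed

lemma pressure_deriv2:
  assumes "s > 1/2"
  shows "(deriv pressure has_real_derivative deriv (deriv pressure) s) (at s)"
  using pressure_deriv2_aux[OF assms] DERIV_imp_deriv by metis

text \<open>Otherwise \<psi>, the derivative of \<phi>, would be negative just to the right of 0 and
  \<phi> would become negative, against \<open>pressure_second_difference\<close>.\<close>

lemma pressure_deriv2_pos:
  assumes "s > 1/2"
  shows "0 < deriv (deriv pressure) s"
proof (rule ccontr)
  let ?D = "deriv (deriv pressure) s"
  assume neg: "\<not> 0 < ?D"
  obtain c h0 where c: "0 < c" "0 < h0" "h0 < s - 1/2"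
    "\<And>h. 0 \<le> h \<Longrightarrow> h \<le> h0 \<Longrightarrow> c * h\<^sup>2 \<le> pressure (s + h) + pressure (s - h) - 2 * pressure s"
    using pressure_second_difference[OF assms] by blast
  define \<psi> where "\<psi> = (\<lambda>h. deriv pressure (s + h) - deriv pressure (s - h) - 2 * c * h)"
  define \<phi> where "\<phi> = (\<lambda>h. pressure (s + h) + pressure (s - h) - 2 * pressure s - c * h\<^sup>2)"
  have d2: "(deriv pressure has_real_derivative ?D) (at (s + 0))" "(deriv pressure has_real_derivative ?D) (at (s - 0))"
    using pressure_deriv2[OF assms] by auto
  have "(\<psi> has_real_derivative (?D - (- ?D) - 2 * c)) (at 0)"
  proof -
    have "((\<lambda>h. deriv pressure (s + h)) has_real_derivative ?D * 1) (at 0)"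
      by (rule DERIV_chain2[where f="deriv pressure" and g="\<lambda>h. s + h"]) (use d2(1) in \<open>auto intro!: derivative_eq_intros\<close>)
    moreover have "((\<lambda>h. deriv pressure (s - h)) has_real_derivative ?D * (-1)) (at 0)"
      by (rule DERIV_chain2[where f="deriv pressure" and g="\<lambda>h. s - h"]) (use d2(2) in \<open>auto intro!: derivative_eq_intros\<close>)
    ultimately show ?thesis unfolding \<psi>_def by (auto intro!: derivative_eq_intros)
  qed
  moreover have "?D - (- ?D) - 2 * c < 0" using neg c(1) by simp
  ultimately obtain d where d: "0 < d" "\<And>h. 0 < h \<Longrightarrow> h < d \<Longrightarrow> \<psi> (0 + h) < \<psi> 0"
    using DERIV_neg_dec_right by blast
  have \<psi>0: "\<psi> 0 = 0" by (simp add: \<psi>_def)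
  define h where "h = min (d / 2) h0"
  have h: "0 < h" "h < d" "h \<le> h0" using d(1) c(2) by (auto simp: h_def min_def)
  have der: "(\<phi> has_real_derivative \<psi> u) (at u)" if "0 \<le> u" "u \<le> h" for u
  proof -
    have "s + u > 1/2" "s - u > 1/2" using that h c assms by auto
    note p = pressure_deriv[OF this(1)] pressure_deriv[OF this(2)]
    have "((\<lambda>h. pressure (s + h)) has_real_derivative deriv pressure (s + u) * 1) (at u)"
      by (rule DERIV_chain2[where f=pressure and g="\<lambda>h. s + h"]) (use p(1) in \<open>auto intro!: derivative_eq_intros\<close>)
    moreover have "((\<lambda>h. pressure (s - h)) has_real_derivative deriv pressure (s - u) * (-1)) (at u)"
      by (rule DERIV_chain2[where f=pressure and g="\<lambda>h. s - h"]) (use p(2) in \<open>auto intro!: derivative_eq_intros\<close>)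
    ultimately show ?thesis unfolding \<phi>_def \<psi>_def by (auto intro!: derivative_eq_intros)
  qed
  obtain z where z: "0 < z" "z < h" "\<phi> h - \<phi> 0 = (h - 0) * \<psi> z"
    using MVT2[OF h(1), of \<phi> \<psi>] der by auto
  have "\<psi> z < 0" using d(2)[of z] z h \<psi>0 by simp
  hence "\<phi> h - \<phi> 0 < 0" unfolding z(3) using h by (simp add: mult_pos_neg)
  moreover have "0 \<le> \<phi> h" using c(4)[of h] h by (simp add: \<phi>_def)
  ultimately show False by (simp add: \<phi>_def)
qed

text \<open>Iterating the inequality gives growth of at least \<open>l ^ n\<close>. Explicit test
  functions can thus replace the eigenfunction: the Gauss density at \<open>s = 1\<close> and a
  power of \<open>golden + x\<close> for general \<open>s\<close>.\<close>

lemma pressure_ge_eigen: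
  assumes s: "s > 1/2" and v: "\<And>x. x \<in> {0..1} \<Longrightarrow> c \<le> v x \<and> v x \<le> C" "0 < c"
    and l: "0 < l" "\<And>x. x \<in> {0..1} \<Longrightarrow> l * v x \<le> transfer s v x"
  shows "ln l \<le> pressure s"
proof -
  have C: "0 < C" using v(1)[of 0] v(2) by auto
  have bd: "c * zpart n s y \<le> (transfer s ^^ n) v y \<and> (transfer s ^^ n) v y \<le> C * zpart n s y" if "y \<in> {0..1}" for n y
    by (rule transfer_iter_bounds[OF s that]) (use v(1) in auto)
  have "l ^ n * v x \<le> (transfer s ^^ n) v x" if "x \<in> {0..1}" for n x
    using that
  proof (induction n arbitrary: x)
    case (Suc n)
    have vb: "\<bar>v y\<bar> \<le> C" if "y \<in> {0..1}" for y using v(1)[OF that] v(2) by auto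
    have "l ^ Suc n * v x \<le> l ^ n * transfer s v x" using l Suc.prems by (simp add: mult_left_mono mult.left_commute mult.commute[of l])
    also have "\<dots> = transfer s (\<lambda>y. l ^ n * v y) x"
      by (rule transfer_cmult[OF s Suc.prems vb, symmetric])
    also have "\<dots> \<le> transfer s ((transfer s ^^ n) v) x"
    proof (rule transfer_mono[OF s Suc.prems Suc.IH])
      fix y :: real assume y: "y \<in> {0..1}"
      show "\<bar>l ^ n * v y\<bar> \<le> l ^ n * C" using vb[OF y] l by (simp add: abs_mult mult_left_mono)
      have "0 \<le> (transfer s ^^ n) v y" using bd[OF y, of n] v(2) part_pos[OF s y, of n] by (smt (verit) mult_pos_pos)
      moreover have "C * zpart n s y \<le> C * (2 powr (4 * s) * zpart n s 0)"
        using part_bound[OF s y, of n] C by (intro mult_left_mono) auto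
      ultimately show "\<bar>(transfer s ^^ n) v y\<bar> \<le> C * (2 powr (4 * s) * zpart n s 0)"
        using bd[OF y, of n] by simp
    qed
    finally show ?case by simp
  qed auto
  hence *: "l ^ n * c \<le> C * zpart n s 0" for n
    using bd[of 0 n] v(1)[of 0] l mult_left_mono[of c "v 0" "l ^ n"] by (smt (verit) atLeastAtMost_iff zero_le_power)
  have "ln l + (ln c - ln C) / real n \<le> ln (zpart n s 0) / real n" if "n > 0" for n
  proof -
    have p: "zpart n s 0 > 0" using part_pos[OF s] by simp
    have "ln (l ^ n * c) \<le> ln (C * zpart n s 0)" using *[of n] l v(2) by (intro ln_mono) auto
    hence "real n * ln l + (ln c - ln C) \<le> ln (zpart n s 0)"
      using l v(2) C p by (simp add: ln_mult ln_realpow)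
    hence "(real n * ln l + (ln c - ln C)) / real n \<le> ln (zpart n s 0) / real n" by (intro divide_right_mono) auto
    thus ?thesis using that by (simp add: add_divide_distrib)
  qed
  from eventually_mono[OF eventually_gt_at_top[of 0] this]
  have "\<forall>\<^sub>F n in sequentially. ln l + (ln c - ln C) / real n \<le> ln (zpart n s 0) / real n" .
  moreover have "(\<lambda>n. ln l + (ln c - ln C) / real n) \<longlonglongrightarrow> ln l + 0" by (intro tendsto_intros lim_const_over_n)
  ultimately have "ln l + 0 \<le> pressure s" by (intro tendsto_le[OF trivial_limit_sequentially pressure_lim[OF s]])
  thus ?thesis by simp
qed

lemma pressure_le_eigen:
  assumes s: "s > 1/2" and v: "\<And>x. x \<in> {0..1} \<Longrightarrow> c \<le> v x \<and> v x \<le> C" "0 < c"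
    and l: "0 < l" "\<And>x. x \<in> {0..1} \<Longrightarrow> transfer s v x \<le> l * v x"
  shows "pressure s \<le> ln l"
proof -
  have C: "0 < C" using v(1)[of 0] v(2) by auto
  have bd: "c * zpart n s y \<le> (transfer s ^^ n) v y \<and> (transfer s ^^ n) v y \<le> C * zpart n s y" if "y \<in> {0..1}" for n y
    by (rule transfer_iter_bounds[OF s that]) (use v(1) in auto)
  have "(transfer s ^^ n) v x \<le> l ^ n * v x" if "x \<in> {0..1}" for n x
    using that
  proof (induction n arbitrary: x)
    case (Suc n)
    have vb: "\<bar>v y\<bar> \<le> C" if "y \<in> {0..1}" for y using v(1)[OF that] v(2) by auto
    have "(transfer s ^^ Suc n) v x = transfer s ((transfer s ^^ n) v) x" by simp
    also have "\<dots> \<le> transfer s (\<lambda>y. l ^ n * v y) x"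
    proof (rule transfer_mono[OF s Suc.prems Suc.IH])
      fix y :: real assume y: "y \<in> {0..1}"
      show "\<bar>l ^ n * v y\<bar> \<le> l ^ n * C" using vb[OF y] l by (simp add: abs_mult mult_left_mono)
      have "0 \<le> (transfer s ^^ n) v y" using bd[OF y, of n] v(2) part_pos[OF s y, of n] by (smt (verit) mult_pos_pos)
      moreover have "C * zpart n s y \<le> C * (2 powr (4 * s) * zpart n s 0)"
        using part_bound[OF s y, of n] C by (intro mult_left_mono) auto
      ultimately show "\<bar>(transfer s ^^ n) v y\<bar> \<le> C * (2 powr (4 * s) * zpart n s 0)"
        using bd[OF y, of n] by simp
    qed
    also have "\<dots> = l ^ n * transfer s v x"
      by (rule transfer_cmult[OF s Suc.prems vb])
    also have "\<dots> \<le> l ^ n * (l * v x)" using l Suc.prems by (intro mult_left_mono) auto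
    finally show ?case by (simp add: mult_ac)
  qed auto
  hence *: "c * zpart n s 0 \<le> l ^ n * C" for n
    using bd[of 0 n] v(1)[of 0] l mult_left_mono[of "v 0" C "l ^ n"] by (smt (verit) atLeastAtMost_iff zero_le_power)
  have "ln (zpart n s 0) / real n \<le> ln l + (ln C - ln c) / real n" if "n > 0" for n
  proof -
    have p: "zpart n s 0 > 0" using part_pos[OF s] by simp
    have "ln (c * zpart n s 0) \<le> ln (l ^ n * C)" using *[of n] v(2) p by (intro ln_mono) auto
    hence "ln (zpart n s 0) \<le> real n * ln l + (ln C - ln c)"
      using l v(2) C p by (simp add: ln_mult ln_realpow)
    hence "ln (zpart n s 0) / real n \<le> (real n * ln l + (ln C - ln c)) / real n" by (intro divide_right_mono) auto
    thus ?thesis using that by (simp add: add_divide_distrib)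
  qed
  from eventually_mono[OF eventually_gt_at_top[of 0] this]
  have "\<forall>\<^sub>F n in sequentially. ln (zpart n s 0) / real n \<le> ln l + (ln C - ln c) / real n" .
  moreover have "(\<lambda>n. ln l + (ln C - ln c) / real n) \<longlonglongrightarrow> ln l + 0" by (intro tendsto_intros lim_const_over_n)
  ultimately have "pressure s \<le> ln l + 0" by (intro tendsto_le[OF trivial_limit_sequentially _ pressure_lim[OF s]])
  thus ?thesis by simp
qed

text \<open>With \<open>y = k + 1 + x\<close> the terms are \<open>1 / y - 1 / (1 + y)\<close> and
  telescope.\<close>

lemma gauss_density_fixed_sums:
  assumes "x \<in> {0..1}"
  shows "(\<lambda>k. (branch k x)\<^sup>2 * (1 / (1 + branch k x))) sums (1 / (1 + x))"
proof -
  have "(\<lambda>k. 1 / (real k + 1 + x)) \<longlonglongrightarrow> 0" using assms by real_asymp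
  from telescope_sums'[OF this]
  have "(\<lambda>k. 1 / (real k + 1 + x) - 1 / (real (Suc k) + 1 + x)) sums (1 / (1 + x))" by simp
  moreover have "1 / (real k + 1 + x) - 1 / (real (Suc k) + 1 + x) = (branch k x)\<^sup>2 * (1 / (1 + branch k x))" for k
  proof -
    define y where "y = real k + 1 + x"
    have y: "y > 0" using assms by (simp add: y_def)
    have "(branch k x)\<^sup>2 * (1 / (1 + branch k x)) = (1 / y)\<^sup>2 * (1 / (1 + 1 / y))" by (simp add: branch_def y_def)
    also have "\<dots> = 1 / y - 1 / (1 + y)" using y by (simp add: divide_simps power2_eq_square)
    finally show ?thesis by (simp add: y_def add_ac)
  qed
  ultimately show ?thesis by simp
qed

lemma gauss_density_fixed:
  assumes "x \<in> {0..1}"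
  shows "transfer 1 (\<lambda>x. 1 / (1 + x)) x = 1 / (1 + x)"
  using gauss_density_fixed_sums[OF assms] assms unfolding transfer_def by (simp add: sums_iff)

lemma pressure_1: "pressure 1 = 0"
proof -
  have "ln 1 \<le> pressure 1"
    by (rule pressure_ge_eigen[where v="\<lambda>x. 1 / (1 + x)" and c="1/2" and C=1]) (auto simp: gauss_density_fixed)
  moreover have "pressure 1 \<le> ln 1"
    by (rule pressure_le_eigen[where v="\<lambda>x. 1 / (1 + x)" and c="1/2" and C=1]) (auto simp: gauss_density_fixed)
  ultimately show ?thesis by simp
qed

section \<open>Behaviour of the pressure at infinity and at 1/2\<close>

definition golden :: real where "golden = (1 + sqrt 5) / 2"

lemma golden: "golden\<^sup>2 = golden + 1" "golden > 1" "golden < 2" "gamma0 = 2 * ln golden"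
proof -
  show "golden\<^sup>2 = golden + 1" by (simp add: golden_def power2_eq_square field_simps)
  show "golden > 1" by (simp add: golden_def)
  have "sqrt 5 < 3" by (intro real_less_lsqrt) auto
  thus "golden < 2" by (simp add: golden_def)
qed (simp add: gamma0_def golden_def)

lemma gamma0_pos: "gamma0 > 0"
  using golden(2) by (simp add: golden(4))

text \<open>Bounds what all branches but the first contribute relative to the first, for the test
  function \<open>(golden + x) powr (- 2 * s)\<close>; the worst case is
  \<open>x = 1\<close>.\<close>

definition golden_tail :: "real \<Rightarrow> real" where
  "golden_tail s = (\<Sum>j. (1 + real (Suc j) / (golden + 1)) powr (- 2 * s))"

lemma golden_tail_summable:
  assumes "s > 1/2"
  shows "summable (\<lambda>j. (1 + real (Suc j) / (golden + 1)) powr (- 2 * s))"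
proof (rule summable_comparison_test'[of "\<lambda>j. (golden + 1) powr (2 * s) * (real j + 1) powr (- 2 * s)" 0])
  show "summable (\<lambda>j. (golden + 1) powr (2 * s) * (real j + 1) powr (- 2 * s))"
    by (intro summable_mult summable_shift_powr assms)
  fix j
  have "(1 + real (Suc j) / (golden + 1)) powr (- 2 * s) \<le> (real (Suc j) / (golden + 1)) powr (- 2 * s)"
    using golden(2) assms by (intro powr_mono2') auto
  also have "\<dots> = (golden + 1) powr (2 * s) * (real j + 1) powr (- 2 * s)"
    using golden(2) by (simp add: powr_divide powr_minus divide_simps add_ac)
  finally show "norm ((1 + real (Suc j) / (golden + 1)) powr (- 2 * s)) \<le> (golden + 1) powr (2 * s) * (real j + 1) powr (- 2 * s)"
    by simp
qed

text \<open>In the coordinate centred at the repelling fixed point \<open>- golden\<close> of the first branch,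
  that branch contracts by exactly \<open>golden powr (- 2)\<close> and all other branches contract more.\<close>

lemma golden_transfer:
  assumes "s > 1/2" "x \<in> {0..1}"
  shows "golden powr (- 2 * s) * (golden + x) powr (- 2 * s) \<le> transfer s (\<lambda>x. (golden + x) powr (- 2 * s)) x"
    "transfer s (\<lambda>x. (golden + x) powr (- 2 * s)) x \<le> golden powr (- 2 * s) * (1 + golden_tail s) * (golden + x) powr (- 2 * s)"
proof -
  let ?v = "\<lambda>x. (golden + x) powr (- 2 * s)"
  let ?w = "golden powr (- 2 * s) * ?v x"
  have x: "0 \<le> x" "x \<le> 1" using assms by auto
  have gx: "golden + x > 0" using golden(2) x by simp
  have eq: "branch k x powr (2 * s) * ?v (branch k x) = ?w * (1 + real k / (golden + x)) powr (- 2 * s)" for k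
  proof -
    have kp: "real k + 1 + x > 0" using x by simp
    \<comment> \<open>Through \<open>golden\<^sup>2 = golden + 1\<close>, each branch multiplies
      \<open>golden + x\<close> by an explicit factor, and the last factor here is 1 for
      \<open>k = 0\<close>.\<close>
    have "(real k + 1 + x) * (golden + branch k x) = golden * (golden + x) * (1 + real k / (golden + x))"
    proof -
      have "(real k + 1 + x) * (golden + branch k x) = golden * (real k + 1 + x) + 1"
        using kp by (simp add: branch_def field_simps)
      also have "\<dots> = golden\<^sup>2 + golden * x + golden * real k" using golden(1) by (simp add: algebra_simps)
      also have "\<dots> = golden * (golden + x) * (1 + real k / (golden + x))"
        using gx by (simp add: field_simps power2_eq_square)
      finally show ?thesis .
    qed
    hence "((real k + 1 + x) * (golden + branch k x)) powr (- 2 * s) = (golden * (golden + x) * (1 + real k / (golden + x))) powr (- 2 * s)"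
      by simp
    moreover have "((real k + 1 + x) * (golden + branch k x)) powr (- 2 * s) = (real k + 1 + x) powr (- 2 * s) * ?v (branch k x)"
      using kp golden(2) x by (intro powr_mult)
    moreover have "(real k + 1 + x) powr (- 2 * s) = branch k x powr (2 * s)"
      using kp by (simp add: branch_def powr_divide powr_minus divide_simps)
    moreover have "(golden * (golden + x) * (1 + real k / (golden + x))) powr (- 2 * s) = ?w * (1 + real k / (golden + x)) powr (- 2 * s)"
      using gx golden(2) by (simp add: powr_mult)
    ultimately show ?thesis by simp
  qed
  have le: "(1 + real (Suc j) / (golden + x)) powr (- 2 * s) \<le> (1 + real (Suc j) / (golden + 1)) powr (- 2 * s)" for j
    using golden(2) x assms gx by (intro powr_mono2') (auto intro!: add_left_mono divide_left_mono mult_pos_pos simp: add_pos_nonneg)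
  have s1: "summable (\<lambda>j. (1 + real (Suc j) / (golden + x)) powr (- 2 * s))"
    using le by (intro summable_comparison_test'[OF golden_tail_summable[OF assms(1)], of 0]) auto
  hence s2: "summable (\<lambda>k. (1 + real k / (golden + x)) powr (- 2 * s))"
    by (subst (asm) summable_Suc_iff)
  have "(\<Sum>k. (1 + real k / (golden + x)) powr (- 2 * s)) = (\<Sum>j. (1 + real (Suc j) / (golden + x)) powr (- 2 * s)) + 1"
    using suminf_split_head[OF s2] by simp
  moreover have "(\<Sum>j. (1 + real (Suc j) / (golden + x)) powr (- 2 * s)) \<le> golden_tail s"
    unfolding golden_tail_def by (intro suminf_le le s1 golden_tail_summable assms)
  moreover have "0 \<le> (\<Sum>j. (1 + real (Suc j) / (golden + x)) powr (- 2 * s))" by (intro suminf_nonneg s1) auto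
  moreover have "transfer s ?v x = ?w * (\<Sum>k. (1 + real k / (golden + x)) powr (- 2 * s))"
    unfolding transfer_def eq by (intro suminf_mult s2)
  moreover have "0 \<le> ?w" by simp
  ultimately have "?w * 1 \<le> transfer s ?v x" "transfer s ?v x \<le> ?w * (1 + golden_tail s)"
    by (simp_all only:) (intro mult_left_mono, linarith, simp)+
  thus "golden powr (- 2 * s) * ?v x \<le> transfer s ?v x"
    "transfer s ?v x \<le> golden powr (- 2 * s) * (1 + golden_tail s) * ?v x"
    by (simp_all add: mult_ac)
qed

lemma golden_weight_bounds:
  assumes "0 \<le> s" "x \<in> {0..1}"
  shows "(golden + 1) powr (- 2 * s) \<le> (golden + x) powr (- 2 * s) \<and> (golden + x) powr (- 2 * s) \<le> 1"
proof -
  have "(golden + x) powr (- 2 * s) \<le> 1 powr (- 2 * s)"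
    using assms golden(2) by (intro powr_mono2') auto
  thus ?thesis using assms golden(2) by (auto intro!: powr_mono2')
qed

lemma ln_golden_powr: "ln (golden powr (- 2 * s)) = - gamma0 * s"
  using golden(2) by (simp add: ln_powr golden(4))

lemma pressure_ge_golden:
  assumes "s > 1/2"
  shows "- gamma0 * s \<le> pressure s"
proof -
  have "ln (golden powr (- 2 * s)) \<le> pressure s"
    by (rule pressure_ge_eigen[OF assms, where v="\<lambda>x. (golden + x) powr (- 2 * s)" and c="(golden + 1) powr (- 2 * s)" and C=1])
       (use golden(2) golden_weight_bounds assms golden_transfer(1)[OF assms] in auto)
  thus ?thesis by (simp only: ln_golden_powr)
qed

lemma golden_tail_nonneg: "s > 1/2 \<Longrightarrow> 0 \<le> golden_tail s"
  unfolding golden_tail_def by (intro suminf_nonneg golden_tail_summable) auto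

lemma pressure_le_golden:
  assumes "s > 1/2"
  shows "pressure s \<le> - gamma0 * s + ln (1 + golden_tail s)"
proof -
  have "pressure s \<le> ln (golden powr (- 2 * s) * (1 + golden_tail s))"
    by (rule pressure_le_eigen[OF assms, where v="\<lambda>x. (golden + x) powr (- 2 * s)" and c="(golden + 1) powr (- 2 * s)" and C=1])
       (use golden(2) golden_weight_bounds assms golden_transfer(2)[OF assms] golden_tail_nonneg[OF assms] in auto)
  also have "\<dots> = - gamma0 * s + ln (1 + golden_tail s)"
    using golden(2) golden_tail_nonneg[OF assms] by (simp only: ln_golden_powr[symmetric]) (simp add: ln_mult)
  finally show ?thesis .
qed

text \<open>All bases are at least \<open>1 + 1 / (golden + 1) > 1\<close>, so the series at
  \<open>s\<close> is at most a decaying factor times the series at 1.\<close>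

lemma golden_tail_tendsto: "(golden_tail \<longlongrightarrow> 0) at_top"
proof -
  let ?q = "1 + 1 / (golden + 1)"
  have q: "?q > 1" using golden(2) by simp
  have le: "golden_tail s \<le> ?q powr (- 2 * (s - 1)) * golden_tail 1" if "s \<ge> 1" for s
  proof -
    have "golden_tail s \<le> (\<Sum>j. ?q powr (- 2 * (s - 1)) * (1 + real (Suc j) / (golden + 1)) powr (- 2 * 1))"
      unfolding golden_tail_def
    proof (rule suminf_le)
      fix j
      let ?z = "1 + real (Suc j) / (golden + 1)"
      have "?z powr (- 2 * s) = ?z powr (- 2 * (s - 1)) * ?z powr (- 2 * 1)"
        by (simp add: powr_add[symmetric] algebra_simps)
      also have "\<dots> \<le> ?q powr (- 2 * (s - 1)) * ?z powr (- 2 * 1)"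
        using golden(2) that q by (intro mult_right_mono powr_mono2') (auto intro!: divide_right_mono add_pos_pos)
      finally show "?z powr (- 2 * s) \<le> ?q powr (- 2 * (s - 1)) * ?z powr (- 2 * 1)" .
    next
      show "summable (\<lambda>j. (1 + real (Suc j) / (golden + 1)) powr (- 2 * s))"
        using that by (intro golden_tail_summable) auto
      show "summable (\<lambda>j. ?q powr (- 2 * (s - 1)) * (1 + real (Suc j) / (golden + 1)) powr (- 2 * 1))"
        by (intro summable_mult golden_tail_summable) auto
    qed
    also have "\<dots> = ?q powr (- 2 * (s - 1)) * golden_tail 1"
      unfolding golden_tail_def by (intro suminf_mult golden_tail_summable) auto
    finally show ?thesis .
  qed
  have "((\<lambda>s. ?q powr (- 2 * (s - 1))) \<longlongrightarrow> 0) at_top"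
  proof -
    define L where "L = ln ?q"
    have L: "L > 0" unfolding L_def using q by (rule ln_gt_zero)
    have "((\<lambda>s. exp (- 2 * (s - 1) * L)) \<longlongrightarrow> 0) at_top" using L by real_asymp
    moreover have "?q powr u = exp (u * L)" for u
    proof -
      have "?q \<noteq> 0" using q by linarith
      thus ?thesis by (simp only: powr_def L_def if_False)
    qed
    ultimately show ?thesis by (simp only:)
  qed
  hence "((\<lambda>s. ?q powr (- 2 * (s - 1)) * golden_tail 1) \<longlongrightarrow> 0) at_top"
    by (rule tendsto_mult_left_zero)
  thus ?thesis
  proof (rule tendsto_sandwich[rotated 2, OF tendsto_const])
    show "\<forall>\<^sub>F s in at_top. golden_tail s \<le> ?q powr (- 2 * (s - 1)) * golden_tail 1"
      using eventually_ge_at_top[of 1] by eventually_elim (rule le)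
    show "\<forall>\<^sub>F s in at_top. 0 \<le> golden_tail s"
      using eventually_ge_at_top[of 1] by eventually_elim (rule golden_tail_nonneg, simp)
  qed
qed

lemma pressure_golden_tendsto: "((\<lambda>s. pressure s + gamma0 * s) \<longlongrightarrow> 0) at_top"
proof (rule tendsto_sandwich[OF _ _ tendsto_const])
  show "\<forall>\<^sub>F s in at_top. 0 \<le> pressure s + gamma0 * s"
    using eventually_ge_at_top[of 1]
  proof eventually_elim
    case (elim s)
    thus ?case using pressure_ge_golden[of s] by simp
  qed
  show "\<forall>\<^sub>F s in at_top. pressure s + gamma0 * s \<le> ln (1 + golden_tail s)"
    using eventually_ge_at_top[of 1]
  proof eventually_elim
    case (elim s)
    thus ?case using pressure_le_golden[of s] by simp
  qed
  have "((\<lambda>s. ln (1 + golden_tail s)) \<longlongrightarrow> ln (1 + 0)) at_top"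
    by (intro tendsto_intros golden_tail_tendsto) auto
  thus "((\<lambda>s. ln (1 + golden_tail s)) \<longlongrightarrow> 0) at_top" by simp
qed

text \<open>At 1/2 the first partition function becomes the harmonic series, and
  \<open>pressure_approx\<close> with \<open>n = 1\<close> passes the divergence on to the
  pressure.\<close>

lemma pressure_at_half: "filterlim pressure at_top (at_right (1/2))"
  unfolding filterlim_at_top_gt[where c=0]
proof (intro allI impI)
  fix Z :: real assume Z: "0 < Z"
  \<comment> \<open>The summand \<open>4 * ln 2\<close> pays for the error
    \<open>4 * s * ln 2\<close> of \<open>pressure_approx\<close>, where
    \<open>s < 1\<close>.\<close>
  define M where "M = exp (Z + 4 * ln 2)"
  obtain N where N: "M < (\<Sum>k<N. 1 / real (Suc k))"
  proof (rule ccontr)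
    assume "\<not> thesis"
    hence "(\<Sum>k<N. 1 / real (Suc k)) \<le> M" for N
      using that by (metis not_le)
    hence "summable (\<lambda>k. 1 / real (Suc k))" by (intro summableI_nonneg_bounded) auto
    hence "summable (\<lambda>k. inverse (real k))" by (subst summable_Suc_iff[symmetric]) (simp add: inverse_eq_divide)
    thus False using not_summable_harmonic[where 'a=real] by simp
  qed
  have "((\<lambda>s. \<Sum>k<N. (real k + 1) powr (- 2 * s)) \<longlongrightarrow> (\<Sum>k<N. (real k + 1) powr (- 2 * (1/2)))) (at_right (1/2))"
    by (intro tendsto_intros) auto
  moreover have "(\<Sum>k<N. (real k + 1) powr (- 2 * (1/2))) = (\<Sum>k<N. 1 / real (Suc k))"
    by (intro sum.cong) (auto simp: powr_minus_divide add.commute)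
  ultimately have "\<forall>\<^sub>F s in at_right (1/2). M < (\<Sum>k<N. (real k + 1) powr (- 2 * s))"
    using N by (intro order_tendstoD(1)) auto
  moreover have "\<forall>\<^sub>F s in at_right (1/2::real). s \<in> {1/2<..<1}" by (intro eventually_at_right_real) simp
  ultimately show "\<forall>\<^sub>F s in at_right (1/2). Z \<le> pressure s"
  proof eventually_elim
    case (elim s)
    hence s: "s > 1/2" "s < 1" by auto
    have "(\<Sum>k<N. (real k + 1) powr (- 2 * s)) = (\<Sum>k<N. branch k 0 powr (2 * s) * 1)"
      by (intro sum.cong) (auto simp: branch_def powr_divide powr_minus divide_simps)
    also have "\<dots> \<le> transfer s (\<lambda>_. 1) 0"
      unfolding transfer_def by (intro sum_le_suminf summable_transfer[where B=1] s) auto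
    finally have "M < zpart 1 s 0" using elim by (simp add: zpart_def)
    hence "ln M < ln (zpart 1 s 0)" using part_pos[OF s(1), of 0 1] by (intro ln_less_cancel_iff[THEN iffD2]) (auto simp: M_def)
    hence "Z + 4 * ln 2 < ln (zpart 1 s 0)" by (simp add: M_def)
    moreover have "4 * s * ln 2 \<le> 4 * ln 2" using s mult_right_mono[of s 1 "4 * ln 2"] by simp
    moreover have "ln (zpart 1 s 0) - pressure s \<le> 4 * s * ln 2" using pressure_approx[OF s(1), of 1] by (simp add: abs_le_iff)
    ultimately show ?case by linarith
  qed
qed

section \<open>The Gauss measure\<close>

lemma branch_measurable [measurable]: "branch k \<in> borel_measurable borel"
  unfolding branch_def[abs_def] by measurable

lemma branch_mem_iff:
  assumes "y \<in> {0<..1::real}"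
  shows "\<exists>!k. y \<in> {1 / (real k + 2)<..1 / (real k + 1)}"
proof (rule ex_ex1I)
  define m where "m = nat \<lfloor>1 / y\<rfloor>"
  have y: "0 < y" "1 \<le> 1 / y" using assms by auto
  hence f1: "1 \<le> \<lfloor>1 / y\<rfloor>" by (simp only: le_floor_iff of_int_1)
  hence "real m = of_int \<lfloor>1 / y\<rfloor>" unfolding m_def by (subst of_nat_nat) linarith+
  hence "real m \<le> 1 / y" "1 / y < real m + 1" "1 \<le> real m" using f1 by (simp_all only:) linarith+
  hence m: "1 \<le> m" "real m \<le> 1 / y" "1 / y < real m + 1" by auto
  have "0 < real m" using m(1) by simp
  hence "y \<le> 1 / real m" "1 / (real m + 1) < y"
    using y m by (auto simp: pos_le_divide_eq pos_divide_less_eq pos_divide_le_eq mult.commute)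
  moreover have "real (m - 1) = real m - 1" using m(1) by simp
  ultimately have "y \<in> {1 / (real (m - 1) + 2)<..1 / (real (m - 1) + 1)}" by (simp add: add.commute)
  thus "\<exists>k. y \<in> {1 / (real k + 2)<..1 / (real k + 1)}" ..
next
  fix k l assume k: "y \<in> {1 / (real k + 2)<..1 / (real k + 1)}" and l: "y \<in> {1 / (real l + 2)<..1 / (real l + 1)}"
  have "real k + 1 \<le> 1 / y" "1 / y < real k + 2" "real l + 1 \<le> 1 / y" "1 / y < real l + 2"
    using k l assms by (auto simp: field_simps)
  thus "k = l" by linarith
qed

lemma suminf_branch_indicator:
  "(\<Sum>k. indicator {1 / (real k + 2)<..1 / (real k + 1)} y :: ennreal) = indicator {0<..1} y"
proof -
  have "disjoint_family (\<lambda>k. {1 / (real k + 2)<..1 / (real k + 1)} :: real set)"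
    unfolding disjoint_family_on_def
  proof (intro ballI impI equals0I)
    fix m n :: nat and y :: real
    assume mn: "m \<noteq> n" and y: "y \<in> {1 / (real m + 2)<..1 / (real m + 1)} \<inter> {1 / (real n + 2)<..1 / (real n + 1)}"
    have "0 < 1 / (real m + 2)" by simp
    moreover have "1 / (real m + 1) \<le> 1" by simp
    moreover have "1 / (real m + 2) < y" "y \<le> 1 / (real m + 1)" using y by auto
    ultimately have "y \<in> {0<..1}" unfolding greaterThanAtMost_iff by linarith
    thus False using branch_mem_iff mn y by blast
  qed
  moreover have "(\<Union>k. {1 / (real k + 2)<..1 / (real k + 1)}) = {0<..1::real}"
  proof (intro equalityI subsetI)
    fix y :: real assume "y \<in> (\<Union>k. {1 / (real k + 2)<..1 / (real k + 1)})"
    then obtain k where k: "y \<in> {1 / (real k + 2)<..1 / (real k + 1)}" by blast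
    have "0 < 1 / (real k + 2)" "1 / (real k + 1) \<le> 1" by simp_all
    moreover have "1 / (real k + 2) < y" "y \<le> 1 / (real k + 1)" using k by auto
    ultimately show "y \<in> {0<..1}" unfolding greaterThanAtMost_iff by linarith
  qed (use branch_mem_iff in blast)
  ultimately show ?thesis by (simp add: suminf_indicator)
qed

lemma nn_integral_branch:
  fixes F :: "real \<Rightarrow> ennreal"
  assumes [measurable]: "F \<in> borel_measurable borel"
  shows "(\<integral>\<^sup>+x. F (branch k x) * ennreal ((branch k x)\<^sup>2) * indicator {0..1} x \<partial>lborel) =
    (\<integral>\<^sup>+y. F y * indicator {1 / (real k + 2)..1 / (real k + 1)} y \<partial>lborel)"
proof -
  \<comment> \<open>Branches are decreasing; reflecting \<open>x\<close> gives an increasing map, as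
    the substitution rule requires.\<close>
  define g where "g = (\<lambda>x. branch k (1 - x))"
  have "(\<integral>\<^sup>+x. F (branch k x) * ennreal ((branch k x)\<^sup>2) * indicator {0..1} x \<partial>lborel)
    = \<bar>-1::real\<bar> * (\<integral>\<^sup>+x. F (branch k (1 + (-1) * x)) * ennreal ((branch k (1 + (-1) * x))\<^sup>2) * indicator {0..1} (1 + (-1) * x) \<partial>lborel)"
    by (rule nn_integral_real_affine) auto
  also have "\<dots> = (\<integral>\<^sup>+x. F (g x) * ennreal ((g x)\<^sup>2) * indicator {0..1} x \<partial>lborel)"
    by (auto simp: g_def intro!: nn_integral_cong split: split_indicator)
  also have "\<dots> = (\<integral>\<^sup>+y. F y * indicator {g 0..g 1} y \<partial>lborel)"
  proof (rule nn_integral_substitution_aux[symmetric])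
    fix x :: real assume x: "x \<in> {0..1}"
    have nz: "real k + 1 + (1 - x) \<noteq> 0" using x by auto
    show "(g has_real_derivative (g x)\<^sup>2) (at x)"
      unfolding g_def branch_def using nz by (auto intro!: derivative_eq_intros simp: field_simps power2_eq_square)
  next
    have "continuous_on {0..1} g"
      unfolding g_def branch_def by (intro continuous_intros) (auto simp: add_nonneg_eq_0_iff)
    thus "continuous_on {0..1} (\<lambda>x. (g x)\<^sup>2)" by (intro continuous_intros)
  qed auto
  also have "\<dots> = (\<integral>\<^sup>+y. F y * indicator {1 / (real k + 2)..1 / (real k + 1)} y \<partial>lborel)"
  proof -
    have "g 0 = 1 / (real k + 2)" "g 1 = 1 / (real k + 1)" by (simp_all add: g_def branch_def)
    thus ?thesis by (simp only:)
  qed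
  finally show ?thesis .
qed

text \<open>The operator at \<open>s = 1\<close> preserves the Lebesgue integral: each branch is a
  change of variables onto one interval of a partition of \<open>{0<..1}\<close>.\<close>

lemma nn_integral_gauss:
  fixes F :: "real \<Rightarrow> ennreal"
  assumes [measurable]: "F \<in> borel_measurable borel"
  shows "(\<integral>\<^sup>+x. (\<Sum>k. F (branch k x) * ennreal ((branch k x)\<^sup>2)) * indicator {0<..1} x \<partial>lborel) =
    (\<integral>\<^sup>+y. F y * indicator {0<..1} y \<partial>lborel)"
proof -
  have "(\<integral>\<^sup>+x. (\<Sum>k. F (branch k x) * ennreal ((branch k x)\<^sup>2)) * indicator {0<..1} x \<partial>lborel)
    = (\<integral>\<^sup>+x. (\<Sum>k. F (branch k x) * ennreal ((branch k x)\<^sup>2) * indicator {0..1} x) \<partial>lborel)"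
  proof (rule nn_integral_cong_AE)
    show "AE x in lborel. (\<Sum>k. F (branch k x) * ennreal ((branch k x)\<^sup>2)) * indicator {0<..1} x
       = (\<Sum>k. F (branch k x) * ennreal ((branch k x)\<^sup>2) * indicator {0..1} x)"
      using AE_lborel_singleton[of 0]
      by eventually_elim (auto split: split_indicator)
  qed
  also have "\<dots> = (\<Sum>k. \<integral>\<^sup>+x. F (branch k x) * ennreal ((branch k x)\<^sup>2) * indicator {0..1} x \<partial>lborel)"
    by (rule nn_integral_suminf) measurable
  also have "\<dots> = (\<Sum>k. \<integral>\<^sup>+y. F y * indicator {1 / (real k + 2)<..1 / (real k + 1)} y \<partial>lborel)"
  proof (rule arg_cong[where f=suminf], rule ext)
    fix k
    have "(\<integral>\<^sup>+y. F y * indicator {1 / (real k + 2)..1 / (real k + 1)} y \<partial>lborel) =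
      (\<integral>\<^sup>+y. F y * indicator {1 / (real k + 2)<..1 / (real k + 1)} y \<partial>lborel)"
    proof (rule nn_integral_cong_AE)
      show "AE y in lborel. F y * indicator {1 / (real k + 2)..1 / (real k + 1)} y = F y * indicator {1 / (real k + 2)<..1 / (real k + 1)} y"
        using AE_lborel_singleton[of "1 / (real k + 2)"]
        by eventually_elim (auto split: split_indicator)
    qed
    thus "(\<integral>\<^sup>+x. F (branch k x) * ennreal ((branch k x)\<^sup>2) * indicator {0..1} x \<partial>lborel) =
       (\<integral>\<^sup>+y. F y * indicator {1 / (real k + 2)<..1 / (real k + 1)} y \<partial>lborel)"
      by (simp add: nn_integral_branch)
  qed
  also have "\<dots> = (\<integral>\<^sup>+y. (\<Sum>k. F y * indicator {1 / (real k + 2)<..1 / (real k + 1)} y) \<partial>lborel)"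
    by (rule nn_integral_suminf[symmetric]) measurable
  also have "\<dots> = (\<integral>\<^sup>+y. F y * indicator {0<..1} y \<partial>lborel)"
    by (simp add: ennreal_suminf_cmult suminf_branch_indicator)
  finally show ?thesis .
qed

lemma integral_gauss:
  fixes u :: "real \<Rightarrow> real"
  assumes [measurable]: "u \<in> borel_measurable borel" and nn: "\<And>y. y \<in> {0<..1} \<Longrightarrow> 0 \<le> u y"
    and int: "integrable lborel (\<lambda>y. u y * indicator {0<..1} y)"
    and sm: "\<And>x. x \<in> {0<..1} \<Longrightarrow> summable (\<lambda>k. (branch k x)\<^sup>2 * u (branch k x))"
  shows "integrable lborel (\<lambda>x. (\<Sum>k. (branch k x)\<^sup>2 * u (branch k x)) * indicator {0<..1} x)"
    "(LINT x|lborel. (\<Sum>k. (branch k x)\<^sup>2 * u (branch k x)) * indicator {0<..1} x) = (LINT y|lborel. u y * indicator {0<..1} y)"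
proof -
  let ?I = "LINT y|lborel. u y * indicator {0<..1} y"
  let ?U = "\<lambda>x. (\<Sum>k. (branch k x)\<^sup>2 * u (branch k x)) * indicator {0<..1} x"
  have brin: "branch k x \<in> {0<..1}" if "x \<in> {0<..1}" for k x using that by auto
  have "(\<integral>\<^sup>+x. ennreal (?U x) \<partial>lborel) = (\<integral>\<^sup>+x. (\<Sum>k. ennreal (u (branch k x)) * ennreal ((branch k x)\<^sup>2)) * indicator {0<..1} x \<partial>lborel)"
  proof (rule nn_integral_cong)
    fix x :: real
    show "ennreal (?U x) = (\<Sum>k. ennreal (u (branch k x)) * ennreal ((branch k x)\<^sup>2)) * indicator {0<..1} x"
    proof (cases "x \<in> {0<..1}")
      case True
      have "(\<Sum>k. ennreal (u (branch k x)) * ennreal ((branch k x)\<^sup>2)) = (\<Sum>k. ennreal ((branch k x)\<^sup>2 * u (branch k x)))"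
        using nn brin[OF True] by (simp add: ennreal_mult mult.commute)
      also have "\<dots> = ennreal (\<Sum>k. (branch k x)\<^sup>2 * u (branch k x))"
        using nn brin[OF True] sm[OF True] by (intro suminf_ennreal2) auto
      finally show ?thesis using True by simp
    qed auto
  qed
  also have "\<dots> = (\<integral>\<^sup>+y. ennreal (u y) * indicator {0<..1} y \<partial>lborel)"
    by (rule nn_integral_gauss) measurable
  also have "\<dots> = (\<integral>\<^sup>+y. ennreal (u y * indicator {0<..1} y) \<partial>lborel)"
    by (auto intro!: nn_integral_cong split: split_indicator)
  also have "\<dots> = ennreal ?I"
    using nn by (intro nn_integral_eq_integral int) (auto split: split_indicator)
  finally have *: "(\<integral>\<^sup>+x. ennreal (?U x) \<partial>lborel) = ennreal ?I" .
  have I0: "0 \<le> ?I" using nn by (intro integral_nonneg_AE) (auto split: split_indicator)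
  have "?U \<in> borel_measurable lborel" by measurable
  moreover have "0 \<le> ?U x" for x
    using nn brin sm by (auto split: split_indicator intro!: suminf_nonneg)
  ultimately show "integrable lborel ?U" "(LINT x|lborel. ?U x) = ?I"
    using * I0 by (auto simp: nn_integral_eq_integrable)
qed

lemma lcone_continuous:
  assumes "f \<in> lcone a" "0 \<le> a"
  shows "continuous_on {0..1} f"
  unfolding continuous_on_def
proof
  fix x :: real assume x: "x \<in> {0..1}"
  have "((\<lambda>y. ldist y x) \<longlongrightarrow> ldist x x) (at x within {0..1})"
    unfolding ldist_def using x by (intro tendsto_intros) auto
  hence "((\<lambda>y. a * 2 powr a * 2 powr a * f 0 * ldist y x) \<longlongrightarrow> a * 2 powr a * 2 powr a * f 0 * 0) (at x within {0..1})"
    by (intro tendsto_mult tendsto_const) simp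
  hence l: "((\<lambda>y. a * 2 powr a * 2 powr a * f 0 * ldist y x) \<longlongrightarrow> 0) (at x within {0..1})" by simp
  have "((\<lambda>y. f y - f x) \<longlongrightarrow> 0) (at x within {0..1})"
  proof (rule Lim_null_comparison[OF _ l])
    show "\<forall>\<^sub>F y in at x within {0..1}. norm (f y - f x) \<le> a * 2 powr a * 2 powr a * f 0 * ldist y x"
      unfolding eventually_at_filter using cone_lip[OF assms _ x] by auto
  qed
  thus "(f \<longlongrightarrow> f x) (at x within {0..1})" by (rule LIM_zero_cancel)
qed

lemma integrable_bounded_unit:
  fixes f :: "real \<Rightarrow> real"
  assumes "continuous_on {0..1} f"
  shows "integrable lborel (\<lambda>x. f x * indicator {0<..1} x)"
proof -
  have "integrable lborel (\<lambda>x. indicator {0..1} x *\<^sub>R f x)"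
    using borel_integrable_atLeastAtMost'[OF assms] by (simp add: set_integrable_def)
  hence "integrable lborel (\<lambda>x. indicator {0<..1} x *\<^sub>R (indicator {0..1} x *\<^sub>R f x))"
    by (rule integrable_mult_indicator[rotated]) auto
  also have "(\<lambda>x. indicator {0<..1} x *\<^sub>R (indicator {0..1} x *\<^sub>R f x)) = (\<lambda>x. f x * indicator {0<..1} x)"
    by (auto simp: fun_eq_iff split: split_indicator)
  finally show ?thesis .
qed

section \<open>The slope of the pressure at 1\<close>

text \<open>Half of \<open>lambda0\<close>, before normalisation by \<open>ln 2\<close>.\<close>

definition log_moment :: real where
  "log_moment = (LINT y|lborel. 1 / (1 + y) * (- ln y) * indicator {0<..1} y)"

lemma neg_ln_le: "0 < y \<Longrightarrow> - ln y \<le> 2 * y powr (- 1/2)" for y :: real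
proof -
  assume y: "0 < y"
  have "ln (y powr (- 1/2)) \<le> y powr (- 1/2) - 1" using y by (intro ln_le_minus_one) auto
  thus ?thesis using y by (simp add: ln_powr)
qed

lemma log_moment_integrable: "integrable lborel (\<lambda>y::real. 1 / (1 + y) * (- ln y) * indicator {0<..1} y)"
proof -
  have "(\<lambda>y::real. y powr (- 1/2)) absolutely_integrable_on {0<..1}"
    by (intro nonnegative_absolutely_integrable_1 integrable_on_powr_from_0') auto
  hence "integrable lebesgue (\<lambda>y::real. indicator {0<..1} y *\<^sub>R y powr (- 1/2))"
    by (simp add: set_integrable_def)
  hence "integrable lborel (\<lambda>y::real. indicator {0<..1} y *\<^sub>R y powr (- 1/2))"
    by (subst (asm) integrable_completion) auto
  hence 1: "integrable lborel (\<lambda>y::real. 2 * (indicator {0<..1} y *\<^sub>R y powr (- 1/2)))" by simp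
  have 2: "(\<lambda>y::real. 1 / (1 + y) * (- ln y) * indicator {0<..1} y) \<in> borel_measurable lborel" by measurable
  have 3: "AE y::real in lborel. norm (1 / (1 + y) * (- ln y) * indicator {0<..1} y) \<le> norm (2 * (indicator {0<..1} y *\<^sub>R y powr (- 1/2)))"
  proof (intro AE_I2)
    fix y :: real
    show "norm (1 / (1 + y) * (- ln y) * indicator {0<..1} y) \<le> norm (2 * (indicator {0<..1} y *\<^sub>R y powr (- 1/2)))"
    proof (cases "y \<in> {0<..1}")
      case True
      hence l: "0 \<le> - ln y" by auto
      have "1 / (1 + y) * (- ln y) \<le> 1 * (- ln y)" using True l by (intro mult_right_mono) auto
      also have "\<dots> \<le> 2 * y powr (- 1/2)" using neg_ln_le[of y] True by simp
      finally have "1 / (1 + y) * (- ln y) \<le> 2 * y powr (- 1/2)" .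
      moreover have "0 \<le> 1 / (1 + y) * (- ln y)" using True l by (intro mult_nonneg_nonneg) auto
      ultimately show ?thesis using True by (simp del: mult_minus_right)
    qed auto
  qed
  show ?thesis by (rule Bochner_Integration.integrable_bound[OF 1 2 3])
qed

text \<open>Jensen's inequality at each \<open>x\<close>, for the probabilities
  \<open>p k / h x\<close> that the Gauss density gives to the branches, integrated by means of the
  invariance of the Gauss measure. It is one step of the variational inequality for that
  measure.\<close>

lemma transfer_jensen:
  assumes f: "f \<in> lcone a" "0 \<le> a" and fp: "\<And>y. y \<in> {0..1} \<Longrightarrow> 0 < f y" and s: "s > 1/2"
  shows "(LINT x|lborel. 1 / (1 + x) * ln (f x) * indicator {0<..1} x) - 2 * (s - 1) * log_moment
    \<le> (LINT x|lborel. 1 / (1 + x) * ln (transfer s f x) * indicator {0<..1} x)"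
proof -
  define h where "h = (\<lambda>x::real. 1 / (1 + x))"
  have hp: "0 < h x" "h x \<le> 1" if "x \<in> {0..1}" for x using that by (auto simp: h_def)
  have hc: "continuous_on {0..1} h" unfolding h_def by (intro continuous_intros) auto
  have fc: "continuous_on {0..1} f" by (rule lcone_continuous[OF f])
  have tc: "continuous_on {0..1} (transfer s f)"
    using f(2) s by (intro lcone_continuous[OF transfer_cone[OF f s]]) auto
  have tp: "0 < transfer s f x" if "x \<in> {0..1}" for x using transfer_pos[OF f s that fp] by blast
  define b where "b = (\<lambda>x. ln (f x) - ln (h x))"
  have bc: "continuous_on {0..1} b" unfolding b_def
    using fp hp by (intro continuous_intros fc hc) (force simp: less_imp_neq[symmetric])+
  obtain B where B: "\<And>x. x \<in> {0..1} \<Longrightarrow> \<bar>b x\<bar> \<le> B" "0 \<le> B"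
  proof -
    have "bounded (b ` {0..1})" by (intro compact_imp_bounded compact_continuous_image bc) auto
    then obtain B where "\<forall>x\<in>b ` {0..1}. norm x \<le> B" by (auto simp: bounded_iff)
    thus ?thesis by (intro that[of "max B 0"]) (auto simp: le_max_iff_disj)
  qed
  \<comment> \<open>The logarithms split into the unbounded part \<open>u1\<close> and the bounded
    part \<open>u2\<close>, which is shifted by \<open>B\<close> because
    \<open>integral_gauss\<close> is about nonnegative functions.\<close>
  define u1 where "u1 = (\<lambda>y. indicator {0<..1} y * (h y * (- ln y)))"
  define u2 where "u2 = (\<lambda>y. indicator {0..1} y *\<^sub>R (h y * (b y + B)))"
  have m1: "u1 \<in> borel_measurable borel" unfolding u1_def h_def by measurable
  have m2: "u2 \<in> borel_measurable borel" unfolding u2_def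
    by (intro borel_measurable_continuous_on_indicator continuous_intros hc bc) auto
  have brin: "branch k x \<in> {0<..1}" "branch k x \<in> {0..1}" if "x \<in> {0..1}" for k x using that by auto
  have sq: "branch k x powr 2 = (branch k x)\<^sup>2" if "x \<in> {0..1}" for k x using that by simp
  have sm1: "summable (\<lambda>k. (branch k x)\<^sup>2 * u1 (branch k x))" if x: "x \<in> {0..1}" for x
  proof (rule summable_comparison_test'[of "\<lambda>k. 2 * branch k x powr (2 * (3/4))" 0])
    show "summable (\<lambda>k. 2 * branch k x powr (2 * (3/4)))"
      using x by (intro summable_mult summable_branch_powr) auto
    fix k
    have y: "0 < branch k x" "branch k x \<le> 1" using x by auto
    hence l: "0 \<le> - ln (branch k x)" by auto
    have "h (branch k x) * (- ln (branch k x)) \<le> 1 * (2 * branch k x powr (- 1/2))"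
      using hp[OF brin(2)[OF x]] l neg_ln_le[OF y(1)] by (intro mult_mono) auto
    hence "(branch k x)\<^sup>2 * (h (branch k x) * (- ln (branch k x))) \<le> branch k x powr 2 * (2 * branch k x powr (- 1/2))"
      unfolding sq[OF x] mult_1 by (intro mult_left_mono) auto
    also have "\<dots> = 2 * branch k x powr (2 * (3/4))" by (simp add: powr_add[symmetric])
    finally have "(branch k x)\<^sup>2 * u1 (branch k x) \<le> 2 * branch k x powr (2 * (3/4))" using y by (simp add: u1_def)
    moreover have "0 \<le> u1 (branch k x)" using hp[OF brin(2)[OF x], of k] l unfolding u1_def by (intro mult_nonneg_nonneg) auto
    ultimately show "norm ((branch k x)\<^sup>2 * u1 (branch k x)) \<le> 2 * branch k x powr (2 * (3/4))" by simp
  qed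
  have u2b: "\<bar>u2 y\<bar> \<le> 2 * B" "0 \<le> u2 y" if "y \<in> {0..1}" for y
  proof -
    have "0 \<le> b y + B" "b y + B \<le> 2 * B" using B(1)[OF that] by (auto simp: abs_le_iff)
    thus "0 \<le> u2 y" "\<bar>u2 y\<bar> \<le> 2 * B" using hp[OF that] mult_mono[of "h y" 1 "b y + B" "2 * B"] B(2) that
      by (auto simp: u2_def abs_mult)
  qed
  have sm2: "summable (\<lambda>k. (branch k x)\<^sup>2 * u2 (branch k x))" if x: "x \<in> {0..1}" for x
    using summable_transfer[of 1 x u2 "2 * B"] u2b x by simp
  have u1nn: "0 \<le> u1 y" if "y \<in> {0<..1}" for y using that hp[of y] unfolding u1_def by (intro mult_nonneg_nonneg) auto
  have i1: "integrable lborel (\<lambda>y. u1 y * indicator {0<..1} y)"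
  proof -
    have "(\<lambda>y. u1 y * indicator {0<..1} y) = (\<lambda>y. 1 / (1 + y) * (- ln y) * indicator {0<..1} y)"
      by (auto simp: fun_eq_iff u1_def h_def split: split_indicator)
    thus ?thesis using log_moment_integrable by (simp only:)
  qed
  have i1v: "(LINT y|lborel. u1 y * indicator {0<..1} y) = log_moment"
    unfolding log_moment_def by (rule Bochner_Integration.integral_cong) (auto simp: u1_def h_def split: split_indicator)
  have ib: "integrable lborel (\<lambda>x. (h x * b x) * indicator {0<..1} x)"
    by (intro integrable_bounded_unit continuous_intros hc bc)
  have ih: "integrable lborel (\<lambda>x. h x * indicator {0<..1} x)"
    by (intro integrable_bounded_unit hc)
  have u2eq: "u2 y * indicator {0<..1} y = (h y * b y) * indicator {0<..1} y + B * (h y * indicator {0<..1} y)" for y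
    by (auto simp: u2_def algebra_simps split: split_indicator)
  have i2: "integrable lborel (\<lambda>y. u2 y * indicator {0<..1} y)" unfolding u2eq by (intro Bochner_Integration.integrable_add ib integrable_mult_right ih)
  have i2v: "(LINT y|lborel. u2 y * indicator {0<..1} y) = (LINT y|lborel. (h y * b y) * indicator {0<..1} y) + B * (LINT y|lborel. h y * indicator {0<..1} y)"
    unfolding u2eq using ib ih by simp
  define U1 where "U1 = (\<lambda>x. \<Sum>k. (branch k x)\<^sup>2 * u1 (branch k x))"
  define U2 where "U2 = (\<lambda>x. \<Sum>k. (branch k x)\<^sup>2 * u2 (branch k x))"
  have g1: "integrable lborel (\<lambda>x. U1 x * indicator {0<..1} x)" "(LINT x|lborel. U1 x * indicator {0<..1} x) = log_moment"
    unfolding U1_def i1v[symmetric] using u1nn sm1 by (auto intro!: integral_gauss m1 i1)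
  have g2: "integrable lborel (\<lambda>x. U2 x * indicator {0<..1} x)"
    "(LINT x|lborel. U2 x * indicator {0<..1} x) = (LINT y|lborel. u2 y * indicator {0<..1} y)"
    unfolding U2_def using u2b sm2 by (auto intro!: integral_gauss m2 i2)
  have pt: "- 2 * (s - 1) * U1 x + U2 x - B * h x \<le> h x * ln (transfer s f x) - h x * ln (h x)" if x: "x \<in> {0<..1}" for x
  proof -
    have x': "x \<in> {0..1}" using x by auto
    define A where "A = transfer s f x / h x"
    have Ap: "0 < A" using tp[OF x'] hp[OF x'] by (simp add: A_def)
    define y where "y = (\<lambda>k. branch k x)"
    have y: "0 < y k" "y k \<le> 1" "y k \<in> {0..1}" for k using x by (auto simp: y_def)
    define p where "p = (\<lambda>k. (y k)\<^sup>2 * h (y k))"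
    have p0: "0 \<le> p k" for k using hp(1)[OF y(3)[of k]] by (simp add: p_def)
    have psum: "p sums h x" using gauss_density_fixed_sums[OF x'] by (simp add: p_def y_def h_def)
    define la where "la = (\<lambda>k. 2 * (s - 1) * ln (y k) + b (y k))"
    define aa where "aa = (\<lambda>k. y k powr (2 * (s - 1)) * f (y k) / h (y k))"
    have aap: "0 < aa k" for k using y[of k] fp[OF y(3)[of k]] hp[OF y(3)[of k]] by (simp add: aa_def)
    have laa: "la k = ln (aa k)" for k
      using y[of k] fp[OF y(3)[of k]] hp[OF y(3)[of k]] by (simp add: aa_def la_def b_def ln_mult ln_div ln_powr)
    have paa: "(\<lambda>k. p k * aa k) sums transfer s f x"
    proof -
      have "p k * aa k = y k powr (2 * s) * f (y k)" for k
      proof -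
        have "p k * aa k = (y k powr 2 * y k powr (2 * (s - 1))) * f (y k)"
          using y[of k] hp[OF y(3)[of k]] by (simp add: p_def aa_def)
        thus ?thesis by (simp add: powr_add[symmetric] algebra_simps)
      qed
      moreover have "summable (\<lambda>k. y k powr (2 * s) * f (y k))"
        unfolding y_def by (rule summable_transfer[OF s x' cone_bound[OF f]])
      ultimately show ?thesis unfolding transfer_def by (simp add: y_def summable_sums)
    qed
    have pla: "(\<lambda>k. p k * la k) sums (- 2 * (s - 1) * U1 x + U2 x - B * h x)"
    proof -
      have "(\<lambda>k. - 2 * (s - 1) * ((y k)\<^sup>2 * u1 (y k)) + (y k)\<^sup>2 * u2 (y k) - B * p k) sums (- 2 * (s - 1) * U1 x + U2 x - B * h x)"
        unfolding U1_def U2_def y_def[symmetric]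
        using summable_sums[OF sm1[OF x']] summable_sums[OF sm2[OF x']] psum
        by (intro sums_diff sums_add sums_mult) (simp_all add: y_def)
      moreover have "- 2 * (s - 1) * ((y k)\<^sup>2 * u1 (y k)) + (y k)\<^sup>2 * u2 (y k) - B * p k = p k * la k" for k
        using y[of k] by (simp add: u1_def u2_def p_def la_def algebra_simps)
      ultimately show ?thesis by simp
    qed
    have "- 2 * (s - 1) * U1 x + U2 x - B * h x \<le> transfer s f x / A - h x + ln A * h x"
    proof (rule sums_le[OF _ pla])
      show "(\<lambda>k. p k * aa k / A - p k + ln A * p k) sums (transfer s f x / A - h x + ln A * h x)"
        by (intro sums_add sums_diff sums_divide sums_mult paa psum)
      show "p k * la k \<le> p k * aa k / A - p k + ln A * p k" for k
      proof -
        \<comment> \<open>Jensen by way of \<open>ln z \<le> z - 1\<close>: summed against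
          \<open>p\<close>, the terms \<open>transfer s f x / A\<close> and \<open>h x\<close>
          cancel by the choice of \<open>A\<close>.\<close>
        have "ln (aa k / A) \<le> aa k / A - 1" using aap[of k] Ap by (intro ln_le_minus_one) auto
        hence "la k \<le> aa k / A - 1 + ln A" using aap[of k] Ap by (simp add: laa ln_div)
        hence "p k * la k \<le> p k * (aa k / A - 1 + ln A)" using p0 by (intro mult_left_mono)
        thus ?thesis by (simp add: algebra_simps)
      qed
    qed
    also have "transfer s f x / A = h x" using tp[OF x'] hp[OF x'] by (simp add: A_def)
    also have "h x - h x + ln A * h x = h x * ln (transfer s f x) - h x * ln (h x)"
      using tp[OF x'] hp[OF x'] by (simp add: A_def ln_div algebra_simps)
    finally show ?thesis .
  qed
  have it: "integrable lborel (\<lambda>x. (h x * ln (transfer s f x)) * indicator {0<..1} x)"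
    using tp by (intro integrable_bounded_unit continuous_intros hc tc) (force simp: less_imp_neq[symmetric])
  have ihh: "integrable lborel (\<lambda>x. (h x * ln (h x)) * indicator {0<..1} x)"
    using hp by (intro integrable_bounded_unit continuous_intros hc) (force simp: less_imp_neq[symmetric])
  have iff: "integrable lborel (\<lambda>x. (h x * ln (f x)) * indicator {0<..1} x)"
    using fp by (intro integrable_bounded_unit continuous_intros hc fc) (force simp: less_imp_neq[symmetric])
  have "(LINT x|lborel. - 2 * (s - 1) * (U1 x * indicator {0<..1} x) + U2 x * indicator {0<..1} x - B * (h x * indicator {0<..1} x))
    \<le> (LINT x|lborel. (h x * ln (transfer s f x)) * indicator {0<..1} x - (h x * ln (h x)) * indicator {0<..1} x)"
  proof (rule integral_mono)
    show "integrable lborel (\<lambda>x. - 2 * (s - 1) * (U1 x * indicator {0<..1} x) + U2 x * indicator {0<..1} x - B * (h x * indicator {0<..1} x))"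
      by (intro Bochner_Integration.integrable_add Bochner_Integration.integrable_diff integrable_mult_right g1 g2 ih)
    show "integrable lborel (\<lambda>x. (h x * ln (transfer s f x)) * indicator {0<..1} x - (h x * ln (h x)) * indicator {0<..1} x)"
      by (intro Bochner_Integration.integrable_diff it ihh)
    fix x :: real
    show "- 2 * (s - 1) * (U1 x * indicator {0<..1} x) + U2 x * indicator {0<..1} x - B * (h x * indicator {0<..1} x) \<le>
       (h x * ln (transfer s f x)) * indicator {0<..1} x - (h x * ln (h x)) * indicator {0<..1} x"
      using pt[of x] by (cases "x \<in> {0<..1}") auto
  qed
  also have "(LINT x|lborel. - 2 * (s - 1) * (U1 x * indicator {0<..1} x) + U2 x * indicator {0<..1} x - B * (h x * indicator {0<..1} x))
     = - 2 * (s - 1) * (LINT x|lborel. U1 x * indicator {0<..1} x) + (LINT x|lborel. U2 x * indicator {0<..1} x) - B * (LINT x|lborel. h x * indicator {0<..1} x)"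
    using g1(1) g2(1) ih by simp
  also have "(LINT x|lborel. (h x * ln (transfer s f x)) * indicator {0<..1} x - (h x * ln (h x)) * indicator {0<..1} x)
     = (LINT x|lborel. (h x * ln (transfer s f x)) * indicator {0<..1} x) - (LINT x|lborel. (h x * ln (h x)) * indicator {0<..1} x)"
    using it ihh by simp
  finally have "- 2 * (s - 1) * log_moment + (LINT y|lborel. (h y * b y) * indicator {0<..1} y) \<le>
     (LINT x|lborel. (h x * ln (transfer s f x)) * indicator {0<..1} x) - (LINT x|lborel. (h x * ln (h x)) * indicator {0<..1} x)"
    unfolding g1(2) g2(2) i2v by simp
  moreover have "(LINT y|lborel. (h y * b y) * indicator {0<..1} y) = (LINT x|lborel. (h x * ln (f x)) * indicator {0<..1} x) - (LINT x|lborel. (h x * ln (h x)) * indicator {0<..1} x)"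
  proof -
    have "(h y * b y) * indicator {0<..1} y = (h y * ln (f y)) * indicator {0<..1} y - (h y * ln (h y)) * indicator {0<..1} y" for y
      by (simp add: b_def algebra_simps)
    thus ?thesis using iff ihh by simp
  qed
  ultimately show ?thesis unfolding h_def by linarith
qed

lemma gauss_mass: "(LINT x|lborel. 1 / (1 + x) * indicator {0<..1} x) = ln (2::real)"
proof -
  have "(LINT x|lborel. 1 / (1 + x) * indicator {0<..1::real} x) = (LINT x|lborel. 1 / (1 + x) * indicator {0..1} x)"
  proof (rule integral_cong_AE)
    show "AE x::real in lborel. 1 / (1 + x) * indicator {0<..1} x = 1 / (1 + x) * indicator {0..1} x"
      using AE_lborel_singleton[of 0] by eventually_elim (auto split: split_indicator)
  qed measurable
  also have "\<dots> = ln (1 + 1) - ln (1 + 0)"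
  proof (rule integral_FTC_Icc_real)
    fix x :: real assume x: "0 \<le> x" "x \<le> 1"
    show "((\<lambda>x. ln (1 + x)) has_real_derivative 1 / (1 + x)) (at x)"
      using x by (auto intro!: derivative_eq_intros)
    show "isCont (\<lambda>x. 1 / (1 + x)) x" using x by (intro continuous_intros) auto
  qed auto
  finally show ?thesis by simp
qed

text \<open>Summing \<open>transfer_jensen\<close> along the iterates and dividing by
  \<open>n\<close>. The line passes through \<open>(1, 0)\<close>, so it must be the tangent
  there.\<close>

lemma pressure_ge_line:
  assumes s: "s > 1/2"
  shows "(1 - s) * (2 * log_moment / ln 2) \<le> pressure s"
proof -
  define c where "c = (\<lambda>n. LINT x|lborel. 1 / (1 + x) * ln (zpart n s x) * indicator {0<..1} x)"
  have low: "real n * (2 * (1 - s) * log_moment) \<le> c n" for n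
  proof (induction n)
    case 0
    show ?case by (simp add: c_def)
  next
    case (Suc n)
    have "c n - 2 * (s - 1) * log_moment \<le> c (Suc n)"
      unfolding c_def part_Suc using part_pos[OF s] s
      by (intro transfer_jensen[OF part_cone[OF s]]) auto
    thus ?case using Suc by (simp add: algebra_simps)
  qed
  define C where "C = 8 * s * ln 2"
  have cont: "continuous_on {0..1} (zpart n s)" for n
    using s by (intro lcone_continuous[OF part_cone[OF s]]) auto
  have up: "c n \<le> ln 2 * (C + real n * pressure s)" for n
  proof -
    have "c n \<le> (LINT x|lborel. (C + real n * pressure s) * (1 / (1 + x) * indicator {0<..1} x))"
      unfolding c_def
    proof (rule integral_mono)
      show "integrable lborel (\<lambda>x. 1 / (1 + x) * ln (zpart n s x) * indicator {0<..1} x)"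
        using part_pos[OF s] by (intro integrable_bounded_unit continuous_intros cont) (force simp: less_imp_neq[symmetric])+
      show "integrable lborel (\<lambda>x. (C + real n * pressure s) * (1 / (1 + x) * indicator {0<..1} (x::real)))"
        by (intro integrable_mult_right integrable_bounded_unit continuous_intros) auto
      fix x :: real
      show "1 / (1 + x) * ln (zpart n s x) * indicator {0<..1} x \<le> (C + real n * pressure s) * (1 / (1 + x) * indicator {0<..1} x)"
      proof (cases "x \<in> {0<..1}")
        case True
        hence x: "x \<in> {0..1}" by auto
        have "ln (zpart n s x) \<le> ln (2 powr (8 * s) * exp (real n * pressure s))"
          using part_le_exp[OF s x, of n] part_pos[OF s x, of n] by (intro ln_mono) auto
        also have "\<dots> = C + real n * pressure s" by (simp add: ln_mult ln_powr C_def)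
        finally have "1 / (1 + x) * ln (zpart n s x) \<le> 1 / (1 + x) * (C + real n * pressure s)"
          using x by (intro mult_left_mono) auto
        thus ?thesis using True by (simp add: mult.commute)
      qed auto
    qed
    also have "\<dots> = (C + real n * pressure s) * ln 2" by (simp only: integral_mult_right_zero gauss_mass)
    finally show ?thesis by (simp only: mult.commute)
  qed
  have "2 * (1 - s) * log_moment \<le> ln 2 * (0 + pressure s)"
  proof (rule tendsto_le[OF trivial_limit_sequentially _ tendsto_const])
    show "(\<lambda>n. ln 2 * (C / real n + pressure s)) \<longlonglongrightarrow> ln 2 * (0 + pressure s)"
      by (intro tendsto_intros lim_const_over_n)
    show "\<forall>\<^sub>F n in sequentially. 2 * (1 - s) * log_moment \<le> ln 2 * (C / real n + pressure s)"
      using eventually_gt_at_top[of 0]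
    proof eventually_elim
      case (elim n)
      have "real n * (2 * (1 - s) * log_moment) \<le> ln 2 * (C + real n * pressure s)"
        using low[of n] up[of n] by linarith
      also have "\<dots> = real n * (ln 2 * (C / real n + pressure s))" using elim by (simp add: field_simps)
      finally show ?case using elim by simp
    qed
  qed
  thus ?thesis by (simp add: divide_simps mult_ac)
qed

text \<open>\<open>pressure\<close> lies above a line that it touches at 1, so the slope is found
  without differentiating an eigenfunction.\<close>

lemma deriv_pressure_1: "deriv pressure 1 = - (2 * log_moment / ln 2)"
proof -
  let ?l = "2 * log_moment / ln 2"
  have "((\<lambda>s. pressure s - (1 - s) * ?l) has_real_derivative (deriv pressure 1 + ?l)) (at 1)"
    by (auto intro!: derivative_eq_intros pressure_deriv)
  moreover have "\<forall>s. \<bar>1 - s\<bar> < 1/2 \<longrightarrow> pressure 1 - (1 - 1) * ?l \<le> pressure s - (1 - s) * ?l"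
  proof (intro allI impI)
    fix s :: real assume "\<bar>1 - s\<bar> < 1/2"
    hence "s > 1/2" unfolding abs_less_iff by linarith
    thus "pressure 1 - (1 - 1) * ?l \<le> pressure s - (1 - s) * ?l"
      using pressure_ge_line[of s] by (simp add: pressure_1)
  qed
  ultimately have "deriv pressure 1 + ?l = 0" by (intro DERIV_local_min[of _ _ 1 "1/2"]) auto
  thus ?thesis by simp
qed

lemma gauss_map_deriv:
  assumes "0 < x" "x < 1" "1 / x \<notin> \<int>"
  shows "(gauss_map has_real_derivative - 1 / x\<^sup>2) (at x)"
proof -
  define m where "m = \<lfloor>1 / x\<rfloor>"
  have "1 \<le> 1 / x" using assms by simp
  hence m1: "1 \<le> m" unfolding m_def by (simp only: le_floor_iff of_int_1)
  have "real_of_int m \<noteq> 1 / x" using assms(3) by (metis Ints_of_int)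
  moreover have "real_of_int m \<le> 1 / x" "1 / x < real_of_int m + 1" unfolding m_def by linarith+
  ultimately have m2: "real_of_int m < 1 / x" "1 / x < real_of_int m + 1" by auto
  define S where "S = {1 / (real_of_int m + 1)<..<1 / real_of_int m}"
  have xS: "x \<in> S" using m1 m2 assms by (auto simp: S_def field_simps)
  have eq: "1 / y - of_int m = gauss_map y" if "y \<in> S" for y
  proof -
    have "0 < 1 / (real_of_int m + 1)" using m1 by simp
    hence y: "0 < y" by (rule less_trans) (use that in \<open>auto simp: S_def\<close>)
    hence "real_of_int m < 1 / y" "1 / y < real_of_int m + 1" using that m1 by (auto simp: S_def field_simps)
    hence "\<lfloor>1 / y\<rfloor> = m" by (intro floor_unique) auto
    thus ?thesis using y by (simp add: gauss_map_def frac_def)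
  qed
  have "((\<lambda>y. 1 / y - of_int m) has_real_derivative - 1 / x\<^sup>2) (at x)"
    using assms by (auto intro!: derivative_eq_intros simp: power2_eq_square)
  thus ?thesis
    by (rule has_field_derivative_transform_within_open[where S=S]) (use xS eq in \<open>auto simp: S_def\<close>)
qed

lemma ln_deriv_gauss_map:
  assumes "0 < x" "x < 1" "1 / x \<notin> \<int>"
  shows "ln \<bar>deriv gauss_map x\<bar> = - 2 * ln x"
proof -
  have "deriv gauss_map x = - 1 / x\<^sup>2" using gauss_map_deriv[OF assms] by (rule DERIV_imp_deriv)
  thus ?thesis using assms by (simp add: ln_div ln_realpow abs_divide)
qed

lemma lambda0_eq: "lambda0 = 2 * log_moment / ln 2"
proof -
  let ?R = "restrict_space lborel {0..<1::real}"
  \<comment> \<open>Contains 0 and all points where \<open>gauss_map\<close> jumps; being countable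
    it is a null set.\<close>
  define X where "X = insert 0 (range (\<lambda>k::int. 1 / real_of_int k))"
  have cX: "countable X" unfolding X_def by simp
  have eqX: "- 2 * ln x = ln \<bar>deriv gauss_map x\<bar>" if "x \<in> {0..<1}" "x \<notin> X" for x
  proof -
    have "1 / x \<notin> \<int>"
    proof
      assume "1 / x \<in> \<int>"
      then obtain k where "1 / x = real_of_int k" by (auto elim: Ints_cases)
      hence "x = 1 / real_of_int k" by (metis divide_divide_eq_right mult.commute mult_1 div_by_1)
      thus False using that(2) by (auto simp: X_def)
    qed
    moreover have "x \<noteq> 0" using that(2) by (auto simp: X_def)
    ultimately show ?thesis using ln_deriv_gauss_map[of x] that(1) by auto
  qed
  have m1: "(\<lambda>x. - 2 * ln x) \<in> borel_measurable ?R" by (intro measurable_restrict_space1) measurable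
  have m2: "(\<lambda>x. ln \<bar>deriv gauss_map x\<bar>) \<in> borel_measurable ?R"
  proof (rule measurable_discrete_difference[OF m1, of "X \<inter> {0..<1}"])
    show "countable (X \<inter> {0..<1})" using cX by auto
    show "{x} \<in> sets ?R" if "x \<in> X \<inter> {0..<1}" for x
      using that by (subst sets_restrict_space_iff) auto
    show "- 2 * ln x = ln \<bar>deriv gauss_map x\<bar>" if "x \<in> space ?R" "x \<notin> X \<inter> {0..<1}" for x
      using that eqX by (auto simp: space_restrict_space)
  qed auto
  have "lambda0 = (LINT x|?R. (1 / ((1 + x) * ln 2)) *\<^sub>R ln \<bar>deriv gauss_map x\<bar>)"
    unfolding lambda0_def gauss_measure_def
  proof (rule integral_density[OF m2])
    show "(\<lambda>x. 1 / ((1 + x) * ln 2)) \<in> borel_measurable ?R" by (intro measurable_restrict_space1) measurable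
    show "AE x in ?R. 0 \<le> 1 / ((1 + x) * ln 2)" by (intro AE_I2) (auto simp: space_restrict_space)
  qed
  also have "\<dots> = (LINT x|lborel. indicator {0..<1} x *\<^sub>R ((1 / ((1 + x) * ln 2)) *\<^sub>R ln \<bar>deriv gauss_map x\<bar>))"
    by (rule integral_restrict_space) auto
  also have "\<dots> = (LINT x::real|lborel. 2 / ln 2 * (1 / (1 + x) * (- ln x) * indicator {0<..1} x))"
  proof (rule integral_cong_AE)
    have "(\<lambda>x. (1 / ((1 + x) * ln 2)) *\<^sub>R ln \<bar>deriv gauss_map x\<bar>) \<in> borel_measurable ?R"
      by (intro borel_measurable_scaleR m2 measurable_restrict_space1) measurable
    thus "(\<lambda>x. indicator {0..<1} x *\<^sub>R ((1 / ((1 + x) * ln 2)) *\<^sub>R ln \<bar>deriv gauss_map x\<bar>)) \<in> borel_measurable lborel"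
      by (subst (asm) borel_measurable_restrict_space_iff) auto
    show "(\<lambda>x::real. 2 / ln 2 * (1 / (1 + x) * (- ln x) * indicator {0<..1} x)) \<in> borel_measurable lborel"
      unfolding measurable_lborel1 by measurable
    have "AE x in lborel. x \<notin> insert 1 X"
      using cX by (intro AE_not_in countable_imp_null_set_lborel) auto
    thus "AE x in lborel. indicator {0..<1} x *\<^sub>R ((1 / ((1 + x) * ln 2)) *\<^sub>R ln \<bar>deriv gauss_map x\<bar>) = 2 / ln 2 * (1 / (1 + x) * (- ln x) * indicator {0<..1} x)"
    proof eventually_elim
      case (elim x)
      show ?case
      proof (cases "x \<in> {0..<1}")
        case True
        hence "ln \<bar>deriv gauss_map x\<bar> = - 2 * ln x" using eqX[of x] elim by auto
        moreover have "x \<in> {0<..1}" using True elim by (auto simp: X_def)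
        ultimately show ?thesis using True by (simp add: field_simps)
      next
        case False
        hence "x \<notin> {0<..1}" using elim by auto
        thus ?thesis using False by simp
      qed
    qed
  qed
  also have "\<dots> = 2 / ln 2 * log_moment" unfolding log_moment_def by (rule integral_mult_right_zero)
  finally show ?thesis by simp
qed

lemma deriv_pressure_lambda0: "deriv pressure 1 = - lambda0"
  by (simp add: deriv_pressure_1 lambda0_eq)

section \<open>The dimension function\<close>

lemma deriv_pressure_strict_mono:
  assumes "1/2 < s" "s < t"
  shows "deriv pressure s < deriv pressure t"
proof (rule DERIV_pos_imp_increasing[OF assms(2)])
  fix x assume "s \<le> x" "x \<le> t"
  hence "x > 1/2" using assms by simp
  thus "\<exists>y. (deriv pressure has_real_derivative y) (at x) \<and> 0 < y"
    using pressure_deriv2 pressure_deriv2_pos by blast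
qed

lemma pressure_mvt:
  assumes "1/2 < s" "s < t"
  obtains z where "s < z" "z < t" "pressure t - pressure s = (t - s) * deriv pressure z"
  using MVT2[OF assms(2), of pressure "deriv pressure"] pressure_deriv assms by (auto intro: less_le_trans)

lemma pressure_tangent:
  assumes "1/2 < s" "1/2 < t"
  shows "pressure s + deriv pressure s * (t - s) \<le> pressure t"
proof (cases s t rule: linorder_cases)
  case less
  obtain z where z: "s < z" "z < t" "pressure t - pressure s = (t - s) * deriv pressure z"
    using pressure_mvt[OF assms(1) less] .
  have "deriv pressure s \<le> deriv pressure z" using deriv_pressure_strict_mono[OF assms(1) z(1)] by simp
  hence "(t - s) * deriv pressure s \<le> (t - s) * deriv pressure z" using less by (intro mult_left_mono) auto
  thus ?thesis using z(3) by (simp add: mult.commute)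
next
  case greater
  obtain z where z: "t < z" "z < s" "pressure s - pressure t = (s - t) * deriv pressure z"
    using pressure_mvt[OF assms(2) greater] .
  have "deriv pressure z \<le> deriv pressure s" using deriv_pressure_strict_mono[of z s] z assms by simp
  hence "(s - t) * deriv pressure z \<le> (s - t) * deriv pressure s" using greater by (intro mult_left_mono) auto
  moreover have "deriv pressure s * (t - s) = - ((s - t) * deriv pressure s)" by (simp add: algebra_simps)
  ultimately show ?thesis using z(3) by linarith
qed simp

text \<open>A slope of at least \<open>- gamma0\<close> at \<open>s\<close> would by strict
  monotonicity be exceeded at \<open>s + 1\<close>. The tangent there would drive
  \<open>pressure t + gamma0 * t\<close> to infinity, whereas it tends to 0.\<close>

lemma deriv_pressure_less:
  assumes "s > 1/2"
  shows "deriv pressure s < - gamma0"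
proof (rule ccontr)
  assume n: "\<not> deriv pressure s < - gamma0"
  define u where "u = s + 1"
  have u: "u > 1/2" using assms by (simp add: u_def)
  define d where "d = deriv pressure u + gamma0"
  have d: "0 < d" using deriv_pressure_strict_mono[OF assms, of u] n by (simp add: d_def u_def)
  have "\<forall>\<^sub>F t in at_top. pressure t + gamma0 * t < 1"
    using pressure_golden_tendsto by (rule order_tendstoD(2)) simp
  moreover have "filterlim (\<lambda>t. pressure u + gamma0 * u + d * (t - u)) at_top at_top"
    using d by real_asymp
  hence "\<forall>\<^sub>F t in at_top. 1 \<le> pressure u + gamma0 * u + d * (t - u)" by (simp add: filterlim_at_top)
  ultimately have "\<forall>\<^sub>F t::real in at_top. False" using eventually_gt_at_top[of "1/2::real"]
  proof eventually_elim
    case (elim t)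
    thus ?case using pressure_tangent[OF u elim(3)] by (simp add: d_def algebra_simps)
  qed
  thus False by simp
qed

lemma deriv_pressure_neg: "s > 1/2 \<Longrightarrow> deriv pressure s < 0"
  using deriv_pressure_less gamma0_pos by force

lemma pressure_decreasing:
  assumes "1/2 < s" "s < t"
  shows "pressure t < pressure s"
proof -
  obtain z where z: "s < z" "z < t" "pressure t - pressure s = (t - s) * deriv pressure z"
    using pressure_mvt[OF assms] .
  have "(t - s) * deriv pressure z < 0" using deriv_pressure_neg[of z] z assms by (intro mult_pos_neg) auto
  thus ?thesis using z(3) by linarith
qed

lemma gamma0_less_lambda0: "gamma0 < lambda0"
  using deriv_pressure_less[of 1] deriv_pressure_lambda0 by simp

text \<open>Steep slopes occur because the pressure blows up at 1/2, slopes close to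
  \<open>- gamma0\<close> because the graph approaches a line of that slope; the rest is the
  intermediate value theorem.\<close>

lemma deriv_pressure_surj:
  assumes "\<beta> > gamma0"
  shows "\<exists>!s. s > 1/2 \<and> deriv pressure s = - \<beta>"
proof (rule ex_ex1I)
  have "\<forall>\<^sub>F s in at_right (1/2). \<beta> + 1 \<le> pressure s" using pressure_at_half by (simp add: filterlim_at_top)
  moreover have "\<forall>\<^sub>F s in at_right (1/2::real). s \<in> {1/2<..<1}" by (intro eventually_at_right_real) simp
  ultimately have "\<forall>\<^sub>F s in at_right (1/2). \<beta> + 1 \<le> pressure s \<and> s \<in> {1/2<..<1}" by (rule eventually_conj)
  then obtain a where a: "\<beta> + 1 \<le> pressure a" "1/2 < a" "a < 1"
    using eventually_happens[of _ "at_right (1/2::real)"] by (auto simp: trivial_limit_at_right_real)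
  obtain z where z: "a < z" "z < 1" "pressure 1 - pressure a = (1 - a) * deriv pressure z"
    using pressure_mvt[OF a(2,3)] .
  have zn: "deriv pressure z < 0" using deriv_pressure_neg[of z] z a by simp
  have "pressure a = (1 - a) * (- deriv pressure z)" using z(3) by (simp add: pressure_1)
  also have "\<dots> \<le> 1 * (- deriv pressure z)" using zn a by (intro mult_right_mono) auto
  finally have zb: "deriv pressure z < - \<beta>" using a by simp
  \<comment> \<open>Together with \<open>pressure (b + 1) \<ge> - gamma0 * (b + 1)\<close> this
    makes the mean slope on \<open>{b..b + 1}\<close> larger than \<open>- \<beta>\<close>.\<close>
  have "\<forall>\<^sub>F t in at_top. pressure t + gamma0 * t < \<beta> - gamma0"
    using assms by (intro order_tendstoD(2)[OF pressure_golden_tendsto]) auto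
  then obtain b where b: "b > 1" "pressure b + gamma0 * b < \<beta> - gamma0"
    using eventually_conj[OF eventually_gt_at_top[of 1]] eventually_happens[of _ "at_top::real filter"]
    by (metis (mono_tags, lifting) eventually_at_top_not_equal trivial_limit_at_top_linorder)
  obtain w where w: "b < w" "w < b + 1" "pressure (b + 1) - pressure b = (b + 1 - b) * deriv pressure w"
    using pressure_mvt[of b "b + 1"] b by auto
  have "- gamma0 * (b + 1) \<le> pressure (b + 1)" using pressure_ge_golden[of "b + 1"] b by simp
  hence "- \<beta> < deriv pressure w" using w(3) b(2) by (simp add: algebra_simps)
  hence "\<exists>x\<ge>z. x \<le> w \<and> deriv pressure x = - \<beta>"
    using zb z w b a by (intro IVT) (auto intro!: DERIV_isCont[OF pressure_deriv2])
  then obtain x where "z \<le> x" "deriv pressure x = - \<beta>" by blast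
  moreover from this have "x > 1/2" using z a by linarith
  ultimately show "\<exists>s. s > 1/2 \<and> deriv pressure s = - \<beta>" by blast
next
  fix s t assume "s > 1/2 \<and> deriv pressure s = - \<beta>" "t > 1/2 \<and> deriv pressure t = - \<beta>"
  thus "s = t" using deriv_pressure_strict_mono[of s t] deriv_pressure_strict_mono[of t s] by (cases s t rule: linorder_cases) auto
qed

section \<open>The dimension function as a Legendre transform\<close>

definition sig :: "real \<Rightarrow> real" where
  "sig \<beta> = (THE s. s > 1/2 \<and> deriv pressure s = - \<beta>)"

lemma sig:
  assumes "\<beta> > gamma0"
  shows "sig \<beta> > 1/2" "deriv pressure (sig \<beta>) = - \<beta>"
  using theI'[OF deriv_pressure_surj[OF assms]] by (auto simp: sig_def)

lemma sig_eqI: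
  assumes "s > 1/2" "deriv pressure s = - \<beta>"
  shows "sig \<beta> = s"
proof -
  have "\<beta> > gamma0" using deriv_pressure_less[OF assms(1)] assms(2) by simp
  thus ?thesis using deriv_pressure_surj[of \<beta>] sig[of \<beta>] assms by blast
qed

lemma sig_deriv_pressure: "s > 1/2 \<Longrightarrow> sig (- deriv pressure s) = s"
  by (rule sig_eqI) auto

lemma sig_lambda0: "sig lambda0 = 1"
  by (rule sig_eqI) (auto simp: deriv_pressure_lambda0)

lemma sig_less:
  assumes "s > 1/2" "\<beta> > gamma0"
  shows "sig \<beta> < s \<longleftrightarrow> - deriv pressure s < \<beta>"
  using deriv_pressure_strict_mono[of "sig \<beta>" s] deriv_pressure_strict_mono[of s "sig \<beta>"] sig[OF assms(2)] assms(1)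
  by (cases "sig \<beta>" s rule: linorder_cases) auto

text \<open>By \<open>tval_le\<close> this is the minimum over \<open>s\<close> of
  \<open>s + pressure s / \<beta>\<close>; upper bounds follow by inserting trial values of
  \<open>s\<close>.\<close>

definition tval :: "real \<Rightarrow> real" where
  "tval \<beta> = sig \<beta> + pressure (sig \<beta>) / \<beta>"

lemma tval_le:
  assumes "\<beta> > gamma0" "s > 1/2"
  shows "tval \<beta> \<le> s + pressure s / \<beta>"
proof -
  have b: "\<beta> > 0" using assms gamma0_pos by simp
  have "pressure (sig \<beta>) + - \<beta> * (s - sig \<beta>) \<le> pressure s"
    using pressure_tangent[OF sig(1)[OF assms(1)] assms(2)] sig(2)[OF assms(1)] by simp
  hence "pressure (sig \<beta>) / \<beta> \<le> (pressure s + \<beta> * (s - sig \<beta>)) / \<beta>" using b by (intro divide_right_mono) auto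
  also have "\<dots> = pressure s / \<beta> + (s - sig \<beta>)" using b by (simp add: add_divide_distrib)
  finally show ?thesis unfolding tval_def by linarith
qed

text \<open>The upper bound is the trial value \<open>s = 1\<close>, where the pressure vanishes;
  the lower one is \<open>pressure_ge_golden\<close>.\<close>

lemma tval_bounds:
  assumes "\<beta> > gamma0"
  shows "0 \<le> tval \<beta>" "tval \<beta> \<le> 1"
proof -
  have b: "\<beta> > 0" using assms gamma0_pos by simp
  show "tval \<beta> \<le> 1" using tval_le[OF assms, of 1] by (simp add: pressure_1)
  have s: "sig \<beta> > 1/2" using sig[OF assms] by simp
  have "- \<beta> * sig \<beta> \<le> - gamma0 * sig \<beta>" using assms s by (intro mult_right_mono) auto
  hence "- \<beta> * sig \<beta> \<le> pressure (sig \<beta>)" using pressure_ge_golden[OF s] by linarith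
  thus "0 \<le> tval \<beta>" using b by (simp add: tval_def field_simps)
qed

text \<open>\<open>P1\<close> depends on \<open>t - q\<close> alone, so the second equation
  determines \<open>t - q = sig \<beta>\<close>, and the first one then determines
  \<open>q\<close>.\<close>

lemma spectrum_point_eq:
  assumes "\<beta> > gamma0"
  shows "spectrum_point \<beta> = (tval \<beta>, pressure (sig \<beta>) / \<beta>)"
  unfolding spectrum_point_def
proof (rule the_equality)
  have b: "\<beta> > 0" using assms gamma0_pos by simp
  have der: "((\<lambda>q'. P1 t q') has_real_derivative - deriv pressure (t - q)) (at q)" if "t - q > 1/2" for t q
  proof -
    have "((\<lambda>q'. pressure (t - q')) has_real_derivative deriv pressure (t - q) * (- 1)) (at q)"
      by (rule DERIV_chain2[where f=pressure and g="\<lambda>q'. t - q'"])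
         (use pressure_deriv[OF that] in \<open>auto intro!: derivative_eq_intros\<close>)
    hence "((\<lambda>q'. pressure (t - q')) has_real_derivative - deriv pressure (t - q)) (at q)" by simp
    thus ?thesis
      by (rule has_field_derivative_transform_within_open[where S="{..<t - 1/2}"])
         (use that in \<open>auto simp: P1_eq\<close>)
  qed
  have s: "sig \<beta> > 1/2" "deriv pressure (sig \<beta>) = - \<beta>" using sig[OF assms] by auto
  have d: "tval \<beta> - pressure (sig \<beta>) / \<beta> = sig \<beta>" by (simp add: tval_def)
  show "case (tval \<beta>, pressure (sig \<beta>) / \<beta>) of (t, q) \<Rightarrow> (t, q) \<in> D0 \<and> P1 t q = q * \<beta> \<and> (P1 t has_real_derivative \<beta>) (at q)"
  proof -
    have h: "tval \<beta> - pressure (sig \<beta>) / \<beta> > 1/2" unfolding d by (rule s)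
    have "P1 (tval \<beta>) (pressure (sig \<beta>) / \<beta>) = pressure (sig \<beta>) / \<beta> * \<beta>"
      unfolding P1_eq[OF h] d using b by simp
    moreover have "(P1 (tval \<beta>) has_real_derivative \<beta>) (at (pressure (sig \<beta>) / \<beta>))"
      using der[OF h] unfolding d s(2) by simp
    moreover have "(tval \<beta>, pressure (sig \<beta>) / \<beta>) \<in> D0"
      unfolding D0_def using h tval_bounds[OF assms] by blast
    ultimately show ?thesis unfolding prod.case by blast
  qed
  fix x assume x: "case x of (t, q) \<Rightarrow> (t, q) \<in> D0 \<and> P1 t q = q * \<beta> \<and> (P1 t has_real_derivative \<beta>) (at q)"
  obtain t q where tq: "x = (t, q)" by (cases x)
  have h: "t - q > 1/2" "P1 t q = q * \<beta>" "(P1 t has_real_derivative \<beta>) (at q)"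
    using x by (auto simp: tq D0_def)
  have "- deriv pressure (t - q) = \<beta>" using der[OF h(1)] h(3) by (rule DERIV_unique)
  hence e: "sig \<beta> = t - q" using h(1) by (intro sig_eqI) auto
  have "pressure (sig \<beta>) = q * \<beta>" using h(1,2) by (simp add: e P1_eq)
  hence "q = pressure (sig \<beta>) / \<beta>" using b by simp
  thus "x = (tval \<beta>, pressure (sig \<beta>) / \<beta>)" using e by (simp add: tq tval_def)
qed

lemma t_tilde_eq: "\<beta> > gamma0 \<Longrightarrow> t_tilde \<beta> = tval \<beta>"
  by (simp add: t_tilde_def spectrum_point_eq)

lemma t_tilde_gamma0: "t_tilde gamma0 = 0"
  by (simp add: t_tilde_def)

lemma sig_deriv:
  assumes "\<beta> > gamma0"
  shows "(sig has_real_derivative - 1 / deriv (deriv pressure) (sig \<beta>)) (at \<beta>)"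
proof -
  let ?s = "sig \<beta>"
  have s: "?s > 1/2" "deriv pressure ?s = - \<beta>" using sig[OF assms] by auto
  have cont: "isCont sig (- deriv pressure ?s)"
  proof (rule isCont_inverse_function2[where f="\<lambda>s. - deriv pressure s" and a="(?s + 1/2) / 2" and b="?s + 1"])
    show "(?s + 1/2) / 2 < ?s" "?s < ?s + 1" using s by (auto simp: field_simps)
    fix z assume "(?s + 1/2) / 2 \<le> z" "z \<le> ?s + 1"
    moreover have "1/2 < (?s + 1/2) / 2" using s by (simp add: field_simps)
    ultimately have z: "z > 1/2" by linarith
    show "sig (- deriv pressure z) = z" by (rule sig_deriv_pressure[OF z])
    show "isCont (\<lambda>s. - deriv pressure s) z"
      by (intro continuous_minus DERIV_isCont[OF pressure_deriv2[OF z]])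
  qed
  have "(sig has_real_derivative inverse (- deriv (deriv pressure) ?s)) (at \<beta>)"
  proof (rule DERIV_inverse_function[where f="\<lambda>s. - deriv pressure s" and a=gamma0 and b="\<beta> + 1"])
    show "((\<lambda>s. - deriv pressure s) has_real_derivative - deriv (deriv pressure) ?s) (at (sig \<beta>))"
      by (intro DERIV_minus pressure_deriv2 s)
    show "- deriv (deriv pressure) ?s \<noteq> 0" using pressure_deriv2_pos[OF s(1)] by simp
    show "isCont sig \<beta>" using cont s by simp
    show "- deriv pressure (sig y) = y" if "gamma0 < y" "y < \<beta> + 1" for y using sig[OF that(1)] by simp
  qed (use assms in auto)
  thus ?thesis by (simp add: inverse_eq_divide)
qed

lemma pressure_sig_deriv:
  assumes "\<beta> > gamma0"
  shows "((\<lambda>\<beta>. pressure (sig \<beta>)) has_real_derivative \<beta> / deriv (deriv pressure) (sig \<beta>)) (at \<beta>)"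
proof -
  have "((\<lambda>\<beta>. pressure (sig \<beta>)) has_real_derivative deriv pressure (sig \<beta>) * (- 1 / deriv (deriv pressure) (sig \<beta>))) (at \<beta>)"
    by (rule DERIV_chain2[OF pressure_deriv sig_deriv]) (use sig assms in auto)
  thus ?thesis using sig[OF assms] by simp
qed

text \<open>The envelope principle: as \<open>sig \<beta>\<close> is a critical point of
  \<open>s + pressure s / \<beta>\<close>, the terms with the derivative of \<open>sig\<close>
  cancel.\<close>

lemma tval_deriv:
  assumes "\<beta> > gamma0"
  shows "(tval has_real_derivative - pressure (sig \<beta>) / \<beta>\<^sup>2) (at \<beta>)"
proof -
  have b: "\<beta> > 0" using assms gamma0_pos by simp
  have p: "deriv (deriv pressure) (sig \<beta>) > 0" using pressure_deriv2_pos sig[OF assms] by simp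
  have "(tval has_real_derivative (- 1 / deriv (deriv pressure) (sig \<beta>) +
      (\<beta> / deriv (deriv pressure) (sig \<beta>) * \<beta> - pressure (sig \<beta>) * 1) / (\<beta> * \<beta>))) (at \<beta>)"
    unfolding tval_def[abs_def] using b
    by (intro DERIV_add DERIV_divide sig_deriv pressure_sig_deriv DERIV_ident assms) auto
  also have "(- 1 / deriv (deriv pressure) (sig \<beta>) +
      (\<beta> / deriv (deriv pressure) (sig \<beta>) * \<beta> - pressure (sig \<beta>) * 1) / (\<beta> * \<beta>)) = - pressure (sig \<beta>) / \<beta>\<^sup>2"
    using b p by (simp add: field_simps power2_eq_square)
  finally show ?thesis .
qed

lemma t_tilde_deriv:
  assumes "\<beta> > gamma0"
  shows "(t_tilde has_real_derivative - pressure (sig \<beta>) / \<beta>\<^sup>2) (at \<beta>)"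
  using tval_deriv[OF assms]
  by (rule has_field_derivative_transform_within_open[where S="{gamma0<..}"]) (use assms t_tilde_eq in auto)

lemma deriv_t_tilde: "\<beta> > gamma0 \<Longrightarrow> deriv t_tilde \<beta> = - pressure (sig \<beta>) / \<beta>\<^sup>2"
  by (rule DERIV_imp_deriv[OF t_tilde_deriv])

lemma t_tilde_deriv2:
  assumes "\<beta> > gamma0"
  shows "(deriv t_tilde has_real_derivative
    (2 * pressure (sig \<beta>) / \<beta> ^ 3 - 1 / (\<beta> * deriv (deriv pressure) (sig \<beta>)))) (at \<beta>)"
proof -
  have b: "\<beta> > 0" using assms gamma0_pos by simp
  have p: "deriv (deriv pressure) (sig \<beta>) > 0" using pressure_deriv2_pos sig[OF assms] by simp
  have "((\<lambda>\<beta>. - pressure (sig \<beta>) / \<beta>\<^sup>2) has_real_derivative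
     ((- (\<beta> / deriv (deriv pressure) (sig \<beta>))) * \<beta>\<^sup>2 - (- pressure (sig \<beta>)) * (2 * \<beta>)) / (\<beta>\<^sup>2 * \<beta>\<^sup>2)) (at \<beta>)"
    using b by (intro DERIV_divide DERIV_minus pressure_sig_deriv assms) (auto intro!: derivative_eq_intros)
  also have "((- (\<beta> / deriv (deriv pressure) (sig \<beta>))) * \<beta>\<^sup>2 - (- pressure (sig \<beta>)) * (2 * \<beta>)) / (\<beta>\<^sup>2 * \<beta>\<^sup>2)
     = 2 * pressure (sig \<beta>) / \<beta> ^ 3 - 1 / (\<beta> * deriv (deriv pressure) (sig \<beta>))"
    using b p by (simp add: field_simps power2_eq_square power3_eq_cube)
  finally show ?thesis
    by (rule has_field_derivative_transform_within_open[where S="{gamma0<..}"]) (use assms deriv_t_tilde in auto)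
qed

lemma t_tilde_lambda0: "t_tilde lambda0 = 1"
  using gamma0_less_lambda0 by (simp add: t_tilde_eq tval_def sig_lambda0 pressure_1)

lemma pressure_sig_pos: "\<beta> > lambda0 \<Longrightarrow> 0 < pressure (sig \<beta>)"
proof -
  assume b: "\<beta> > lambda0"
  hence g: "\<beta> > gamma0" using gamma0_less_lambda0 by simp
  have "sig \<beta> < 1" using sig_less[of 1, OF _ g] b by (simp add: deriv_pressure_lambda0)
  thus ?thesis using pressure_decreasing[OF sig(1)[OF g], of 1] by (simp add: pressure_1)
qed

lemma pressure_sig_neg: "gamma0 < \<beta> \<Longrightarrow> \<beta> < lambda0 \<Longrightarrow> pressure (sig \<beta>) < 0"
proof -
  assume g: "gamma0 < \<beta>" and b: "\<beta> < lambda0"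
  have "\<not> sig \<beta> < 1" using sig_less[of 1, OF _ g] b by (simp add: deriv_pressure_lambda0)
  moreover have "sig \<beta> \<noteq> 1" using sig(2)[OF g] b deriv_pressure_lambda0 by auto
  ultimately have "1 < sig \<beta>" by simp
  thus ?thesis using pressure_decreasing[of 1 "sig \<beta>"] by (simp add: pressure_1)
qed

lemma deriv_t_tilde_neg: "\<beta> > lambda0 \<Longrightarrow> deriv t_tilde \<beta> < 0"
  using pressure_sig_pos[of \<beta>] gamma0_less_lambda0 gamma0_pos by (simp add: deriv_t_tilde)

lemma deriv_t_tilde_pos: "gamma0 < \<beta> \<Longrightarrow> \<beta> < lambda0 \<Longrightarrow> 0 < deriv t_tilde \<beta>"
  using pressure_sig_neg[of \<beta>] gamma0_pos by (simp add: deriv_t_tilde divide_neg_pos)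

lemma deriv_t_tilde_lambda0: "deriv t_tilde lambda0 = 0"
  using gamma0_less_lambda0 by (simp add: deriv_t_tilde sig_lambda0 pressure_1)

lemma t_tilde_gt_half:
  assumes "\<beta> > lambda0"
  shows "t_tilde \<beta> > 1/2"
proof -
  have g: "\<beta> > gamma0" using assms gamma0_less_lambda0 by simp
  hence "0 < pressure (sig \<beta>) / \<beta>" using pressure_sig_pos[OF assms] gamma0_pos by simp
  thus ?thesis using sig(1)[OF g] unfolding t_tilde_eq[OF g] tval_def by linarith
qed

lemma t_tilde_tendsto: "(t_tilde \<longlongrightarrow> 1 / 2) at_top"
proof (rule order_tendstoI)
  fix a :: real assume "a < 1/2"
  show "\<forall>\<^sub>F \<beta> in at_top. a < t_tilde \<beta>"
    using eventually_gt_at_top[of lambda0]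
  proof eventually_elim
    case (elim \<beta>)
    show ?case using \<open>a < 1/2\<close> t_tilde_gt_half[OF elim] by (rule less_trans)
  qed
next
  fix a :: real assume a: "1/2 < a"
  \<comment> \<open>Any fixed number strictly between 1/2 and \<open>a\<close> serves as trial value
    in \<open>tval_le\<close>.\<close>
  define u where "u = (1/2 + a) / 2"
  have u: "1/2 < u" "u < a" using a by (auto simp: u_def field_simps)
  have "((\<lambda>\<beta>. u + pressure u / \<beta>) \<longlongrightarrow> u + 0) at_top" by real_asymp
  hence "\<forall>\<^sub>F \<beta> in at_top. u + pressure u / \<beta> < a" using u by (intro order_tendstoD(2)) auto
  thus "\<forall>\<^sub>F \<beta> in at_top. t_tilde \<beta> < a" using eventually_gt_at_top[of gamma0]
  proof eventually_elim
    case (elim \<beta>)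
    thus ?case using tval_le[OF elim(2) u(1)] by (simp add: t_tilde_eq)
  qed
qed

lemma deriv_t_tilde_tendsto: "(deriv t_tilde \<longlongrightarrow> 0) at_top"
proof (rule Lim_null_comparison)
  show "\<forall>\<^sub>F \<beta> in at_top. norm (deriv t_tilde \<beta>) \<le> 1 / \<beta>"
    using eventually_gt_at_top[of lambda0]
  proof eventually_elim
    case (elim \<beta>)
    hence g: "\<beta> > gamma0" using gamma0_less_lambda0 by simp
    hence b: "\<beta> > 0" using gamma0_pos by simp
    have p: "0 < pressure (sig \<beta>)" using pressure_sig_pos[OF elim] .
    have "pressure (sig \<beta>) / \<beta> \<le> 1" using tval_bounds(2)[OF g] sig(1)[OF g] by (simp add: tval_def)
    hence "pressure (sig \<beta>) / \<beta> / \<beta> \<le> 1 / \<beta>" using b by (intro divide_right_mono) auto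
    moreover have "norm (deriv t_tilde \<beta>) = pressure (sig \<beta>) / \<beta> / \<beta>"
      using p b by (simp add: deriv_t_tilde[OF g] power2_eq_square)
    ultimately show ?case by simp
  qed
  show "((\<lambda>\<beta>::real. 1 / \<beta>) \<longlongrightarrow> 0) at_top" by real_asymp
qed

text \<open>As \<beta> decreases to \<open>gamma0\<close>, \<open>sig \<beta>\<close> goes to
  infinity and \<open>- pressure (sig \<beta>)\<close> grows like
  \<open>gamma0 * sig \<beta>\<close>, while \<open>\<beta>\<^sup>2\<close> stays bounded.\<close>

lemma deriv_t_tilde_at_gamma0: "filterlim (deriv t_tilde) at_top (at_right gamma0)"
  unfolding filterlim_at_top_gt[where c=0]
proof (intro allI impI)
  fix Z :: real assume Z: "0 < Z"
  have "\<forall>\<^sub>F s in at_top. pressure s + gamma0 * s < 1"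
    by (rule order_tendstoD(2)[OF pressure_golden_tendsto]) simp
  then obtain K0 where K0: "\<And>s. s \<ge> K0 \<Longrightarrow> pressure s + gamma0 * s < 1"
    by (auto simp: eventually_at_top_linorder)
  \<comment> \<open>Ensures \<open>gamma0 * K - 1 \<ge> Z * (2 * gamma0)\<^sup>2\<close>; \<beta>
    will stay below \<open>2 * gamma0\<close>.\<close>
  define K where "K = max (max 1 K0) ((4 * gamma0\<^sup>2 * Z + 1) / gamma0)"
  have K: "1 \<le> K" "K0 \<le> K" by (auto simp: K_def)
  have "(4 * gamma0\<^sup>2 * Z + 1) / gamma0 \<le> K" by (simp add: K_def)
  hence K3: "4 * gamma0\<^sup>2 * Z + 1 \<le> gamma0 * K" using gamma0_pos by (simp add: pos_divide_le_eq mult.commute)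
  define b where "b = min (- deriv pressure K) (2 * gamma0)"
  have b: "gamma0 < b" using deriv_pressure_less[of K] K gamma0_pos by (simp add: b_def)
  have "\<forall>\<^sub>F \<beta> in at_right gamma0. \<beta> \<in> {gamma0<..<b}" by (rule eventually_at_right_real[OF b])
  thus "\<forall>\<^sub>F \<beta> in at_right gamma0. Z \<le> deriv t_tilde \<beta>"
  proof eventually_elim
    case (elim \<beta>)
    hence g: "gamma0 < \<beta>" and u: "\<beta> < - deriv pressure K" "\<beta> < 2 * gamma0" by (auto simp: b_def)
    have s: "K \<le> sig \<beta>" using sig_less[of K, OF _ g] K u by simp
    have "pressure (sig \<beta>) + gamma0 * sig \<beta> < 1" using K0 s K by simp
    moreover have "gamma0 * K \<le> gamma0 * sig \<beta>" using s gamma0_pos by (intro mult_left_mono) auto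
    ultimately have q: "4 * gamma0\<^sup>2 * Z \<le> - pressure (sig \<beta>)" using K3 by linarith
    have "\<beta>\<^sup>2 \<le> (2 * gamma0)\<^sup>2" using g u gamma0_pos by (intro power_mono) auto
    hence "Z * \<beta>\<^sup>2 \<le> Z * (2 * gamma0)\<^sup>2" using Z by (intro mult_left_mono) auto
    also have "\<dots> = 4 * gamma0\<^sup>2 * Z" by (simp add: power2_eq_square)
    also note q
    finally have "Z * \<beta>\<^sup>2 \<le> - pressure (sig \<beta>)" .
    moreover have "0 < \<beta>\<^sup>2" using g gamma0_pos by simp
    ultimately show ?case unfolding deriv_t_tilde[OF g] by (simp only: pos_le_divide_eq)
  qed
qed

lemma deriv2_t_tilde_lambda0: "deriv (deriv t_tilde) lambda0 < 0"
proof -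
  have "deriv (deriv t_tilde) lambda0 = 2 * pressure (sig lambda0) / lambda0 ^ 3 - 1 / (lambda0 * deriv (deriv pressure) (sig lambda0))"
    by (rule DERIV_imp_deriv[OF t_tilde_deriv2[OF gamma0_less_lambda0]])
  also have "\<dots> = - (1 / (lambda0 * deriv (deriv pressure) 1))" by (simp add: sig_lambda0 pressure_1)
  also have "\<dots> < 0" using pressure_deriv2_pos[of 1] gamma0_less_lambda0 gamma0_pos by simp
  finally show ?thesis .
qed

lemma deriv_t_tilde_differentiable: "\<beta> > gamma0 \<Longrightarrow> deriv t_tilde differentiable (at \<beta>)"
  using t_tilde_deriv2 real_differentiable_def by blast

text \<open>Otherwise \<open>deriv t_tilde\<close> would be nonincreasing beyond
  \<open>lambda0\<close>, and being negative there it could not tend to 0.\<close>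

lemma deriv2_t_tilde_pos: "\<exists>\<beta>1>lambda0. deriv t_tilde differentiable (at \<beta>1) \<and> deriv (deriv t_tilde) \<beta>1 > 0"
proof (rule ccontr)
  assume n: "\<not> ?thesis"
  let ?b = "lambda0 + 1"
  have le: "deriv t_tilde \<beta> \<le> deriv t_tilde ?b" if "\<beta> \<ge> ?b" for \<beta>
  proof (rule DERIV_nonpos_imp_nonincreasing[OF that])
    fix x assume x: "?b \<le> x" "x \<le> \<beta>"
    hence l: "x > lambda0" "x > gamma0" using gamma0_less_lambda0 by auto
    have "deriv (deriv t_tilde) x \<le> 0" using n l deriv_t_tilde_differentiable[OF l(2)] by (auto simp: not_less)
    moreover have "(deriv t_tilde has_real_derivative deriv (deriv t_tilde) x) (at x)"
      using t_tilde_deriv2[OF l(2)] DERIV_imp_deriv by metis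
    ultimately show "\<exists>y. (deriv t_tilde has_real_derivative y) (at x) \<and> y \<le> 0" by blast
  qed
  have "0 \<le> deriv t_tilde ?b"
  proof (rule tendsto_upperbound[OF deriv_t_tilde_tendsto])
    show "\<forall>\<^sub>F \<beta> in at_top. deriv t_tilde \<beta> \<le> deriv t_tilde ?b"
      using eventually_ge_at_top[of ?b] by eventually_elim (rule le)
  qed simp
  thus False using deriv_t_tilde_neg[of ?b] by simp
qed

section \<open>Failure of convexity and of concavity\<close>

text \<open>Strictness of \<open>tval_le\<close> at \<open>s = 1\<close>: the tangent inequality is
  applied in two steps through the midpoint \<open>m\<close>, where the slope has strictly
  changed.\<close>

lemma t_tilde_strict:
  assumes "\<beta> > gamma0" "\<beta> \<noteq> lambda0"
  shows "t_tilde \<beta> < 1"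
proof -
  have "sig \<beta> \<noteq> 1" using sig(2)[OF assms(1)] assms(2) deriv_pressure_lambda0 by auto
  have "pressure (sig \<beta>) + deriv pressure (sig \<beta>) * (1 - sig \<beta>) < pressure 1"
  proof -
    define m where "m = (sig \<beta> + 1) / 2"
    have s: "sig \<beta> > 1/2" using sig[OF assms(1)] by simp
    have m: "m > 1/2" using s by (simp add: m_def field_simps)
    have m2: "m - sig \<beta> = (1 - sig \<beta>) / 2" "1 - m = (1 - sig \<beta>) / 2" by (auto simp: m_def field_simps)
    have 1: "pressure (sig \<beta>) + deriv pressure (sig \<beta>) * (m - sig \<beta>) \<le> pressure m" by (rule pressure_tangent[OF s m])
    have 2: "pressure m + deriv pressure m * (1 - m) \<le> pressure 1" by (rule pressure_tangent[OF m]) simp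
    have 3: "deriv pressure (sig \<beta>) * (1 - m) < deriv pressure m * (1 - m)"
    proof (cases "sig \<beta> < 1")
      case True
      hence "sig \<beta> < m" "0 < 1 - m" by (auto simp: m_def field_simps)
      thus ?thesis using deriv_pressure_strict_mono[OF s, of m] by (intro mult_strict_right_mono) auto
    next
      case False
      hence "m < sig \<beta>" "1 - m < 0" using \<open>sig \<beta> \<noteq> 1\<close> by (auto simp: m_def field_simps)
      thus ?thesis using deriv_pressure_strict_mono[OF m, of "sig \<beta>"] by (intro mult_strict_right_mono_neg) auto
    qed
    have "deriv pressure (sig \<beta>) * (1 - sig \<beta>) = deriv pressure (sig \<beta>) * (m - sig \<beta>) + deriv pressure (sig \<beta>) * (1 - m)"
      by (simp add: algebra_simps)
    thus ?thesis using 1 2 3 by linarith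
  qed
  hence "pressure (sig \<beta>) < \<beta> * (1 - sig \<beta>)" using sig(2)[OF assms(1)] by (simp add: pressure_1)
  moreover have "\<beta> > 0" using assms gamma0_pos by simp
  ultimately have "pressure (sig \<beta>) / \<beta> < 1 - sig \<beta>" by (simp add: pos_divide_less_eq mult.commute)
  thus ?thesis using assms(1) by (simp add: t_tilde_eq tval_def)
qed

lemma t_tilde_not_convex: "\<not> convex_on {gamma0..} t_tilde"
proof
  assume c: "convex_on {gamma0..} t_tilde"
  define d where "d = (lambda0 - gamma0) / 2"
  have d: "0 < d" "gamma0 < lambda0 - d" using gamma0_less_lambda0 by (auto simp: d_def field_simps)
  have "t_tilde ((1 - 1/2) *\<^sub>R (lambda0 - d) + (1/2) *\<^sub>R (lambda0 + d)) \<le> (1 - 1/2) * t_tilde (lambda0 - d) + 1/2 * t_tilde (lambda0 + d)"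
    by (rule convex_onD[OF c]) (use d in auto)
  moreover have "(1 - 1/2) *\<^sub>R (lambda0 - d) + (1/2) *\<^sub>R (lambda0 + d) = lambda0" by (simp add: field_simps)
  moreover have "t_tilde (lambda0 - d) < 1" "t_tilde (lambda0 + d) < 1" using d gamma0_less_lambda0 by (auto intro!: t_tilde_strict)
  ultimately show False by (simp add: t_tilde_lambda0)
qed

lemma t_tilde_not_concave: "\<not> concave_on {gamma0..} t_tilde"
proof
  assume c: "concave_on {gamma0..} t_tilde"
  define e where "e = 1 - t_tilde (lambda0 + 1)"
  have e: "0 < e" using t_tilde_strict[of "lambda0 + 1"] gamma0_less_lambda0 by (simp add: e_def)
  \<comment> \<open>The chord from \<open>lambda0\<close> to \<open>lambda0 + n\<close> lies above
    \<open>1 - 1 / n\<close> at \<open>lambda0 + 1\<close>, as \<open>t_tilde\<close> stays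
    positive; for large \<open>n\<close> this exceeds \<open>t_tilde (lambda0 + 1)\<close>.\<close>
  obtain n :: nat where n: "1 / e < real n" using reals_Archimedean2 by blast
  have n0: "0 < n" using n e by (cases n) auto
  have "(1 - 1 / real n) * t_tilde lambda0 + 1 / real n * t_tilde (lambda0 + real n) \<le> t_tilde ((1 - 1 / real n) *\<^sub>R lambda0 + (1 / real n) *\<^sub>R (lambda0 + real n))"
    by (rule concave_onD[OF c]) (use n0 gamma0_less_lambda0 in auto)
  moreover have "(1 - 1 / real n) *\<^sub>R lambda0 + (1 / real n) *\<^sub>R (lambda0 + real n) = lambda0 + 1"
    using n0 by (simp add: field_simps)
  ultimately have "1 - 1 / real n + 1 / real n * t_tilde (lambda0 + real n) \<le> 1 - e"
    by (simp add: t_tilde_lambda0 e_def)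
  moreover have "0 < 1 / real n * t_tilde (lambda0 + real n)"
    using t_tilde_gt_half[of "lambda0 + real n"] n0 by (intro mult_pos_pos) auto
  moreover have "1 / real n < e" using n n0 e by (simp add: field_simps)
  ultimately show False by linarith
qed

section \<open>Covers by cylinders\<close>

lemma gauss_map_branch:
  assumes "0 < x" "x < 1"
  shows "1 \<le> nat \<lfloor>1 / x\<rfloor>" "x = 1 / (real (nat \<lfloor>1 / x\<rfloor>) + gauss_map x)" "0 \<le> gauss_map x" "gauss_map x < 1"
proof -
  have "1 \<le> 1 / x" using assms by simp
  hence f1: "1 \<le> \<lfloor>1 / x\<rfloor>" by (simp only: le_floor_iff of_int_1)
  thus n1: "1 \<le> nat \<lfloor>1 / x\<rfloor>" by linarith
  have "real (nat \<lfloor>1 / x\<rfloor>) = of_int \<lfloor>1 / x\<rfloor>" using f1 by (subst of_nat_nat) linarith+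
  moreover have "gauss_map x = 1 / x - of_int \<lfloor>1 / x\<rfloor>" using assms by (simp add: gauss_map_def frac_def)
  ultimately have "real (nat \<lfloor>1 / x\<rfloor>) + gauss_map x = 1 / x" by simp
  thus "x = 1 / (real (nat \<lfloor>1 / x\<rfloor>) + gauss_map x)" by simp
  show "0 \<le> gauss_map x" "gauss_map x < 1" using assms by (auto simp: gauss_map_def frac_lt_1)
qed

lemma gauss_map_inverse_branch:
  assumes "0 < y" "y < 1" "1 \<le> (w::nat)"
  shows "nat \<lfloor>1 / (1 / (real w + y))\<rfloor> = w" "gauss_map (1 / (real w + y)) = y"
    "0 < 1 / (real w + y)" "1 / (real w + y) < 1"
proof -
  have w: "1 \<le> real w" using assms by simp
  have f: "\<lfloor>real w + y\<rfloor> = int w" using assms by (intro floor_unique) auto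
  show "nat \<lfloor>1 / (1 / (real w + y))\<rfloor> = w" by (simp add: f)
  show "gauss_map (1 / (real w + y)) = y" using assms w f by (simp add: gauss_map_def frac_def)
  show "0 < 1 / (real w + y)" "1 / (real w + y) < 1" using assms w by auto
qed

section \<open>Digits and derivatives along irrational orbits\<close>

definition irr :: "real set" where "irr = {0..<1} - \<rat>"

lemma irrD: "x \<in> irr \<Longrightarrow> 0 < x \<and> x < 1"
  using Rats_0 by (auto simp: irr_def less_le)

lemma gauss_map_irr:
  assumes "x \<in> irr"
  shows "gauss_map x \<in> irr"
proof -
  have x: "0 < x" "x < 1" "x \<notin> \<rat>" using irrD[OF assms] assms by (auto simp: irr_def)
  have "gauss_map x \<notin> \<rat>"
  proof
    assume "gauss_map x \<in> \<rat>"
    hence "1 / (real (nat \<lfloor>1 / x\<rfloor>) + gauss_map x) \<in> \<rat>" by (intro Rats_divide Rats_add) auto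
    thus False using gauss_map_branch(2)[OF x(1,2)] x(3) by simp
  qed
  thus ?thesis using gauss_map_branch(3,4)[OF x(1,2)] by (simp add: irr_def)
qed

lemma gauss_iter_irr: "x \<in> irr \<Longrightarrow> (gauss_map ^^ n) x \<in> irr"
  by (induction n) (auto intro: gauss_map_irr)

definition cword :: "nat \<Rightarrow> real \<Rightarrow> nat list" where
  "cword n x = map (\<lambda>j. nat \<lfloor>1 / (gauss_map ^^ j) x\<rfloor>) [0..<n]"

lemma cword_0 [simp]: "cword 0 x = []"
  by (simp add: cword_def)

lemma cword_Suc: "cword (Suc n) x = nat \<lfloor>1 / x\<rfloor> # cword n (gauss_map x)"
proof -
  have "map (\<lambda>j. nat \<lfloor>1 / (gauss_map ^^ j) x\<rfloor>) [0..<Suc n] = nat \<lfloor>1 / x\<rfloor> # map (\<lambda>j. nat \<lfloor>1 / (gauss_map ^^ Suc j) x\<rfloor>) [0..<n]"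
    by (simp only: upt_conv_Cons[of 0 "Suc n"] map_Suc_upt[symmetric] list.map map_map o_def funpow_0 zero_less_Suc)
  thus ?thesis by (simp add: cword_def funpow_swap1)
qed

lemma cword_words: "x \<in> irr \<Longrightarrow> cword n x \<in> words n"
proof (induction n arbitrary: x)
  case (Suc n)
  have "1 \<le> nat \<lfloor>1 / x\<rfloor>" using irrD[OF Suc.prems] gauss_map_branch by blast
  thus ?case using Suc.IH[OF gauss_map_irr[OF Suc.prems]] by (simp add: cword_Suc words_def)
qed simp

lemma cfrac_tail_cword: "x \<in> irr \<Longrightarrow> cfrac_tail (cword n x) ((gauss_map ^^ n) x) = x"
proof (induction n arbitrary: x)
  case (Suc n)
  have "cfrac_tail (cword (Suc n) x) ((gauss_map ^^ Suc n) x) = 1 / (real (nat \<lfloor>1 / x\<rfloor>) + gauss_map x)"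
    using Suc.IH[OF gauss_map_irr[OF Suc.prems]] by (simp add: cword_Suc funpow_swap1)
  thus ?case using irrD[OF Suc.prems] gauss_map_branch(2) by metis
qed simp

lemma wprod_Cons: "wprod (w # ws) z = cfrac_tail (w # ws) z * wprod ws z"
  unfolding wprod_def by (simp add: prod.lessThan_Suc_shift del: prod.lessThan_Suc)

text \<open>At the \<open>n\<close>-th iterate \<open>wprod\<close> is the product of the iterates
  before it, which is what the chain rule yields. Only \<open>\<bar>D\<bar>\<close> is recorded, as
  the sign alternates with \<open>n\<close>.\<close>

lemma gauss_iter_deriv:
  "x \<in> irr \<Longrightarrow> \<exists>D. ((gauss_map ^^ n) has_real_derivative D) (at x) \<and> \<bar>D\<bar> = 1 / (wprod (cword n x) ((gauss_map ^^ n) x))\<^sup>2"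
proof (induction n arbitrary: x)
  case 0
  show ?case by (intro exI[of _ 1]) (auto simp: id_def)
next
  case (Suc n)
  have x: "0 < x" "x < 1" "x \<notin> \<rat>" using irrD[OF Suc.prems] Suc.prems by (auto simp: irr_def)
  have "1 / x \<notin> \<int>"
  proof
    assume "1 / x \<in> \<int>"
    hence "1 / x \<in> \<rat>" using Ints_subset_Rats by blast
    hence "inverse (1 / x) \<in> \<rat>" by (rule Rats_inverse)
    thus False using x by simp
  qed
  hence d: "(gauss_map has_real_derivative - 1 / x\<^sup>2) (at x)" using gauss_map_deriv x by blast
  obtain D where D: "((gauss_map ^^ n) has_real_derivative D) (at (gauss_map x))"
    "\<bar>D\<bar> = 1 / (wprod (cword n (gauss_map x)) ((gauss_map ^^ n) (gauss_map x)))\<^sup>2"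
    using Suc.IH[OF gauss_map_irr[OF Suc.prems]] by blast
  have "((gauss_map ^^ Suc n) has_real_derivative D * (- 1 / x\<^sup>2)) (at x)"
    using DERIV_chain2[OF D(1) d] by (simp add: funpow_Suc_right o_def del: funpow.simps)
  moreover have "wprod (cword (Suc n) x) ((gauss_map ^^ Suc n) x) = x * wprod (cword n (gauss_map x)) ((gauss_map ^^ n) (gauss_map x))"
    using cfrac_tail_cword[OF Suc.prems, of "Suc n"] by (simp add: cword_Suc wprod_Cons funpow_swap1)
  hence "\<bar>D * (- 1 / x\<^sup>2)\<bar> = 1 / (wprod (cword (Suc n) x) ((gauss_map ^^ Suc n) x))\<^sup>2"
    by (simp add: abs_mult D(2) power_mult_distrib)
  ultimately show ?case by blast
qed

text \<open>Twice the logarithm of the last denominator. Up to \<open>2 * ln 2\<close> it is the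
  logarithm of the derivative of the iterate on the cylinder of \<omega>.\<close>

definition wlen :: "nat list \<Rightarrow> real" where
  "wlen \<omega> = - 2 * ln (wprod \<omega> 0)"

lemma wprod_powr_wlen: "\<omega> \<in> words n \<Longrightarrow> wprod \<omega> 0 powr (2 * t) = exp (- t * wlen \<omega>)"
  using wprod_0_pos[of \<omega> n] by (simp add: powr_def wlen_def)

lemma ln_deriv_bounds:
  assumes "x \<in> irr"
  shows "wlen (cword n x) \<le> ln \<bar>deriv (gauss_map ^^ n) x\<bar>" "ln \<bar>deriv (gauss_map ^^ n) x\<bar> \<le> wlen (cword n x) + 2 * ln 2"
proof -
  let ?w = "cword n x" and ?y = "(gauss_map ^^ n) x"
  obtain D where D: "((gauss_map ^^ n) has_real_derivative D) (at x)" "\<bar>D\<bar> = 1 / (wprod ?w ?y)\<^sup>2"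
    using gauss_iter_deriv[OF assms] by blast
  have w: "?w \<in> words n" by (rule cword_words[OF assms])
  have y: "?y \<in> {0..1}" using irrD[OF gauss_iter_irr[OF assms, of n]] by auto
  note b = wprod_bounds[OF w y] wprod_0_pos[OF w]
  have "ln \<bar>deriv (gauss_map ^^ n) x\<bar> = - 2 * ln (wprod ?w ?y)"
    using DERIV_imp_deriv[OF D(1)] D(2) b by (simp add: ln_div ln_realpow)
  moreover have "ln (wprod ?w ?y) \<le> ln (wprod ?w 0)" using b by (intro ln_mono) auto
  moreover have "ln (wprod ?w 0) \<le> ln (2 * wprod ?w ?y)" using b by (intro ln_mono) auto
  moreover have "ln (2 * wprod ?w ?y) = ln 2 + ln (wprod ?w ?y)" using b by (simp add: ln_mult)
  ultimately show "wlen ?w \<le> ln \<bar>deriv (gauss_map ^^ n) x\<bar>" "ln \<bar>deriv (gauss_map ^^ n) x\<bar> \<le> wlen ?w + 2 * ln 2"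
    by (auto simp: wlen_def)
qed

text \<open>Bounded distortion lets the exponent be read off from the digits alone.\<close>

lemma lyapunov_level_set_iff:
  "x \<in> lyapunov_level_set \<beta> \<longleftrightarrow> x \<in> irr \<and> (\<lambda>n. wlen (cword n x) / real n) \<longlonglongrightarrow> \<beta>"
proof (cases "x \<in> irr")
  case True
  let ?a = "\<lambda>n. 1 / real n * ln \<bar>deriv (gauss_map ^^ n) x\<bar>" and ?b = "\<lambda>n. wlen (cword n x) / real n"
  have "(\<lambda>n. ?a n - ?b n) \<longlonglongrightarrow> 0"
  proof (rule Lim_null_comparison)
    show "\<forall>\<^sub>F n in sequentially. norm (?a n - ?b n) \<le> (2 * ln 2) / real n"
    proof (intro always_eventually allI)
      fix n
      have "?a n - ?b n = (ln \<bar>deriv (gauss_map ^^ n) x\<bar> - wlen (cword n x)) / real n"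
        by (simp add: diff_divide_distrib)
      thus "norm (?a n - ?b n) \<le> (2 * ln 2) / real n"
        using ln_deriv_bounds[OF True, of n] by (auto intro!: divide_right_mono)
    qed
    show "(\<lambda>n. (2 * ln 2) / real n) \<longlonglongrightarrow> 0" by (rule lim_const_over_n)
  qed
  hence "?a \<longlonglongrightarrow> \<beta> \<longleftrightarrow> ?b \<longlonglongrightarrow> \<beta>"
    using tendsto_diff[of ?a \<beta> sequentially "\<lambda>n. ?a n - ?b n" 0] tendsto_add[of ?b \<beta> sequentially "\<lambda>n. ?a n - ?b n" 0] by auto
  thus ?thesis using True by (auto simp: lyapunov_level_set_def irr_def)
qed (auto simp: lyapunov_level_set_def irr_def)

section \<open>Upper bounds for Hausdorff measure and dimension\<close>

lemma hausdorff_dim_le: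
  fixes A :: "'a::metric_space set"
  assumes "0 \<le> t" "\<And>s. t < s \<Longrightarrow> hausdorff_measure s A = 0"
  shows "hausdorff_dim A \<le> ereal t"
proof (rule ereal_le_epsilon2)
  fix e :: real assume "0 < e"
  hence "hausdorff_dim A \<le> ereal (t + e)"
    unfolding hausdorff_dim_def using assms by (intro Inf_lower) auto
  thus "hausdorff_dim A \<le> ereal t + ereal e" by simp
qed

lemma hausdorff_dim_ge:
  fixes A :: "'a::metric_space set"
  assumes "\<And>s. 0 \<le> s \<Longrightarrow> s < t \<Longrightarrow> hausdorff_measure s A \<noteq> 0"
  shows "ereal t \<le> hausdorff_dim A"
  unfolding hausdorff_dim_def using assms by (intro Inf_greatest) (auto simp: not_less[symmetric])

lemma hausdorff_measure_zeroI:
  fixes A :: "'a::metric_space set"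
  assumes "\<And>\<delta> e. 0 < \<delta> \<Longrightarrow> 0 < e \<Longrightarrow> \<exists>U :: nat \<Rightarrow> 'a set. A \<subseteq> (\<Union>i. U i) \<and> (\<forall>i. bounded (U i) \<and> diameter (U i) \<le> \<delta>) \<and>
     (\<Sum>i. ennreal (hausdorff_gauge s (U i))) \<le> ennreal e"
  shows "hausdorff_measure s A = 0"
proof -
  have "hausdorff_pre_measure s \<delta> A = 0" if \<delta>: "0 < \<delta>" for \<delta>
  proof -
    have le: "hausdorff_pre_measure s \<delta> A \<le> 0 + ennreal e" if e: "0 < e" for e
    proof -
      obtain U :: "nat \<Rightarrow> 'a set" where U: "A \<subseteq> (\<Union>i. U i)" "\<forall>i. bounded (U i) \<and> diameter (U i) \<le> \<delta>"
        "(\<Sum>i. ennreal (hausdorff_gauge s (U i))) \<le> ennreal e" using assms[OF \<delta> e] by blast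
      have "hausdorff_pre_measure s \<delta> A \<le> (\<Sum>i. ennreal (hausdorff_gauge s (U i)))"
        unfolding hausdorff_pre_measure_def using U by (intro INF_lower) auto
      also note U(3)
      finally show ?thesis by (simp only: add_0)
    qed
    have "hausdorff_pre_measure s \<delta> A \<le> 0" by (rule ennreal_le_epsilon, erule le)
    thus ?thesis by (simp only: le_zero_eq)
  qed
  hence "hausdorff_measure s A = (SUP \<delta>\<in>{0::real<..}. 0)"
    unfolding hausdorff_measure_def by (intro SUP_cong) auto
  thus ?thesis by simp
qed

text \<open>Families of words are indexed by \<open>nat\<close> through \<open>from_nat\<close>, and
  the condition \<open>to_nat (from_nat i) = i\<close> counts every word once. A partial sum is
  grouped by length and bounded by a geometric series.\<close>

lemma words_suminf_le:
  fixes f :: "nat list \<Rightarrow> real"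
  assumes nn: "\<And>\<omega>. 0 \<le> f \<omega>" and r: "0 \<le> r" "r < 1" "0 \<le> C"
    and G: "\<And>\<omega>. \<omega> \<in> G \<Longrightarrow> n0 \<le> length \<omega>"
    and S: "\<And>n S. finite S \<Longrightarrow> S \<subseteq> G \<Longrightarrow> (\<And>\<omega>. \<omega> \<in> S \<Longrightarrow> length \<omega> = n) \<Longrightarrow> sum f S \<le> C * r ^ n"
  shows "(\<Sum>i. ennreal (if to_nat (from_nat i :: nat list) = i \<and> from_nat i \<in> G then f (from_nat i) else 0)) \<le> ennreal (C * r ^ n0 / (1 - r))"
proof (rule suminf_le_const[OF summableI])
  fix m
  let ?g = "\<lambda>i. if to_nat (from_nat i :: nat list) = i \<and> from_nat i \<in> G then f (from_nat i) else 0"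
  define I where "I = {i \<in> {..<m}. to_nat (from_nat i :: nat list) = i \<and> from_nat i \<in> G}"
  define S where "S = (from_nat ` I :: nat list set)"
  have fin: "finite S" by (simp add: S_def I_def)
  have SG: "S \<subseteq> G" by (auto simp: S_def I_def)
  define M where "M = Max (insert n0 (length ` S))"
  have M: "n0 \<le> length \<omega>" "length \<omega> \<le> M" if "\<omega> \<in> S" for \<omega>
    using that fin SG G by (auto simp: M_def)
  have "(\<Sum>i<m. ennreal (?g i)) = ennreal (\<Sum>i<m. ?g i)" using nn by (intro sum_ennreal) auto
  also have "(\<Sum>i<m. ?g i) = (\<Sum>i\<in>I. f (from_nat i))"
    by (rule sum.mono_neutral_cong_right) (auto simp: I_def)
  also have "\<dots> = sum f S"
  proof -
    have "inj_on (from_nat :: nat \<Rightarrow> nat list) I" by (rule inj_on_inverseI[of _ to_nat]) (auto simp: I_def)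
    thus ?thesis unfolding S_def by (simp add: sum.reindex)
  qed
  also have "\<dots> = (\<Sum>n\<in>{n0..M}. sum f {\<omega> \<in> S. length \<omega> = n})"
    using fin M by (intro sum.group[symmetric]) auto
  also have "\<dots> \<le> (\<Sum>n\<in>{n0..M}. C * r ^ n)"
    using fin SG by (intro sum_mono assms(6)) auto
  also have "\<dots> \<le> C * r ^ n0 / (1 - r)"
  proof -
    have "(\<Sum>n\<in>{n0..M}. C * r ^ n) \<le> (\<Sum>n. C * r ^ (n + n0))"
    proof (cases "n0 \<le> M")
      case True
      have "(\<Sum>n\<in>{n0..M}. C * r ^ n) = (\<Sum>n\<in>{0..M - n0}. C * r ^ (n + n0))"
        using True by (intro sum.reindex_bij_witness[of _ "\<lambda>n. n + n0" "\<lambda>n. n - n0"]) auto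
      also have "\<dots> \<le> (\<Sum>n. C * r ^ (n + n0))"
        using r by (intro sum_le_suminf) (auto simp: power_add intro!: summable_mult summable_mult2 summable_geometric)
      finally show ?thesis .
    next
      case False
      thus ?thesis using r by (auto intro!: suminf_nonneg summable_mult summable_mult2 summable_geometric simp: power_add)
    qed
    also have "(\<Sum>n. C * r ^ (n + n0)) = C * r ^ n0 * (\<Sum>n. r ^ n)"
      using r by (subst suminf_mult[symmetric]) (auto simp: power_add mult_ac intro!: summable_geometric)
    also have "(\<Sum>n. r ^ n) = 1 / (1 - r)" using r by (intro suminf_geometric) auto
    finally show ?thesis by simp
  qed
  finally show "(\<Sum>i<m. ennreal (?g i)) \<le> ennreal (C * r ^ n0 / (1 - r))" using nn by (simp add: ennreal_leI)
qed

lemma cfrac_tail_image: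
  assumes "\<omega> \<in> words n"
  shows "bounded (cfrac_tail \<omega> ` {0..1})" "diameter (cfrac_tail \<omega> ` {0..1}) \<le> exp (- wlen \<omega>)"
proof -
  have w: "\<forall>w\<in>set \<omega>. 1 \<le> w" using assms by (simp add: words_def)
  have d: "dist (cfrac_tail \<omega> x) (cfrac_tail \<omega> y) \<le> exp (- wlen \<omega>)" if "x \<in> {0..1}" "y \<in> {0..1}" for x y
  proof -
    have "dist (cfrac_tail \<omega> x) (cfrac_tail \<omega> y) = wprod \<omega> x * wprod \<omega> y * \<bar>x - y\<bar>"
      using cfrac_tail_diff[OF w] that by (simp add: dist_real_def)
    also have "\<dots> \<le> wprod \<omega> 0 * wprod \<omega> 0 * 1"
      using wprod_bounds[OF assms that(1)] wprod_bounds[OF assms that(2)] that by (intro mult_mono) auto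
    also have "\<dots> = exp (- wlen \<omega>)"
      using wprod_powr_wlen[OF assms, of 1] wprod_0_pos[OF assms] by (simp add: power2_eq_square)
    finally show ?thesis .
  qed
  show "bounded (cfrac_tail \<omega> ` {0..1})"
    unfolding bounded_def using d[of 0] by (intro exI[of _ "cfrac_tail \<omega> 0"] exI[of _ "exp (- wlen \<omega>)"]) auto
  show "diameter (cfrac_tail \<omega> ` {0..1}) \<le> exp (- wlen \<omega>)"
    by (rule diameter_le) (use d in \<open>auto simp: dist_norm\<close>)
qed

text \<open>Tilting: \<open>exp (- t * wlen \<omega>)\<close> is
  \<open>exp (- u * wlen \<omega>)\<close> times \<open>exp (- (t - u) * wlen \<omega>)\<close>. On
  words of length \<open>n\<close> with \<open>wlen \<omega>\<close> close to
  \<open>n * \<beta>\<close> the second factor is nearly constant, and the first sums to at most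
  about \<open>exp (n * pressure u)\<close>.\<close>

lemma hausdorff_measure_level_set_zero:
  assumes u: "u > 1/2" and t: "t > 0" and b: "0 < \<beta>" and c: "pressure u < (t - u) * \<beta>"
  shows "hausdorff_measure t (lyapunov_level_set \<beta>) = 0"
proof (rule hausdorff_measure_zeroI)
  fix \<delta> e :: real assume \<delta>: "0 < \<delta>" and e: "0 < e"
  \<comment> \<open>The first bound keeps \<open>\<beta> - \<epsilon>\<close> positive, so that the
    cylinders shrink; the second leaves a positive rate \<open>q\<close> after the loss
    \<open>\<epsilon> * \<bar>t - u\<bar>\<close>, whatever the sign of
    \<open>t - u\<close>.\<close>
  define \<epsilon> where "\<epsilon> = min (\<beta> / 2) (((t - u) * \<beta> - pressure u) / (2 * (\<bar>t - u\<bar> + 1)))"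
  have "0 < ((t - u) * \<beta> - pressure u) / (2 * (\<bar>t - u\<bar> + 1))"
    using c by (intro divide_pos_pos mult_pos_pos) auto
  moreover have "\<epsilon> \<le> \<beta> / 2" unfolding \<epsilon>_def by (rule min.cobounded1)
  ultimately have \<epsilon>: "0 < \<epsilon>" "\<epsilon> < \<beta>" using b by (auto simp: \<epsilon>_def)
  define q where "q = (t - u) * \<beta> - \<epsilon> * \<bar>t - u\<bar> - pressure u"
  have q: "0 < q"
  proof -
    define g where "g = (t - u) * \<beta> - pressure u"
    have g: "0 < g" using c by (simp add: g_def)
    have "\<epsilon> \<le> g / (2 * (\<bar>t - u\<bar> + 1))" by (simp add: \<epsilon>_def g_def)
    hence "\<epsilon> * (2 * (\<bar>t - u\<bar> + 1)) \<le> g" by (subst (asm) pos_le_divide_eq) (auto simp: add_nonneg_pos)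
    hence "2 * (\<epsilon> * \<bar>t - u\<bar>) + 2 * \<epsilon> \<le> g" by (simp add: algebra_simps)
    moreover have "0 \<le> \<epsilon> * \<bar>t - u\<bar>" using \<epsilon> by simp
    ultimately show ?thesis using \<epsilon> g by (simp add: q_def g_def)
  qed
  define r where "r = exp (- q)"
  have r: "0 < r" "r < 1" using q by (auto simp: r_def)
  define C where "C = (2::real) powr (8 * u)"
  define good where "good = {\<omega>. \<omega> \<in> words (length \<omega>) \<and> \<bar>wlen \<omega> - real (length \<omega>) * \<beta>\<bar> \<le> \<epsilon> * real (length \<omega>)}"
  have "(\<lambda>n. C * r ^ n / (1 - r)) \<longlonglongrightarrow> C * 0 / (1 - r)" using r by (intro tendsto_intros LIMSEQ_realpow_zero) auto
  hence ev1: "\<forall>\<^sub>F n in sequentially. C * r ^ n / (1 - r) < e" using e by (intro order_tendstoD(2)) auto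
  have "(\<lambda>n. exp (- (\<beta> - \<epsilon>)) ^ n) \<longlonglongrightarrow> 0" using \<epsilon> by (intro LIMSEQ_realpow_zero) auto
  hence ev2: "\<forall>\<^sub>F n in sequentially. exp (- (\<beta> - \<epsilon>)) ^ n < \<delta>" using \<delta> by (rule order_tendstoD(2))
  obtain n0 where n0: "\<And>n. n \<ge> n0 \<Longrightarrow> C * r ^ n / (1 - r) < e \<and> exp (- (\<beta> - \<epsilon>)) ^ n < \<delta>"
    using eventually_conj[OF ev1 ev2] by (auto simp: eventually_sequentially)
  \<comment> \<open>Words of all lengths from \<open>n0\<close> on: a point of the level set has a
    good prefix of some such length, but not of a length fixed in advance.\<close>
  define G where "G = {\<omega> \<in> good. n0 \<le> length \<omega>}"
  define f where "f = (\<lambda>\<omega>. wprod \<omega> 0 powr (2 * t))"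
  have fsum: "sum f S \<le> C * r ^ n" if S: "finite S" "S \<subseteq> G" "\<And>\<omega>. \<omega> \<in> S \<Longrightarrow> length \<omega> = n" for n S
  proof -
    have Sw: "\<omega> \<in> words n" if "\<omega> \<in> S" for \<omega> using that S by (auto simp: G_def good_def)
    have "sum f S \<le> (\<Sum>\<omega>\<in>S. wprod \<omega> 0 powr (2 * u) * exp (- real n * ((t - u) * \<beta> - \<epsilon> * \<bar>t - u\<bar>)))"
    proof (rule sum_mono)
      fix \<omega> assume w: "\<omega> \<in> S"
      have wl: "\<bar>wlen \<omega> - real n * \<beta>\<bar> \<le> \<epsilon> * real n" using w S by (auto simp: G_def good_def)
      have "\<bar>(t - u) * (wlen \<omega> - real n * \<beta>)\<bar> \<le> \<bar>t - u\<bar> * (\<epsilon> * real n)"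
        unfolding abs_mult using wl by (intro mult_left_mono) auto
      hence "- (t - u) * wlen \<omega> \<le> - real n * ((t - u) * \<beta> - \<epsilon> * \<bar>t - u\<bar>)"
        by (simp add: abs_le_iff algebra_simps)
      hence "exp (- (t - u) * wlen \<omega>) \<le> exp (- real n * ((t - u) * \<beta> - \<epsilon> * \<bar>t - u\<bar>))" by simp
      hence "exp (- u * wlen \<omega>) * exp (- (t - u) * wlen \<omega>) \<le> exp (- u * wlen \<omega>) * exp (- real n * ((t - u) * \<beta> - \<epsilon> * \<bar>t - u\<bar>))"
        by (intro mult_left_mono) auto
      moreover have "exp (- u * wlen \<omega>) * exp (- (t - u) * wlen \<omega>) = f \<omega>"
        unfolding f_def wprod_powr_wlen[OF Sw[OF w]] exp_add[symmetric] by (simp add: algebra_simps)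
      ultimately show "f \<omega> \<le> wprod \<omega> 0 powr (2 * u) * exp (- real n * ((t - u) * \<beta> - \<epsilon> * \<bar>t - u\<bar>))"
        unfolding wprod_powr_wlen[OF Sw[OF w]] by (simp only:)
    qed
    also have "\<dots> = sum (\<lambda>\<omega>. wprod \<omega> 0 powr (2 * u)) S * exp (- real n * ((t - u) * \<beta> - \<epsilon> * \<bar>t - u\<bar>))"
      by (simp only: sum_distrib_right)
    also have "\<dots> \<le> (C * exp (real n * pressure u)) * exp (- real n * ((t - u) * \<beta> - \<epsilon> * \<bar>t - u\<bar>))"
    proof (rule mult_right_mono)
      have "sum (\<lambda>\<omega>. wprod \<omega> 0 powr (2 * u)) S \<le> zpart n u 0"
        using Sw by (intro finite_sum_le_has_sum[OF has_sum_words[OF u]] S(1)) auto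
      also have "\<dots> \<le> C * exp (real n * pressure u)" unfolding C_def by (rule part_le_exp[OF u]) simp
      finally show "sum (\<lambda>\<omega>. wprod \<omega> 0 powr (2 * u)) S \<le> C * exp (real n * pressure u)" .
    qed simp
    also have "\<dots> = C * r ^ n"
      unfolding r_def mult.assoc exp_add[symmetric] exp_of_nat_mult[symmetric] by (simp add: q_def algebra_simps)
    finally show ?thesis .
  qed
  define U where "U = (\<lambda>i. if to_nat (from_nat i :: nat list) = i \<and> from_nat i \<in> G then cfrac_tail (from_nat i) ` {0..1} else {})"
  have GD: "\<omega> \<in> words (length \<omega>)" "exp (- wlen \<omega>) \<le> \<delta>" if "\<omega> \<in> G" for \<omega>
  proof -
    show w: "\<omega> \<in> words (length \<omega>)" using that by (simp add: G_def good_def)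
    have "real (length \<omega>) * (\<beta> - \<epsilon>) \<le> wlen \<omega>"
      using that by (simp add: G_def good_def abs_le_iff algebra_simps)
    hence "exp (- wlen \<omega>) \<le> exp (- (real (length \<omega>) * (\<beta> - \<epsilon>)))" by simp
    also have "\<dots> = exp (- (\<beta> - \<epsilon>)) ^ length \<omega>"
      unfolding exp_of_nat_mult[symmetric] by (simp only: mult_minus_right)
    finally have "exp (- wlen \<omega>) \<le> exp (- (\<beta> - \<epsilon>)) ^ length \<omega>" .
    thus "exp (- wlen \<omega>) \<le> \<delta>" using n0[of "length \<omega>"] that by (simp add: G_def)
  qed
  have "lyapunov_level_set \<beta> \<subseteq> (\<Union>i. U i)"
  proof
    fix x assume "x \<in> lyapunov_level_set \<beta>"
    hence x: "x \<in> irr" "(\<lambda>n. wlen (cword n x) / real n) \<longlonglongrightarrow> \<beta>" by (auto simp: lyapunov_level_set_iff)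
    have "\<forall>\<^sub>F n in sequentially. dist (wlen (cword n x) / real n) \<beta> < \<epsilon>"
      using x(2) \<epsilon>(1) by (rule tendstoD)
    hence "\<forall>\<^sub>F n in sequentially. dist (wlen (cword n x) / real n) \<beta> < \<epsilon> \<and> max 1 n0 \<le> n"
      by (intro eventually_conj eventually_ge_at_top)
    then obtain n where n: "dist (wlen (cword n x) / real n) \<beta> < \<epsilon>" "max 1 n0 \<le> n"
      using eventually_happens'[OF trivial_limit_sequentially] by blast
    have np: "0 < real n" using n(2) by simp
    have w: "cword n x \<in> words n" by (rule cword_words[OF x(1)])
    hence len: "length (cword n x) = n" by (simp add: words_def)
    have "\<bar>wlen (cword n x) - real n * \<beta>\<bar> = real n * \<bar>wlen (cword n x) / real n - \<beta>\<bar>"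
    proof -
      have "wlen (cword n x) - real n * \<beta> = real n * (wlen (cword n x) / real n - \<beta>)" using np by (simp add: field_simps)
      thus ?thesis using np by (simp add: abs_mult)
    qed
    also have "\<dots> \<le> real n * \<epsilon>" using n(1) np by (intro mult_left_mono) (auto simp: dist_real_def)
    finally have "cword n x \<in> G" using w len n(2) by (simp add: G_def good_def mult.commute)
    moreover have "x \<in> cfrac_tail (cword n x) ` {0..1}"
      using cfrac_tail_cword[OF x(1), of n] irrD[OF gauss_iter_irr[OF x(1), of n]] by (intro image_eqI[of _ _ "(gauss_map ^^ n) x"]) auto
    ultimately have "x \<in> U (to_nat (cword n x))" by (simp add: U_def)
    thus "x \<in> (\<Union>i. U i)" by blast
  qed
  moreover have "bounded (U i) \<and> diameter (U i) \<le> \<delta>" for i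
    using cfrac_tail_image[OF GD(1)] GD(2) \<delta> by (auto simp: U_def intro: order_trans)
  moreover have "(\<Sum>i. ennreal (hausdorff_gauge t (U i))) \<le> ennreal e"
  proof -
    have "(\<Sum>i. ennreal (hausdorff_gauge t (U i))) \<le> (\<Sum>i. ennreal (if to_nat (from_nat i :: nat list) = i \<and> from_nat i \<in> G then f (from_nat i) else 0))"
    proof (rule suminf_le[OF _ summableI summableI])
      fix i
      show "ennreal (hausdorff_gauge t (U i)) \<le> ennreal (if to_nat (from_nat i :: nat list) = i \<and> from_nat i \<in> G then f (from_nat i) else 0)"
      proof (cases "to_nat (from_nat i :: nat list) = i \<and> from_nat i \<in> G")
        case True
        let ?\<omega> = "from_nat i :: nat list"
        have "diameter (U i) powr t \<le> exp (- wlen ?\<omega>) powr t"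
          using True t cfrac_tail_image[OF GD(1)] by (intro powr_mono2 diameter_ge_0) (auto simp: U_def)
        also have "\<dots> = exp (- t * wlen ?\<omega>)" by (simp add: powr_def)
        also have "\<dots> = f ?\<omega>" unfolding f_def using True by (intro wprod_powr_wlen[OF GD(1), symmetric]) simp
        finally have "diameter (U i) powr t \<le> f ?\<omega>" .
        moreover have "hausdorff_gauge t (U i) = diameter (U i) powr t"
          using True t by (auto simp: hausdorff_gauge_def U_def)
        ultimately show ?thesis using True by (auto intro!: ennreal_leI)
      qed (auto simp: hausdorff_gauge_def U_def)
    qed
    also have "\<dots> \<le> ennreal (C * r ^ n0 / (1 - r))"
      using r fsum by (intro words_suminf_le) (auto simp: f_def C_def G_def)
    also have "\<dots> \<le> ennreal e" using n0[of n0] by (intro ennreal_leI) auto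
    finally show ?thesis .
  qed
  ultimately show "\<exists>U. lyapunov_level_set \<beta> \<subseteq> (\<Union>i. U i) \<and> (\<forall>i. bounded (U i) \<and> diameter (U i) \<le> \<delta>) \<and>
     (\<Sum>i. ennreal (hausdorff_gauge t (U i))) \<le> ennreal e" by blast
qed

lemma hausdorff_dim_level_set_le:
  assumes "\<beta> \<ge> gamma0"
  shows "hausdorff_dim (lyapunov_level_set \<beta>) \<le> ereal (t_tilde \<beta>)"
proof (cases "\<beta> = gamma0")
  case True
  show ?thesis
    unfolding True t_tilde_gamma0
  proof (rule hausdorff_dim_le)
    fix t :: real assume t: "0 < t"
    \<comment> \<open>No \<open>s\<close> has slope \<open>- gamma0\<close>; a large
      \<open>s\<close> takes the place of the missing minimiser.\<close>
    have "\<forall>\<^sub>F s in at_top. pressure s + gamma0 * s < gamma0 * t"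
      using t gamma0_pos by (intro order_tendstoD(2)[OF pressure_golden_tendsto]) auto
    hence "\<forall>\<^sub>F s in at_top. pressure s + gamma0 * s < gamma0 * t \<and> 1/2 < s"
      by (intro eventually_conj eventually_gt_at_top)
    then obtain u where u: "pressure u + gamma0 * u < gamma0 * t \<and> 1/2 < u"
      using eventually_happens'[OF trivial_limit_at_top_linorder] by blast
    hence "pressure u < (t - u) * gamma0" by (simp add: algebra_simps)
    thus "hausdorff_measure t (lyapunov_level_set gamma0) = 0"
      using u t gamma0_pos hausdorff_measure_level_set_zero by blast
  qed simp
next
  case False
  hence g: "\<beta> > gamma0" using assms by simp
  have b: "\<beta> > 0" using g gamma0_pos by simp
  show ?thesis
    unfolding t_tilde_eq[OF g]
  proof (rule hausdorff_dim_le[OF tval_bounds(1)[OF g]])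
    fix t assume t: "tval \<beta> < t"
    have "pressure (sig \<beta>) / \<beta> < t - sig \<beta>" using t by (simp add: tval_def)
    hence "pressure (sig \<beta>) < (t - sig \<beta>) * \<beta>" using b by (simp only: pos_divide_less_eq)
    thus "hausdorff_measure t (lyapunov_level_set \<beta>) = 0"
      using sig(1)[OF g] b order_le_less_trans[OF tval_bounds(1)[OF g] t] by (intro hausdorff_measure_level_set_zero[of "sig \<beta>"])
  qed
qed

section \<open>A Gibbs measure on digit sequences\<close>

text \<open>\<open>h\<close> is the upper limit of the normalised \<open>zpart n s\<close>. The
  image of a supremum is at least the supremum of the images, and the decreasing limit passes
  through the series by domination. The upper limit therefore gives the inequality in the direction
  that the Markov kernel uses.\<close>

lemma sub_eigenfunction:
  assumes s: "s > 1/2"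
  shows "\<exists>c h C. 0 < c \<and> (\<forall>x\<in>{0..1}. c \<le> h x \<and> h x \<le> C) \<and> (\<forall>x\<in>{0..1}. exp (pressure s) * h x \<le> transfer s h x)"
proof -
  define c C where "c = (2::real) powr (- (8 * s))" "C = (2::real) powr (8 * s)"
  define v where "v = (\<lambda>n x. exp (- real n * pressure s) * zpart n s x)"
  have cp: "0 < c" by (simp add: c_C_def)
  have vb: "c \<le> v n x" "v n x \<le> C" if "x \<in> {0..1}" for n x
  proof -
    have "exp (- real n * pressure s) * (c * exp (real n * pressure s)) \<le> v n x"
      unfolding v_def c_C_def using part_ge_exp[OF s that] by (intro mult_left_mono) auto
    thus "c \<le> v n x" by (simp add: mult.left_commute exp_add[symmetric])
    have "v n x \<le> exp (- real n * pressure s) * (C * exp (real n * pressure s))"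
      unfolding v_def c_C_def using part_le_exp[OF s that] by (intro mult_left_mono) auto
    thus "v n x \<le> C" by (simp add: mult.left_commute exp_add[symmetric])
  qed
  have vstep: "transfer s (v n) x = exp (pressure s) * v (Suc n) x" if x: "x \<in> {0..1}" for n x
  proof -
    have "transfer s (v n) x = exp (- real n * pressure s) * zpart (Suc n) s x"
      unfolding v_def part_Suc by (rule transfer_cmult[OF s x part_bound[OF s]])
    also have "exp (- real n * pressure s) = exp (pressure s) * exp (- real (Suc n) * pressure s)"
      by (simp add: exp_add[symmetric] algebra_simps)
    finally show ?thesis by (simp only: v_def mult.assoc)
  qed
  define g where "g = (\<lambda>N x. SUP n\<in>{N..}. v n x)"
  have bdd: "bdd_above ((\<lambda>n. v n x) ` A)" if "x \<in> {0..1}" for x A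
    using vb(2)[OF that] by (intro bdd_aboveI[of _ C]) auto
  have vg: "v n x \<le> g N x" if "N \<le> n" "x \<in> {0..1}" for n N x
    unfolding g_def using that by (intro cSUP_upper bdd) auto
  have gb: "c \<le> g N x" "g N x \<le> C" if "x \<in> {0..1}" for N x
    using vb[OF that] vg[OF order_refl that, of N] order_trans[OF vb(1)[OF that, of N]]
    by (auto simp: g_def intro!: cSUP_least)
  have gdec: "decseq (\<lambda>N. g N x)" if "x \<in> {0..1}" for x
    unfolding decseq_def g_def using that by (auto intro!: cSUP_subset_mono bdd)
  define h where "h = (\<lambda>x. INF N. g N x)"
  have bddb: "bdd_below (range (\<lambda>N. g N x))" if "x \<in> {0..1}" for x
    using gb(1)[OF that] by (intro bdd_belowI[of _ c]) auto
  have gh: "(\<lambda>N. g N x) \<longlonglongrightarrow> h x" if "x \<in> {0..1}" for x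
    unfolding h_def by (rule LIMSEQ_decseq_INF[OF bddb[OF that] gdec[OF that]])
  have hb: "c \<le> h x" "h x \<le> C" if "x \<in> {0..1}" for x
    using LIMSEQ_le_const[OF gh[OF that]] LIMSEQ_le_const2[OF gh[OF that]] gb[OF that] by blast+
  have hg: "h x \<le> g N x" if "x \<in> {0..1}" for x N
    unfolding h_def by (intro cINF_lower bddb that) auto
  have step: "exp (pressure s) * h x \<le> transfer s (g N) x" if x: "x \<in> {0..1}" for x N
  proof -
    have "g (Suc N) x \<le> transfer s (g N) x / exp (pressure s)"
      unfolding g_def
    proof (rule cSUP_least)
      fix m assume "m \<in> {Suc N..}"
      then obtain m' where m': "m = Suc m'" "N \<le> m'" by (cases m) auto
      have "exp (pressure s) * v m x = transfer s (v m') x" by (simp add: vstep[OF x] m')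
      also have "\<dots> \<le> transfer s (g N) x"
      proof (rule transfer_mono[OF s x vg[OF m'(2)], where B=C and C=C])
        show "\<bar>v m' y\<bar> \<le> C" "\<bar>g N y\<bar> \<le> C" if "y \<in> {0..1}" for y
          using vb[OF that, of m'] gb[OF that, of N] cp by (simp_all add: abs_le_iff)
      qed
      finally show "v m x \<le> transfer s (\<lambda>x. SUP n\<in>{N..}. v n x) x / exp (pressure s)"
        by (simp add: g_def field_simps)
    qed auto
    hence "g (Suc N) x * exp (pressure s) \<le> transfer s (g N) x" by (subst (asm) pos_le_divide_eq) auto
    moreover have "exp (pressure s) * h x \<le> exp (pressure s) * g (Suc N) x" using hg[OF x] by (intro mult_left_mono) auto
    ultimately show ?thesis by (metis mult.commute order_trans)
  qed
  have lim: "(\<lambda>N. transfer s (g N) x) \<longlonglongrightarrow> transfer s h x" if x: "x \<in> {0..1}" for x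
  proof -
    have br: "branch k x \<in> {0..1}" for k using x by (rule branch_in)
    have "(\<lambda>n. suminf (\<lambda>k. branch k x powr (2 * s) * g n (branch k x))) \<longlonglongrightarrow> suminf (\<lambda>k. branch k x powr (2 * s) * h (branch k x))"
    proof (rule tannerys_theorem[where M="\<lambda>k. branch k x powr (2 * s) * C", THEN conjunct2, THEN conjunct2])
      show "(\<lambda>n. branch k x powr (2 * s) * g n (branch k x)) \<longlonglongrightarrow> branch k x powr (2 * s) * h (branch k x)" for k
        by (intro tendsto_intros gh br)
      show "summable (\<lambda>k. branch k x powr (2 * s) * C)" using x by (intro summable_mult2 summable_branch_powr s) auto
      have "norm (branch k x powr (2 * s) * g n (branch k x)) \<le> branch k x powr (2 * s) * C" for k n
        using gb[OF br[of k], of n] cp by (auto simp: abs_mult intro!: mult_left_mono)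
      thus "\<forall>\<^sub>F (k, n) in sequentially \<times>\<^sub>F sequentially. norm (branch k x powr (2 * s) * g n (branch k x)) \<le> branch k x powr (2 * s) * C"
        by (intro always_eventually) auto
    qed auto
    thus ?thesis by (simp only: transfer_def)
  qed
  have "exp (pressure s) * h x \<le> transfer s h x" if x: "x \<in> {0..1}" for x
    by (rule LIMSEQ_le_const[OF lim[OF x]]) (use step[OF x] in blast)
  thus ?thesis using cp hb by (intro exI[of _ c] exI[of _ h] exI[of _ C] conjI ballI) simp_all
qed

text \<open>Digits are appended at the end of a word, while \<open>st\<close> is the continued fraction of the reversed
  word. The transition probabilities then depend on \<open>st\<close> alone, and since reversal preserves the
  denominator, their product is comparable to the weight of the original word.\<close>

primrec st :: "(nat \<Rightarrow> nat) \<Rightarrow> nat \<Rightarrow> real" where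
  "st \<kappa> 0 = 0"
| "st \<kappa> (Suc n) = branch (\<kappa> n) (st \<kappa> n)"

lemma st_in: "st \<kappa> n \<in> {0..1}"
proof (induction n)
  case (Suc n)
  show ?case unfolding st.simps by (rule branch_in[OF Suc])
qed simp

lemma st_cong: "(\<And>j. j < n \<Longrightarrow> \<kappa> j = \<kappa>' j) \<Longrightarrow> st \<kappa> n = st \<kappa>' n"
  by (induction n) auto

lemma st_foldl: "st \<kappa> n = foldl (\<lambda>x k. branch k x) 0 (map \<kappa> [0..<n])"
  by (induction n) auto

definition wd :: "(nat \<Rightarrow> nat) \<Rightarrow> nat \<Rightarrow> nat list" where
  "wd \<kappa> n = map (\<lambda>j. Suc (\<kappa> j)) [0..<n]"

lemma wd_Suc: "wd \<kappa> (Suc n) = wd \<kappa> n @ [Suc (\<kappa> n)]"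
  by (simp add: wd_def)

lemma wd_words: "wd \<kappa> n \<in> words n"
  by (auto simp: wd_def words_def)

text \<open>The quotient of the last two denominators is the continued fraction of the reversed
  word.\<close>

lemma st_cden: "st \<kappa> n = real (snd (cden (wd \<kappa> n))) / real (fst (cden (wd \<kappa> n)))"
proof (induction n)
  case 0
  show ?case by (simp add: wd_def)
next
  case (Suc n)
  define A B where "A = real (fst (cden (wd \<kappa> n)))" "B = real (snd (cden (wd \<kappa> n)))"
  have A: "1 \<le> A" using cden_bounds[OF wd_words, of \<kappa> n] by (simp add: A_B_def)
  have "st \<kappa> (Suc n) = 1 / (real (\<kappa> n) + 1 + B / A)" using Suc by (simp add: branch_def A_B_def)
  also have "\<dots> = A / (A * (real (\<kappa> n) + 1) + B)" using A by (simp add: field_simps)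
  finally show ?case by (simp add: wd_Suc cden_snoc A_B_def algebra_simps)
qed

text \<open>The weight of a word becomes a product of factors that depend on the current state and
  the next digit only, as a Markov chain requires.\<close>

lemma wprod_wd: "wprod (wd \<kappa> n) 0 = (\<Prod>j<n. branch (\<kappa> j) (st \<kappa> j))"
proof (induction n)
  case 0
  show ?case by (simp add: wd_def)
next
  case (Suc n)
  define A B where "A = real (fst (cden (wd \<kappa> n)))" "B = real (snd (cden (wd \<kappa> n)))"
  have A: "1 \<le> A" "0 \<le> B" using cden_bounds[OF wd_words, of \<kappa> n] by (auto simp: A_B_def)
  have "wprod (wd \<kappa> (Suc n)) 0 = 1 / (A * (real (\<kappa> n) + 1) + B)"
    using wprod_0[OF wd_words, of \<kappa> "Suc n"] by (simp add: wd_Suc cden_snoc A_B_def algebra_simps)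
  also have "\<dots> = 1 / A * (1 / (real (\<kappa> n) + 1 + B / A))" using A by (simp add: field_simps)
  also have "\<dots> = wprod (wd \<kappa> n) 0 * branch (\<kappa> n) (st \<kappa> n)"
    using wprod_0[OF wd_words, of \<kappa> n] by (simp add: branch_def st_cden A_B_def)
  finally show ?case using Suc by simp
qed

lemma measurable_map_upt:
  assumes "{0..<n} \<subseteq> I"
  shows "(\<lambda>\<omega>. map \<omega> [0..<n]) \<in> measurable (PiM I (\<lambda>_. count_space (UNIV :: nat set))) (count_space UNIV)"
  using assms
proof (induction n)
  case (Suc n)
  have "(\<lambda>\<omega>. map \<omega> [0..<n] @ [\<omega> n]) \<in> measurable (PiM I (\<lambda>_. count_space (UNIV :: nat set))) (count_space UNIV)"
  proof (rule measurable_compose_countable[where f="\<lambda>l \<omega>. l @ [\<omega> n]" and g="\<lambda>\<omega>. map \<omega> [0..<n]"])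
    show "(\<lambda>\<omega>. map \<omega> [0..<n]) \<in> measurable (PiM I (\<lambda>_. count_space (UNIV :: nat set))) (count_space UNIV)"
      using Suc by (intro Suc.IH) auto
    show "(\<lambda>\<omega>. l @ [\<omega> n]) \<in> measurable (PiM I (\<lambda>_. count_space (UNIV :: nat set))) (count_space UNIV)" for l
      using Suc.prems by (intro measurable_compose[OF measurable_component_singleton[of n]]) auto
  qed
  thus ?case by simp
qed simp

section \<open>The Markov chain of digits\<close>

locale gibbs =
  fixes s c C :: real and h :: "real \<Rightarrow> real"
  assumes s: "s > 1/2" and c: "0 < c"
    and bds: "\<And>x. x \<in> {0..1} \<Longrightarrow> c \<le> h x \<and> h x \<le> C"
    and sub: "\<And>x. x \<in> {0..1} \<Longrightarrow> exp (pressure s) * h x \<le> transfer s h x"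
begin

lemma h_pos: "x \<in> {0..1} \<Longrightarrow> 0 < h x"
  using bds c by fastforce

lemma tr_pos: "x \<in> {0..1} \<Longrightarrow> 0 < transfer s h x"
  using sub[of x] h_pos[of x] by (smt (verit) exp_gt_zero mult_pos_pos)

text \<open>Normalised by \<open>transfer s h x\<close> and not by
  \<open>exp (pressure s) * h x\<close>: since \<open>h\<close> satisfies only an inequality, this
  is what makes the sum exactly 1.\<close>

definition kern :: "real \<Rightarrow> nat \<Rightarrow> real" where
  "kern x k = branch k x powr (2 * s) * h (branch k x) / transfer s h x"

lemma kern_nonneg: "x \<in> {0..1} \<Longrightarrow> 0 \<le> kern x k"
  unfolding kern_def using tr_pos[of x] h_pos[OF branch_in, of x k] by simp

lemma kern_sums:
  assumes "x \<in> {0..1}"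
  shows "kern x sums 1"
proof -
  have "\<bar>h y\<bar> \<le> C" if "y \<in> {0..1}" for y using bds[OF that] c by auto
  hence "(\<lambda>k. branch k x powr (2 * s) * h (branch k x)) sums transfer s h x"
    unfolding transfer_def by (intro summable_sums summable_transfer[OF s assms])
  hence "(\<lambda>k. branch k x powr (2 * s) * h (branch k x) / transfer s h x) sums (transfer s h x / transfer s h x)"
    by (rule sums_divide)
  thus ?thesis using tr_pos[OF assms] by (simp add: kern_def[abs_def])
qed

text \<open>The default outside \<open>{0..1}\<close> is a point mass, so that
  \<open>embed_pmf\<close> is applied to a distribution for every \<open>x\<close>.\<close>

definition kpmf :: "real \<Rightarrow> nat pmf" where
  "kpmf x = embed_pmf (\<lambda>k. if x \<in> {0..1} then kern x k else if k = 0 then 1 else 0)"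

lemma pmf_kpmf:
  assumes "x \<in> {0..1}"
  shows "pmf (kpmf x) k = kern x k"
proof -
  have "(\<integral>\<^sup>+k. ennreal (kern x k) \<partial>count_space UNIV) = (\<Sum>k. ennreal (kern x k))" by (rule nn_integral_count_space_nat)
  also have "\<dots> = ennreal (suminf (kern x))"
    using kern_nonneg[OF assms] kern_sums[OF assms] by (intro suminf_ennreal2) (auto simp: sums_iff)
  also have "\<dots> = 1" using kern_sums[OF assms] by (simp add: sums_iff)
  finally have "(\<integral>\<^sup>+k. ennreal (kern x k) \<partial>count_space UNIV) = 1" .
  thus ?thesis unfolding kpmf_def using assms kern_nonneg[OF assms] by (simp add: pmf_embed_pmf)
qed

sublocale IT: Ionescu_Tulcea "\<lambda>i \<omega>. measure_pmf (kpmf (st \<omega> i))" "\<lambda>_. count_space UNIV"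
proof
  fix i
  \<comment> \<open>The kernel depends on the past only through a finite list of digits, an element
    of a countable space.\<close>
  have "(\<lambda>l. measure_pmf (kpmf (foldl (\<lambda>x k. branch k x) 0 l))) \<in> measurable (count_space UNIV) (subprob_algebra (count_space UNIV))"
    by (simp add: measure_pmf_in_subprob_algebra)
  from measurable_compose[OF measurable_map_upt this, of i "{0..<i}"]
  show "(\<lambda>\<omega>. measure_pmf (kpmf (st \<omega> i))) \<in> measurable (PiM {0..<i} (\<lambda>_. count_space UNIV)) (subprob_algebra (count_space UNIV))"
    unfolding st_foldl by simp
qed

abbreviation cylf :: "nat \<Rightarrow> (nat \<Rightarrow> nat) \<Rightarrow> (nat \<Rightarrow> nat) set" where
  "cylf n a \<equiv> PiE {0..<n} (\<lambda>j. {a j})"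

lemma cylf_sets: "cylf n a \<in> sets (PiM {0..<n} (\<lambda>_. count_space UNIV))"
  by (intro sets_PiM_I_finite) auto

lemma emeasure_C_cyl: "emeasure (IT.C 0 n (\<lambda>_. undefined)) (cylf n a) = ennreal (\<Prod>j<n. kern (st a j) (a j))"
proof (induction n)
  case 0
  show ?case by (simp add: emeasure_return space_PiM PiE_empty_domain sets_PiM_empty indicator_def)
next
  case (Suc n)
  let ?u = "\<lambda>_::nat. undefined :: nat"
  let ?N = "PiM {0..<n} (\<lambda>_. count_space (UNIV :: nat set))"
  have us: "?u \<in> space (PiM {0..<0} (\<lambda>_. count_space UNIV))" by (simp add: space_PiM)
  have sC: "sets (IT.C 0 n ?u) = sets ?N" using IT.sets_C[OF us, of n] by simp
  hence spC: "space (IT.C 0 n ?u) = space ?N" by (rule sets_eq_imp_space_eq)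
  have ne: "space (IT.C 0 n ?u) \<noteq> {}" unfolding spC by (simp add: space_PiM PiE_eq_empty_iff)
  have k0: "0 \<le> kern (st a n) (a n)" by (rule kern_nonneg[OF st_in])
  have "emeasure (IT.C 0 (Suc n) ?u) (cylf (Suc n) a) = (\<integral>\<^sup>+\<omega>. emeasure (IT.eP n \<omega>) (cylf (Suc n) a) \<partial>IT.C 0 n ?u)"
    unfolding IT.C.simps add_0
  proof (rule emeasure_bind[OF ne])
    show "IT.eP n \<in> measurable (IT.C 0 n ?u) (subprob_algebra (PiM {0..<Suc n} (\<lambda>_. count_space UNIV)))"
      using IT.measurable_eP[of n] by (simp only: measurable_cong_sets[OF sC refl])
  qed (rule cylf_sets)
  also have "\<dots> = (\<integral>\<^sup>+\<omega>. ennreal (kern (st a n) (a n)) * indicator (cylf n a) \<omega> \<partial>IT.C 0 n ?u)"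
  proof (rule nn_integral_cong)
    fix \<omega> assume "\<omega> \<in> space (IT.C 0 n ?u)"
    hence \<omega>: "\<omega> \<in> space ?N" by (simp only: spC)
    hence ext: "\<omega> \<in> extensional {0..<n}" by (auto simp: space_PiM PiE_def)
    have e: "emeasure (IT.eP n \<omega>) (cylf (Suc n) a) = emeasure (measure_pmf (kpmf (st \<omega> n))) ((\<lambda>x. fun_upd \<omega> n x) -` cylf (Suc n) a)"
      using IT.emeasure_eP[OF \<omega> cylf_sets] by simp
    show "emeasure (IT.eP n \<omega>) (cylf (Suc n) a) = ennreal (kern (st a n) (a n)) * indicator (cylf n a) \<omega>"
    proof (cases "\<omega> \<in> cylf n a")
      case True
      hence agree: "\<omega> j = a j" if "j < n" for j using that by auto
      have "(\<lambda>x. fun_upd \<omega> n x) -` cylf (Suc n) a = {a n}"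
      proof (rule set_eqI)
        fix x
        have "fun_upd \<omega> n x \<in> cylf (Suc n) a \<longleftrightarrow> x = a n"
          using ext agree by (simp add: PiE_iff extensional_def atLeast0_lessThan_Suc)
        thus "x \<in> (\<lambda>x. fun_upd \<omega> n x) -` cylf (Suc n) a \<longleftrightarrow> x \<in> {a n}" by simp
      qed
      moreover have "st \<omega> n = st a n" using agree by (rule st_cong)
      ultimately show ?thesis unfolding e using True
        by (simp add: emeasure_pmf_single pmf_kpmf[OF st_in])
    next
      case False
      then obtain j where j: "j < n" "\<omega> j \<noteq> a j" using ext by (auto simp: PiE_iff)
      have "fun_upd \<omega> n x \<notin> cylf (Suc n) a" for x
      proof
        assume "fun_upd \<omega> n x \<in> cylf (Suc n) a"
        hence "fun_upd \<omega> n x j \<in> {a j}" using j(1) by (intro PiE_mem[where S="{0..<Suc n}" and T="\<lambda>j. {a j}"]) auto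
        thus False using j by simp
      qed
      hence "(\<lambda>x. fun_upd \<omega> n x) -` cylf (Suc n) a = {}" by blast
      thus ?thesis unfolding e using False by simp
    qed
  qed
  also have "\<dots> = ennreal (kern (st a n) (a n)) * emeasure (IT.C 0 n ?u) (cylf n a)"
    by (rule nn_integral_cmult_indicator) (simp only: sC cylf_sets)
  also have "\<dots> = ennreal (\<Prod>j<Suc n. kern (st a j) (a j))"
    unfolding Suc using k0 by (simp add: ennreal_mult'[symmetric] mult.commute)
  finally show ?case .
qed

definition Q :: "(nat \<Rightarrow> nat) measure" where "Q = IT.PF.lim"

lemma sets_Q: "sets Q = sets (PiM UNIV (\<lambda>_. count_space UNIV))"
  by (simp add: Q_def)

lemma space_Q: "space Q = UNIV"
  using sets_eq_imp_space_eq[OF sets_Q] by (simp add: space_PiM)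

lemma emeasure_cyl: "emeasure Q {\<kappa>. \<forall>j<n. \<kappa> j = a j} = ennreal (\<Prod>j<n. kern (st a j) (a j))"
proof -
  have "emeasure Q (IT.PF.emb UNIV {0..<n} (cylf n a)) = emeasure (IT.CI {0..<n}) (cylf n a)"
    unfolding Q_def by (intro IT.lim cylf_sets) auto
  also have "\<dots> = emeasure (IT.C 0 n (\<lambda>_. undefined)) (IT.PF.emb {0..<n} {0..<n} (cylf n a))"
    by (intro IT.emeasure_CI cylf_sets) auto
  also have "IT.PF.emb {0..<n} {0..<n} (cylf n a) = cylf n a"
    by (intro prod_emb_id) auto
  also have "IT.PF.emb UNIV {0..<n} (cylf n a) = {\<kappa>. \<forall>j<n. \<kappa> j = a j}"
    by (auto simp: prod_emb_def space_PiM PiE_iff)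
  finally show ?thesis by (simp add: emeasure_C_cyl)
qed

lemma prob_Q: "prob_space Q"
proof
  have "emeasure Q {\<kappa>. \<forall>j<0. \<kappa> j = 0} = 1" by (subst emeasure_cyl) simp
  thus "emeasure Q (space Q) = 1" by (simp add: space_Q)
qed

text \<open>Each factor is at most the weight of its branch times \<open>exp (- pressure s)\<close>
  times a quotient of consecutive values of \<open>h\<close>, and these quotients telescope.\<close>

lemma kern_prod_le:
  "(\<Prod>j<n. kern (st a j) (a j)) \<le> C / c * exp (- real n * pressure s) * wprod (wd a n) 0 powr (2 * s)"
proof -
  have "(\<Prod>j<n. kern (st a j) (a j)) \<le> exp (- real n * pressure s) * wprod (wd a n) 0 powr (2 * s) * (h (st a n) / h 0)"
  proof (induction n)
    case 0
    show ?case using h_pos[of 0] by (simp add: wd_def)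
  next
    case (Suc n)
    let ?x = "st a n" and ?y = "st a (Suc n)"
    have hp: "0 < h ?x" "0 < h ?y" "0 < h 0" using h_pos[OF st_in[of a n]] h_pos[OF st_in[of a "Suc n"]] h_pos[of 0] by simp_all
    have bp: "0 < branch (a n) ?x" using st_in[of a n] by auto
    have wp: "0 < wprod (wd a n) 0" by (rule wprod_0_pos[OF wd_words])
    have kle: "kern ?x (a n) \<le> branch (a n) ?x powr (2 * s) * h ?y * (exp (- pressure s) / h ?x)"
    proof -
      have "kern ?x (a n) = branch (a n) ?x powr (2 * s) * h ?y * (1 / transfer s h ?x)" by (simp add: kern_def)
      also have "1 / transfer s h ?x \<le> 1 / (exp (pressure s) * h ?x)"
        using sub[OF st_in] hp tr_pos[OF st_in] by (intro divide_left_mono) auto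
      also have "\<dots> = exp (- pressure s) / h ?x" by (simp add: exp_minus divide_simps)
      finally show ?thesis using hp by (simp add: mult_left_mono)
    qed
    have "(\<Prod>j<Suc n. kern (st a j) (a j)) \<le> (exp (- real n * pressure s) * wprod (wd a n) 0 powr (2 * s) * (h ?x / h 0)) *
        (branch (a n) ?x powr (2 * s) * h ?y * (exp (- pressure s) / h ?x))"
      unfolding prod.lessThan_Suc using Suc kle kern_nonneg[OF st_in] hp wp by (intro mult_mono) auto
    also have "\<dots> = (exp (- real n * pressure s) * exp (- pressure s)) * (wprod (wd a n) 0 powr (2 * s) * branch (a n) ?x powr (2 * s)) * (h ?y / h 0)"
      using hp by (simp add: field_simps)
    also have "exp (- real n * pressure s) * exp (- pressure s) = exp (- real (Suc n) * pressure s)"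
      by (simp add: exp_add[symmetric] algebra_simps)
    also have "wprod (wd a n) 0 powr (2 * s) * branch (a n) ?x powr (2 * s) = wprod (wd a (Suc n)) 0 powr (2 * s)"
      by (simp add: wprod_wd powr_mult)
    finally show ?case .
  qed
  also have "\<dots> \<le> exp (- real n * pressure s) * wprod (wd a n) 0 powr (2 * s) * (C / c)"
  proof (rule mult_left_mono)
    have "h (st a n) \<le> C" "c \<le> h 0" "0 < h (st a n)" using bds[OF st_in[of a n]] bds[of 0] h_pos[OF st_in[of a n]] by simp_all
    thus "h (st a n) / h 0 \<le> C / c" using c by (intro frac_le) linarith+
  qed simp
  also have "\<dots> = C / c * exp (- real n * pressure s) * wprod (wd a n) 0 powr (2 * s)"
  proof -
    have "x * y * z = z * x * y" for x y z :: real by simp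
    thus ?thesis .
  qed
  finally show ?thesis .
qed

end

text \<open>The upper half of the Gibbs property; tail bounds and mass distribution both rest on
  it.\<close>

lemma gibbs_measure:
  assumes "s > 1/2"
  shows "\<exists>Q K. prob_space Q \<and> space Q = UNIV \<and> sets Q = sets (PiM UNIV (\<lambda>_. count_space (UNIV :: nat set))) \<and> 0 < K \<and>
    (\<forall>n a. emeasure Q {\<kappa>. \<forall>j<n. \<kappa> j = a j} \<le> ennreal (K * exp (- real n * pressure s) * wprod (wd a n) 0 powr (2 * s)))"
proof -
  obtain c h C where h: "0 < c" "\<forall>x\<in>{0..1}. c \<le> h x \<and> h x \<le> C"
    "\<forall>x\<in>{0..1}. exp (pressure s) * h x \<le> transfer s h x" using sub_eigenfunction[OF assms] by (elim exE conjE)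
  have g: "gibbs s c C h" using assms h by (simp add: gibbs_def)
  have "c \<le> h 0" "h 0 \<le> C" using h(2) by auto
  hence "0 < C / c" using h(1) by (intro divide_pos_pos) linarith+
  moreover have "emeasure (gibbs.Q s h) {\<kappa>. \<forall>j<n. \<kappa> j = a j} \<le> ennreal (C / c * exp (- real n * pressure s) * wprod (wd a n) 0 powr (2 * s))" for n a
    unfolding gibbs.emeasure_cyl[OF g] by (rule ennreal_leI[OF gibbs.kern_prod_le[OF g]])
  ultimately show ?thesis
    using gibbs.prob_Q[OF g] gibbs.space_Q[OF g] gibbs.sets_Q[OF g]
    by (intro exI[of _ "gibbs.Q s h"] exI[of _ "C / c"] conjI allI) simp_all
qed

section \<open>Digit sequences and irrational numbers\<close>

text \<open>The Euclidean algorithm: \<open>gauss_map\<close> turns \<open>a / b\<close> into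
  \<open>(b mod a) / a\<close>.\<close>

lemma gauss_iter_rational: "\<exists>n. (gauss_map ^^ n) (real a / real b) = 0"
proof (induction a arbitrary: b rule: less_induct)
  case (less a)
  show ?case
  proof (cases "a = 0 \<or> b = 0")
    case True
    thus ?thesis by (intro exI[of _ 0]) auto
  next
    case False
    hence ab: "0 < real a" "0 < real b" by auto
    have "real b = real (b div a) * real a + real (b mod a)"
      by (simp only: of_nat_mult[symmetric] of_nat_add[symmetric] div_mult_mod_eq)
    hence e: "real b / real a = real (b div a) + real (b mod a) / real a" using ab by (simp add: field_simps)
    have m: "b mod a < a" using False by simp
    hence "\<lfloor>real b / real a\<rfloor> = int (b div a)" unfolding e using ab by (intro floor_unique) auto
    hence "gauss_map (real a / real b) = real (b mod a) / real a"
      using ab e by (simp add: gauss_map_def frac_def)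
    moreover obtain n where "(gauss_map ^^ n) (real (b mod a) / real a) = 0" using less.IH[OF m] by blast
    ultimately have "(gauss_map ^^ Suc n) (real a / real b) = 0" by (simp add: funpow_swap1)
    thus ?thesis by blast
  qed
qed

lemma cfrac_tail_open:
  "\<forall>w\<in>set \<omega>. 1 \<le> w \<Longrightarrow> y \<in> {0<..<1} \<Longrightarrow> cfrac_tail \<omega> y \<in> {0<..<1}"
  by (induction \<omega>) (simp_all add: add_pos_pos)

lemma cword_cfrac_tail:
  "\<omega> \<in> words n \<Longrightarrow> y \<in> {0<..<1} \<Longrightarrow> cword n (cfrac_tail \<omega> y) = \<omega>"
proof (induction \<omega> arbitrary: n)
  case Nil
  thus ?case by (simp add: words_def)
next
  case (Cons w ws)
  then obtain m where n: "n = Suc m" "ws \<in> words m" "1 \<le> w" "\<forall>w\<in>set ws. 1 \<le> w"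
    by (auto simp: words_def)
  have "cfrac_tail ws y \<in> {0<..<1}" by (rule cfrac_tail_open[OF n(4) Cons.prems(2)])
  thus ?case
    using gauss_map_inverse_branch[of "cfrac_tail ws y" w] Cons.IH[OF n(2) Cons.prems(2)] n(3)
    by (simp add: n(1) cword_Suc)
qed

lemma continuous_cfrac_tail:
  "\<forall>w\<in>set \<omega>. 1 \<le> w \<Longrightarrow> continuous_on {0..1} (cfrac_tail \<omega>)"
proof (induction \<omega>)
  case (Cons w ws)
  have "real w + cfrac_tail ws x \<noteq> 0" if "x \<in> {0..1}" for x
    using cfrac_tail_pos(1)[of ws x] Cons.prems that by auto
  thus ?case using Cons by (auto intro!: continuous_intros)
qed (simp add: continuous_on_id)

text \<open>The open cylinder of \<open>x'\<close> is connected and contains neither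
  \<open>x\<close> nor \<open>x''\<close>, so it lies between them and its length bounds their
  distance. Two points in different cylinders would not do, as they may be arbitrarily close to a
  common end point.\<close>

lemma cword_separation:
  assumes "x \<in> irr" "x' \<in> irr" "x'' \<in> irr" "x < x'" "x' < x''"
    "cword n x \<noteq> cword n x'" "cword n x'' \<noteq> cword n x'"
  shows "exp (- wlen (cword n x')) / 8 \<le> x'' - x"
proof -
  let ?\<omega> = "cword n x'"
  have w: "?\<omega> \<in> words n" by (rule cword_words[OF assms(2)])
  hence w1: "\<forall>w\<in>set ?\<omega>. 1 \<le> w" by (simp add: words_def)
  define J where "J = cfrac_tail ?\<omega> ` {0<..<1}"
  have "connected J" unfolding J_def
    by (intro connected_continuous_image continuous_on_subset[OF continuous_cfrac_tail[OF w1]]) auto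
  hence J: "{a..b} \<subseteq> J" if "a \<in> J" "b \<in> J" for a b
    using that connected_contains_Icc by blast
  have Jw: "cword n z = ?\<omega>" if "z \<in> J" for z
    using that cword_cfrac_tail[OF w] by (auto simp: J_def)
  have x'J: "x' \<in> J" unfolding J_def
    using cfrac_tail_cword[OF assms(2), of n] irrD[OF gauss_iter_irr[OF assms(2), of n]]
    by (intro image_eqI[of _ _ "(gauss_map ^^ n) x'"]) auto
  have bd: "x \<le> z \<and> z \<le> x''" if "z \<in> J" for z
  proof (rule ccontr)
    assume "\<not> (x \<le> z \<and> z \<le> x'')"
    hence "x \<in> {z..x'} \<or> x'' \<in> {x'..z}" using assms(4,5) by auto
    hence "x \<in> J \<or> x'' \<in> J" using J[OF that x'J] J[OF x'J that] by blast
    thus False using Jw assms(6,7) by blast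
  qed
  \<comment> \<open>Interior points, as \<open>cword_cfrac_tail\<close> is about the open interval.
    Their distance 1/2 and a distortion factor 1/2 at each of them give 1/8.\<close>
  let ?a = "cfrac_tail ?\<omega> (1/4)" and ?b = "cfrac_tail ?\<omega> (3/4)"
  have "?a \<in> J" "?b \<in> J" by (auto simp: J_def)
  hence "\<bar>?a - ?b\<bar> \<le> x'' - x" using bd[of ?a] bd[of ?b] by linarith
  moreover have "\<bar>?a - ?b\<bar> = wprod ?\<omega> (1/4) * wprod ?\<omega> (3/4) / 2"
    using cfrac_tail_diff[OF w1, of "1/4" "3/4"] by simp
  moreover have "wprod ?\<omega> 0 / 2 * (wprod ?\<omega> 0 / 2) \<le> wprod ?\<omega> (1/4) * wprod ?\<omega> (3/4)"
    using wprod_bounds[OF w, of "1/4"] wprod_bounds[OF w, of "3/4"] wprod_0_pos[OF w] by (intro mult_mono) auto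
  moreover have "exp (- wlen ?\<omega>) = wprod ?\<omega> 0 * wprod ?\<omega> 0"
    using wprod_powr_wlen[OF w, of 1] wprod_0_pos[OF w] by (simp add: power2_eq_square)
  ultimately show ?thesis by simp
qed

lemma wd_Suc_shift: "wd \<kappa> (Suc n) = Suc (\<kappa> 0) # wd (\<kappa> \<circ> Suc) n"
  unfolding wd_def by (simp only: upt_conv_Cons[of 0 "Suc n"] map_Suc_upt[symmetric] list.map map_map o_def zero_less_Suc)

text \<open>Closed cylinders, so that compactness yields a point (\<open>codes_ex\<close>); further
  digits then show that it avoids the end points.\<close>

definition codes :: "(nat \<Rightarrow> nat) \<Rightarrow> real \<Rightarrow> bool" where
  "codes \<kappa> x \<longleftrightarrow> (\<forall>n. x \<in> cfrac_tail (wd \<kappa> n) ` {0..1})"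

lemma wd_ge_1: "\<forall>w\<in>set (wd \<kappa> n). 1 \<le> w"
  by (simp add: wd_def)

text \<open>A digit after the first makes the tail strictly positive and so excludes the end point
  1.\<close>

lemma cfrac_tail_wd_2:
  assumes "z \<in> cfrac_tail (wd \<kappa> (Suc (Suc n))) ` {0..1}"
  shows "0 < z" "z < 1"
proof -
  obtain y where y: "z = 1 / (real (Suc (\<kappa> 0)) + cfrac_tail (wd (\<kappa> \<circ> Suc) (Suc n)) y)" "y \<in> {0..1}"
    using assms by (auto simp: wd_Suc_shift[of \<kappa> "Suc n"])
  have "0 < cfrac_tail (wd (\<kappa> \<circ> Suc) (Suc n)) y"
    using cfrac_tail_pos(2)[OF wd_ge_1[of "\<kappa> \<circ> Suc" "Suc n"], of y] y(2) by (simp add: wd_Suc)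
  thus "0 < z" "z < 1" unfolding y(1) by (simp_all add: add_pos_pos)
qed

lemma cfrac_tail_wd_antimono:
  "cfrac_tail (wd \<kappa> (Suc n)) ` {0..1} \<subseteq> cfrac_tail (wd \<kappa> n) ` {0..1}"
  using branch_in by (auto simp: wd_Suc cfrac_tail_snoc intro!: imageI)

lemma codes_ex: "\<exists>x. codes \<kappa> x"
proof -
  have "(\<Inter>n. cfrac_tail (wd \<kappa> n) ` {0..1}) \<noteq> {}"
  proof (rule compact_nest)
    show "compact (cfrac_tail (wd \<kappa> n) ` {0..1})" for n
      by (intro compact_continuous_image continuous_cfrac_tail wd_ge_1) auto
    show "cfrac_tail (wd \<kappa> n) ` {0..1} \<subseteq> cfrac_tail (wd \<kappa> m) ` {0..1}" if "m \<le> n" for m n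
      using that by (induction rule: dec_induct) (use cfrac_tail_wd_antimono in blast)+
  qed auto
  thus ?thesis by (auto simp: codes_def)
qed

lemma codes_step:
  assumes "codes \<kappa> x"
  shows "0 < x" "x < 1" "nat \<lfloor>1 / x\<rfloor> = Suc (\<kappa> 0)" "codes (\<kappa> \<circ> Suc) (gauss_map x)"
proof -
  have step: "nat \<lfloor>1 / x\<rfloor> = Suc (\<kappa> 0) \<and> gauss_map x \<in> cfrac_tail (wd (\<kappa> \<circ> Suc) (Suc (Suc n))) ` {0..1}" for n
  proof -
    \<comment> \<open>Three extra digits: without its first digit the word still has the two digits
      that \<open>cfrac_tail_wd_2\<close> asks for.\<close>
    have "x \<in> cfrac_tail (wd \<kappa> (Suc (Suc (Suc n)))) ` {0..1}" using assms by (simp add: codes_def)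
    then obtain y where y: "y \<in> {0..1}" "x = cfrac_tail (wd \<kappa> (Suc (Suc (Suc n)))) y" by blast
    define z where "z = cfrac_tail (wd (\<kappa> \<circ> Suc) (Suc (Suc n))) y"
    have x: "x = 1 / (real (Suc (\<kappa> 0)) + z)"
      unfolding y(2) z_def wd_Suc_shift[of \<kappa> "Suc (Suc n)"] cfrac_tail.simps ..
    have z: "z \<in> cfrac_tail (wd (\<kappa> \<circ> Suc) (Suc (Suc n))) ` {0..1}" unfolding z_def using y(1) by (rule imageI)
    have "0 < z" "z < 1" using cfrac_tail_wd_2[OF z] by auto
    thus ?thesis using gauss_map_inverse_branch(1,2)[of z "Suc (\<kappa> 0)"] z unfolding x by simp
  qed
  show "nat \<lfloor>1 / x\<rfloor> = Suc (\<kappa> 0)" using step by blast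
  have "x \<in> cfrac_tail (wd \<kappa> (Suc (Suc 0))) ` {0..1}" using assms unfolding codes_def by blast
  thus "0 < x" "x < 1" by (rule cfrac_tail_wd_2)+
  have "gauss_map x \<in> cfrac_tail (wd (\<kappa> \<circ> Suc) n) ` {0..1}" for n
    using step[of n] cfrac_tail_wd_antimono[of "\<kappa> \<circ> Suc" n] cfrac_tail_wd_antimono[of "\<kappa> \<circ> Suc" "Suc n"] by blast
  thus "codes (\<kappa> \<circ> Suc) (gauss_map x)" by (simp add: codes_def)
qed

lemma codes_cword: "codes \<kappa> x \<Longrightarrow> cword n x = wd \<kappa> n"
proof (induction n arbitrary: \<kappa> x)
  case 0
  show ?case by (simp add: wd_def)
next
  case (Suc n)
  show ?case unfolding cword_Suc wd_Suc_shift codes_step(3)[OF Suc.prems] Suc.IH[OF codes_step(4)[OF Suc.prems]] ..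
qed

text \<open>Iterates of a coded point are coded and hence positive, whereas the orbit of a rational
  number reaches 0.\<close>

lemma codes_irr:
  assumes "codes \<kappa> x"
  shows "x \<in> irr"
proof -
  have x: "0 < x" "x < 1" using codes_step[OF assms] by auto
  have it: "(gauss_map ^^ n) x > 0" for n
  proof -
    have "\<exists>\<kappa>'. codes \<kappa>' ((gauss_map ^^ n) x)"
    proof (induction n)
      case 0
      show ?case using assms by auto
    next
      case (Suc n)
      then obtain \<kappa>' where "codes \<kappa>' ((gauss_map ^^ n) x)" by blast
      from codes_step(4)[OF this] show ?case by auto
    qed
    thus ?thesis using codes_step(1) by blast
  qed
  have "x \<notin> \<rat>"
  proof
    assume "x \<in> \<rat>"
    then obtain m n :: nat where "n \<noteq> 0" "\<bar>x\<bar> = real m / real n" by (rule Rats_abs_nat_div_natE)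
    hence "x = real m / real n" using x by simp
    thus False using gauss_iter_rational[of m n] it by (metis less_irrefl)
  qed
  thus ?thesis using x by (simp add: irr_def)
qed

lemma coding_point: "\<exists>x\<in>irr. \<forall>n. cword n x = wd \<kappa> n"
  using codes_ex codes_irr codes_cword by blast

section \<open>The mass distribution principle\<close>

text \<open>Exponents for the tail bounds: a small shift \<delta> of \<open>s\<close> changes the
  pressure by nearly \<open>\<delta> * \<beta>\<close>, so a deviation by \<epsilon> wins in both
  directions.\<close>

lemma pressure_tangent_at_sig:
  assumes "\<beta> > gamma0" "\<epsilon> > 0"
  shows "\<exists>\<delta>>0. 1/2 < sig \<beta> - \<delta> \<and> pressure (sig \<beta> - \<delta>) - pressure (sig \<beta>) < \<delta> * (\<beta> + \<epsilon>) \<and>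
    pressure (sig \<beta> + \<delta>) - pressure (sig \<beta>) < - \<delta> * (\<beta> - \<epsilon>)"
proof -
  define s where "s = sig \<beta>"
  have s: "s > 1/2" "deriv pressure s = - \<beta>" using sig[OF assms(1)] by (auto simp: s_def)
  have "((\<lambda>h. (pressure (s + h) - pressure s) / h) \<longlongrightarrow> - \<beta>) (at 0)"
    using pressure_deriv[OF s(1)] unfolding s(2) DERIV_def .
  from LIM_D[OF this assms(2)] obtain r where r: "0 < r"
    "\<And>h. h \<noteq> 0 \<Longrightarrow> \<bar>h\<bar> < r \<Longrightarrow> \<bar>(pressure (s + h) - pressure s) / h + \<beta>\<bar> < \<epsilon>" by auto
  define \<delta> where "\<delta> = min r (s - 1/2) / 2"
  have d: "0 < \<delta>" "\<delta> < r" "1/2 < s - \<delta>" using r(1) s(1) by (auto simp: \<delta>_def min_def field_simps)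
  have "(pressure (s + \<delta>) - pressure s) / \<delta> < \<epsilon> - \<beta>" using r(2)[of \<delta>] d by (simp add: abs_less_iff)
  hence 1: "pressure (s + \<delta>) - pressure s < (\<epsilon> - \<beta>) * \<delta>" using d(1) by (simp only: pos_divide_less_eq)
  have "- \<epsilon> - \<beta> < (pressure (s + - \<delta>) - pressure s) / (- \<delta>)" using r(2)[of "- \<delta>"] d unfolding abs_less_iff by linarith
  hence "pressure (s + - \<delta>) - pressure s < (- \<epsilon> - \<beta>) * (- \<delta>)" using d(1) by (subst (asm) neg_less_divide_eq) auto
  with 1 d show ?thesis unfolding s_def[symmetric] by (intro exI[of _ \<delta>]) (simp add: algebra_simps)
qed

section \<open>Typical digit sequences of a Gibbs measure\<close>

locale gibbs_state = prob_space Q for Q :: "(nat \<Rightarrow> nat) measure" +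
  fixes s K :: real
  assumes space: "space Q = UNIV" and sets: "sets Q = sets (PiM UNIV (\<lambda>_. count_space UNIV))"
    and K: "0 < K"
    and bound: "\<And>n a. emeasure Q {\<kappa>. \<forall>j<n. \<kappa> j = a j} \<le> ennreal (K * exp (- real n * pressure s) * wprod (wd a n) 0 powr (2 * s))"
begin

lemma sets_wd: "{\<kappa>. P (wd \<kappa> n)} \<in> sets Q"
proof -
  have "(\<lambda>\<kappa>. map \<kappa> [0..<n]) \<in> measurable Q (count_space UNIV)"
    unfolding measurable_cong_sets[OF sets refl] by (rule measurable_map_upt) simp
  hence "(\<lambda>\<kappa>. map \<kappa> [0..<n]) -` {l. P (map Suc l)} \<inter> space Q \<in> sets Q" by (rule measurable_sets) simp
  moreover have "wd \<kappa> n = map Suc (map \<kappa> [0..<n])" for \<kappa> by (simp add: wd_def)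
  ultimately show ?thesis by (simp add: space vimage_def)
qed

lemma emeasure_word:
  assumes "\<omega> \<in> words n"
  shows "emeasure Q {\<kappa>. wd \<kappa> n = \<omega>} \<le> ennreal (K * exp (- real n * pressure s) * wprod \<omega> 0 powr (2 * s))"
proof -
  \<comment> \<open>The sequence stores each digit decreased by one, in line with
    \<open>branch\<close>.\<close>
  let ?a = "\<lambda>j. \<omega> ! j - 1"
  have w: "length \<omega> = n" "\<And>j. j < n \<Longrightarrow> 1 \<le> \<omega> ! j" using assms by (auto simp: words_def)
  have e: "wd ?a n = \<omega>" using w by (intro nth_equalityI) (auto simp: wd_def Suc_le_eq)
  have i: "wd \<kappa> n = \<omega> \<longleftrightarrow> (\<forall>j<n. \<kappa> j = ?a j)" for \<kappa>
  proof -
    have "wd \<kappa> n = \<omega> \<longleftrightarrow> (\<forall>j<n. Suc (\<kappa> j) = \<omega> ! j)" using w(1) by (simp add: wd_def list_eq_iff_nth_eq)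
    also have "\<dots> \<longleftrightarrow> (\<forall>j<n. \<kappa> j = ?a j)" using w(2) by (metis Suc_diff_1 diff_Suc_1 less_eq_Suc_le One_nat_def)
    finally show ?thesis .
  qed
  show ?thesis using bound[of n ?a] unfolding e i .
qed

text \<open>Chernoff's bound: on \<open>A\<close> the weight with exponent \<open>s\<close> is at
  most \<open>exp (n * c)\<close> times the weight with exponent \<open>u\<close>, whose total is at
  most about \<open>exp (n * pressure u)\<close>.\<close>

lemma emeasure_words_le:
  assumes A: "A \<subseteq> words n" and u: "u > 1/2" and c: "\<And>\<omega>. \<omega> \<in> A \<Longrightarrow> (u - s) * wlen \<omega> \<le> real n * c"
  shows "emeasure Q {\<kappa>. wd \<kappa> n \<in> A} \<le> ennreal (2 * K * 2 powr (8 * u) * exp (pressure u + c - pressure s) ^ n)"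
proof -
  define f where "f = (\<lambda>\<omega>. K * exp (- real n * pressure s) * wprod \<omega> 0 powr (2 * s))"
  define B where "B = K * 2 powr (8 * u) * exp (pressure u + c - pressure s) ^ n"
  define E where "E = (\<lambda>i. {\<kappa>. to_nat (from_nat i :: nat list) = i \<and> from_nat i \<in> A \<and> wd \<kappa> n = from_nat i})"
  \<comment> \<open>\<open>2 ^ n * (1/2) ^ m\<close> is 1 for the only length \<open>m = n\<close>
    that occurs. It gives the bound the geometric form of \<open>words_suminf_le\<close>, whose
    factor \<open>1 / (1 - 1/2)\<close> becomes the 2 of the claim.\<close>
  have S: "sum f S \<le> B * 2 ^ n * (1/2) ^ m" if S: "finite S" "S \<subseteq> A" "\<And>\<omega>. \<omega> \<in> S \<Longrightarrow> length \<omega> = m" for m S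
  proof (cases "S = {}")
    case True
    thus ?thesis using K by (simp add: B_def)
  next
    case False
    hence m: "m = n" using S A by (auto simp: words_def)
    have "sum f S \<le> (\<Sum>\<omega>\<in>S. K * exp (- real n * pressure s) * exp (real n * c) * wprod \<omega> 0 powr (2 * u))"
    proof (rule sum_mono)
      fix \<omega> assume w: "\<omega> \<in> S"
      hence ww: "\<omega> \<in> words n" using S A by auto
      have "- s * wlen \<omega> \<le> real n * c + - u * wlen \<omega>" using c[of \<omega>] w S(2) by (auto simp: algebra_simps)
      hence "exp (- s * wlen \<omega>) \<le> exp (real n * c) * exp (- u * wlen \<omega>)" by (simp add: exp_add[symmetric])
      thus "f \<omega> \<le> K * exp (- real n * pressure s) * exp (real n * c) * wprod \<omega> 0 powr (2 * u)"
        unfolding f_def wprod_powr_wlen[OF ww] mult.assoc using K by (intro mult_left_mono) auto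
    qed
    also have "\<dots> = K * exp (- real n * pressure s) * exp (real n * c) * (\<Sum>\<omega>\<in>S. wprod \<omega> 0 powr (2 * u))"
      by (simp only: sum_distrib_left)
    also have "(\<Sum>\<omega>\<in>S. wprod \<omega> 0 powr (2 * u)) \<le> zpart n u 0"
      using S A by (intro finite_sum_le_has_sum[OF has_sum_words[OF u]]) auto
    also have "zpart n u 0 \<le> 2 powr (8 * u) * exp (real n * pressure u)" by (rule part_le_exp[OF u]) simp
    finally have "sum f S \<le> K * exp (- real n * pressure s) * exp (real n * c) * (2 powr (8 * u) * exp (real n * pressure u))"
      using K by (auto intro: mult_left_mono)
    also have "\<dots> = K * 2 powr (8 * u) * (exp (- real n * pressure s) * exp (real n * c) * exp (real n * pressure u))"
      by (simp only: mult_ac)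
    also have "exp (- real n * pressure s) * exp (real n * c) * exp (real n * pressure u) = exp (pressure u + c - pressure s) ^ n"
      unfolding exp_add[symmetric] exp_of_nat_mult[symmetric] by (simp add: algebra_simps)
    also have "K * 2 powr (8 * u) * \<dots> = B * 2 ^ n * (1/2) ^ m" by (simp add: B_def m power_one_over)
    finally show ?thesis .
  qed
  have Esets: "range E \<subseteq> sets Q" unfolding E_def
    using sets_wd[of "\<lambda>l. to_nat (from_nat i :: nat list) = i \<and> from_nat i \<in> A \<and> l = from_nat i" n for i] by auto
  have "{\<kappa>. wd \<kappa> n \<in> A} \<subseteq> (\<Union>i. E i)"
  proof
    fix \<kappa> assume "\<kappa> \<in> {\<kappa>. wd \<kappa> n \<in> A}"
    hence "\<kappa> \<in> E (to_nat (wd \<kappa> n))" by (simp add: E_def)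
    thus "\<kappa> \<in> (\<Union>i. E i)" by blast
  qed
  hence "emeasure Q {\<kappa>. wd \<kappa> n \<in> A} \<le> emeasure Q (\<Union>i. E i)"
    using Esets by (intro emeasure_mono sets.countable_UN) auto
  also have "\<dots> \<le> (\<Sum>i. emeasure Q (E i))" by (rule emeasure_subadditive_countably[OF Esets])
  also have "\<dots> \<le> (\<Sum>i. ennreal (if to_nat (from_nat i :: nat list) = i \<and> from_nat i \<in> A then f (from_nat i) else 0))"
  proof (rule suminf_le[OF _ summableI summableI])
    fix i
    show "emeasure Q (E i) \<le> ennreal (if to_nat (from_nat i :: nat list) = i \<and> from_nat i \<in> A then f (from_nat i) else 0)"
    proof (cases "to_nat (from_nat i :: nat list) = i \<and> from_nat i \<in> A")
      case True
      hence "E i = {\<kappa>. wd \<kappa> n = from_nat i}" by (simp add: E_def)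
      thus ?thesis using True emeasure_word[of "from_nat i" n] A by (auto simp: f_def)
    next
      case False
      hence "E i = {}" by (auto simp: E_def)
      thus ?thesis by simp
    qed
  qed
  also have "\<dots> \<le> ennreal (B * 2 ^ n * (1/2) ^ n / (1 - 1/2))"
    using A S K by (intro words_suminf_le) (auto simp: f_def B_def words_def)
  also have "B * 2 ^ n * (1/2) ^ n / (1 - 1/2) = 2 * K * 2 powr (8 * u) * exp (pressure u + c - pressure s) ^ n"
    by (simp add: B_def power_one_over)
  finally show ?thesis .
qed

text \<open>Large values of \<open>wlen\<close> are controlled with the exponent
  \<open>s - \<delta>\<close>, small ones with \<open>s + \<delta>\<close>. Both probabilities decay
  exponentially, so Borel-Cantelli applies.\<close>

lemma AE_deviation:
  assumes b: "\<beta> > gamma0" and s: "s = sig \<beta>" and e: "\<epsilon> > 0"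
  shows "AE \<kappa> in Q. \<forall>\<^sub>F n in sequentially. \<bar>wlen (wd \<kappa> n) - real n * \<beta>\<bar> \<le> \<epsilon> * real n"
proof -
  obtain \<delta> where d: "0 < \<delta>" "1/2 < s - \<delta>" "pressure (s - \<delta>) - pressure s < \<delta> * (\<beta> + \<epsilon>)"
    "pressure (s + \<delta>) - pressure s < - \<delta> * (\<beta> - \<epsilon>)" using pressure_tangent_at_sig[OF b e] unfolding s by blast
  define A where "A = (\<lambda>n. {\<kappa>. \<bar>wlen (wd \<kappa> n) - real n * \<beta>\<bar> > \<epsilon> * real n})"
  define A1 where "A1 = (\<lambda>n. {\<omega> \<in> words n. wlen \<omega> \<ge> real n * (\<beta> + \<epsilon>)})"
  define A2 where "A2 = (\<lambda>n. {\<omega> \<in> words n. wlen \<omega> \<le> real n * (\<beta> - \<epsilon>)})"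
  define p1 where "p1 = exp (pressure (s - \<delta>) + - \<delta> * (\<beta> + \<epsilon>) - pressure s)"
  define p2 where "p2 = exp (pressure (s + \<delta>) + \<delta> * (\<beta> - \<epsilon>) - pressure s)"
  define C1 where "C1 = 2 * K * 2 powr (8 * (s - \<delta>))"
  define C2 where "C2 = 2 * K * 2 powr (8 * (s + \<delta>))"
  have p: "0 < p1" "p1 < 1" "0 < p2" "p2 < 1" using d by (simp_all add: p1_def p2_def)
  have C: "0 \<le> C1" "0 \<le> C2" using K by (simp_all add: C1_def C2_def)
  have e1: "emeasure Q {\<kappa>. wd \<kappa> n \<in> A1 n} \<le> ennreal (C1 * p1 ^ n)" for n
    unfolding C1_def p1_def
  proof (rule emeasure_words_le)
    fix \<omega> assume "\<omega> \<in> A1 n"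
    hence "\<delta> * (real n * (\<beta> + \<epsilon>)) \<le> \<delta> * wlen \<omega>" using d(1) by (intro mult_left_mono) (auto simp: A1_def)
    thus "(s - \<delta> - s) * wlen \<omega> \<le> real n * (- \<delta> * (\<beta> + \<epsilon>))" by (simp add: algebra_simps)
  qed (use d in \<open>auto simp: A1_def\<close>)
  have e2: "emeasure Q {\<kappa>. wd \<kappa> n \<in> A2 n} \<le> ennreal (C2 * p2 ^ n)" for n
    unfolding C2_def p2_def
  proof (rule emeasure_words_le)
    fix \<omega> assume "\<omega> \<in> A2 n"
    hence "\<delta> * wlen \<omega> \<le> \<delta> * (real n * (\<beta> - \<epsilon>))" using d(1) by (intro mult_left_mono) (auto simp: A2_def)
    thus "(s + \<delta> - s) * wlen \<omega> \<le> real n * (\<delta> * (\<beta> - \<epsilon>))" by (simp add: algebra_simps)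
  qed (use d in \<open>auto simp: A2_def\<close>)
  have sub: "A n \<subseteq> {\<kappa>. wd \<kappa> n \<in> A1 n} \<union> {\<kappa>. wd \<kappa> n \<in> A2 n}" for n
    using wd_words[of _ n] by (auto simp: A_def A1_def A2_def algebra_simps abs_if split: if_splits)
  have mA: "emeasure Q (A n) \<le> ennreal (C1 * p1 ^ n + C2 * p2 ^ n)" for n
  proof -
    have "emeasure Q (A n) \<le> emeasure Q ({\<kappa>. wd \<kappa> n \<in> A1 n} \<union> {\<kappa>. wd \<kappa> n \<in> A2 n})"
      by (intro emeasure_mono sub sets.Un sets_wd)
    also have "\<dots> \<le> emeasure Q {\<kappa>. wd \<kappa> n \<in> A1 n} + emeasure Q {\<kappa>. wd \<kappa> n \<in> A2 n}"
      by (intro emeasure_subadditive sets_wd)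
    also have "\<dots> \<le> ennreal (C1 * p1 ^ n) + ennreal (C2 * p2 ^ n)" by (intro add_mono e1 e2)
    also have "\<dots> = ennreal (C1 * p1 ^ n + C2 * p2 ^ n)" using C p by (intro ennreal_plus[symmetric]) auto
    finally show ?thesis .
  qed
  have sA: "A n \<in> sets Q" for n unfolding A_def by (rule sets_wd)
  have "summable (\<lambda>n. measure Q (A n))"
  proof (rule summable_comparison_test')
    show "summable (\<lambda>n. C1 * p1 ^ n + C2 * p2 ^ n)"
      using p by (intro summable_add summable_mult summable_geometric) auto
    have "measure Q (A n) \<le> C1 * p1 ^ n + C2 * p2 ^ n" for n
      using mA[of n] C p by (subst (asm) emeasure_eq_measure, subst (asm) ennreal_le_iff) auto
    thus "norm (measure Q (A n)) \<le> C1 * p1 ^ n + C2 * p2 ^ n" for n by simp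
  qed
  hence "AE \<kappa> in Q. \<forall>\<^sub>F n in sequentially. \<kappa> \<in> space Q - A n"
    using sA by (intro borel_cantelli_AE1) (auto simp: emeasure_eq_measure)
  thus ?thesis
    by (rule AE_mp) (intro AE_I2 impI, erule eventually_mono, simp add: A_def not_less)
qed

lemma AE_typical:
  assumes b: "\<beta> > gamma0" and s: "s = sig \<beta>"
  shows "AE \<kappa> in Q. (\<lambda>n. wlen (wd \<kappa> n) / real n) \<longlonglongrightarrow> \<beta>"
proof -
  have "AE \<kappa> in Q. \<forall>m. \<forall>\<^sub>F n in sequentially. \<bar>wlen (wd \<kappa> n) - real n * \<beta>\<bar> \<le> 1 / real (Suc m) * real n"
    unfolding AE_all_countable by (intro allI AE_deviation[OF b s]) auto
  thus ?thesis
  proof (rule AE_mp, intro AE_I2 impI)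
    fix \<kappa> assume h: "\<forall>m. \<forall>\<^sub>F n in sequentially. \<bar>wlen (wd \<kappa> n) - real n * \<beta>\<bar> \<le> 1 / real (Suc m) * real n"
    show "(\<lambda>n. wlen (wd \<kappa> n) / real n) \<longlonglongrightarrow> \<beta>"
    proof (rule tendstoI)
      fix e :: real assume "0 < e"
      then obtain m where m: "1 / real (Suc m) < e" using nat_approx_posE by blast
      have "\<forall>\<^sub>F n in sequentially. \<bar>wlen (wd \<kappa> n) - real n * \<beta>\<bar> \<le> 1 / real (Suc m) * real n \<and> 1 \<le> n"
        using h by (intro eventually_conj eventually_ge_at_top) auto
      thus "\<forall>\<^sub>F n in sequentially. dist (wlen (wd \<kappa> n) / real n) \<beta> < e"
      proof (rule eventually_mono)
        fix n assume n: "\<bar>wlen (wd \<kappa> n) - real n * \<beta>\<bar> \<le> 1 / real (Suc m) * real n \<and> 1 \<le> n"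
        have "dist (wlen (wd \<kappa> n) / real n) \<beta> = \<bar>wlen (wd \<kappa> n) - real n * \<beta>\<bar> / real n"
          using n by (simp add: dist_real_def abs_div_pos[symmetric] field_simps)
        also have "\<dots> \<le> 1 / real (Suc m)" using n by (subst pos_divide_le_eq) auto
        finally show "dist (wlen (wd \<kappa> n) / real n) \<beta> < e" using m by linarith
      qed
    qed
  qed
qed

end

context gibbs_state
begin

text \<open>Choose \<open>n\<close> so that typical cylinders of length \<open>n\<close> are just
  longer than a multiple of \<open>r\<close>. By \<open>cword_separation\<close> at most two typical
  words of that length meet \<open>U\<close>, and each has mass of order
  \<open>r powr \<tau>\<close>. The claim is about a measurable superset \<open>W\<close>, because
  the sequences coded by points of an arbitrary \<open>U\<close> need not form a measurable
  set.\<close>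

lemma mass_distribution:
  assumes s: "s > 1/2" and b: "0 < \<beta>" and e: "0 < \<epsilon>" "\<epsilon> < \<beta>" and \<tau>: "0 \<le> \<tau>"
    and ge: "\<tau> * (\<beta> + \<epsilon>) \<le> pressure s + s * (\<beta> - \<epsilon>)"
  shows "\<exists>r0>0. \<exists>C>0. \<forall>U r. bounded U \<longrightarrow> diameter U \<le> r \<longrightarrow> 0 < r \<longrightarrow> r \<le> r0 \<longrightarrow>
    (\<exists>W\<in>sets Q. {\<kappa>. (\<forall>n\<ge>N. \<bar>wlen (wd \<kappa> n) - real n * \<beta>\<bar> \<le> \<epsilon> * real n) \<and> (\<exists>x\<in>U \<inter> irr. \<forall>n. cword n x = wd \<kappa> n)} \<subseteq> W \<and>
      emeasure Q W \<le> ennreal (C * r powr \<tau>))"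
proof -
  define b where "b = \<beta> + \<epsilon>"
  have b0: "0 < b" using assms by (simp add: b_def)
  \<comment> \<open>The bound on \<open>r\<close> forces \<open>n \<ge> N\<close>. Of the factor 16,
    8 comes from \<open>cword_separation\<close>, and the remaining 2 makes the contradiction
    strict.\<close>
  define r0 where "r0 = exp (- real N * b) / 16"
  define C1 where "C1 = K * (16 powr \<tau> * exp (\<tau> * b))"
  have C1: "0 < C1" using K by (simp add: C1_def)
  have main: "\<exists>W\<in>sets Q. {\<kappa>. (\<forall>n\<ge>N. \<bar>wlen (wd \<kappa> n) - real n * \<beta>\<bar> \<le> \<epsilon> * real n) \<and> (\<exists>x\<in>U \<inter> irr. \<forall>n. cword n x = wd \<kappa> n)} \<subseteq> W \<and>
      emeasure Q W \<le> ennreal (2 * C1 * r powr \<tau>)"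
    if U: "bounded U" "diameter U \<le> r" and r: "0 < r" "r \<le> r0" for U r
  proof -
    define L where "L = ln (16 * r)"
    have L: "16 * r = exp L" using r(1) by (simp add: L_def)
    \<comment> \<open>The largest \<open>n\<close> with
      \<open>16 * r \<le> exp (- real n * b)\<close>.\<close>
    define n where "n = nat \<lfloor>- L / b\<rfloor>"
    have "exp L \<le> exp (- real N * b)" using r(2) by (simp add: L[symmetric] r0_def)
    hence "real N * b \<le> - L" by simp
    hence m: "real N \<le> - L / b" using b0 by (subst pos_le_divide_eq)
    hence n: "N \<le> n" "real n \<le> - L / b" "- L / b < real n + 1" unfolding n_def by linarith+
    have "real n * b \<le> - L" "- L < (real n + 1) * b"
      using n(2,3) b0 by (simp_all only: pos_le_divide_eq pos_divide_less_eq)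
    hence rn: "16 * r \<le> exp (- real n * b)" "exp (- (real n + 1) * b) < 16 * r"
      unfolding L by (simp_all only: exp_le_cancel_iff exp_less_cancel_iff mult_minus_left)
    define A where "A = {\<omega> \<in> words n. \<bar>wlen \<omega> - real n * \<beta>\<bar> \<le> \<epsilon> * real n \<and> (\<exists>x\<in>U \<inter> irr. cword n x = \<omega>)}"
    have three: False if h: "x \<in> U \<inter> irr" "x' \<in> U \<inter> irr" "x'' \<in> U \<inter> irr" "x < x'" "x' < x''"
      "cword n x \<noteq> cword n x'" "cword n x'' \<noteq> cword n x'" "cword n x' \<in> A" for x x' x''
    proof -
      have "exp (- wlen (cword n x')) / 8 \<le> x'' - x" using h by (intro cword_separation) auto
      also have "\<dots> \<le> dist x x''" by (simp add: dist_real_def)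
      also have "\<dots> \<le> r" using diameter_bounded_bound[OF U(1), of x x''] h U(2) by auto
      finally have "exp (- wlen (cword n x')) \<le> 8 * r" by simp
      moreover have "wlen (cword n x') \<le> real n * b" using h(8) by (auto simp: A_def b_def abs_le_iff algebra_simps)
      hence "exp (- real n * b) \<le> exp (- wlen (cword n x'))" by simp
      ultimately show False using rn(1) r(1) by linarith
    qed
    have three': False if h: "a \<in> A" "c \<in> A" "d \<in> A" "a \<noteq> c" "a \<noteq> d" "c \<noteq> d" for a c d
    proof -
      obtain x y z where x: "x \<in> U \<inter> irr" "cword n x = a" "y \<in> U \<inter> irr" "cword n y = c" "z \<in> U \<inter> irr" "cword n z = d"
        using h(1-3) unfolding A_def by blast
      hence "x \<noteq> y" "x \<noteq> z" "y \<noteq> z" using that by auto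
      then consider "x < y" "y < z" | "x < z" "z < y" | "y < x" "x < z" | "y < z" "z < x" | "z < x" "x < y" | "z < y" "y < x"
        by linarith
      thus False
        using three[of x y z] three[of x z y] three[of y x z] three[of y z x] three[of z x y] three[of z y x] x that
        by cases auto
    qed
    have word: "emeasure Q {\<kappa>. wd \<kappa> n = \<omega>} \<le> ennreal (C1 * r powr \<tau>)" if w: "\<omega> \<in> A" for \<omega>
    proof -
      have ww: "\<omega> \<in> words n" "real n * (\<beta> - \<epsilon>) \<le> wlen \<omega>" using w by (auto simp: A_def abs_le_iff algebra_simps)
      have "s * (real n * (\<beta> - \<epsilon>)) \<le> s * wlen \<omega>" using ww(2) s by (intro mult_left_mono) auto
      moreover have "real n * (\<tau> * b) \<le> real n * (pressure s + s * (\<beta> - \<epsilon>))" using ge by (intro mult_left_mono) (auto simp: b_def)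
      ultimately have l: "- real n * pressure s + - s * wlen \<omega> \<le> \<tau> * (- (real n + 1) * b) + \<tau> * b"
        by (simp add: algebra_simps)
      have "exp (- real n * pressure s) * wprod \<omega> 0 powr (2 * s) = exp (- real n * pressure s + - s * wlen \<omega>)"
        unfolding wprod_powr_wlen[OF ww(1)] exp_add ..
      also have "\<dots> \<le> exp (\<tau> * (- (real n + 1) * b) + \<tau> * b)" using l by (simp only: exp_le_cancel_iff)
      also have "\<dots> = exp (- (real n + 1) * b) powr \<tau> * exp (\<tau> * b)" by (simp add: exp_add powr_def)
      also have "\<dots> \<le> (16 * r) powr \<tau> * exp (\<tau> * b)"
        using rn(2) \<tau> by (intro mult_right_mono powr_mono2) auto
      also have "\<dots> = 16 powr \<tau> * exp (\<tau> * b) * r powr \<tau>" using r(1) by (simp add: powr_mult)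
      finally have "K * (exp (- real n * pressure s) * wprod \<omega> 0 powr (2 * s)) \<le> K * (16 powr \<tau> * exp (\<tau> * b) * r powr \<tau>)"
        using K by (intro mult_left_mono) auto
      hence "ennreal (K * exp (- real n * pressure s) * wprod \<omega> 0 powr (2 * s)) \<le> ennreal (C1 * r powr \<tau>)"
        unfolding C1_def mult.assoc by (rule ennreal_leI)
      with emeasure_word[OF ww(1)] show ?thesis by (rule order_trans)
    qed
    have "emeasure Q {\<kappa>. wd \<kappa> n \<in> A} \<le> ennreal (2 * C1 * r powr \<tau>)"
    proof (cases "A = {}")
      case False
      then obtain a where a: "a \<in> A" by blast
      obtain c where c: "c \<in> A" "A \<subseteq> {a, c}" using a three' by (cases "A = {a}") (blast, blast)
      have "emeasure Q {\<kappa>. wd \<kappa> n \<in> A} \<le> emeasure Q ({\<kappa>. wd \<kappa> n = a} \<union> {\<kappa>. wd \<kappa> n = c})"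
        using c(2) by (intro emeasure_mono sets.Un sets_wd) auto
      also have "\<dots> \<le> emeasure Q {\<kappa>. wd \<kappa> n = a} + emeasure Q {\<kappa>. wd \<kappa> n = c}"
        by (intro emeasure_subadditive sets_wd)
      also have "\<dots> \<le> ennreal (C1 * r powr \<tau>) + ennreal (C1 * r powr \<tau>)" by (intro add_mono word a c(1))
      also have "\<dots> = ennreal (2 * C1 * r powr \<tau>)" using C1 by (subst ennreal_plus[symmetric]) auto
      finally show ?thesis .
    qed simp
    moreover have "{\<kappa>. (\<forall>n\<ge>N. \<bar>wlen (wd \<kappa> n) - real n * \<beta>\<bar> \<le> \<epsilon> * real n) \<and> (\<exists>x\<in>U \<inter> irr. \<forall>n. cword n x = wd \<kappa> n)} \<subseteq> {\<kappa>. wd \<kappa> n \<in> A}"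
      using n(1) wd_words[of _ n] unfolding A_def by blast
    ultimately show ?thesis using sets_wd[of "\<lambda>l. l \<in> A" n] by blast
  qed
  have "0 < r0" "0 < 2 * C1" using C1 by (auto simp: r0_def)
  thus ?thesis using main by blast
qed

end

text \<open>Some set \<open>G N\<close> of uniformly typical sequences has positive mass, and a
  cover of the level set with small gauge sum would bound this mass by half of itself.\<close>

lemma hausdorff_measure_level_set_nonzero:
  assumes g: "\<beta> > gamma0" and \<tau>: "0 \<le> \<tau>" "\<tau> < tval \<beta>"
  shows "hausdorff_measure \<tau> (lyapunov_level_set \<beta>) \<noteq> 0"
proof
  assume zero: "hausdorff_measure \<tau> (lyapunov_level_set \<beta>) = 0"
  define s where "s = sig \<beta>"
  have s: "s > 1/2" using sig(1)[OF g] by (simp add: s_def)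
  have b: "0 < \<beta>" using g gamma0_pos by simp
  define D where "D = pressure s + s * \<beta> - \<tau> * \<beta>"
  have "\<tau> - s < pressure s / \<beta>" using \<tau>(2) by (simp add: tval_def s_def)
  hence "(\<tau> - s) * \<beta> < pressure s" using b by (simp only: pos_less_divide_eq)
  hence D: "0 < D" by (simp add: D_def algebra_simps)
  \<comment> \<open>\<open>mass_distribution\<close> loses \<open>\<epsilon> * (s + \<tau>)\<close>
    against the margin \<open>D\<close>.\<close>
  define \<epsilon> where "\<epsilon> = min (\<beta> / 2) (D / (s + \<tau>))"
  have st: "0 < s + \<tau>" using s \<tau> by simp
  have "0 < D / (s + \<tau>)" using D st by (rule divide_pos_pos)
  hence e: "0 < \<epsilon>" "\<epsilon> < \<beta>" using b by (auto simp: \<epsilon>_def)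
  have "\<epsilon> \<le> D / (s + \<tau>)" by (simp add: \<epsilon>_def)
  hence "\<epsilon> * (s + \<tau>) \<le> D" using st by (simp only: pos_le_divide_eq)
  hence ge: "\<tau> * (\<beta> + \<epsilon>) \<le> pressure s + s * (\<beta> - \<epsilon>)" by (simp add: D_def algebra_simps)
  obtain Q K where Q: "prob_space Q" "space Q = UNIV" "sets Q = sets (PiM UNIV (\<lambda>_. count_space (UNIV :: nat set)))" "0 < K"
    "\<And>n a. emeasure Q {\<kappa>. \<forall>j<n. \<kappa> j = a j} \<le> ennreal (K * exp (- real n * pressure s) * wprod (wd a n) 0 powr (2 * s))"
    using gibbs_measure[OF s] by blast
  have gs: "gibbs_state Q s K" using Q by (simp add: gibbs_state_def gibbs_state_axioms_def)
  interpret gibbs_state Q s K by (rule gs)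
  define G where "G = (\<lambda>N. {\<kappa>. \<forall>n\<ge>N. \<bar>wlen (wd \<kappa> n) - real n * \<beta>\<bar> \<le> \<epsilon> * real n})"
  have Gs: "G N \<in> sets Q" for N
  proof -
    have "G N = (\<Inter>n\<in>{N..}. {\<kappa>. \<bar>wlen (wd \<kappa> n) - real n * \<beta>\<bar> \<le> \<epsilon> * real n})" by (auto simp: G_def)
    thus ?thesis by (simp only:) (intro sets.countable_INT'' sets_wd; auto simp: space[symmetric])
  qed
  have "\<exists>N. emeasure Q (G N) \<noteq> 0"
  proof (rule ccontr)
    assume "\<not> ?thesis"
    hence "G N \<in> null_sets Q" for N using Gs by auto
    hence "AE \<kappa> in Q. \<forall>N. \<kappa> \<notin> G N" unfolding AE_all_countable by (intro allI AE_not_in)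
    moreover have "AE \<kappa> in Q. \<exists>N. \<kappa> \<in> G N"
      using AE_deviation[OF g s_def e(1)] by (simp add: G_def eventually_sequentially)
    ultimately have "AE \<kappa> in Q. False" by eventually_elim blast
    thus False by simp
  qed
  then obtain N where N: "emeasure Q (G N) \<noteq> 0" by blast
  define m where "m = measure Q (G N)"
  have m: "emeasure Q (G N) = ennreal m" "0 < m"
    using N by (auto simp: m_def emeasure_eq_measure zero_less_measure_iff)
  obtain r0 C where r0: "0 < r0" "0 < C"
    and mass: "\<And>U r. bounded U \<Longrightarrow> diameter U \<le> r \<Longrightarrow> 0 < r \<Longrightarrow> r \<le> r0 \<Longrightarrow>
    \<exists>W\<in>sets Q. {\<kappa>. (\<forall>n\<ge>N. \<bar>wlen (wd \<kappa> n) - real n * \<beta>\<bar> \<le> \<epsilon> * real n) \<and> (\<exists>x\<in>U \<inter> irr. \<forall>n. cword n x = wd \<kappa> n)} \<subseteq> W \<and>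
      emeasure Q W \<le> ennreal (C * r powr \<tau>)"
    using mass_distribution[OF s b e \<tau>(1) ge, of N] by blast
  \<comment> \<open>A cover with gauge sum below \<open>c\<close>, enlarged by a total slack
    \<open>c\<close>, has mass at most \<open>C * (c + c) = m / 2\<close>.\<close>
  define c where "c = m / (4 * C)"
  have c: "0 < c" using m r0 by (simp add: c_def)
  have "hausdorff_pre_measure \<tau> r0 (lyapunov_level_set \<beta>) \<le> hausdorff_measure \<tau> (lyapunov_level_set \<beta>)"
    unfolding hausdorff_measure_def using r0 by (intro SUP_upper) auto
  hence "hausdorff_pre_measure \<tau> r0 (lyapunov_level_set \<beta>) < ennreal c" using zero c by simp
  then obtain U :: "nat \<Rightarrow> real set" where U: "lyapunov_level_set \<beta> \<subseteq> (\<Union>i. U i)" "\<And>i. bounded (U i)" "\<And>i. diameter (U i) \<le> r0"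
    "(\<Sum>i. ennreal (hausdorff_gauge \<tau> (U i))) < ennreal c"
    unfolding hausdorff_pre_measure_def INF_less_iff by blast
  \<comment> \<open>Slack: \<open>mass_distribution\<close> asks for a positive radius, but sets of
    the cover may have diameter 0.\<close>
  define f where "f = (\<lambda>i::nat. c / 2 * (1/2) ^ i)"
  have f: "0 < f i" for i using c by (simp add: f_def)
  have "\<exists>W. W \<in> sets Q \<and> {\<kappa> \<in> G N. \<exists>x\<in>U i \<inter> irr. \<forall>n. cword n x = wd \<kappa> n} \<subseteq> W \<and>
    emeasure Q W \<le> ennreal (C * (hausdorff_gauge \<tau> (U i) + f i))" (is "\<exists>W. ?P i W") for i
  proof (cases "U i = {}")
    case True
    thus ?thesis by (intro exI[of _ "{}"]) auto
  next
    case False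
    let ?d = "diameter (U i)"
    have d: "0 \<le> ?d" by (rule diameter_ge_0[OF U(2)])
    have "\<exists>r. ?d \<le> r \<and> 0 < r \<and> r \<le> r0 \<and> r powr \<tau> \<le> hausdorff_gauge \<tau> (U i) + f i"
    proof (cases "\<tau> = 0")
      case True
      \<comment> \<open>Here the gauge is 1 and every positive radius has
        \<open>r powr 0 = 1\<close>, so the largest admissible one will do.\<close>
      thus ?thesis using U(3)[of i] r0 False f[of i] by (intro exI[of _ r0]) (auto simp: hausdorff_gauge_def)
    next
      case tp: False
      hence tp: "0 < \<tau>" using \<tau> by simp
      \<comment> \<open>Chosen so that \<open>R powr \<tau>\<close> is the gauge plus the
        slack.\<close>
      define R where "R = (?d powr \<tau> + f i) powr (1 / \<tau>)"
      have fp: "0 < ?d powr \<tau> + f i" using f[of i] by (intro add_nonneg_pos) auto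
      have "?d = (?d powr \<tau>) powr (1 / \<tau>)" using d tp by (simp add: powr_powr)
      also have "\<dots> \<le> R" unfolding R_def using tp f[of i] by (intro powr_mono2) auto
      finally have dR: "?d \<le> R" .
      have Rp: "0 < R" using fp by (simp add: R_def)
      have "min r0 R powr \<tau> \<le> R powr \<tau>" using tp Rp r0 by (intro powr_mono2) auto
      also have "\<dots> = hausdorff_gauge \<tau> (U i) + f i" using tp fp False by (simp add: R_def powr_powr hausdorff_gauge_def)
      finally show ?thesis using dR Rp r0 U(3)[of i] by (intro exI[of _ "min r0 R"]) auto
    qed
    then obtain r where r: "?d \<le> r" "0 < r" "r \<le> r0" "r powr \<tau> \<le> hausdorff_gauge \<tau> (U i) + f i" by blast
    obtain W where W: "W \<in> sets Q" "{\<kappa>. (\<forall>n\<ge>N. \<bar>wlen (wd \<kappa> n) - real n * \<beta>\<bar> \<le> \<epsilon> * real n) \<and> (\<exists>x\<in>U i \<inter> irr. \<forall>n. cword n x = wd \<kappa> n)} \<subseteq> W"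
      "emeasure Q W \<le> ennreal (C * r powr \<tau>)" using mass[OF U(2) r(1-3)] by blast
    have "ennreal (C * r powr \<tau>) \<le> ennreal (C * (hausdorff_gauge \<tau> (U i) + f i))"
      using r(4) r0(2) by (intro ennreal_leI mult_left_mono) auto
    with W(3) have "emeasure Q W \<le> ennreal (C * (hausdorff_gauge \<tau> (U i) + f i))" by (rule order_trans)
    thus ?thesis using W(1,2) by (intro exI[of _ W]) (auto simp: G_def)
  qed
  hence "\<forall>i. \<exists>W. ?P i W" by (rule allI)
  then obtain W where "\<forall>i. ?P i (W i)" by (rule choice[THEN exE])
  hence W: "W i \<in> sets Q" "{\<kappa> \<in> G N. \<exists>x\<in>U i \<inter> irr. \<forall>n. cword n x = wd \<kappa> n} \<subseteq> W i"
    "emeasure Q (W i) \<le> ennreal (C * (hausdorff_gauge \<tau> (U i) + f i))" for i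
    by (simp_all only:)
  \<comment> \<open>Almost every sequence of \<open>G N\<close> codes a point of the level set, and
    this point lies in some set of the cover.\<close>
  have "AE \<kappa> in Q. \<kappa> \<in> G N \<longrightarrow> \<kappa> \<in> (\<Union>i. W i)"
  proof (rule AE_mp[OF AE_typical[OF g s_def]], intro AE_I2 impI)
    fix \<kappa> assume k: "(\<lambda>n. wlen (wd \<kappa> n) / real n) \<longlonglongrightarrow> \<beta>" "\<kappa> \<in> G N"
    obtain x where x: "x \<in> irr" "\<And>n. cword n x = wd \<kappa> n" using coding_point by blast
    have "x \<in> lyapunov_level_set \<beta>" using k(1) x by (simp add: lyapunov_level_set_iff)
    then obtain i where "x \<in> U i" using U(1) by blast
    hence "\<kappa> \<in> W i" using W(2)[of i] k(2) x by blast
    thus "\<kappa> \<in> (\<Union>i. W i)" by blast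
  qed
  hence "emeasure Q (G N) \<le> emeasure Q (\<Union>i. W i)" using W(1) by (intro emeasure_mono_AE sets.countable_UN) auto
  also have "\<dots> \<le> (\<Sum>i. emeasure Q (W i))" using W(1) by (intro emeasure_subadditive_countably) auto
  also have "\<dots> \<le> (\<Sum>i. ennreal C * (ennreal (hausdorff_gauge \<tau> (U i)) + ennreal (f i)))"
  proof (rule suminf_le[OF _ summableI summableI])
    fix i
    have "0 \<le> hausdorff_gauge \<tau> (U i)" by (simp add: hausdorff_gauge_def)
    thus "emeasure Q (W i) \<le> ennreal C * (ennreal (hausdorff_gauge \<tau> (U i)) + ennreal (f i))"
      using W(3)[of i] f[of i] r0(2) by (simp add: ennreal_mult)
  qed
  also have "\<dots> = ennreal C * ((\<Sum>i. ennreal (hausdorff_gauge \<tau> (U i))) + (\<Sum>i. ennreal (f i)))"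
    by (simp only: ennreal_suminf_cmult suminf_add[OF summableI summableI])
  also have "(\<Sum>i. ennreal (f i)) = ennreal c"
  proof -
    have "f sums (c / 2 * (1 / (1 - 1/2)))" unfolding f_def by (intro sums_mult geometric_sums) auto
    hence fs: "f sums c" by simp
    have "(\<Sum>i. ennreal (f i)) = ennreal (suminf f)"
      by (rule suminf_ennreal2[OF less_imp_le[OF f] sums_summable[OF fs]])
    thus ?thesis by (simp only: sums_unique[OF fs, symmetric])
  qed
  also have "ennreal C * ((\<Sum>i. ennreal (hausdorff_gauge \<tau> (U i))) + ennreal c) \<le> ennreal C * (ennreal c + ennreal c)"
    using U(4) by (intro mult_left_mono add_mono) auto
  also have "\<dots> = ennreal (m / 2)"
    using c r0 by (simp add: ennreal_plus[symmetric] ennreal_mult[symmetric] del: ennreal_plus) (simp add: c_def)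
  finally show False using m by (simp add: ennreal_le_iff2)
qed

lemma hausdorff_dim_level_set:
  assumes "\<beta> \<ge> gamma0"
  shows "hausdorff_dim (lyapunov_level_set \<beta>) = ereal (t_tilde \<beta>)"
proof (rule antisym[OF hausdorff_dim_level_set_le[OF assms]])
  show "ereal (t_tilde \<beta>) \<le> hausdorff_dim (lyapunov_level_set \<beta>)"
  proof (cases "\<beta> = gamma0")
    case True
    \<comment> \<open>The lower bound 0 is vacuous: no exponent \<open>s\<close> satisfies
      \<open>0 \<le> s < 0\<close>.\<close>
    show ?thesis unfolding True t_tilde_gamma0 by (rule hausdorff_dim_ge) simp
  next
    case False
    hence g: "\<beta> > gamma0" using assms by simp
    show ?thesis unfolding t_tilde_eq[OF g]
      by (rule hausdorff_dim_ge) (rule hausdorff_measure_level_set_nonzero[OF g])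
  qed
qed

theorem theorem1p3:
  shows "(\<forall>\<beta>\<ge>gamma0. hausdorff_dim (lyapunov_level_set \<beta>) = ereal (t_tilde \<beta>))
    \<and> t_tilde lambda0 = 1
    \<and> (t_tilde \<longlongrightarrow> 1 / 2) at_top
    \<and> (\<forall>\<beta>>gamma0. t_tilde differentiable (at \<beta>))
    \<and> gamma0 < lambda0
    \<and> (\<forall>\<beta>>lambda0. deriv t_tilde \<beta> < 0)
    \<and> deriv t_tilde lambda0 = 0
    \<and> (\<forall>\<beta>. gamma0 < \<beta> \<and> \<beta> < lambda0 \<longrightarrow> deriv t_tilde \<beta> > 0)
    \<and> filterlim (deriv t_tilde) at_top (at_right gamma0)
    \<and> (deriv t_tilde \<longlongrightarrow> 0) at_top
    \<and> deriv t_tilde differentiable (at lambda0)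
    \<and> deriv (deriv t_tilde) lambda0 < 0
    \<and> (\<exists>\<beta>1>lambda0. deriv t_tilde differentiable (at \<beta>1) \<and> deriv (deriv t_tilde) \<beta>1 > 0)
    \<and> \<not> convex_on {gamma0..} t_tilde
    \<and> \<not> concave_on {gamma0..} t_tilde"
proof (intro conjI allI impI)
  show "t_tilde differentiable (at \<beta>)" if "\<beta> > gamma0" for \<beta>
    using t_tilde_deriv[OF that] real_differentiable_def by blast
qed (simp_all only: hausdorff_dim_level_set t_tilde_lambda0 t_tilde_tendsto gamma0_less_lambda0 deriv_t_tilde_neg
  deriv_t_tilde_lambda0 deriv_t_tilde_pos deriv_t_tilde_at_gamma0 deriv_t_tilde_tendsto deriv_t_tilde_differentiable
  deriv2_t_tilde_lambda0 deriv2_t_tilde_pos t_tilde_not_convex t_tilde_not_concave not_False_eq_True)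

end
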